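(* Let $f$ be a univalent analytic function on $\mathbb D$, let $\mathsf S(f)=\left(\frac{f''}{f'}\right)'-\frac12\left(\frac{f''}{f'}\right)^2$ be its Schwarzian derivative, and set $d\mu_f(z)=|\mathsf S(f)(z)|^2(1-|z|^2)^3dm(z)$. (1) Case $p\in(0,1)$. If $\log f'\in\mathcal{CA}_p$ (respectively $\log f'\in\mathcal{CA}_{0,p}$), then $\mu_f$ is a bounded (respectively vanishing) $p$-Carleson measure and $\log f'\in\mathcal B$. Conversely, if $\mu_f$ is a bounded (respectively vanishing) $p$-Carleson measure and $\log f'\in\mathcal B_0$, then $\log f'\in\mathcal{CA}_p$ (respectively $\log f'\in\mathcal{CA}_{0,p}$). (2) Case $p\in(1,3)$. $\log f'\in\mathcal{CA}_p$ (respectively $\log f'\in\mathcal{CA}_{0,p}$) if and only if $\mu_f$ is a bounded (respectively vanishing) $p$-Carleson measure and $\log f'\in\mathcal B_0$.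
   Context: $\mathbb D$ is the open unit disk, $\mathbb T$ the unit circle, $dm$ is two-dimensional Lebesgue area measure, $|d\xi|=d\theta$ for $\xi=e^{i\theta}$. For an arc $I\subseteq\mathbb T$, $|I|=(2\pi)^{-1}\int_I|d\xi|$, $f_I=(2\pi|I|)^{-1}\int_I f(\xi)|d\xi|$, and $S(I)=\{re^{i\theta}\in\mathbb D: 1-|I|\le r<1,\ e^{i\theta}\in I\}$. $\mathcal{CA}_p$ is the space of all functions $f$ in the Hardy space $\mathcal H^2$ of $\mathbb D$ (identified with their radial boundary values on $\mathbb T$) with $\sup_{I\subseteq\mathbb T}|I|^{-p}\int_I|f(\xi)-f_I|^2|d\xi|<\infty$ (supremum over all sub-arcs). $\mathcal{CA}_{0,p}$ is the subspace of those $f\in\mathcal{CA}_p$ with $\lim_{|I|\to0}|I|^{-p}\int_I|f(\xi)-f_I|^2|d\xi|=0$. A nonnegative measure $\mu$ on $\mathbb D$ is a bounded $p$-Carleson measure if $\sup_{I\subseteq\mathbb T}\mu(S(I))/|I|^p<\infty$, and a vanishing (also called compact) $p$-Carleson measure if $\lim_{|I|\to0}\mu(S(I))/|I|^p=0$. $\mathcal B$ is the Bloch space of analytic $g$ on $\mathbb D$ with $\sup_{z\in\mathbb D}(1-|z|^2)|g'(z)|<\infty$; $\mathcal B_0$ is the subspace of $g\in\mathcal B$ with $\lim_{|z|\to1}(1-|z|^2)|g'(z)|=0$. $\log f'$ denotes any analytic branch on $\mathbb D$ (which exists since $f'$ has no zeros). *)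

theory Defs
  imports "HOL-Complex_Analysis.Complex_Analysis"
begin

definition univalent_on_disc :: "(complex \<Rightarrow> complex) \<Rightarrow> bool" where
  "univalent_on_disc f \<longleftrightarrow> f holomorphic_on ball 0 1 \<and> inj_on f (ball 0 1)"

definition schwarzian :: "(complex \<Rightarrow> complex) \<Rightarrow> complex \<Rightarrow> complex" where
  "schwarzian f z =
     deriv (\<lambda>w. deriv (deriv f) w / deriv f w) z - 1 / 2 * (deriv (deriv f) z / deriv f z)\<^sup>2"

text \<open>The measure \<open>|d\<xi>|\<close> on the unit circle, of total mass \<open>2 * pi\<close>.\<close>

definition circle_measure :: "complex measure" where
  "circle_measure =
     distr (restrict_space lborel {0..<2 * pi}) (restrict_space borel (sphere 0 1)) cis"

text \<open>
  Arcs are closed, nondegenerate, and may be the whole circle. For the suprema and limits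
  below it is immaterial whether the end points belong to the arc.
\<close>

definition arcs :: "complex set set" where
  "arcs = {cis ` {a..b} | a b. a < b \<and> b \<le> a + 2 * pi}"

definition arc_length :: "complex set \<Rightarrow> real" where
  "arc_length I = measure circle_measure I / (2 * pi)"

definition small_arcs :: "complex set filter" where
  "small_arcs = inf (filtercomap arc_length (at_right 0)) (principal arcs)"

definition carleson_box :: "complex set \<Rightarrow> complex set" where
  "carleson_box I = {of_real r * \<xi> | r \<xi>. 0 \<le> r \<and> 1 - arc_length I \<le> r \<and> r < 1 \<and> \<xi> \<in> I}"

definition hardy2 :: "(complex \<Rightarrow> complex) set" where
  "hardy2 = {f. f holomorphic_on ball 0 1 \<and>
     (SUP r\<in>{0<..<1::real}. \<integral>\<^sup>+\<xi>. ennreal ((cmod (f (of_real r * \<xi>)))\<^sup>2) \<partial>circle_measure) < \<infinity>}"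

text \<open>
  For \<open>f\<close> in \<open>hardy2\<close> the radial limit exists at almost every point of the circle; elsewhere
  \<open>Lim\<close> returns a fixed unspecified value, which does not affect the integrals below.
\<close>

definition radial_limit :: "(complex \<Rightarrow> complex) \<Rightarrow> complex \<Rightarrow> complex" where
  "radial_limit f \<xi> = Lim (at_left (1::real)) (\<lambda>r. f (of_real r * \<xi>))"

definition arc_mean :: "(complex \<Rightarrow> complex) \<Rightarrow> complex set \<Rightarrow> complex" where
  "arc_mean f I = (LINT \<xi>:I|circle_measure. radial_limit f \<xi>) / of_real (2 * pi * arc_length I)"

definition mean_oscillation :: "real \<Rightarrow> (complex \<Rightarrow> complex) \<Rightarrow> complex set \<Rightarrow> ennreal" where
  "mean_oscillation p f I = ennreal (arc_length I powr (-p)) *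
     (\<integral>\<^sup>+\<xi>\<in>I. ennreal ((cmod (radial_limit f \<xi> - arc_mean f I))\<^sup>2) \<partial>circle_measure)"

definition CA :: "real \<Rightarrow> (complex \<Rightarrow> complex) set" where
  "CA p = {f \<in> hardy2. (SUP I\<in>arcs. mean_oscillation p f I) < \<infinity>}"

definition CA0 :: "real \<Rightarrow> (complex \<Rightarrow> complex) set" where
  "CA0 p = {f \<in> CA p. (mean_oscillation p f \<longlongrightarrow> 0) small_arcs}"

definition bounded_carleson :: "real \<Rightarrow> complex measure \<Rightarrow> bool" where
  "bounded_carleson p \<mu> \<longleftrightarrow>
     (SUP I\<in>arcs. emeasure \<mu> (carleson_box I) / ennreal (arc_length I powr p)) < \<infinity>"

definition vanishing_carleson :: "real \<Rightarrow> complex measure \<Rightarrow> bool" where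
  "vanishing_carleson p \<mu> \<longleftrightarrow>
     ((\<lambda>I. emeasure \<mu> (carleson_box I) / ennreal (arc_length I powr p)) \<longlongrightarrow> 0) small_arcs"

definition bloch :: "(complex \<Rightarrow> complex) set" where
  "bloch = {g. g holomorphic_on ball 0 1 \<and>
     bdd_above ((\<lambda>z. (1 - (cmod z)\<^sup>2) * cmod (deriv g z)) ` ball 0 1)}"

definition bloch0 :: "(complex \<Rightarrow> complex) set" where
  "bloch0 = {g \<in> bloch.
     ((\<lambda>z. (1 - (cmod z)\<^sup>2) * cmod (deriv g z)) \<longlongrightarrow> 0) (filtercomap cmod (at_left 1))}"

definition schwarzian_measure :: "(complex \<Rightarrow> complex) \<Rightarrow> complex measure" where
  "schwarzian_measure f = density (restrict_space lborel (ball 0 1))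
     (\<lambda>z. ennreal ((cmod (schwarzian f z))\<^sup>2 * (1 - (cmod z)\<^sup>2) ^ 3))"

end

theory Submission
  imports Defs
begin

text \<open>
  Write \<open>g = log f'\<close> and pass to logarithmic coordinates: \<open>z = exp w\<close> with \<open>w = s + i t\<close>, \<open>s < 0\<close>, and
  \<open>G w = g (exp w)\<close>. Arcs become intervals, Carleson boxes become squares of side comparable to \<open>L\<close>
  at the line \<open>s = 0\<close>, and \<open>exp (2 w) * S(f)(exp w)\<close> equals \<open>\<sigma> = G'' - G' - G'\<^sup>2 / 2\<close>. Bounded and vanishing
  conditions are treated together as ``for all small \<open>L\<close> the quantity is at most \<open>C * L powr p\<close>'' with
  some \<open>C\<close>, respectively every \<open>C\<close>; it then suffices to pass between such conditions at the cost of a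
  factor that does not depend on \<open>C\<close>.

  From oscillation to Schwarzian: the Cauchy formula over dyadic intervals gives the growth
  \<open>|G'| \<le> C (-s) powr ((p - 3) / 2)\<close>. The energy \<open>\<integral>\<integral> (-s) |G'|\<^sup>2\<close> over squares is of order \<open>L powr p\<close> by
  integrating this growth if \<open>p > 1\<close>, and by Green's identity with weight \<open>s1 - s\<close> if \<open>p < 1\<close>. Green's
  identity for \<open>G'\<close> with weight \<open>(s1 - s)^3\<close> bounds \<open>\<integral>\<integral> (-s)^3 |G''|\<^sup>2\<close> by the energy, and the univalence
  bound \<open>(-s) |G'| \<le> B\<close> takes care of the quadratic term of \<open>\<sigma>\<close>. If \<open>p > 1\<close>, the growth already forces
  the little Bloch condition.

  From Schwarzian to oscillation: the area mean value property gives
  \<open>|\<sigma>| \<le> C (-s) powr ((p - 5) / 2)\<close>. Under the little Bloch condition \<open>G'' = \<sigma> + o(1 / (-s)) * G'\<close>, so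
  integration in \<open>s\<close> bounds \<open>G'\<close>, Hardy's inequality absorbs the error term in the energy, and Green's
  identity turns the energy into the oscillation of \<open>G\<close> on horizontal lines. Radial limits of functions
  in \<open>hardy2\<close> carry the estimates to the circle.
\<close>

subsection \<open>The Bloch bound for univalent functions\<close>

text \<open>Univalence is used only through the bound on (1 - |z|) |g'|. Logarithmic coordinates
  turn rotations into translations and sectors into rectangles, so Green's identity is the
  fundamental theorem of calculus in each variable. Area estimates are made on boxes that stop short
  of the boundary, with constants that do not depend on where they stop; Fatou's lemma then reaches
  the boundary. The vanishing case needs bounds linear in \<open>C\<close>, with G' of order sqrt C.
  The term G'^2 has degree two, so one of its factors is always measured by a Bloch bound instead:
  by \<open>B\<close> in one direction, by a small \<epsilon> in the other. The value p = 1 is a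
  threshold: growth makes (-s) |G'|^2 of order (-s)^(p - 2), which is integrable only for p > 1. For
  p < 1 growth instead makes G - c of order (-s)^((p - 1)/2), and (-s) |G - c|^2 of order (-s)^p;
  this feeds the remainder terms of Green's identity. In the converse direction, membership in the
  Hardy space is not given; it is deduced from oscillation bounds on the horizontal lines.\<close>

lemma univalent_omits:
  assumes holF: "F holomorphic_on ball 0 1" and inj: "inj_on F (ball 0 1)"
    and F0: "F 0 = 0" and dF0: "deriv F 0 = 1"
  obtains w where "w \<noteq> 0" "cmod w \<le> 2" "w \<notin> F ` ball 0 1"
proof -
  have "\<not> cball 0 2 \<subseteq> F ` ball 0 1"
  proof
    assume sub: "cball 0 2 \<subseteq> F ` ball 0 1"
    obtain h where holh: "h holomorphic_on (F ` ball 0 1)"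
      and dh: "\<And>z. z \<in> ball 0 1 \<Longrightarrow> deriv F z * deriv h (F z) = 1"
      and hF: "\<And>z. z \<in> ball 0 1 \<Longrightarrow> h (F z) = z"
      using holomorphic_has_inverse[OF holF open_ball inj] by metis
    have dh0: "deriv h 0 = 1" using dh[of 0] F0 dF0 by simp
    \<comment> \<open>The inverse \<open>h\<close> has values in the unit disc, so on a disc of
      radius 2 Cauchy's inequality would give |h'(0)| at most 1/2, whereas h'(0) = 1.\<close>
    have "cmod ((deriv ^^ 1) h 0) \<le> fact 1 * 1 / 2 ^ 1"
    proof (rule Cauchy_inequality)
      show "h holomorphic_on ball 0 2"
        using holh sub by (meson ball_subset_cball holomorphic_on_subset subset_trans)
      show "continuous_on (cball 0 2) h"
        using holh sub holomorphic_on_imp_continuous_on holomorphic_on_subset by blast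
      fix x :: complex assume "cmod (0 - x) = 2"
      then have "x \<in> F ` ball 0 1" using sub by auto
      then show "cmod (h x) \<le> 1" using hF by force
    qed simp
    then show False using dh0 by simp
  qed
  then obtain w where "w \<in> cball 0 2" "w \<notin> F ` ball 0 1" by blast
  moreover have "w \<noteq> 0" using F0 \<open>w \<notin> _\<close> by force
  ultimately show thesis using that by auto
qed

text \<open>
  A weak form of Bieberbach's inequality. If \<open>F\<close> omits \<open>w\<close>, the branch of \<open>sqrt (1 - F / w)\<close> with
  value \<open>1\<close> at the origin omits \<open>0\<close> and \<open>-1\<close>, so that Schottky's theorem bounds it.
\<close>

lemma univalent_second_coefficient_bound:
  obtains B where "B > 0"
    "\<And>F. \<lbrakk>F holomorphic_on ball 0 1; inj_on F (ball 0 1); F 0 = 0; deriv F 0 = 1\<rbrakk>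
        \<Longrightarrow> cmod (deriv (deriv F) 0) \<le> B"
proof -
  \<comment> \<open>\<open>M\<close> is Schottky's bound on the disc of radius 1/2 for a function
    whose value at 0 has modulus at most 1. \<open>B\<close> comes from Cauchy's inequality for the
    second derivative on the disc of radius 1/4, where |F| is at most 2 (1 + M^2).\<close>
  define M where "M = exp (pi * exp (pi * (2 + 2 * 1 + 12 * (1/2) / (1 - 1/2))))"
  define B where "B = 2 * (2 * (1 + M\<^sup>2)) / (1/4)^2"
  have M: "M > 0" by (simp add: M_def)
  have "B > 0" using M by (simp add: B_def add_pos_nonneg)
  moreover have "cmod (deriv (deriv F) 0) \<le> B"
    if holF: "F holomorphic_on ball 0 1" and inj: "inj_on F (ball 0 1)"
      and F0: "F 0 = 0" and dF0: "deriv F 0 = 1" for F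
  proof -
    obtain w where w: "w \<noteq> 0" "cmod w \<le> 2" "w \<notin> F ` ball 0 1"
      using univalent_omits[OF holF inj F0 dF0] by blast
    have holk: "(\<lambda>z. 1 - F z / w) holomorphic_on ball 0 1"
      using holF w by (intro holomorphic_intros) auto
    have nz: "1 - F z / w \<noteq> 0" if "z \<in> ball 0 1" for z
      using w that by (auto simp: field_simps)
    obtain h0 where h0: "h0 holomorphic_on ball 0 1"
      "\<And>z. z \<in> ball 0 1 \<Longrightarrow> 1 - F z / w = (h0 z)\<^sup>2"
      by (rule contractible_imp_holomorphic_sqrt[OF holk _ nz])
         (auto intro: convex_imp_contractible)
    have h00: "h0 0 ^ 2 = 1" using h0(2)[of 0] F0 by simp
    \<comment> \<open>The factor \<open>h0 0\<close> is 1 or -1 and normalises the branch. The minus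
      sign turns the omitted value -1 into 1, as Schottky's theorem wants it, and halving the
      argument gives holomorphy on the closed disc.\<close>
    define v where "v = (\<lambda>z. - h0 0 * h0 (z / 2))"
    have holv: "v holomorphic_on cball 0 1"
    proof -
      have "h0 \<circ> (\<lambda>z. z / 2) holomorphic_on cball 0 1"
        by (rule holomorphic_on_compose_gen[OF _ h0(1)]) (auto intro!: holomorphic_intros)
      then show ?thesis unfolding v_def o_def by (intro holomorphic_intros) auto
    qed
    have v2: "(v z)\<^sup>2 = 1 - F (z/2) / w" if "z \<in> cball 0 1" for z
      using h0(2)[of "z/2"] h00 that by (simp add: v_def power_mult_distrib)
    have v0: "v 0 = -1" using h00 by (simp add: v_def power2_eq_square)
    have vbd: "cmod (v z) \<le> M" if "cmod z \<le> 1/2" for z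
      unfolding M_def
    proof (rule Schottky[OF holv])
      show "cmod (v 0) \<le> 1" using v0 by simp
      show "\<not> (v z = 0 \<or> v z = 1)" if z: "z \<in> cball 0 1" for z
      proof
        assume "v z = 0 \<or> v z = 1"
        then show False
        proof
          assume "v z = 0"
          then show False using v2[OF z] nz[of "z/2"] z by simp
        next
          assume v1: "v z = 1"
          then have "F (z/2) = F 0" using v2[OF z] w F0 by simp
          then have "z/2 = 0" using inj_onD[OF inj, of "z/2" 0] z by auto
          then show False using v1 v0 by simp
        qed
      qed
    qed (use that in auto)
    have Fbd: "cmod (F z) \<le> 2 * (1 + M\<^sup>2)" if "cmod z \<le> 1/4" for z
    proof -
      have "F z = w * (1 - (v (2*z))\<^sup>2)"
        using v2[of "2*z"] w that by (simp add: field_simps norm_mult)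
      then have "cmod (F z) = cmod w * cmod (1 - (v (2*z))\<^sup>2)" by (simp add: norm_mult)
      also have "\<dots> \<le> 2 * (1 + M\<^sup>2)"
      proof (rule mult_mono)
        have "cmod (1 - (v (2*z))\<^sup>2) \<le> 1 + cmod (v (2*z)) ^ 2"
          using norm_triangle_ineq4[of 1 "(v (2*z))\<^sup>2"] by (simp add: norm_power)
        also have "\<dots> \<le> 1 + M\<^sup>2"
          using vbd[of "2*z"] that by (simp add: norm_mult power_mono)
        finally show "cmod (1 - (v (2*z))\<^sup>2) \<le> 1 + M\<^sup>2" .
      qed (use w in auto)
      finally show ?thesis .
    qed
    have "cmod ((deriv ^^ 2) F 0) \<le> fact 2 * (2 * (1 + M\<^sup>2)) / (1/4) ^ 2"
    proof (rule Cauchy_inequality)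
      show "F holomorphic_on ball 0 (1/4)" using holF by (rule holomorphic_on_subset) auto
      show "continuous_on (cball 0 (1/4)) F"
        using holF by (intro holomorphic_on_imp_continuous_on) (auto elim!: holomorphic_on_subset)
    qed (use Fbd in auto)
    then show ?thesis by (simp add: B_def numeral_2_eq_2)
  qed
  ultimately show thesis using that by blast
qed

text \<open>The coefficient bound is applied to f restricted to the disc of radius d = 1 - |z| about
  z and renormalised affinely. Unlike a Moebius renormalisation this adds no correction term: the
  second derivative at 0 is exactly d f''(z) / f'(z).\<close>

lemma univalent_pre_schwarzian_bound:
  assumes "univalent_on_disc f"
  obtains B where "B > 0"
    "\<And>z. z \<in> ball 0 1 \<Longrightarrow> (1 - cmod z) * cmod (deriv (deriv f) z) \<le> B * cmod (deriv f z)"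
proof -
  have hol: "f holomorphic_on ball 0 1" and inj: "inj_on f (ball 0 1)"
    using assms by (auto simp: univalent_on_disc_def)
  obtain B where B: "B > 0"
    "\<And>F. \<lbrakk>F holomorphic_on ball 0 1; inj_on F (ball 0 1); F 0 = 0; deriv F 0 = 1\<rbrakk>
        \<Longrightarrow> cmod (deriv (deriv F) 0) \<le> B"
    using univalent_second_coefficient_bound by blast
  have "(1 - cmod z) * cmod (deriv (deriv f) z) \<le> B * cmod (deriv f z)" if z: "z \<in> ball 0 1" for z
  proof -
    define d where "d = 1 - cmod z"
    have d: "d > 0" using z by (simp add: d_def)
    have nz: "deriv f z \<noteq> 0"
      using holomorphic_injective_imp_regular[OF hol open_ball inj z] .
    define q where "q = (\<lambda>x. z + of_real d * x)"
    have q_in: "q x \<in> ball 0 1" if "x \<in> ball 0 1" for x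
    proof -
      have "cmod (q x) \<le> cmod z + d * cmod x"
        using norm_triangle_ineq[of z "of_real d * x"] d by (simp add: q_def norm_mult)
      also have "\<dots> < cmod z + d * 1" using that d by (intro add_strict_left_mono mult_strict_left_mono) auto
      finally show ?thesis by (simp add: d_def)
    qed
    define F where "F = (\<lambda>x. (f (q x) - f z) / (of_real d * deriv f z))"
    have dq: "(q has_field_derivative of_real d) (at x)" for x
      unfolding q_def by (auto intro!: derivative_eq_intros)
    have df: "(f has_field_derivative deriv f y) (at y)" if "y \<in> ball 0 1" for y
      using hol that by (simp add: holomorphic_derivI)
    have ddf: "(deriv f has_field_derivative deriv (deriv f) y) (at y)" if "y \<in> ball 0 1" for y
      using holomorphic_deriv[OF hol open_ball] that by (simp add: holomorphic_derivI)
    have DF: "(F has_field_derivative (deriv f (q x) / deriv f z)) (at x)" if "x \<in> ball 0 1" for x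
      unfolding F_def using d nz
      by (auto intro!: derivative_eq_intros DERIV_chain2[OF df dq] q_in[OF that])
    have dF: "deriv F x = deriv f (q x) / deriv f z" if "x \<in> ball 0 1" for x
      using DF[OF that] by (rule DERIV_imp_deriv)
    have q0: "q 0 = z" by (simp add: q_def)
    have "((\<lambda>x. deriv f (q x) / deriv f z) has_field_derivative
             (deriv (deriv f) (q 0) * of_real d / deriv f z)) (at 0)"
      using d nz q_in[of 0] by (auto intro!: derivative_eq_intros DERIV_chain2[OF ddf dq])
    then have "(deriv F has_field_derivative (deriv (deriv f) z * of_real d / deriv f z)) (at 0)"
      unfolding q0
      by (rule has_field_derivative_transform_within_open[where S="ball 0 1"]) (auto simp: dF)
    then have ddF: "deriv (deriv F) 0 = deriv (deriv f) z * of_real d / deriv f z"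
      by (rule DERIV_imp_deriv)
    have "cmod (deriv (deriv F) 0) \<le> B"
    proof (rule B(2))
      show "F holomorphic_on ball 0 1"
        using DF by (subst holomorphic_on_open) (simp, blast)
      show "inj_on F (ball 0 1)"
      proof (rule inj_onI)
        fix x y assume xy: "x \<in> ball 0 1" "y \<in> ball 0 1" "F x = F y"
        then have "f (q x) = f (q y)" using d nz by (simp add: F_def)
        then have "q x = q y" using inj q_in xy by (meson inj_onD)
        then show "x = y" using d by (simp add: q_def)
      qed
      show "F 0 = 0" by (simp add: F_def q0)
      show "deriv F 0 = 1" using dF[of 0] nz by (simp add: q0)
    qed
    then show ?thesis using d nz
      by (simp add: ddF norm_mult norm_divide field_simps flip: d_def)
  qed
  then show thesis using that B(1) by blast
qed

subsection \<open>Green's identity and Hardy's inequality in the left half plane\<close>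

abbreviation left_half_plane :: "complex set"
  where "left_half_plane \<equiv> {w. Re w < 0}"

lemma open_left_half_plane: "open left_half_plane"
  by (rule open_halfspace_Re_lt)

lemma half_plane_continuous:
  assumes "H holomorphic_on left_half_plane" "continuous_on S f" "continuous_on S g"
    "\<And>x. x \<in> S \<Longrightarrow> f x < 0"
  shows "continuous_on S (\<lambda>x. H (Complex (f x) (g x)))"
proof -
  have "continuous_on left_half_plane H"
    using assms(1) by (rule holomorphic_on_imp_continuous_on)
  then show ?thesis
    by (rule continuous_on_compose2) (auto intro!: continuous_intros assms)
qed

lemma half_plane_derivs:
  assumes hol: "H holomorphic_on left_half_plane" and s: "s < 0"
  shows half_plane_deriv_Re: "((\<lambda>s. H (Complex s t)) has_vector_derivative deriv H (Complex s t)) (at s within S)"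
    and half_plane_deriv_Im: "((\<lambda>t. H (Complex s t)) has_vector_derivative \<i> * deriv H (Complex s t)) (at t within T)"
proof -
  have D: "(H has_field_derivative deriv H (Complex s t)) (at (Complex s t))"
    using hol s by (intro holomorphic_derivI[OF _ open_left_half_plane]) auto
  have "((\<lambda>s. Complex s t) has_vector_derivative 1) (at s within S)"
    unfolding Complex_eq by (auto intro!: derivative_eq_intros)
  from field_vector_diff_chain_within[OF this] D
  show "((\<lambda>s. H (Complex s t)) has_vector_derivative deriv H (Complex s t)) (at s within S)"
    by (auto simp: o_def intro: has_field_derivative_at_within)
  have "((\<lambda>t. Complex s t) has_vector_derivative \<i>) (at t within T)"
    unfolding Complex_eq by (auto intro!: derivative_eq_intros)
  from field_vector_diff_chain_within[OF this] D
  show "((\<lambda>t. H (Complex s t)) has_vector_derivative \<i> * deriv H (Complex s t)) (at t within T)"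
    by (auto simp: o_def intro: has_field_derivative_at_within)
qed

lemma holomorphic_deriv_left_half_plane:
  "H holomorphic_on left_half_plane \<Longrightarrow> deriv H holomorphic_on left_half_plane"
  by (rule holomorphic_deriv[OF _ open_left_half_plane])

lemma has_real_derivative_inner:
  fixes u v :: "real \<Rightarrow> 'a::real_inner"
  assumes "(u has_vector_derivative u') (at x within S)" "(v has_vector_derivative v') (at x within S)"
  shows "((\<lambda>x. u x \<bullet> v x) has_real_derivative (u x \<bullet> v' + u' \<bullet> v x)) (at x within S)"
  using bounded_bilinear.has_vector_derivative[OF bounded_bilinear_inner assms]
  by (simp add: has_real_derivative_iff_has_vector_derivative)

text \<open>Integrate the derivative of -(s1 - s)^2 |u|^2 / 2, which vanishes at \<open>s1\<close>.
  The cross term (s1 - s)^2 (u . u') is split evenly by the arithmetic-geometric mean inequality,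
  and half of the left side is absorbed.\<close>

lemma hardy_inequality:
  fixes u u' :: "real \<Rightarrow> complex"
  assumes le: "s0 \<le> s1"
    and der: "\<And>s. s \<in> {s0..s1} \<Longrightarrow> (u has_vector_derivative u' s) (at s within {s0..s1})"
    and cont': "continuous_on {s0..s1} u'"
  shows "integral {s0..s1} (\<lambda>s. (s1 - s) * (cmod (u s))\<^sup>2)
     \<le> (s1 - s0)\<^sup>2 * (cmod (u s0))\<^sup>2 + integral {s0..s1} (\<lambda>s. (s1 - s)^3 * (cmod (u' s))\<^sup>2)"
proof -
  have cont: "continuous_on {s0..s1} u"
    using der by (rule continuous_on_vector_derivative)
  let ?A = "integral {s0..s1} (\<lambda>s. (s1 - s) * (cmod (u s))\<^sup>2)"
  let ?B = "integral {s0..s1} (\<lambda>s. (s1 - s)^3 * (cmod (u' s))\<^sup>2)"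
  have "((\<lambda>s. - ((s1 - s)\<^sup>2 / 2) * (u s \<bullet> u s)) has_real_derivative
      (s1 - s) * (u s \<bullet> u s) - (s1 - s)\<^sup>2 * (u s \<bullet> u' s)) (at s within {s0..s1})"
    if "s \<in> {s0..s1}" for s
    by (rule derivative_eq_intros has_real_derivative_inner der that refl | simp)+
       (simp add: field_simps inner_commute power2_eq_square)
  then have "((\<lambda>s. (s1 - s) * (u s \<bullet> u s) - (s1 - s)\<^sup>2 * (u s \<bullet> u' s)) has_integral
     (- ((s1 - s1)\<^sup>2 / 2) * (u s1 \<bullet> u s1)) - (- ((s1 - s0)\<^sup>2 / 2) * (u s0 \<bullet> u s0))) {s0..s1}"
    using le by (intro fundamental_theorem_of_calculus)
       (auto simp: has_real_derivative_iff_has_vector_derivative[symmetric])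
  then have eq: "integral {s0..s1} (\<lambda>s. (s1 - s) * (u s \<bullet> u s) - (s1 - s)\<^sup>2 * (u s \<bullet> u' s))
      = (s1 - s0)\<^sup>2 / 2 * (cmod (u s0))\<^sup>2"
    by (simp add: integral_unique dot_square_norm)
  have "?A - ((s1 - s0)\<^sup>2 / 2 * (cmod (u s0))\<^sup>2)
      = integral {s0..s1} (\<lambda>s. (s1 - s)\<^sup>2 * (u s \<bullet> u' s))"
  proof -
    have "integral {s0..s1} (\<lambda>s. (s1 - s) * (u s \<bullet> u s) - (s1 - s)\<^sup>2 * (u s \<bullet> u' s))
      = ?A - integral {s0..s1} (\<lambda>s. (s1 - s)\<^sup>2 * (u s \<bullet> u' s))"
      unfolding dot_square_norm
      by (intro integral_diff integrable_continuous_interval continuous_intros cont cont')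
    then show ?thesis using eq by linarith
  qed
  also have "\<dots> \<le> integral {s0..s1} (\<lambda>s. (1/2) * ((s1 - s) * (cmod (u s))\<^sup>2) + (1/2) * ((s1 - s)^3 * (cmod (u' s))\<^sup>2))"
  proof (rule integral_le)
    fix s assume s: "s \<in> {s0..s1}"
    define x where "x = s1 - s"
    have x: "x \<ge> 0" using s by (simp add: x_def)
    have "u s \<bullet> u' s \<le> cmod (u s) * cmod (u' s)" by (rule norm_cauchy_schwarz)
    then have "x\<^sup>2 * (u s \<bullet> u' s) \<le> x\<^sup>2 * (cmod (u s) * cmod (u' s))"
      by (rule mult_left_mono) simp
    also have "\<dots> = x * (cmod (u s) * (x * cmod (u' s)))" by (simp add: power2_eq_square)
    also have "\<dots> \<le> x * (((cmod (u s))\<^sup>2 + (x * cmod (u' s))\<^sup>2) / 2)"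
      using x sum_squares_bound[of "cmod (u s)" "x * cmod (u' s)"] by (intro mult_left_mono) auto
    also have "\<dots> = (1/2) * (x * (cmod (u s))\<^sup>2) + (1/2) * (x^3 * (cmod (u' s))\<^sup>2)"
      by (simp add: power2_eq_square power3_eq_cube algebra_simps)
    finally show "(s1 - s)\<^sup>2 * (u s \<bullet> u' s) \<le> (1/2) * ((s1 - s) * (cmod (u s))\<^sup>2) + (1/2) * ((s1 - s)^3 * (cmod (u' s))\<^sup>2)"
      by (simp add: x_def)
  qed (auto intro!: integrable_continuous_interval continuous_intros cont cont')
  also have "\<dots> = (1/2) * ?A + (1/2) * ?B"
    by (subst integral_add)
       (auto intro!: integrable_continuous_interval continuous_intros cont cont')
  finally have "?A \<le> (s1 - s0)\<^sup>2 * (cmod (u s0))\<^sup>2 + ?B" by (simp add: field_simps)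
  then show ?thesis .
qed

definition bump :: "real \<Rightarrow> real \<Rightarrow> real \<Rightarrow> real" where
  "bump a L t = (1 - ((t - a) / L)\<^sup>2)\<^sup>2"

definition bump' :: "real \<Rightarrow> real \<Rightarrow> real \<Rightarrow> real" where
  "bump' a L t = - (4 * (t - a) / L\<^sup>2) * (1 - ((t - a) / L)\<^sup>2)"

lemma bump_deriv: "(bump a L has_real_derivative bump' a L t) (at t within S)"
  unfolding bump_def bump'_def
  by (auto intro!: derivative_eq_intros simp: power2_eq_square divide_simps) (simp add: algebra_simps)

lemma continuous_on_bump [continuous_intros]:
  assumes "continuous_on S f"
  shows "continuous_on S (\<lambda>x. bump a L (f x))" "continuous_on S (\<lambda>x. bump' a L (f x))"
  unfolding bump_def bump'_def divide_inverse by (auto intro!: continuous_intros assms)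

lemma bump_bounds:
  assumes "L > 0" "t \<in> {a - L..a + L}"
  shows "0 \<le> bump a L t" "bump a L t \<le> 1" "(bump' a L t)\<^sup>2 \<le> (16 / L\<^sup>2) * bump a L t"
    "\<bar>bump' a L t\<bar> \<le> 4 / L"
proof -
  define x where "x = (t - a) / L"
  have x: "\<bar>x\<bar> \<le> 1" using assms by (auto simp: x_def abs_le_iff field_simps)
  have x2: "x\<^sup>2 \<le> 1" using x by (simp add: abs_square_le_1)
  show "0 \<le> bump a L t" by (simp add: bump_def)
  show le1: "bump a L t \<le> 1" unfolding bump_def x_def[symmetric]
    using x2 by (simp add: abs_square_le_1 power_le_one)
  have b': "bump' a L t = - (4 * x / L) * (1 - x\<^sup>2)"
    using assms by (simp add: bump'_def x_def power2_eq_square)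
  have "(bump' a L t)\<^sup>2 = (16 / L\<^sup>2) * (x\<^sup>2 * bump a L t)"
    unfolding b' bump_def x_def[symmetric] by (simp add: power_mult_distrib power_divide)
  also have "\<dots> \<le> (16 / L\<^sup>2) * (1 * bump a L t)"
    using x2 \<open>0 \<le> bump a L t\<close> by (intro mult_left_mono mult_right_mono) auto
  finally show sq: "(bump' a L t)\<^sup>2 \<le> (16 / L\<^sup>2) * bump a L t" by simp
  also have "\<dots> \<le> (16 / L\<^sup>2) * 1" using le1 by (intro mult_left_mono) auto
  finally have "\<bar>bump' a L t\<bar>\<^sup>2 \<le> (4/L)\<^sup>2" by (simp add: power_divide)
  then show "\<bar>bump' a L t\<bar> \<le> 4 / L" using assms by (simp add: power2_le_iff_abs_le)
qed

lemma bump_ends: "L > 0 \<Longrightarrow> bump a L (a - L) = 0" "L > 0 \<Longrightarrow> bump a L (a + L) = 0"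
  by (auto simp: bump_def)

text \<open>The second derivatives of |u|^2 in s and t are 2 |D|^2 + 2 (u . H'') and 2 |D|^2 - 2 (u
  . H''), so adding the two integrations by parts eliminates H''. The cut-off removes the sides t =
  a - L and t = a + L, and \<open>\<omega> s1 = 0\<close> keeps H' away from the side nearest to the
  boundary, where only |u|^2 remains.\<close>

lemma green_identity:
  fixes H :: "complex \<Rightarrow> complex" and c :: complex and a L :: real and \<omega> \<omega>' \<omega>'' :: "real \<Rightarrow> real"
  assumes hol: "H holomorphic_on left_half_plane" and s01: "s0 \<le> s1" "s1 < 0" and L: "L > 0"
    and \<omega>: "\<And>s. s \<in> {s0..s1} \<Longrightarrow> (\<omega> has_real_derivative \<omega>' s) (at s within {s0..s1})"
      "\<And>s. s \<in> {s0..s1} \<Longrightarrow> (\<omega>' has_real_derivative \<omega>'' s) (at s within {s0..s1})"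
      "continuous_on {s0..s1} \<omega>''" "\<omega> s1 = 0"
  defines "u \<equiv> \<lambda>p. H (Complex (fst p) (snd p)) - c"
    and "D \<equiv> \<lambda>p. deriv H (Complex (fst p) (snd p))"
    and "R \<equiv> cbox (s0, a - L) (s1, a + L)"
  shows "4 * integral R (\<lambda>p. \<omega> (fst p) * (bump a L (snd p) * (cmod (D p))\<^sup>2)) =
     integral {a - L..a + L} (\<lambda>t. bump a L t *
        (- (\<omega> s0 * (2 * (u (s0,t) \<bullet> D (s0,t)))) + \<omega>' s0 * (cmod (u (s0,t)))\<^sup>2 - \<omega>' s1 * (cmod (u (s1,t)))\<^sup>2))
     + integral R (\<lambda>p. \<omega>'' (fst p) * (bump a L (snd p) * (cmod (u p))\<^sup>2))
     - 2 * integral R (\<lambda>p. \<omega> (fst p) * (bump' a L (snd p) * (u p \<bullet> (\<i> * D p))))"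
proof -
  define E where "E = (\<lambda>p. deriv (deriv H) (Complex (fst p) (snd p)))"
  have hol1: "deriv H holomorphic_on left_half_plane"
    and hol2: "deriv (deriv H) holomorphic_on left_half_plane"
    using hol holomorphic_deriv_left_half_plane by blast+
  have neg: "s < 0" if "s \<in> {s0..s1}" for s using that s01 by auto
  have c\<omega>': "continuous_on {s0..s1} \<omega>'" using \<omega>(2) by (rule DERIV_continuous_on)
  have c\<omega>: "continuous_on {s0..s1} \<omega>" using \<omega>(1) by (rule DERIV_continuous_on)
  have cw: "continuous_on R (\<lambda>p. f (fst p))" if "continuous_on {s0..s1} f" for f :: "real \<Rightarrow> real"
    by (rule continuous_on_compose2[OF that]) (auto intro!: continuous_intros simp: R_def)
  have cu: "continuous_on S (\<lambda>x. u (f x, g x))" "continuous_on S (\<lambda>x. D (f x, g x))"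
      "continuous_on S (\<lambda>x. E (f x, g x))"
    if "continuous_on S f" "continuous_on S g" "\<And>x. x \<in> S \<Longrightarrow> f x < 0" for f g and S :: "'z::topological_space set"
    unfolding u_def D_def E_def fst_conv snd_conv
    by (intro continuous_intros half_plane_continuous hol hol1 hol2 that; assumption)+
  have cR: "continuous_on R u" "continuous_on R D" "continuous_on R E"
  proof -
    have "fst p < 0" if "p \<in> R" for p using that s01 by (cases p) (auto simp: R_def)
    then show "continuous_on R u" "continuous_on R D" "continuous_on R E"
      using cu[of R fst snd] by (simp_all add: continuous_on_fst continuous_on_snd)
  qed
  note ci = continuous_intros cw[OF c\<omega>] cw[OF c\<omega>'] cw[OF \<omega>(3)] cR
  have us: "((\<lambda>s. u (s,t)) has_vector_derivative D (s,t)) (at s within S)"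
    and ds: "((\<lambda>s. D (s,t)) has_vector_derivative E (s,t)) (at s within S)"
    and ut: "((\<lambda>t. u (s,t)) has_vector_derivative \<i> * D (s,t)) (at t within S)"
    and dt: "((\<lambda>t. D (s,t)) has_vector_derivative \<i> * E (s,t)) (at t within S)"
    if "s \<in> {s0..s1}" for s t S
    unfolding u_def D_def E_def using neg[OF that]
    by (auto intro!: derivative_eq_intros half_plane_deriv_Re half_plane_deriv_Im hol hol1)
  let ?Vss = "\<lambda>p. 2 * (cmod (D p))\<^sup>2 + 2 * (u p \<bullet> E p)"
  let ?bd = "\<lambda>t. - (\<omega> s0 * (2 * (u (s0,t) \<bullet> D (s0,t)))) + \<omega>' s0 * (cmod (u (s0,t)))\<^sup>2 - \<omega>' s1 * (cmod (u (s1,t)))\<^sup>2"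
  \<comment> \<open>Both integrations by parts in s at once: the integrand is the derivative of
    \<omega> times the s-derivative of |u|^2, minus \<omega>' |u|^2.\<close>
  have S: "integral {s0..s1} (\<lambda>s. \<omega> s * ?Vss (s,t) - \<omega>'' s * (cmod (u (s,t)))\<^sup>2) = ?bd t" for t
  proof -
    have "((\<lambda>s. \<omega> s * (2 * (u (s,t) \<bullet> D (s,t))) - \<omega>' s * (u (s,t) \<bullet> u (s,t))) has_real_derivative
       \<omega> s * ?Vss (s,t) - \<omega>'' s * (cmod (u (s,t)))\<^sup>2) (at s within {s0..s1})" if s: "s \<in> {s0..s1}" for s
      unfolding dot_square_norm[symmetric]
      by (rule derivative_eq_intros has_real_derivative_inner us ds \<omega> s refl)+
         (simp add: algebra_simps inner_commute)
    then have "((\<lambda>s. \<omega> s * ?Vss (s,t) - \<omega>'' s * (cmod (u (s,t)))\<^sup>2) has_integral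
       (\<omega> s1 * (2 * (u (s1,t) \<bullet> D (s1,t))) - \<omega>' s1 * (u (s1,t) \<bullet> u (s1,t))) -
       (\<omega> s0 * (2 * (u (s0,t) \<bullet> D (s0,t))) - \<omega>' s0 * (u (s0,t) \<bullet> u (s0,t)))) {s0..s1}"
      using s01 by (intro fundamental_theorem_of_calculus)
       (auto simp: has_real_derivative_iff_has_vector_derivative[symmetric])
    then show ?thesis using \<omega>(4) by (simp add: integral_unique dot_square_norm)
  qed
  \<comment> \<open>A t-derivative is i times the complex derivative; the resulting factor i * i =
    -1 gives u . H'' the sign opposite to the one in \<open>S\<close>.\<close>
  have T: "integral {a - L..a + L} (\<lambda>t. bump' a L t * (u (s,t) \<bullet> (\<i> * D (s,t))) + bump a L t * ((cmod (D (s,t)))\<^sup>2 - u (s,t) \<bullet> E (s,t))) = 0"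
    if s: "s \<in> {s0..s1}" for s
  proof -
    have "((\<lambda>t. bump a L t * (u (s,t) \<bullet> (\<i> * D (s,t)))) has_real_derivative
        (bump' a L t * (u (s,t) \<bullet> (\<i> * D (s,t))) + bump a L t * ((cmod (D (s,t)))\<^sup>2 - u (s,t) \<bullet> E (s,t))))
        (at t within {a - L..a + L})" for t
    proof -
      have d: "((\<lambda>t. \<i> * D (s,t)) has_vector_derivative \<i> * (\<i> * E (s,t))) (at t within {a - L..a + L})"
        by (intro has_vector_derivative_mult_right dt s)
      show ?thesis
        by (rule derivative_eq_intros has_real_derivative_inner ut d bump_deriv s refl)+
           (simp add: algebra_simps dot_square_norm norm_mult inner_minus_right flip: mult.assoc)
    qed
    then have "((\<lambda>t. bump' a L t * (u (s,t) \<bullet> (\<i> * D (s,t))) + bump a L t * ((cmod (D (s,t)))\<^sup>2 - u (s,t) \<bullet> E (s,t))) has_integral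
       (bump a L (a+L) * (u (s,a+L) \<bullet> (\<i> * D (s,a+L)))) - (bump a L (a-L) * (u (s,a-L) \<bullet> (\<i> * D (s,a-L))))) {a - L..a + L}"
      using L by (intro fundamental_theorem_of_calculus)
       (auto simp: has_real_derivative_iff_has_vector_derivative[symmetric])
    then show ?thesis using bump_ends[OF L] by (simp add: integral_unique)
  qed
  have I1: "integral R (\<lambda>p. \<omega> (fst p) * (bump' a L (snd p) * (u p \<bullet> (\<i> * D p)) + bump a L (snd p) * ((cmod (D p))\<^sup>2 - u p \<bullet> E p))) = 0"
    (is "integral R ?f = 0")
  proof -
    have "integral R ?f = integral (cbox s0 s1) (\<lambda>s. integral (cbox (a-L) (a+L)) (\<lambda>t. ?f (s,t)))"
      unfolding R_def by (rule integral_prod_continuous) (fold R_def, intro ci)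
    also have "\<dots> = integral (cbox s0 s1) (\<lambda>s. 0)"
      using T by (intro integral_cong) simp
    finally show ?thesis by simp
  qed
  let ?g = "\<lambda>p. bump a L (snd p) * (\<omega> (fst p) * ?Vss p - \<omega>'' (fst p) * (cmod (u p))\<^sup>2)"
  have cg: "continuous_on (cbox (s0, a - L) (s1, a + L)) ?g"
    by (fold R_def, intro ci)
  have I2: "integral R (\<lambda>p. bump a L (snd p) * (\<omega> (fst p) * ?Vss p - \<omega>'' (fst p) * (cmod (u p))\<^sup>2)) =
    integral {a - L..a + L} (\<lambda>t. bump a L t * ?bd t)"
  proof -
    have "integral R ?g = integral (cbox s0 s1) (\<lambda>s. integral (cbox (a-L) (a+L)) (\<lambda>t. ?g (s,t)))"
      unfolding R_def by (rule integral_prod_continuous[OF cg])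
    also have "\<dots> = integral (cbox (a-L) (a+L)) (\<lambda>t. integral (cbox s0 s1) (\<lambda>s. ?g (s,t)))"
      using cg by (intro integral_swap_continuous) (simp add: case_prod_unfold)
    also have "\<dots> = integral {a - L..a + L} (\<lambda>t. bump a L t * ?bd t)"
      using S by simp
    finally show ?thesis .
  qed
  have int: "f integrable_on R" if "continuous_on R f" for f :: "real \<times> real \<Rightarrow> real"
    using that unfolding R_def by (rule integrable_continuous)
  let ?X = "\<lambda>p. \<omega> (fst p) * (bump a L (snd p) * (cmod (D p))\<^sup>2)"
  let ?Y = "\<lambda>p. \<omega>'' (fst p) * (bump a L (snd p) * (cmod (u p))\<^sup>2)"
  let ?Z = "\<lambda>p. \<omega> (fst p) * (bump' a L (snd p) * (u p \<bullet> (\<i> * D p)))"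
  let ?W = "\<lambda>p. \<omega> (fst p) * (bump a L (snd p) * (u p \<bullet> E p))"
  have i: "?X integrable_on R" "?Y integrable_on R" "?Z integrable_on R" "?W integrable_on R"
    by (intro int ci)+
  have "integral R ?f = integral R (\<lambda>p. ?Z p + ?X p - ?W p)"
    by (rule integral_cong) (simp add: algebra_simps)
  also have "\<dots> = integral R ?Z + integral R ?X - integral R ?W"
    using i by (simp add: integral_add integral_diff integrable_add)
  finally have e1: "integral R ?Z + integral R ?X - integral R ?W = 0" using I1 by simp
  have "integral R ?g = integral R (\<lambda>p. 2 * ?X p + 2 * ?W p - ?Y p)"
    by (rule integral_cong) (simp add: algebra_simps)
  also have "\<dots> = 2 * integral R ?X + 2 * integral R ?W - integral R ?Y"
    using i by (simp add: integral_add integral_diff integrable_add integrable_on_mult_right)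
  finally show ?thesis using e1 I2 by (simp add: algebra_simps)
qed

lemma bump_ge_half:
  assumes "L > 0" "t \<in> {a - L/2..a + L/2}"
  shows "1 / 2 \<le> bump a L t"
proof -
  have "\<bar>t - a\<bar> \<le> L / 2" using assms by (simp only: abs_le_iff atLeastAtMost_iff) linarith
  then have "\<bar>(t - a) / L\<bar> \<le> 1/2" using assms by (simp add: abs_divide divide_le_eq)
  then have "((t - a) / L)\<^sup>2 \<le> (1/2)\<^sup>2" by (metis abs_ge_zero power2_abs power_mono)
  then have "(3/4)\<^sup>2 \<le> (1 - ((t - a) / L)\<^sup>2)\<^sup>2" by (intro power_mono) (auto simp: power2_eq_square)
  then have "9/16 \<le> bump a L t" by (simp add: bump_def power2_eq_square)
  then show ?thesis by linarith
qed

section \<open>Integrals over boxes and consequences of Green's identity\<close>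

lemma half_plane_continuous_box:
  assumes "H holomorphic_on left_half_plane" "s1 < 0"
  shows "continuous_on (cbox (s0, l) (s1, r)) (\<lambda>p. H (Complex (fst p) (snd p)))"
proof (rule half_plane_continuous[OF assms(1)])
  fix p assume "p \<in> cbox (s0, l) (s1, r)"
  then show "fst p < 0" using assms(2) by (cases p) auto
qed (auto intro!: continuous_intros)

lemma box_integral_iterated:
  fixes f :: "real \<times> real \<Rightarrow> real"
  assumes "continuous_on (cbox (s0, l) (s1, r)) f"
  shows "integral (cbox (s0, l) (s1, r)) f = integral {l..r} (\<lambda>t. integral {s0..s1} (\<lambda>s. f (s, t)))"
proof -
  have "integral (cbox (s0, l) (s1, r)) f = integral (cbox s0 s1) (\<lambda>s. integral (cbox l r) (\<lambda>t. f (s, t)))"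
    by (rule integral_prod_continuous[OF assms])
  also have "\<dots> = integral (cbox l r) (\<lambda>t. integral (cbox s0 s1) (\<lambda>s. f (s, t)))"
    using assms by (intro integral_swap_continuous) (simp add: case_prod_unfold)
  finally show ?thesis by simp
qed

lemma continuous_on_iterated_integral:
  fixes f :: "real \<times> real \<Rightarrow> real"
  assumes "continuous_on (cbox (s0, l) (s1, r)) f"
  shows "continuous_on {l..r} (\<lambda>t. integral {s0..s1} (\<lambda>s. f (s, t)))"
proof -
  have "continuous_on (cbox l r) (\<lambda>t. integral (cbox s0 s1) (\<lambda>s. f (s, t)))"
    by (rule integral_continuous_on_param)
       (unfold case_prod_unfold, rule continuous_on_compose2[OF assms], auto intro!: continuous_intros)
  then show ?thesis by simp
qed

lemma hardy_box:
  assumes hol: "H holomorphic_on left_half_plane" and s: "s0 \<le> s1" "s1 < 0"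
  shows "integral (cbox (s0, l) (s1, r)) (\<lambda>p. (s1 - fst p) * (cmod (H (Complex (fst p) (snd p)) - c))\<^sup>2)
    \<le> (s1 - s0)\<^sup>2 * integral {l..r} (\<lambda>t. (cmod (H (Complex s0 t) - c))\<^sup>2)
      + integral (cbox (s0, l) (s1, r)) (\<lambda>p. (s1 - fst p)^3 * (cmod (deriv H (Complex (fst p) (snd p))))\<^sup>2)"
    (is "integral ?R ?f \<le> _ + integral ?R ?g")
proof -
  have hol': "deriv H holomorphic_on left_half_plane" using hol by (rule holomorphic_deriv_left_half_plane)
  have cf: "continuous_on ?R ?f" and cg: "continuous_on ?R ?g"
    by (intro continuous_intros half_plane_continuous_box hol hol' s)+
  have "integral ?R ?f = integral {l..r} (\<lambda>t. integral {s0..s1} (\<lambda>s. ?f (s, t)))"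
    by (rule box_integral_iterated[OF cf])
  also have "\<dots> \<le> integral {l..r} (\<lambda>t. (s1 - s0)\<^sup>2 * (cmod (H (Complex s0 t) - c))\<^sup>2 + integral {s0..s1} (\<lambda>s. ?g (s, t)))"
  proof (intro integral_le integrable_continuous_interval continuous_intros
      continuous_on_iterated_integral[OF cf] continuous_on_iterated_integral[OF cg] half_plane_continuous[OF hol])
    fix t
    have "integral {s0..s1} (\<lambda>s. (s1 - s) * (cmod (H (Complex s t) - c))\<^sup>2)
     \<le> (s1 - s0)\<^sup>2 * (cmod (H (Complex s0 t) - c))\<^sup>2 + integral {s0..s1} (\<lambda>s. (s1 - s)^3 * (cmod (deriv H (Complex s t)))\<^sup>2)"
    proof (rule hardy_inequality[OF s(1)])
      fix s assume "s \<in> {s0..s1}"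
      then show "((\<lambda>s. H (Complex s t) - c) has_vector_derivative deriv H (Complex s t)) (at s within {s0..s1})"
        using s by (auto intro!: derivative_eq_intros half_plane_deriv_Re hol)
    qed (use s in \<open>auto intro!: half_plane_continuous hol' continuous_intros\<close>)
    then show "integral {s0..s1} (\<lambda>s. ?f (s, t)) \<le> (s1 - s0)\<^sup>2 * (cmod (H (Complex s0 t) - c))\<^sup>2 + integral {s0..s1} (\<lambda>s. ?g (s, t))"
      by simp
  qed (use s in auto)
  also have "\<dots> = (s1 - s0)\<^sup>2 * integral {l..r} (\<lambda>t. (cmod (H (Complex s0 t) - c))\<^sup>2) + integral {l..r} (\<lambda>t. integral {s0..s1} (\<lambda>s. ?g (s, t)))"
  proof -
    have "(\<lambda>t. (cmod (H (Complex s0 t) - c))\<^sup>2) integrable_on {l..r}"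
      using s by (intro integrable_continuous_interval continuous_intros half_plane_continuous[OF hol]) auto
    moreover have "(\<lambda>t. integral {s0..s1} (\<lambda>s. ?g (s, t))) integrable_on {l..r}"
      by (intro integrable_continuous_interval continuous_on_iterated_integral[OF cg])
    ultimately show ?thesis by (simp add: integral_add integrable_on_mult_right)
  qed
  also have "integral {l..r} (\<lambda>t. integral {s0..s1} (\<lambda>s. ?g (s, t))) = integral ?R ?g"
    by (rule box_integral_iterated[OF cg, symmetric])
  finally show ?thesis .
qed

lemma integral_le_const_interval:
  fixes f :: "real \<Rightarrow> real"
  assumes "continuous_on {l..r} f" "\<And>t. t \<in> {l..r} \<Longrightarrow> f t \<le> M" "l \<le> r"
  shows "integral {l..r} f \<le> (r - l) * M"
proof -
  have "integral {l..r} f \<le> integral {l..r} (\<lambda>_. M)"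
    by (intro integral_le integrable_continuous_interval assms continuous_intros)
  then show ?thesis using assms by simp
qed

text \<open>The weight s1 - s has second derivative 0 and slope -1, so Green's identity isolates the
  cut-off integral of |G - c|^2 at \<open>s1\<close>. The cross term produces an area integral of |G
  - c|^2, which Hardy's inequality converts back into the energy. \<open>T\<close> is the size of G'
  at the top \<open>s0\<close>, and the powers of \<open>L\<close> make all terms scale
  alike.\<close>

lemma green_boundary_upper:
  assumes hol: "G holomorphic_on left_half_plane" and s: "s0 \<le> s1" "s1 < 0" "s1 - s0 \<le> L"
    and L: "L > 0"
    and top: "\<And>t. t \<in> {a - L..a + L} \<Longrightarrow> cmod (G (Complex s0 t) - c) \<le> L * T"
      "\<And>t. t \<in> {a - L..a + L} \<Longrightarrow> cmod (deriv G (Complex s0 t)) \<le> T"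
  shows "integral {a - L..a + L} (\<lambda>t. bump a L t * (cmod (G (Complex s1 t) - c))\<^sup>2)
     \<le> 14 * (L^3 * T\<^sup>2 + integral (cbox (s0, a - L) (s1, a + L))
          (\<lambda>p. (s1 - fst p) * (cmod (deriv G (Complex (fst p) (snd p))))\<^sup>2))"
proof -
  define R where "R = cbox (s0, a - L) (s1, a + L)"
  define u where "u = (\<lambda>p. G (Complex (fst p) (snd p)) - c)"
  define D where "D = (\<lambda>p. deriv G (Complex (fst p) (snd p)))"
  have hol': "deriv G holomorphic_on left_half_plane" using hol by (rule holomorphic_deriv_left_half_plane)
  have cu: "continuous_on R u" and cD: "continuous_on R D"
    unfolding u_def D_def R_def by (intro continuous_intros half_plane_continuous_box hol hol' s)+
  have cu': "continuous_on {a - L..a + L} (\<lambda>t. u (s,t))" "continuous_on {a - L..a + L} (\<lambda>t. D (s,t))" if "s < 0" for s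
    unfolding u_def D_def fst_conv snd_conv using that
    by (auto intro!: continuous_intros half_plane_continuous hol hol')
  have s0: "s0 < 0" using s by simp
  have T: "T \<ge> 0" using order_trans[OF norm_ge_zero top(2)[of a]] L by simp
  have fstR: "0 \<le> s1 - fst p" "s1 - fst p \<le> L" "snd p \<in> {a - L..a + L}" if "p \<in> R" for p
    using that s by (cases p; auto simp: R_def)+
  have int: "f integrable_on R" if "continuous_on R f" for f :: "real \<times> real \<Rightarrow> real"
    using that unfolding R_def by (rule integrable_continuous)
  define J where "J = integral R (\<lambda>p. (s1 - fst p) * (cmod (D p))\<^sup>2)"
  define X where "X = integral R (\<lambda>p. (s1 - fst p) * (bump a L (snd p) * (cmod (D p))\<^sup>2))"
  define Z where "Z = integral R (\<lambda>p. (s1 - fst p) * (bump' a L (snd p) * (u p \<bullet> (\<i> * D p))))"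
  define U where "U = integral R (\<lambda>p. (s1 - fst p) * (cmod (u p))\<^sup>2)"
  have XJ: "X \<le> J" unfolding X_def J_def
  proof (intro integral_le int continuous_intros cD)
    fix p assume p: "p \<in> R"
    show "(s1 - fst p) * (bump a L (snd p) * (cmod (D p))\<^sup>2) \<le> (s1 - fst p) * (cmod (D p))\<^sup>2"
      using fstR[OF p] bump_bounds(1,2)[OF L fstR(3)[OF p]]
      by (intro mult_left_mono) (auto intro: mult_left_le_one_le)
  qed
  \<comment> \<open>Hardy's inequality along each vertical segment; one factor (s1 - s)^2 of its
    right side is at most L^2, which leaves the weight of the energy.\<close>
  have U: "U \<le> L\<^sup>2 * (2 * L * (L * T)\<^sup>2) + L\<^sup>2 * J"
  proof -
    have "U \<le> (s1 - s0)\<^sup>2 * integral {a-L..a+L} (\<lambda>t. (cmod (G (Complex s0 t) - c))\<^sup>2)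
        + integral R (\<lambda>p. (s1 - fst p)^3 * (cmod (D p))\<^sup>2)"
      unfolding U_def u_def D_def R_def by (rule hardy_box[OF hol s(1,2)])
    also have "\<dots> \<le> L\<^sup>2 * (2 * L * (L * T)\<^sup>2) + L\<^sup>2 * J"
    proof (rule add_mono)
      have "integral {a-L..a+L} (\<lambda>t. (cmod (G (Complex s0 t) - c))\<^sup>2) \<le> ((a+L) - (a-L)) * (L * T)\<^sup>2"
        using L cu'(1)[OF s0]
        by (intro integral_le_const_interval) (auto simp: u_def intro!: continuous_intros power_mono top)
      moreover have "0 \<le> integral {a-L..a+L} (\<lambda>t. (cmod (G (Complex s0 t) - c))\<^sup>2)"
        using cu'(1)[OF s0] by (intro integral_nonneg integrable_continuous_interval) (auto simp: u_def intro!: continuous_intros)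
      ultimately show "(s1 - s0)\<^sup>2 * integral {a-L..a+L} (\<lambda>t. (cmod (G (Complex s0 t) - c))\<^sup>2) \<le> L\<^sup>2 * (2 * L * (L * T)\<^sup>2)"
        using s L by (intro mult_mono power_mono) auto
      have "integral R (\<lambda>p. (s1 - fst p)^3 * (cmod (D p))\<^sup>2) \<le> integral R (\<lambda>p. L\<^sup>2 * ((s1 - fst p) * (cmod (D p))\<^sup>2))"
      proof (intro integral_le int continuous_intros cD)
        fix p assume p: "p \<in> R"
        have "(s1 - fst p)^2 * ((s1 - fst p) * (cmod (D p))\<^sup>2) \<le> L\<^sup>2 * ((s1 - fst p) * (cmod (D p))\<^sup>2)"
          using fstR[OF p] by (intro mult_right_mono power_mono) auto
        then show "(s1 - fst p)^3 * (cmod (D p))\<^sup>2 \<le> L\<^sup>2 * ((s1 - fst p) * (cmod (D p))\<^sup>2)"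
          by (simp add: power3_eq_cube power2_eq_square mult.assoc)
      qed
      then show "integral R (\<lambda>p. (s1 - fst p)^3 * (cmod (D p))\<^sup>2) \<le> L\<^sup>2 * J"
        by (simp add: J_def)
    qed
    finally show ?thesis .
  qed
  have Z: "2 * Z \<le> 4 * J + (4 / L\<^sup>2) * U"
  proof -
    have "2 * Z = integral R (\<lambda>p. 2 * ((s1 - fst p) * (bump' a L (snd p) * (u p \<bullet> (\<i> * D p)))))"
      by (simp add: Z_def)
    also have "\<dots> \<le> integral R (\<lambda>p. 4 * ((s1 - fst p) * (cmod (D p))\<^sup>2) + (4 / L\<^sup>2) * ((s1 - fst p) * (cmod (u p))\<^sup>2))"
    proof (intro integral_le int continuous_intros cD cu)
      fix p assume p: "p \<in> R"
      have "bump' a L (snd p) * (u p \<bullet> (\<i> * D p)) \<le> \<bar>bump' a L (snd p)\<bar> * \<bar>u p \<bullet> (\<i> * D p)\<bar>"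
        by (metis abs_ge_self abs_mult)
      also have "\<dots> \<le> (4 / L) * (cmod (u p) * cmod (D p))"
        using bump_bounds(4)[OF L fstR(3)[OF p]] Cauchy_Schwarz_ineq2[of "u p" "\<i> * D p"] L
        by (intro mult_mono) (auto simp: norm_mult)
      also have "\<dots> = (4 / L\<^sup>2) * (cmod (u p) * (L * cmod (D p)))" using L by (simp add: power2_eq_square)
      also have "\<dots> \<le> (4 / L\<^sup>2) * (((cmod (u p))\<^sup>2 + (L * cmod (D p))\<^sup>2) / 2)"
        using sum_squares_bound[of "cmod (u p)" "L * cmod (D p)"] by (intro mult_left_mono) auto
      also have "\<dots> = 2 * (cmod (D p))\<^sup>2 + (2 / L\<^sup>2) * (cmod (u p))\<^sup>2"
        using L by (simp add: power2_eq_square field_simps)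
      finally have "(s1 - fst p) * (bump' a L (snd p) * (u p \<bullet> (\<i> * D p)))
          \<le> (s1 - fst p) * (2 * (cmod (D p))\<^sup>2 + (2 / L\<^sup>2) * (cmod (u p))\<^sup>2)"
        using fstR[OF p] by (intro mult_left_mono)
      then have "2 * ((s1 - fst p) * (bump' a L (snd p) * (u p \<bullet> (\<i> * D p))))
          \<le> 2 * ((s1 - fst p) * (2 * (cmod (D p))\<^sup>2 + (2 / L\<^sup>2) * (cmod (u p))\<^sup>2))"
        by (rule mult_left_mono) simp
      also have "\<dots> = 4 * ((s1 - fst p) * (cmod (D p))\<^sup>2) + (4 / L\<^sup>2) * ((s1 - fst p) * (cmod (u p))\<^sup>2)"
        by (simp add: distrib_left)
      finally show "2 * ((s1 - fst p) * (bump' a L (snd p) * (u p \<bullet> (\<i> * D p)))) \<le>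
          4 * ((s1 - fst p) * (cmod (D p))\<^sup>2) + (4 / L\<^sup>2) * ((s1 - fst p) * (cmod (u p))\<^sup>2)" .
    qed
    also have "\<dots> = 4 * J + (4 / L\<^sup>2) * U"
    proof -
      have i1: "(\<lambda>p. (s1 - fst p) * (cmod (D p))\<^sup>2) integrable_on R"
        and i2: "(\<lambda>p. (s1 - fst p) * (cmod (u p))\<^sup>2) integrable_on R"
        by (intro int continuous_intros cD cu)+
      show ?thesis
        by (simp only: integral_add[OF integrable_on_mult_right[OF i1] integrable_on_mult_right[OF i2]] integral_mult_right J_def U_def)
    qed
    finally show ?thesis .
  qed
  have bd: "integral {a-L..a+L} (\<lambda>t. bump a L t * ((s1 - s0) * (2 * (u (s0,t) \<bullet> D (s0,t))) + (cmod (u (s0,t)))\<^sup>2))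
      \<le> ((a+L) - (a-L)) * (3 * (L * T)\<^sup>2 )"
  proof (intro integral_le_const_interval continuous_intros cu' s0)
    fix t assume t: "t \<in> {a-L..a+L}"
    have 1: "cmod (u (s0,t)) \<le> L * T" "cmod (D (s0,t)) \<le> T" using top[OF t] by (auto simp: u_def D_def)
    have "u (s0,t) \<bullet> D (s0,t) \<le> cmod (u (s0,t)) * cmod (D (s0,t))" by (rule norm_cauchy_schwarz)
    also have "\<dots> \<le> (L * T) * T" using 1 L T by (intro mult_mono) auto
    finally have "(s1 - s0) * (2 * (u (s0,t) \<bullet> D (s0,t))) \<le> (s1 - s0) * (2 * ((L * T) * T))"
      using s by (intro mult_left_mono) auto
    also have "\<dots> \<le> L * (2 * ((L * T) * T))" using s L T by (intro mult_right_mono) auto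
    finally have 2: "(s1 - s0) * (2 * (u (s0,t) \<bullet> D (s0,t))) + (cmod (u (s0,t)))\<^sup>2 \<le> L * (2 * ((L * T) * T)) + (L * T)\<^sup>2"
      using 1 by (intro add_mono power_mono) auto
    have "bump a L t * ((s1 - s0) * (2 * (u (s0,t) \<bullet> D (s0,t))) + (cmod (u (s0,t)))\<^sup>2) \<le> bump a L t * (3 * (L*T)\<^sup>2)"
      using 2 bump_bounds(1)[OF L t] by (intro mult_left_mono) (auto simp: power2_eq_square algebra_simps)
    also have "\<dots> \<le> 1 * (3 * (L*T)\<^sup>2)" using bump_bounds(2)[OF L t] by (intro mult_right_mono) auto
    finally show "bump a L t * ((s1 - s0) * (2 * (u (s0,t) \<bullet> D (s0,t))) + (cmod (u (s0,t)))\<^sup>2) \<le> 3 * (L*T)\<^sup>2" by simp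
  qed (use L in auto)
  have "4 * X = integral {a - L..a + L} (\<lambda>t. bump a L t *
        (- ((s1 - s0) * (2 * (u (s0,t) \<bullet> D (s0,t)))) + (-1) * (cmod (u (s0,t)))\<^sup>2 - (-1) * (cmod (u (s1,t)))\<^sup>2))
     + integral R (\<lambda>p. 0 * (bump a L (snd p) * (cmod (u p))\<^sup>2)) - 2 * Z"
    unfolding X_def Z_def R_def u_def D_def
    by (rule green_identity[OF hol s(1,2) L, where \<omega>' = "\<lambda>_. -1"]) (auto intro!: derivative_eq_intros)
  also have "integral {a - L..a + L} (\<lambda>t. bump a L t *
        (- ((s1 - s0) * (2 * (u (s0,t) \<bullet> D (s0,t)))) + (-1) * (cmod (u (s0,t)))\<^sup>2 - (-1) * (cmod (u (s1,t)))\<^sup>2))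
     = integral {a - L..a + L} (\<lambda>t. bump a L t * (cmod (u (s1,t)))\<^sup>2) -
       integral {a-L..a+L} (\<lambda>t. bump a L t * ((s1 - s0) * (2 * (u (s0,t) \<bullet> D (s0,t))) + (cmod (u (s0,t)))\<^sup>2))"
    (is "integral _ ?l = integral _ ?l1 - integral _ ?l2")
  proof -
    have "?l1 integrable_on {a-L..a+L}" "?l2 integrable_on {a-L..a+L}"
      using s0 s(2) by (intro integrable_continuous_interval continuous_intros cu'; simp)+
    then have "integral {a-L..a+L} ?l1 - integral {a-L..a+L} ?l2 = integral {a-L..a+L} (\<lambda>t. ?l1 t - ?l2 t)"
      by (simp add: integral_diff)
    also have "\<dots> = integral {a-L..a+L} ?l" by (rule integral_cong) (simp add: algebra_simps)
    finally show ?thesis by simp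
  qed
  finally have "integral {a - L..a + L} (\<lambda>t. bump a L t * (cmod (u (s1,t)))\<^sup>2) \<le> 4 * X + 2 * Z + ((a+L) - (a-L)) * (3 * (L * T)\<^sup>2 )"
    using bd by simp
  also have "\<dots> \<le> 4 * J + (4 * J + (4 / L\<^sup>2) * (L\<^sup>2 * (2 * L * (L * T)\<^sup>2) + L\<^sup>2 * J)) + ((a+L) - (a-L)) * (3 * (L * T)\<^sup>2 )"
  proof -
    have "(4 / L\<^sup>2) * U \<le> (4 / L\<^sup>2) * (L\<^sup>2 * (2 * L * (L * T)\<^sup>2) + L\<^sup>2 * J)"
      by (rule mult_left_mono[OF U]) simp
    then show ?thesis using XJ Z by linarith
  qed
  also have "\<dots> = 12 * J + 14 * (L^3 * T\<^sup>2)"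
    using L by (simp add: field_simps power2_eq_square power3_eq_cube)
  also have "\<dots> \<le> 14 * (L^3 * T\<^sup>2 + J)"
  proof -
    have "J \<ge> 0" unfolding J_def by (rule integral_nonneg) (auto intro!: int continuous_intros cD fstR mult_nonneg_nonneg)
    then show ?thesis by simp
  qed
  finally show ?thesis unfolding u_def D_def J_def R_def by simp
qed

text \<open>Here the area term is the one to be bounded, so the cross term has to be absorbed into
  it. Because |bump'| is at most (4 / L) sqrt bump, the arithmetic-geometric mean inequality puts
  exactly bump |D|^2 on one side; this costs one of the four copies.\<close>

lemma green_area_upper:
  fixes H :: "complex \<Rightarrow> complex" and c :: complex and a L :: real and \<omega> \<omega>' \<omega>'' :: "real \<Rightarrow> real"
  assumes hol: "H holomorphic_on left_half_plane" and s: "s0 \<le> s1" "s1 < 0" and L: "L > 0"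
    and \<omega>: "\<And>s. s \<in> {s0..s1} \<Longrightarrow> (\<omega> has_real_derivative \<omega>' s) (at s within {s0..s1})"
      "\<And>s. s \<in> {s0..s1} \<Longrightarrow> (\<omega>' has_real_derivative \<omega>'' s) (at s within {s0..s1})"
      "continuous_on {s0..s1} \<omega>''" "\<omega> s1 = 0"
    and nonneg: "\<And>s. s \<in> {s0..s1} \<Longrightarrow> 0 \<le> \<omega> s"
  defines "u \<equiv> \<lambda>p. H (Complex (fst p) (snd p)) - c"
    and "D \<equiv> \<lambda>p. deriv H (Complex (fst p) (snd p))"
    and "R \<equiv> cbox (s0, a - L) (s1, a + L)"
  shows "3 * integral R (\<lambda>p. \<omega> (fst p) * (bump a L (snd p) * (cmod (D p))\<^sup>2)) \<le>
     integral {a - L..a + L} (\<lambda>t. bump a L t *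
        (- (\<omega> s0 * (2 * (u (s0,t) \<bullet> D (s0,t)))) + \<omega>' s0 * (cmod (u (s0,t)))\<^sup>2 - \<omega>' s1 * (cmod (u (s1,t)))\<^sup>2))
     + integral R (\<lambda>p. \<omega>'' (fst p) * (bump a L (snd p) * (cmod (u p))\<^sup>2))
     + (16 / L\<^sup>2) * integral R (\<lambda>p. \<omega> (fst p) * (cmod (u p))\<^sup>2)"
proof -
  have hol': "deriv H holomorphic_on left_half_plane" using hol by (rule holomorphic_deriv_left_half_plane)
  have cu: "continuous_on R u" and cD: "continuous_on R D"
    unfolding u_def D_def R_def by (intro continuous_intros half_plane_continuous_box hol hol' s)+
  have c\<omega>0: "continuous_on {s0..s1} \<omega>" using \<omega>(1) by (rule DERIV_continuous_on)
  have c\<omega>: "continuous_on R (\<lambda>p. \<omega> (fst p))"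
    by (rule continuous_on_compose2[OF c\<omega>0]) (auto intro!: continuous_intros simp: R_def)
  have fstR: "fst p \<in> {s0..s1}" "snd p \<in> {a - L..a + L}" if "p \<in> R" for p
    using that s by (cases p; auto simp: R_def)+
  have int: "f integrable_on R" if "continuous_on R f" for f :: "real \<times> real \<Rightarrow> real"
    using that unfolding R_def by (rule integrable_continuous)
  define X where "X = integral R (\<lambda>p. \<omega> (fst p) * (bump a L (snd p) * (cmod (D p))\<^sup>2))"
  define Z where "Z = integral R (\<lambda>p. \<omega> (fst p) * (bump' a L (snd p) * (u p \<bullet> (\<i> * D p))))"
  define U where "U = integral R (\<lambda>p. \<omega> (fst p) * (cmod (u p))\<^sup>2)"
  have "- 2 * Z = integral R (\<lambda>p. - 2 * (\<omega> (fst p) * (bump' a L (snd p) * (u p \<bullet> (\<i> * D p)))))"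
    by (simp only: Z_def integral_mult_right)
  also have "\<dots> \<le> integral R (\<lambda>p. \<omega> (fst p) * (bump a L (snd p) * (cmod (D p))\<^sup>2) + (16 / L\<^sup>2) * (\<omega> (fst p) * (cmod (u p))\<^sup>2))"
  proof (intro integral_le int continuous_intros cD cu c\<omega>)
    fix p assume p: "p \<in> R"
    define b where "b = bump a L (snd p)"
    have b: "0 \<le> b" "(bump' a L (snd p))\<^sup>2 \<le> (16 / L\<^sup>2) * b"
      using bump_bounds[OF L fstR(2)[OF p]] by (auto simp: b_def)
    have b'2: "\<bar>bump' a L (snd p)\<bar> \<le> 4 / L * sqrt b"
    proof -
      have "\<bar>bump' a L (snd p)\<bar>\<^sup>2 \<le> (4 / L * sqrt b)\<^sup>2" using b by (simp add: power_mult_distrib power_divide)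
      then show ?thesis using L b by (simp add: power2_le_iff_abs_le)
    qed
    have "- 2 * (bump' a L (snd p) * (u p \<bullet> (\<i> * D p))) \<le> 2 * (\<bar>bump' a L (snd p)\<bar> * \<bar>u p \<bullet> (\<i> * D p)\<bar>)"
      using abs_ge_minus_self[of "bump' a L (snd p) * (u p \<bullet> (\<i> * D p))"] by (simp add: abs_mult)
    also have "\<dots> \<le> 2 * ((4 / L * sqrt b) * (cmod (u p) * cmod (D p)))"
      using b'2 Cauchy_Schwarz_ineq2[of "u p" "\<i> * D p"] L b
      by (intro mult_mono) (auto simp: norm_mult)
    also have "\<dots> = 2 * ((4 / L) * cmod (u p)) * (sqrt b * cmod (D p))" by simp
    also have "\<dots> \<le> ((4 / L) * cmod (u p))\<^sup>2 + (sqrt b * cmod (D p))\<^sup>2"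
      by (rule sum_squares_bound)
    also have "\<dots> = b * (cmod (D p))\<^sup>2 + (16 / L\<^sup>2) * (cmod (u p))\<^sup>2"
      using b by (simp add: power_mult_distrib power_divide)
    finally have "\<omega> (fst p) * (- 2 * (bump' a L (snd p) * (u p \<bullet> (\<i> * D p)))) \<le> \<omega> (fst p) * (b * (cmod (D p))\<^sup>2 + (16 / L\<^sup>2) * (cmod (u p))\<^sup>2)"
      using nonneg[OF fstR(1)[OF p]] by (intro mult_left_mono)
    then show "- 2 * (\<omega> (fst p) * (bump' a L (snd p) * (u p \<bullet> (\<i> * D p)))) \<le>
       \<omega> (fst p) * (bump a L (snd p) * (cmod (D p))\<^sup>2) + (16 / L\<^sup>2) * (\<omega> (fst p) * (cmod (u p))\<^sup>2)"
      by (simp add: b_def algebra_simps)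
  qed
  also have "\<dots> = X + (16 / L\<^sup>2) * U"
  proof -
    have i1: "(\<lambda>p. \<omega> (fst p) * (bump a L (snd p) * (cmod (D p))\<^sup>2)) integrable_on R"
      and i2: "(\<lambda>p. \<omega> (fst p) * (cmod (u p))\<^sup>2) integrable_on R"
      by (intro int continuous_intros cD cu c\<omega>)+
    show ?thesis
      by (simp only: integral_add[OF i1 integrable_on_mult_right[OF i2]] integral_mult_right X_def U_def)
  qed
  finally have "- 2 * Z \<le> X + (16 / L\<^sup>2) * U" .
  then show ?thesis
    using green_identity[OF hol s L \<omega>, where a=a and c=c]
    unfolding X_def[symmetric] Z_def[symmetric] U_def[symmetric] u_def[symmetric] D_def[symmetric] R_def[symmetric]
    by (simp add: X_def Z_def U_def u_def D_def R_def)
qed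

subsection \<open>From the Schwarzian to the oscillation\<close>

definition strip_schwarzian :: "(complex \<Rightarrow> complex) \<Rightarrow> complex \<Rightarrow> complex" where
  "strip_schwarzian G w = deriv (deriv G) w - deriv G w - (deriv G w)\<^sup>2 / 2"

abbreviation (input) schwarzian_density :: "(complex \<Rightarrow> complex) \<Rightarrow> real \<times> real \<Rightarrow> real" where
  "schwarzian_density G \<equiv> (\<lambda>p. (- fst p)^3 * (cmod (strip_schwarzian G (Complex (fst p) (snd p))))\<^sup>2)"

abbreviation (input) energy_density :: "(complex \<Rightarrow> complex) \<Rightarrow> real \<times> real \<Rightarrow> real" where
  "energy_density G \<equiv> (\<lambda>p. (- fst p) * (cmod (deriv G (Complex (fst p) (snd p))))\<^sup>2)"

definition strip_little_bloch :: "(complex \<Rightarrow> complex) \<Rightarrow> bool" where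
  "strip_little_bloch G \<longleftrightarrow> (\<forall>\<epsilon>>0. \<exists>\<delta>>0. \<forall>s t. - \<delta> \<le> s \<and> s < 0 \<longrightarrow> - s * cmod (deriv G (Complex s t)) \<le> \<epsilon>)"

text \<open>
  Growth, Carleson and oscillation conditions only concern small scales. The cut-off at \<open>s1 < 0\<close> in the area integrals,
  and at \<open>s2\<close> in the oscillation, keeps all integrands continuous up to the boundary of the region.
\<close>

definition strip_growth :: "real \<Rightarrow> real \<Rightarrow> (complex \<Rightarrow> complex) \<Rightarrow> bool" where
  "strip_growth p C G \<longleftrightarrow> (\<exists>\<delta>>0. \<forall>s t. - \<delta> \<le> s \<and> s < 0 \<longrightarrow>
     cmod (deriv G (Complex s t)) \<le> C * (- s) powr ((p - 3) / 2))"

definition strip_carleson :: "real \<Rightarrow> real \<Rightarrow> (real \<times> real \<Rightarrow> real) \<Rightarrow> bool" where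
  "strip_carleson p C F \<longleftrightarrow> (\<exists>\<delta>>0. \<forall>L a s1. 0 < L \<and> L \<le> \<delta> \<and> - L \<le> s1 \<and> s1 < 0 \<longrightarrow>
     integral (cbox (- L, a - L) (s1, a + L)) F \<le> C * L powr p)"

lemma deriv2_eq_strip_schwarzian:
  "deriv (deriv G) w = strip_schwarzian G w + deriv G w + (deriv G w)\<^sup>2 / 2"
  by (simp add: strip_schwarzian_def)

lemma holomorphic_strip_schwarzian:
  assumes "G holomorphic_on left_half_plane"
  shows "strip_schwarzian G holomorphic_on left_half_plane"
  unfolding strip_schwarzian_def
  by (intro holomorphic_intros holomorphic_deriv_left_half_plane assms) auto

text \<open>Both lower order terms of the Riccati equation are charged to \<epsilon> / (-s) * |G'|:
  G' pays with -s \<le> \<epsilon> / 2, and G'^2 / 2 pays with (-s) |G'| \<le> \<epsilon>.\<close>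

lemma deriv2_bound:
  assumes s: "s < 0" "- s * cmod (deriv G (Complex s t)) \<le> \<epsilon>" "- s \<le> \<epsilon> / 2"
  shows "cmod (deriv (deriv G) (Complex s t))
     \<le> cmod (strip_schwarzian G (Complex s t)) + \<epsilon> / (- s) * cmod (deriv G (Complex s t))"
proof -
  let ?d = "cmod (deriv G (Complex s t))"
  have "cmod (deriv (deriv G) (Complex s t)) \<le> cmod (strip_schwarzian G (Complex s t)) + ?d + ?d\<^sup>2 / 2"
    unfolding deriv2_eq_strip_schwarzian[of G]
    by (rule norm_triangle_le, intro add_mono order_refl norm_triangle_le)
       (auto simp: norm_power norm_divide)
  moreover have "- s * (?d + ?d\<^sup>2 / 2) \<le> \<epsilon> * ?d"
  proof -
    have "- s * (?d + ?d\<^sup>2 / 2) = (- s + (- s * ?d) / 2) * ?d" by (simp add: power2_eq_square algebra_simps)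
    also have "\<dots> \<le> (\<epsilon> / 2 + \<epsilon> / 2) * ?d" using s by (intro mult_right_mono add_mono) auto
    finally show ?thesis by simp
  qed
  then have "?d + ?d\<^sup>2 / 2 \<le> \<epsilon> / (- s) * ?d" using s(1)
    by (subst times_divide_eq_left, subst pos_le_divide_eq) (auto simp: mult.commute)
  ultimately show ?thesis by linarith
qed

lemma growth_step:
  fixes u u' :: "real \<Rightarrow> complex"
  assumes s: "s0 \<le> s" "s < 0" and \<beta>: "\<beta> > 0"
    and der: "\<And>r. r \<in> {s0..s} \<Longrightarrow> (u has_vector_derivative u' r) (at r within {s0..s})"
    and bd: "\<And>r. r \<in> {s0..s} \<Longrightarrow> cmod (u' r) \<le> K * (- r) powr (- \<beta> - 1)" and K: "K \<ge> 0"
  shows "cmod (u s) \<le> cmod (u s0) + K / \<beta> * (- s) powr (- \<beta>)"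
proof (cases "s0 = s")
  case True
  then show ?thesis using K \<beta> by simp
next
  case False
  have "norm (u s - u s0) \<le> K / \<beta> * (- s) powr (- \<beta>) - K / \<beta> * (- s0) powr (- \<beta>)"
  proof (rule differentiable_bound_general)
    show "s0 < s" using s False by simp
    show "continuous_on {s0..s} u" using der by (rule continuous_on_vector_derivative)
    show "continuous_on {s0..s} (\<lambda>s. K / \<beta> * (- s) powr (- \<beta>))"
      using s by (intro continuous_intros) auto
    fix r assume r: "s0 < r" "r < s"
    show "(u has_vector_derivative u' r) (at r)"
      using der[of r] r by (simp add: at_within_Icc_at)
    show "((\<lambda>s. K / \<beta> * (- s) powr (- \<beta>)) has_vector_derivative K * (- r) powr (- \<beta> - 1)) (at r)"
      unfolding has_real_derivative_iff_has_vector_derivative[symmetric]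
      using r s \<beta> by (auto intro!: derivative_eq_intros)
    show "norm (u' r) \<le> K * (- r) powr (- \<beta> - 1)" using bd[of r] r by simp
  qed
  moreover have "0 \<le> K / \<beta> * (- s0) powr (- \<beta>)" using K \<beta> by simp
  ultimately show ?thesis using norm_triangle_sub[of "u s" "u s0"] by linarith
qed

text \<open>
  The Riccati equation gives \<open>|G''| \<le> |\<sigma>| + \<epsilon> / (-s) * |G'|\<close> near the boundary; for small \<open>\<epsilon>\<close> the last
  term is absorbed into the supremum of \<open>(-s) powr ((3 - p) / 2) * |G'|\<close>.
\<close>

lemma growth_from_schwarzian:
  assumes hol: "G holomorphic_on left_half_plane" and lb: "strip_little_bloch G" and p: "p < 3"
    and C: "C > 0" and \<delta>0: "\<delta>0 > 0"
    and \<sigma>: "\<And>s t. - \<delta>0 \<le> s \<Longrightarrow> s < 0 \<Longrightarrow> cmod (strip_schwarzian G (Complex s t)) \<le> C * (- s) powr ((p - 5) / 2)"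
  shows "strip_growth p (6 / (3 - p) * C) G"
proof -
  define \<beta> where "\<beta> = (3 - p) / 2"
  have \<beta>: "\<beta> > 0" using p by (simp add: \<beta>_def)
  have e: "(p - 5) / 2 = - \<beta> - 1" "(p - 3) / 2 = - \<beta>" "6 / (3 - p) = 3 / \<beta>"
    using p by (simp_all add: \<beta>_def field_simps)
  let ?D = "\<lambda>s t. deriv G (Complex s t)"
  have hol': "deriv G holomorphic_on left_half_plane" using hol by (rule holomorphic_deriv_left_half_plane)
  have step: "cmod (?D s t) \<le> cmod (?D s0 t) + (\<epsilon> * M + C) / \<beta> * (- s) powr (- \<beta>)"
    if s: "s0 \<le> s" "s < 0" "- \<delta>0 \<le> s0" "- s0 \<le> \<epsilon> / 2" and M: "M \<ge> 0" "\<epsilon> > 0"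
      and b: "\<And>r. r \<in> {s0..s} \<Longrightarrow> - r * cmod (?D r t) \<le> \<epsilon>"
      and m: "\<And>r. r \<in> {s0..s} \<Longrightarrow> cmod (?D r t) \<le> M * (- r) powr (- \<beta>)" for s0 s t \<epsilon> M
  proof (rule growth_step[OF s(1,2) \<beta>])
    fix r assume r: "r \<in> {s0..s}"
    then have r0: "r < 0" using s by simp
    show "((\<lambda>s. ?D s t) has_vector_derivative deriv (deriv G) (Complex r t)) (at r within {s0..s})"
      using half_plane_deriv_Re[OF hol' r0] .
    have "cmod (deriv (deriv G) (Complex r t)) \<le> cmod (strip_schwarzian G (Complex r t)) + \<epsilon> / (- r) * cmod (?D r t)"
      using r s by (intro deriv2_bound b r0) auto
    also have "\<dots> \<le> C * (- r) powr (- \<beta> - 1) + \<epsilon> / (- r) * (M * (- r) powr (- \<beta>))"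
    proof (intro add_mono mult_left_mono m r)
      show "cmod (strip_schwarzian G (Complex r t)) \<le> C * (- r) powr (- \<beta> - 1)"
        using \<sigma>[of r t] r r0 s unfolding e by auto
      show "0 \<le> \<epsilon> / (- r)" using M r0 by (intro divide_nonneg_pos) auto
    qed
    also have "\<epsilon> / (- r) * (M * (- r) powr (- \<beta>)) = \<epsilon> * M * (- r) powr (- \<beta> - 1)"
      using r0 by (simp add: powr_diff)
    finally show "cmod (deriv (deriv G) (Complex r t)) \<le> (\<epsilon> * M + C) * (- r) powr (- \<beta> - 1)"
      by (simp add: algebra_simps)
  qed (use M C in auto)
  obtain \<delta>1 where \<delta>1: "\<delta>1 > 0" "\<And>s t. - \<delta>1 \<le> s \<Longrightarrow> s < 0 \<Longrightarrow> - s * cmod (?D s t) \<le> \<beta> / 2"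
    using lb \<beta> unfolding strip_little_bloch_def by (metis half_gt_zero)
  define d where "d = min \<delta>1 (min \<delta>0 (\<beta> / 4))"
  have d: "d > 0" "d \<le> \<delta>1" "d \<le> \<delta>0" "d \<le> \<beta> / 4" using \<delta>1 \<delta>0 \<beta> by (auto simp: d_def)
  \<comment> \<open>First pass, with \<epsilon> = \<beta> / 2, so that exactly half of the supremum
    is absorbed. \<open>M0\<close> still contains the size of G' at height \<open>d\<close> and is
    therefore not proportional to \<open>C\<close>.\<close>
  define M0 where "M0 = 2 * ((\<beta> / 2 / d) * d powr \<beta>) + 2 * C / \<beta>"
  have M0: "M0 > 0" using d \<beta> C by (simp add: M0_def add_nonneg_pos)
  have first: "cmod (?D s t) \<le> M0 * (- s) powr (- \<beta>)" if s: "- d \<le> s" "s < 0" for s t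
  proof -
    \<comment> \<open>The maximum is taken over a compact interval that stops at \<open>s\<close>,
      so it is known to be finite before it is absorbed; the resulting bound does not depend on
      \<open>s\<close>.\<close>
    have "continuous_on {-d..s} (\<lambda>r. cmod (?D r t) * (- r) powr \<beta>)"
      using s by (intro continuous_intros half_plane_continuous[OF hol']) auto
    then obtain q where q: "q \<in> {-d..s}" "\<And>r. r \<in> {-d..s} \<Longrightarrow> cmod (?D r t) * (- r) powr \<beta> \<le> cmod (?D q t) * (- q) powr \<beta>"
      using s continuous_attains_sup[of "{-d..s}" "\<lambda>r. cmod (?D r t) * (- r) powr \<beta>"] by auto
    define M where "M = cmod (?D q t) * (- q) powr \<beta>"
    have M: "M \<ge> 0" by (simp add: M_def)
    have q0: "q < 0" using q s by simp
    have m: "cmod (?D r t) \<le> M * (- r) powr (- \<beta>)" if "r \<in> {-d..s}" for r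
      using q(2)[OF that] that s by (simp add: M_def[symmetric] powr_minus divide_simps)
    have dd: "cmod (?D (-d) t) \<le> \<beta> / 2 / d" using \<delta>1(2)[of "-d" t] d by (simp add: field_simps)
    have "cmod (?D q t) \<le> cmod (?D (-d) t) + (\<beta> / 2 * M + C) / \<beta> * (- q) powr (- \<beta>)"
    proof (rule step)
      show "- d \<le> q" "q < 0" "- \<delta>0 \<le> - d" "- (- d) \<le> \<beta> / 2 / 2" "M \<ge> 0" "\<beta> / 2 > 0"
        using q q0 d M \<beta> by auto
      fix r assume r: "r \<in> {- d..q}"
      then show "- r * cmod (?D r t) \<le> \<beta> / 2" using \<delta>1(2)[of r t] d q0 by auto
      show "cmod (?D r t) \<le> M * (- r) powr (- \<beta>)" using m[of r] r q by auto
    qed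
    then have "cmod (?D q t) * (- q) powr \<beta> \<le> (cmod (?D (-d) t) + (\<beta> / 2 * M + C) / \<beta> * (- q) powr (- \<beta>)) * (- q) powr \<beta>"
      by (rule mult_right_mono) simp
    also have "\<dots> = cmod (?D (-d) t) * (- q) powr \<beta> + (\<beta> / 2 * M + C) / \<beta>"
      using q0 by (simp add: algebra_simps powr_minus)
    also have "cmod (?D (-d) t) * (- q) powr \<beta> \<le> (\<beta> / 2 / d) * d powr \<beta>"
      using dd q q0 \<beta> d by (intro mult_mono powr_mono2) auto
    finally have "M \<le> (\<beta> / 2 / d) * d powr \<beta> + (\<beta> / 2 * M + C) / \<beta>" by (simp add: M_def)
    also have "(\<beta> / 2 * M + C) / \<beta> = M / 2 + C / \<beta>" using \<beta> by (simp add: field_simps)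
    finally have "M \<le> M0" by (simp add: M0_def)
    then show ?thesis using m[of s] s by (auto intro: order_trans mult_right_mono)
  qed
  \<comment> \<open>Second pass: with this \<epsilon> the absorbed term \<epsilon> * M0 contributes
    just another \<open>C\<close>, which removes \<open>M0\<close> from the constant.\<close>
  define \<epsilon> where "\<epsilon> = C / M0"
  have \<epsilon>: "\<epsilon> > 0" using C M0 by (simp add: \<epsilon>_def)
  obtain \<delta>2 where \<delta>2: "\<delta>2 > 0" "\<And>s t. - \<delta>2 \<le> s \<Longrightarrow> s < 0 \<Longrightarrow> - s * cmod (?D s t) \<le> \<epsilon>"
    using lb \<epsilon> unfolding strip_little_bloch_def by metis
  define h where "h = min \<delta>2 (min d (\<epsilon> / 2))"
  have h: "h > 0" "h \<le> \<delta>2" "h \<le> d" "h \<le> \<epsilon> / 2" using \<delta>2 d \<epsilon> by (auto simp: h_def)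
  \<comment> \<open>\<open>k\<close> is so small that the starting value \<epsilon> / h at height
    \<open>h\<close> is at most (C / \<beta>) (-s)^(-\<beta>). Together with the 2 * C from the
    integral this accounts for the factor 3 / \<beta>.\<close>
  define k where "k = min h ((C / \<beta> * h / \<epsilon>) powr (1 / \<beta>))"
  have k: "k > 0" "k \<le> h" "k \<le> (C / \<beta> * h / \<epsilon>) powr (1 / \<beta>)" using h C \<beta> \<epsilon> by (auto simp: k_def)
  show ?thesis unfolding strip_growth_def e
  proof (intro exI[of _ k] conjI k allI impI)
    fix s t assume s: "- k \<le> s \<and> s < 0"
    have "cmod (?D s t) \<le> cmod (?D (-h) t) + (\<epsilon> * M0 + C) / \<beta> * (- s) powr (- \<beta>)"
    proof (rule step)
      show "- h \<le> s" "s < 0" "- \<delta>0 \<le> - h" "- (- h) \<le> \<epsilon> / 2" "M0 \<ge> 0" "\<epsilon> > 0"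
        using s k h d M0 \<epsilon> by auto
      fix r assume r: "r \<in> {- h..s}"
      then show "- r * cmod (?D r t) \<le> \<epsilon>" using \<delta>2(2)[of r t] h s by auto
      show "cmod (?D r t) \<le> M0 * (- r) powr (- \<beta>)" using first[of r t] r h s by auto
    qed
    also have "\<epsilon> * M0 + C = 2 * C" using M0 by (simp add: \<epsilon>_def)
    also have "cmod (?D (-h) t) \<le> C / \<beta> * (- s) powr (- \<beta>)"
    proof -
      have "(- s) powr \<beta> \<le> ((C / \<beta> * h / \<epsilon>) powr (1 / \<beta>)) powr \<beta>"
        using s k \<beta> by (intro powr_mono2) auto
      also have "\<dots> = C / \<beta> * h / \<epsilon>" using \<beta> C h \<epsilon> by (simp add: powr_powr)
      finally have 1: "\<epsilon> / h \<le> C / \<beta> * (- s) powr (- \<beta>)"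
        using s h \<epsilon> \<beta> by (simp add: powr_minus field_simps)
      have "cmod (?D (-h) t) \<le> \<epsilon> / h" using \<delta>2(2)[of "-h" t] h by (simp add: field_simps)
      with 1 show ?thesis by linarith
    qed
    finally show "cmod (?D s t) \<le> 3 / \<beta> * C * (- s) powr (- \<beta>)" by (simp add: field_simps)
  qed
qed

text \<open>
  Hardy's inequality bounds the energy by \<open>\<integral>\<integral> (s1 - s)^3 |G''|\<^sup>2\<close>, in which the contribution of
  \<open>\<epsilon> / (-s) * G'\<close> is a small multiple of the energy itself.
\<close>

lemma energy_from_schwarzian:
  assumes hol: "G holomorphic_on left_half_plane" and s: "s0 \<le> s1" "s1 < 0" "s1 - s0 \<le> L"
    and \<epsilon>: "\<epsilon> \<le> 1 / 2" "- s0 \<le> \<epsilon> / 2"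
    and b: "\<And>s t. s0 \<le> s \<Longrightarrow> s < 0 \<Longrightarrow> - s * cmod (deriv G (Complex s t)) \<le> \<epsilon>"
    and T: "\<And>t. t \<in> {l..r} \<Longrightarrow> cmod (deriv G (Complex s0 t)) \<le> T" and lr: "l \<le> r"
  shows "integral (cbox (s0, l) (s1, r)) (\<lambda>p. (s1 - fst p) * (cmod (deriv G (Complex (fst p) (snd p))))\<^sup>2)
     \<le> 2 * (r - l) * L\<^sup>2 * T\<^sup>2
       + 4 * integral (cbox (s0, l) (s1, r)) (schwarzian_density G)"
proof -
  let ?R = "cbox (s0, l) (s1, r)"
  let ?E = "\<lambda>p. (s1 - fst p) * (cmod (deriv G (Complex (fst p) (snd p))))\<^sup>2"
  let ?S = "schwarzian_density G"
  let ?F = "\<lambda>p. (s1 - fst p)^3 * (cmod (deriv (deriv G) (Complex (fst p) (snd p))))\<^sup>2"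
  have hol': "deriv G holomorphic_on left_half_plane" using hol by (rule holomorphic_deriv_left_half_plane)
  have hol'': "deriv (deriv G) holomorphic_on left_half_plane" using hol' by (rule holomorphic_deriv_left_half_plane)
  have holS: "strip_schwarzian G holomorphic_on left_half_plane" using hol by (rule holomorphic_strip_schwarzian)
  have iE: "?E integrable_on ?R" and iS: "?S integrable_on ?R" and iF: "?F integrable_on ?R"
    by (intro integrable_continuous continuous_intros half_plane_continuous_box hol' hol'' holS s)+
  have eps0: "\<epsilon> > 0" using \<epsilon> s by linarith
  have "integral ?R ?E \<le> (s1 - s0)\<^sup>2 * integral {l..r} (\<lambda>t. (cmod (deriv G (Complex s0 t)))\<^sup>2) + integral ?R ?F"
    using hardy_box[OF hol' s(1,2), of l r 0] by simp
  also have "(s1 - s0)\<^sup>2 * integral {l..r} (\<lambda>t. (cmod (deriv G (Complex s0 t)))\<^sup>2) \<le> L\<^sup>2 * ((r - l) * T\<^sup>2)"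
  proof (intro mult_mono power_mono)
    show "integral {l..r} (\<lambda>t. (cmod (deriv G (Complex s0 t)))\<^sup>2) \<le> (r - l) * T\<^sup>2"
      using s lr by (intro integral_le_const_interval continuous_intros half_plane_continuous[OF hol'] power_mono T) auto
    show "0 \<le> integral {l..r} (\<lambda>t. (cmod (deriv G (Complex s0 t)))\<^sup>2)"
      using s by (intro integral_nonneg integrable_continuous_interval continuous_intros half_plane_continuous[OF hol']) auto
  qed (use s in auto)
  also have "integral ?R ?F \<le> integral ?R (\<lambda>p. 2 * ?S p + (1/2) * ?E p)"
  proof (intro integral_le iF integrable_add integrable_on_mult_right iE iS)
    fix p assume "p \<in> ?R"
    then have p: "s0 \<le> fst p" "fst p \<le> s1" by (cases p; simp)+
    then have p0: "fst p < 0" using s by simp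
    define x where "x = - fst p"
    define y where "y = s1 - fst p"
    have xy: "0 \<le> y" "y \<le> x" "x > 0" using p p0 s by (auto simp: x_def y_def)
    define d where "d = cmod (deriv G (Complex (fst p) (snd p)))"
    define \<sigma> where "\<sigma> = cmod (strip_schwarzian G (Complex (fst p) (snd p)))"
    define e where "e = cmod (deriv (deriv G) (Complex (fst p) (snd p)))"
    have "e \<le> \<sigma> + \<epsilon> / x * d"
      using deriv2_bound[OF p0 b[OF p(1) p0]] \<epsilon> p unfolding e_def \<sigma>_def d_def x_def by auto
    moreover have "e \<ge> 0" by (simp add: e_def)
    ultimately have "e\<^sup>2 \<le> (\<sigma> + \<epsilon> / x * d)\<^sup>2" by (intro power_mono)
    also have "\<dots> \<le> 2 * \<sigma>\<^sup>2 + 2 * (\<epsilon> / x * d)\<^sup>2"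
      using sum_squares_bound[of \<sigma> "\<epsilon> / x * d"] by (simp add: power2_sum)
    finally have "y^3 * e\<^sup>2 \<le> y^3 * (2 * \<sigma>\<^sup>2 + 2 * (\<epsilon> / x * d)\<^sup>2)" using xy by (intro mult_left_mono) auto
    also have "\<dots> = 2 * (y^3 * \<sigma>\<^sup>2) + 2 * \<epsilon>\<^sup>2 * (y * ((y / x)\<^sup>2 * d\<^sup>2))"
      by (simp add: power_mult_distrib power_divide algebra_simps power2_eq_square power3_eq_cube)
    also have "\<dots> \<le> 2 * (x^3 * \<sigma>\<^sup>2) + (1/2) * (y * (1 * d\<^sup>2))"
    proof (intro add_mono mult_mono power_mono)
      show "(y / x)\<^sup>2 \<le> 1" using xy by (simp add: power_le_one)
      have "\<epsilon>\<^sup>2 \<le> (1/2)\<^sup>2" using \<epsilon> eps0 by (intro power_mono) auto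
      then show "2 * \<epsilon>\<^sup>2 \<le> 1 / 2" by (simp add: power2_eq_square)
    qed (use xy in \<open>auto simp: \<sigma>_def d_def\<close>)
    finally show "?F p \<le> 2 * ?S p + (1/2) * ?E p" by (simp add: x_def y_def d_def \<sigma>_def e_def)
  qed
  also have "\<dots> = 2 * integral ?R ?S + (1/2) * integral ?R ?E"
    by (simp only: integral_add[OF integrable_on_mult_right[OF iS] integrable_on_mult_right[OF iE]] integral_mult_right)
  finally have "integral ?R ?E \<le> L\<^sup>2 * ((r - l) * T\<^sup>2) + (2 * integral ?R ?S + (1/2) * integral ?R ?E)" by simp
  moreover have "2 * (r - l) * L\<^sup>2 * T\<^sup>2 = 2 * (L\<^sup>2 * ((r - l) * T\<^sup>2))" by simp
  ultimately show ?thesis by linarith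
qed

lemma top_bound:
  assumes hol: "G holomorphic_on left_half_plane" and L: "L > 0"
    and T: "\<And>t. t \<in> {a - L..a + L} \<Longrightarrow> cmod (deriv G (Complex (-L) t)) \<le> T" and t: "t \<in> {a - L..a + L}"
  shows "cmod (G (Complex (-L) t) - G (Complex (-L) a)) \<le> L * T"
proof -
  have T0: "T \<ge> 0" using order_trans[OF norm_ge_zero T[of a]] L by simp
  have "norm (G (Complex (-L) t) - G (Complex (-L) a)) \<le> T * norm (t - a)"
  proof (rule differentiable_bound)
    show "convex {a - L..a + L}" by simp
    fix x assume x: "x \<in> {a - L..a + L}"
    show "((\<lambda>t. G (Complex (-L) t)) has_derivative (\<lambda>h. h *\<^sub>R (\<i> * deriv G (Complex (-L) x)))) (at x within {a - L..a + L})"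
      using half_plane_deriv_Im[OF hol, of "-L" x] L by (simp add: has_vector_derivative_def)
    show "onorm (\<lambda>h. h *\<^sub>R (\<i> * deriv G (Complex (-L) x))) \<le> T"
      using T[OF x] by (intro onorm_le) (simp add: norm_mult mult.commute[of T] mult_left_mono)
  qed (use t L in auto)
  also have "\<dots> \<le> T * L" using t T0 by (intro mult_left_mono) auto
  finally show ?thesis by (simp add: mult.commute)
qed

lemma oscillation_from_schwarzian:
  assumes hol: "G holomorphic_on left_half_plane" and lb: "strip_little_bloch G"
    and gr: "strip_growth p C1 G" and C2: "C2 \<ge> 0"
    and car: "strip_carleson p C2 (schwarzian_density G)"
  shows "\<exists>\<delta>>0. \<forall>L a. 0 < L \<and> L \<le> \<delta> \<longrightarrow> (\<exists>c. \<forall>s1. - L \<le> s1 \<and> s1 < 0 \<longrightarrow>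
     integral {a - L / 2..a + L / 2} (\<lambda>t. (cmod (G (Complex s1 t) - c))\<^sup>2) \<le> 140 * (C1\<^sup>2 + C2) * L powr p)"
proof -
  obtain \<delta>1 where \<delta>1: "\<delta>1 > 0" "\<And>s t. - \<delta>1 \<le> s \<Longrightarrow> s < 0 \<Longrightarrow> - s * cmod (deriv G (Complex s t)) \<le> 1/2"
    using lb unfolding strip_little_bloch_def by (metis half_gt_zero zero_less_one)
  obtain \<delta>2 where \<delta>2: "\<delta>2 > 0" "\<And>s t. - \<delta>2 \<le> s \<Longrightarrow> s < 0 \<Longrightarrow> cmod (deriv G (Complex s t)) \<le> C1 * (- s) powr ((p - 3) / 2)"
    using gr unfolding strip_growth_def by metis
  let ?S = "schwarzian_density G"
  obtain \<delta>3 where \<delta>3: "\<delta>3 > 0" "\<forall>L a s1. 0 < L \<and> L \<le> \<delta>3 \<and> - L \<le> s1 \<and> s1 < 0 \<longrightarrow>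
     integral (cbox (- L, a - L) (s1, a + L)) ?S \<le> C2 * L powr p"
    using car unfolding strip_carleson_def by blast
  define \<delta> where "\<delta> = min (min \<delta>1 \<delta>2) (min \<delta>3 (1/4))"
  have \<delta>: "\<delta> > 0" "\<delta> \<le> \<delta>1" "\<delta> \<le> \<delta>2" "\<delta> \<le> \<delta>3" "\<delta> \<le> 1/4" using \<delta>1 \<delta>2 \<delta>3 by (auto simp: \<delta>_def)
  show ?thesis
  proof (intro exI[of _ \<delta>] conjI \<delta>(1) allI impI)
    fix L a assume L': "0 < L \<and> L \<le> \<delta>"
    then have L: "L > 0" "L \<le> \<delta>" by auto
    define T where "T = C1 * L powr ((p - 3) / 2)"
    have T: "cmod (deriv G (Complex (-L) t)) \<le> T" for t
      using \<delta>2(2)[of "-L" t] L \<delta> by (simp add: T_def)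
    have T2: "L^3 * T\<^sup>2 = C1\<^sup>2 * L powr p"
    proof -
      have "L^3 * (L powr ((p - 3) / 2))\<^sup>2 = L powr p"
      proof -
        have "(L powr ((p - 3) / 2))\<^sup>2 = L powr (p - 3)"
          using L by (simp add: power2_eq_square flip: powr_add)
        moreover have "L^3 = L powr 3" using L by simp
        ultimately show ?thesis by (simp flip: powr_add)
      qed
      then show ?thesis by (simp add: T_def power_mult_distrib mult.left_commute)
    qed
    \<comment> \<open>The reference value is taken in the middle of the top side and is the same for
      all \<open>s1\<close>; this later gives a single constant for all slices and, in the limit,
      for the boundary values.\<close>
    define c where "c = G (Complex (-L) a)"
    have cb: "cmod (G (Complex (-L) t) - c) \<le> L * T" if "t \<in> {a - L..a + L}" for t
      unfolding c_def using that by (intro top_bound[OF hol L(1)] T)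
    show "\<exists>c. \<forall>s1. - L \<le> s1 \<and> s1 < 0 \<longrightarrow>
     integral {a - L / 2..a + L / 2} (\<lambda>t. (cmod (G (Complex s1 t) - c))\<^sup>2) \<le> 140 * (C1\<^sup>2 + C2) * L powr p"
    proof (intro exI[of _ c] allI impI)
      fix s1 assume s1: "- L \<le> s1 \<and> s1 < 0"
      let ?E = "integral (cbox (-L, a - L) (s1, a + L)) (\<lambda>p. (s1 - fst p) * (cmod (deriv G (Complex (fst p) (snd p))))\<^sup>2)"
      have cont: "continuous_on A (\<lambda>t. (cmod (G (Complex s1 t) - c))\<^sup>2)" for A
        using s1 by (intro continuous_intros half_plane_continuous[OF hol]) auto
      have "?E \<le> 2 * ((a+L) - (a-L)) * L\<^sup>2 * T\<^sup>2 + 4 * integral (cbox (-L, a - L) (s1, a + L)) ?S"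
      proof (rule energy_from_schwarzian[where \<epsilon>="1/2", OF hol])
        fix s t assume "- L \<le> s" "s < 0"
        then show "- s * cmod (deriv G (Complex s t)) \<le> 1/2" using L \<delta> by (intro \<delta>1) auto
      qed (use s1 L \<delta> T in auto)
      also have "\<dots> \<le> 4 * (L^3 * T\<^sup>2) + 4 * (C2 * L powr p)"
        using \<delta>3(2)[rule_format, of L s1 a] s1 L \<delta> by (simp add: power2_eq_square power3_eq_cube)
      finally have E: "?E \<le> 4 * (L^3 * T\<^sup>2) + 4 * (C2 * L powr p)" .
      have "integral {a - L / 2..a + L / 2} (\<lambda>t. (1/2) * (cmod (G (Complex s1 t) - c))\<^sup>2)
          \<le> integral {a - L / 2..a + L / 2} (\<lambda>t. bump a L t * (cmod (G (Complex s1 t) - c))\<^sup>2)"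
        using bump_ge_half[OF L(1)]
        by (intro integral_le integrable_continuous_interval continuous_intros cont mult_right_mono) auto
      also have "\<dots> \<le> integral {a - L..a + L} (\<lambda>t. bump a L t * (cmod (G (Complex s1 t) - c))\<^sup>2)"
        using L bump_bounds(1)[OF L(1)]
        by (intro integral_subset_le integrable_continuous_interval continuous_intros cont mult_nonneg_nonneg) auto
      also have "\<dots> \<le> 14 * (L^3 * T\<^sup>2 + ?E)"
        using s1 L by (intro green_boundary_upper hol cb T) auto
      also have "\<dots> \<le> 14 * (L^3 * T\<^sup>2 + (4 * (L^3 * T\<^sup>2) + 4 * (C2 * L powr p)))" using E by simp
      also have "\<dots> \<le> 70 * (C1\<^sup>2 + C2) * L powr p" using C2 by (simp add: T2 algebra_simps)
      finally show "integral {a - L / 2..a + L / 2} (\<lambda>t. (cmod (G (Complex s1 t) - c))\<^sup>2) \<le> 140 * (C1\<^sup>2 + C2) * L powr p"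
        by (simp add: algebra_simps)
    qed
  qed
qed

subsection \<open>From the oscillation to the Schwarzian\<close>

text \<open>\<open>c\<close> and \<open>s2\<close> may depend on the interval. Slices converge to
  the boundary values in mean square without any rate, so an estimate on an arc controls only those
  slices that are close enough to the boundary relative to its length.\<close>

definition strip_oscillation :: "real \<Rightarrow> real \<Rightarrow> (complex \<Rightarrow> complex) \<Rightarrow> bool" where
  "strip_oscillation p C G \<longleftrightarrow> (\<exists>\<delta>>0. \<forall>L a. 0 < L \<and> L \<le> \<delta> \<longrightarrow> (\<exists>c s2. s2 < 0 \<and> (\<forall>s1. s2 \<le> s1 \<and> s1 < 0 \<longrightarrow>
     integral {a - L..a + L} (\<lambda>t. (cmod (G (Complex s1 t) - c))\<^sup>2) \<le> C * L powr p)))"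

lemma box_integral_le:
  fixes f :: "real \<times> real \<Rightarrow> real"
  assumes "continuous_on (cbox (s0, l) (s1, r)) f" "s0 \<le> s1" "l \<le> r" "M \<ge> 0"
    and "\<And>t. t \<in> {l..r} \<Longrightarrow> integral {s0..s1} (\<lambda>s. f (s, t)) \<le> M"
  shows "integral (cbox (s0, l) (s1, r)) f \<le> (r - l) * M"
  unfolding box_integral_iterated[OF assms(1)]
  by (intro integral_le_const_interval continuous_on_iterated_integral assms)

lemma energy_from_growth:
  assumes hol: "G holomorphic_on left_half_plane" and p: "p > 1" and gr: "strip_growth p C G" and C: "C \<ge> 0"
  shows "strip_carleson p (2 / (p - 1) * C\<^sup>2) (energy_density G)"
proof -
  have hol': "deriv G holomorphic_on left_half_plane" using hol by (rule holomorphic_deriv_left_half_plane)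
  obtain \<delta> where \<delta>: "\<delta> > 0" "\<And>s t. - \<delta> \<le> s \<Longrightarrow> s < 0 \<Longrightarrow> cmod (deriv G (Complex s t)) \<le> C * (- s) powr ((p - 3) / 2)"
    using gr unfolding strip_growth_def by metis
  show ?thesis unfolding strip_carleson_def
  proof (intro exI[of _ \<delta>] conjI \<delta>(1) allI impI)
    fix L a s1 assume *: "0 < L \<and> L \<le> \<delta> \<and> - L \<le> s1 \<and> s1 < 0"
    let ?f = "energy_density G"
    have cf: "continuous_on (cbox (-L, a - L) (s1, a + L)) ?f"
      using * by (intro continuous_intros half_plane_continuous_box hol') auto
    have "integral (cbox (- L, a - L) (s1, a + L)) ?f \<le> ((a + L) - (a - L)) * (C\<^sup>2 * (L powr (p - 1) / (p - 1)))"
    proof (rule box_integral_le[OF cf])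
      fix t
      have "((\<lambda>s. C\<^sup>2 * (- s) powr (p - 2)) has_integral
          (- C\<^sup>2 * ((- s1) powr (p - 1) / (p - 1)) - (- C\<^sup>2 * ((- (- L)) powr (p - 1) / (p - 1))))) {-L..s1}"
        using * p by (intro fundamental_theorem_of_calculus)
          (auto intro!: derivative_eq_intros simp: has_real_derivative_iff_has_vector_derivative[symmetric])
      then have I: "integral {-L..s1} (\<lambda>s. C\<^sup>2 * (- s) powr (p - 2)) =
         (- C\<^sup>2 * ((- s1) powr (p - 1) / (p - 1)) - (- C\<^sup>2 * ((- (- L)) powr (p - 1) / (p - 1))))"
        by (rule integral_unique)
      have "integral {-L..s1} (\<lambda>s. ?f (s, t)) \<le> integral {-L..s1} (\<lambda>s. C\<^sup>2 * (- s) powr (p - 2))"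
      proof (intro integral_le integrable_continuous_interval)
        show "continuous_on {-L..s1} (\<lambda>s. ?f (s, t))"
          using * by (auto intro!: continuous_intros half_plane_continuous[OF hol'])
        show "continuous_on {-L..s1} (\<lambda>s. C\<^sup>2 * (- s) powr (p - 2))"
          using * by (intro continuous_intros) auto
        fix s assume s: "s \<in> {-L..s1}"
        have "(cmod (deriv G (Complex s t)))\<^sup>2 \<le> (C * (- s) powr ((p - 3) / 2))\<^sup>2"
          using \<delta>(2)[of s t] s * by (intro power_mono) auto
        also have "\<dots> = C\<^sup>2 * (- s) powr (p - 3)"
          by (simp add: power_mult_distrib power2_eq_square flip: powr_add)
        finally have "(- s) * (cmod (deriv G (Complex s t)))\<^sup>2 \<le> (- s) * (C\<^sup>2 * (- s) powr (p - 3))"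
          using s * by (intro mult_left_mono) auto
        also have "\<dots> = C\<^sup>2 * ((- s) powr 1 * (- s) powr (p - 3))" using s * by simp
        also have "\<dots> = C\<^sup>2 * (- s) powr (p - 2)" unfolding powr_add[symmetric] by simp
        finally show "?f (s, t) \<le> C\<^sup>2 * (- s) powr (p - 2)" by simp
      qed
      also have "\<dots> \<le> C\<^sup>2 * (L powr (p - 1) / (p - 1))" unfolding I using p by simp
      finally show "integral {-L..s1} (\<lambda>s. ?f (s, t)) \<le> C\<^sup>2 * (L powr (p - 1) / (p - 1))" .
    qed (use * p in auto)
    also have "\<dots> = 2 / (p - 1) * C\<^sup>2 * (L powr 1 * L powr (p - 1))" using * by simp
    also have "\<dots> = 2 / (p - 1) * C\<^sup>2 * L powr p" unfolding powr_add[symmetric] by simp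
    finally show "integral (cbox (- L, a - L) (s1, a + L)) ?f \<le> 2 / (p - 1) * C\<^sup>2 * L powr p" .
  qed
qed

text \<open>Green's identity needs a weight that vanishes at the cut-off, whereas the Carleson
  conditions carry powers of the full distance to s = 0. Moving the cut-off to some s \<ge> s1 / 2
  makes s - r at least -r / 2 for r \<le> s1, and doubling the width makes \<open>bump\<close> at
  least 1/2 on the smaller box.\<close>

lemma box_weight_compare:
  fixes f :: "real \<times> real \<Rightarrow> real"
  assumes cf: "continuous_on (cbox (- (2 * L), a - 2 * L) (s, a + 2 * L)) f"
    and f: "\<And>p. p \<in> cbox (- (2 * L), a - 2 * L) (s, a + 2 * L) \<Longrightarrow> 0 \<le> f p"
    and L: "L > 0" and s: "- L \<le> s1" "s1 / 2 \<le> s" "s < 0"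
  shows "integral (cbox (- L, a - L) (s1, a + L)) (\<lambda>p. (- fst p)^n * f p)
      \<le> 2 ^ Suc n * integral (cbox (- (2 * L), a - 2 * L) (s, a + 2 * L)) (\<lambda>p. (s - fst p)^n * (bump a (2 * L) (snd p) * f p))"
    (is "integral ?R _ \<le> _ * integral ?R' _")
proof -
  have sub: "?R \<subseteq> ?R'" using L s by (auto simp: cbox_Pair_eq)
  have cf': "continuous_on ?R f" using cf sub by (rule continuous_on_subset)
  have "integral ?R (\<lambda>p. (- fst p)^n * f p) \<le> integral ?R (\<lambda>p. 2 ^ Suc n * ((s - fst p)^n * (bump a (2 * L) (snd p) * f p)))"
  proof (intro integral_le integrable_continuous continuous_intros cf')
    fix p assume p: "p \<in> ?R"
    then have 1: "fst p \<le> s1" "snd p \<in> {a - (2*L)/2..a + (2*L)/2}" by (cases p; auto)+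
    have fp: "0 \<le> f p" by (rule f) (use sub p in blast)
    have "(- fst p)^n * f p \<le> (2 * (s - fst p))^n * f p"
      using 1 s fp by (intro mult_right_mono power_mono) auto
    also have "\<dots> = 2 ^ Suc n * ((s - fst p)^n * (1/2 * f p))" by (simp only: power_mult_distrib power_Suc mult_1 mult.assoc mult.left_commute)
    also have "\<dots> \<le> 2 ^ Suc n * ((s - fst p)^n * (bump a (2 * L) (snd p) * f p))"
      using bump_ge_half[of "2*L", OF _ 1(2)] 1 s fp L by (intro mult_left_mono mult_right_mono) auto
    finally show "(- fst p)^n * f p \<le> 2 ^ Suc n * ((s - fst p)^n * (bump a (2 * L) (snd p) * f p))" .
  qed
  also have "\<dots> = 2 ^ Suc n * integral ?R (\<lambda>p. (s - fst p)^n * (bump a (2 * L) (snd p) * f p))"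
    by (rule integral_mult_right)
  also have "\<dots> \<le> 2 ^ Suc n * integral ?R' (\<lambda>p. (s - fst p)^n * (bump a (2 * L) (snd p) * f p))"
  proof (rule mult_left_mono[OF integral_subset_le[OF sub]])
    show "(\<lambda>p. (s - fst p)^n * (bump a (2 * L) (snd p) * f p)) integrable_on ?R"
      "(\<lambda>p. (s - fst p)^n * (bump a (2 * L) (snd p) * f p)) integrable_on ?R'"
      by (intro integrable_continuous continuous_intros cf cf')+
    show "\<forall>p\<in>?R'. 0 \<le> (s - fst p)^n * (bump a (2 * L) (snd p) * f p)"
    proof
      fix p assume p: "p \<in> ?R'"
      then have "fst p \<le> s" "snd p \<in> {a - (2*L)..a + (2*L)}" by (cases p; auto)+
      then show "0 \<le> (s - fst p)^n * (bump a (2 * L) (snd p) * f p)"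
        using f[OF p] bump_bounds(1)[of "2*L" "snd p" a] L by auto
    qed
  qed auto
  finally show ?thesis .
qed

lemma strip_carleson_mono:
  assumes "strip_carleson p C F" "C \<le> C'"
  shows "strip_carleson p C' F"
proof -
  have "C * x powr p \<le> C' * x powr p" for x using assms(2) by (rule mult_right_mono) simp
  then show ?thesis using assms(1) unfolding strip_carleson_def by (meson order_trans)
qed

text \<open>For the cubic weight, both the weight and its derivative vanish at the cut-off, so
  nothing has to be known about G' there, and the second derivative 6 (s - x) of the weight is below
  six times the weight of the energy.\<close>

lemma second_derivative_from_energy:
  assumes hol: "G holomorphic_on left_half_plane" and p: "0 < p" "p < 3" and gr: "strip_growth p C1 G" and C1: "C1 \<ge> 0"
    and en: "strip_carleson p C2 (energy_density G)"
  shows "\<exists>\<delta>>0. \<forall>L a s1. 0 < L \<and> L \<le> \<delta> \<and> - L \<le> s1 \<and> s1 < 0 \<longrightarrow>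
     integral (cbox (- L, a - L) (s1, a + L)) (\<lambda>p. (- fst p)^3 * (cmod (deriv (deriv G) (Complex (fst p) (snd p))))\<^sup>2)
       \<le> 16 * (128 * C1\<^sup>2 + 22 * C2) * (2 * L) powr p"
proof -
  have hol': "deriv G holomorphic_on left_half_plane" using hol by (rule holomorphic_deriv_left_half_plane)
  have hol'': "deriv (deriv G) holomorphic_on left_half_plane" using hol' by (rule holomorphic_deriv_left_half_plane)
  obtain \<delta>1 where \<delta>1: "\<delta>1 > 0" "\<And>s t. - \<delta>1 \<le> s \<Longrightarrow> s < 0 \<Longrightarrow> cmod (deriv G (Complex s t)) \<le> C1 * (- s) powr ((p - 3) / 2)"
    using gr unfolding strip_growth_def by metis
  let ?E = "energy_density G"
  obtain \<delta>2 where \<delta>2: "\<delta>2 > 0" "\<forall>L a s1. 0 < L \<and> L \<le> \<delta>2 \<and> - L \<le> s1 \<and> s1 < 0 \<longrightarrow>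
     integral (cbox (- L, a - L) (s1, a + L)) ?E \<le> C2 * L powr p"
    using en unfolding strip_carleson_def by blast
  define \<delta> where "\<delta> = min \<delta>1 \<delta>2 / 4"
  have \<delta>: "\<delta> > 0" "4 * \<delta> \<le> \<delta>1" "4 * \<delta> \<le> \<delta>2" using \<delta>1 \<delta>2 by (auto simp: \<delta>_def)
  show ?thesis
  proof (intro exI[of _ \<delta>] conjI \<delta>(1) allI impI)
    fix L' a s1 assume *: "0 < L' \<and> L' \<le> \<delta> \<and> - L' \<le> s1 \<and> s1 < 0"
    define L where "L = 2 * L'"
    have L: "L > 0" "2 * L \<le> \<delta>1" "L \<le> \<delta>2" using * \<delta> by (auto simp: L_def)
    define s where "s = s1 / 2"
    have s: "- L \<le> s" "s < 0" using * by (auto simp: s_def L_def)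
    let ?R = "cbox (- L, a - L) (s, a + L)"
    \<comment> \<open>A bound for G' at all heights between L/2 and 2L, not only at L: the Cauchy
      estimate for G'' on the top side uses discs of radius L/4. The exponent is negative, so height
      L/2 is the worst one.\<close>
    define T where "T = (L / 2) powr ((p - 3) / 2) * C1"
    have T: "T \<ge> 0" using C1 by (simp add: T_def)
    have T2: "L^3 * T\<^sup>2 \<le> 8 * C1\<^sup>2 * L powr p"
    proof -
      have "((L / 2) powr ((p - 3) / 2))\<^sup>2 = (L / 2) powr (p - 3)"
        using L by (simp add: power2_eq_square flip: powr_add)
      moreover have "L^3 = 8 * (L / 2) powr 3" using L by (simp add: power_divide)
      ultimately have "L^3 * T\<^sup>2 = 8 * C1\<^sup>2 * ((L / 2) powr 3 * (L / 2) powr (p - 3))"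
        by (simp add: T_def power_mult_distrib)
      also have "\<dots> = 8 * C1\<^sup>2 * (L / 2) powr p" unfolding powr_add[symmetric] by simp
      finally have e: "L^3 * T\<^sup>2 = 8 * C1\<^sup>2 * (L / 2) powr p" .
      show ?thesis unfolding e using L p by (intro mult_left_mono powr_mono2) auto
    qed
    have Db: "cmod (deriv G w) \<le> T" if "Re w < - (L/2)" "Re w > - 2 * L" for w
    proof -
      have "cmod (deriv G (Complex (Re w) (Im w))) \<le> C1 * (- Re w) powr ((p - 3) / 2)"
        using that L by (intro \<delta>1) auto
      also have "\<dots> \<le> C1 * (L / 2) powr ((p - 3) / 2)"
        using that L C1 p by (intro mult_left_mono powr_mono2') auto
      finally show ?thesis by (simp add: T_def mult.commute)
    qed
    have top: "cmod (deriv G (Complex (-L) t)) \<le> T" for t by (rule Db) (use L in auto)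
    have top': "cmod (deriv (deriv G) (Complex (-L) t)) \<le> 4 / L * T" for t
    proof -
      have re: "Re w < - (L/2) \<and> Re w > - 2 * L" if "w \<in> cball (Complex (-L) t) (L/4)" for w
      proof -
        have "\<bar>Re (Complex (-L) t - w)\<bar> \<le> L / 4"
          using that abs_Re_le_cmod[of "Complex (-L) t - w"] by (simp add: dist_norm)
        then have "- L - Re w \<le> L / 4" "- (- L - Re w) \<le> L / 4"
          by (simp_all only: minus_complex.sel complex.sel abs_le_iff)
        then show ?thesis using L by linarith
      qed
      have sub: "cball (Complex (-L) t) (L/4) \<subseteq> left_half_plane" using re L by force
      have "cmod ((deriv ^^ 1) (deriv G) (Complex (-L) t)) \<le> fact 1 * T / (L/4) ^ 1"
      proof (rule Cauchy_inequality)
        show "deriv G holomorphic_on ball (Complex (-L) t) (L/4)"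
          using hol' sub by (meson ball_subset_cball holomorphic_on_subset subset_trans)
        show "continuous_on (cball (Complex (-L) t) (L/4)) (deriv G)"
          using hol' sub holomorphic_on_imp_continuous_on holomorphic_on_subset by blast
        fix x assume "cmod (Complex (-L) t - x) = L/4"
        then show "cmod (deriv G x) \<le> T" using re[of x] by (intro Db) (auto simp: dist_norm)
      qed (use L in auto)
      then show ?thesis using L by (simp add: field_simps)
    qed
    let ?D = "\<lambda>p. deriv G (Complex (fst p) (snd p)) - 0"
    let ?D2 = "\<lambda>p. deriv (deriv G) (Complex (fst p) (snd p))"
    have cD2: "continuous_on ?R ?D2"
      by (intro continuous_intros half_plane_continuous_box hol'' s)
    have cc: "continuous_on ?R (\<lambda>p. deriv G (Complex (fst p) (snd p)))"
      by (intro half_plane_continuous_box hol' s)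
    have pR: "fst p \<le> s" "fst p \<ge> - L" "snd p \<in> {a - L..a + L}" if "p \<in> ?R" for p using that by (cases p; auto)+
    have E: "integral ?R ?E \<le> C2 * L powr p" using \<delta>2(2) L s by auto
    have h1: "3 * integral ?R (\<lambda>p. (s - fst p)^3 * (bump a L (snd p) * (cmod (?D2 p))\<^sup>2)) \<le>
     integral {a - L..a + L} (\<lambda>t. bump a L t *
        (- ((s - (-L))^3 * (2 * (?D (-L,t) \<bullet> ?D2 (-L,t)))) + - 3 * (s - (-L))\<^sup>2 * (cmod (?D (-L,t)))\<^sup>2 - - 3 * (s - s)\<^sup>2 * (cmod (?D (s,t)))\<^sup>2))
     + integral ?R (\<lambda>p. 6 * (s - fst p) * (bump a L (snd p) * (cmod (?D p))\<^sup>2))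
     + (16 / L\<^sup>2) * integral ?R (\<lambda>p. (s - fst p)^3 * (cmod (?D p))\<^sup>2)"
      by (rule green_area_upper[OF hol' s(1,2) L(1), where \<omega>' = "\<lambda>x. - 3 * (s - x)\<^sup>2" and \<omega>'' = "\<lambda>x. 6 * (s - x)"])
         (auto intro!: derivative_eq_intros continuous_intros)
    have h2: "integral {a - L..a + L} (\<lambda>t. bump a L t *
        (- ((s - (-L))^3 * (2 * (?D (-L,t) \<bullet> ?D2 (-L,t)))) + - 3 * (s - (-L))\<^sup>2 * (cmod (?D (-L,t)))\<^sup>2 - - 3 * (s - s)\<^sup>2 * (cmod (?D (s,t)))\<^sup>2))
      \<le> ((a + L) - (a - L)) * (8 * (L\<^sup>2 * T\<^sup>2))"
    proof (rule integral_le_const_interval)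
      show "continuous_on {a - L..a + L} (\<lambda>t. bump a L t *
        (- ((s - (-L))^3 * (2 * (?D (-L,t) \<bullet> ?D2 (-L,t)))) + - 3 * (s - (-L))\<^sup>2 * (cmod (?D (-L,t)))\<^sup>2 - - 3 * (s - s)\<^sup>2 * (cmod (?D (s,t)))\<^sup>2))"
        unfolding fst_conv snd_conv
        by (intro continuous_intros half_plane_continuous[OF hol'] half_plane_continuous[OF hol'']) (use s L in auto)
      fix t assume t: "t \<in> {a - L..a + L}"
      have "- (?D (-L,t) \<bullet> ?D2 (-L,t)) \<le> cmod (?D (-L,t)) * cmod (?D2 (-L,t))"
        using Cauchy_Schwarz_ineq2[of "?D (-L,t)" "?D2 (-L,t)"] by linarith
      also have "\<dots> \<le> T * (4 / L * T)" using top[of t] top'[of t] T by (intro mult_mono) auto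
      finally have "(s - (-L))^3 * (2 * - (?D (-L,t) \<bullet> ?D2 (-L,t))) \<le> (s - (-L))^3 * (2 * (T * (4 / L * T)))"
        using s by (intro mult_left_mono) auto
      also have "\<dots> \<le> L^3 * (2 * (T * (4 / L * T)))" using s L T by (intro mult_right_mono power_mono) auto
      also have "\<dots> = 8 * (L\<^sup>2 * T\<^sup>2)" using L by (simp add: power2_eq_square power3_eq_cube)
      finally have 0: "(s - (-L))^3 * (2 * - (?D (-L,t) \<bullet> ?D2 (-L,t))) \<le> 8 * (L\<^sup>2 * T\<^sup>2)" .
      have 1: "- ((s - (-L))^3 * (2 * (?D (-L,t) \<bullet> ?D2 (-L,t)))) + - 3 * (s - (-L))\<^sup>2 * (cmod (?D (-L,t)))\<^sup>2 - - 3 * (s - s)\<^sup>2 * (cmod (?D (s,t)))\<^sup>2 \<le> 8 * (L\<^sup>2 * T\<^sup>2)"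
      proof -
        have aux: "- (A * (2 * X)) + - 3 * B * Y - - 3 * 0\<^sup>2 * Z \<le> m" if "A * (2 * - X) \<le> m" "0 \<le> B * Y" for A X B Y Z m :: real
          using that by simp
        show ?thesis unfolding diff_self by (rule aux[OF 0]) simp
      qed
      show "bump a L t *
        (- ((s - (-L))^3 * (2 * (?D (-L,t) \<bullet> ?D2 (-L,t)))) + - 3 * (s - (-L))\<^sup>2 * (cmod (?D (-L,t)))\<^sup>2 - - 3 * (s - s)\<^sup>2 * (cmod (?D (s,t)))\<^sup>2) \<le> 8 * (L\<^sup>2 * T\<^sup>2)"
        by (rule order_trans[OF mult_left_mono[OF 1 bump_bounds(1)[OF L(1) t]]])
           (use bump_bounds(1,2)[OF L(1) t] in \<open>simp add: mult_left_le_one_le\<close>)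
    qed (use L in auto)
    have "integral ?R (\<lambda>p. 6 * (s - fst p) * (bump a L (snd p) * (cmod (?D p))\<^sup>2)) \<le> integral ?R (\<lambda>p. 6 * ?E p)"
    proof (intro integral_le integrable_continuous continuous_intros cc)
      fix p assume p: "p \<in> ?R"
      have "6 * (s - fst p) * (bump a L (snd p) * (cmod (?D p))\<^sup>2) \<le> 6 * (- fst p) * (1 * (cmod (?D p))\<^sup>2)"
        using pR[OF p] s bump_bounds(1,2)[OF L(1) pR(3)[OF p]] by (intro mult_mono mult_right_mono) auto
      then show "6 * (s - fst p) * (bump a L (snd p) * (cmod (?D p))\<^sup>2) \<le> 6 * ?E p" by simp
    qed
    also have "\<dots> = 6 * integral ?R ?E" by (rule integral_mult_right)
    finally have h3: "integral ?R (\<lambda>p. 6 * (s - fst p) * (bump a L (snd p) * (cmod (?D p))\<^sup>2)) \<le> 6 * integral ?R ?E" .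
    have "integral ?R (\<lambda>p. (s - fst p)^3 * (cmod (?D p))\<^sup>2) \<le> integral ?R (\<lambda>p. L\<^sup>2 * ?E p)"
    proof (intro integral_le integrable_continuous continuous_intros cc)
      fix p assume p: "p \<in> ?R"
      have "(s - fst p)^3 = (s - fst p)^2 * (s - fst p)" by (simp add: power2_eq_square power3_eq_cube)
      also have "\<dots> \<le> L\<^sup>2 * (- fst p)" using pR[OF p] s L by (intro mult_mono power_mono) auto
      finally have "(s - fst p)^3 * (cmod (?D p))\<^sup>2 \<le> L\<^sup>2 * (- fst p) * (cmod (?D p))\<^sup>2" by (rule mult_right_mono) simp
      then show "(s - fst p)^3 * (cmod (?D p))\<^sup>2 \<le> L\<^sup>2 * ?E p" by simp
    qed
    also have "\<dots> = L\<^sup>2 * integral ?R ?E" by (rule integral_mult_right)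
    finally have "(16 / L\<^sup>2) * integral ?R (\<lambda>p. (s - fst p)^3 * (cmod (?D p))\<^sup>2) \<le> (16 / L\<^sup>2) * (L\<^sup>2 * integral ?R ?E)"
      by (rule mult_left_mono) simp
    also have "\<dots> = 16 * integral ?R ?E" using L by simp
    finally have h4: "(16 / L\<^sup>2) * integral ?R (\<lambda>p. (s - fst p)^3 * (cmod (?D p))\<^sup>2) \<le> 16 * integral ?R ?E" .
    have "((a + L) - (a - L)) * (8 * (L\<^sup>2 * T\<^sup>2)) = 16 * (L^3 * T\<^sup>2)"
      by (simp add: power2_eq_square power3_eq_cube)
    with h1 h2 h3 h4 have "3 * integral ?R (\<lambda>p. (s - fst p)^3 * (bump a L (snd p) * (cmod (?D2 p))\<^sup>2)) \<le>
      16 * (L^3 * T\<^sup>2) + 22 * integral ?R ?E"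
      by linarith
    also have "\<dots> \<le> 16 * (8 * C1\<^sup>2 * L powr p) + 22 * (C2 * L powr p)"
      using T2 E by (intro add_mono mult_left_mono) auto
    finally have fin: "3 * integral ?R (\<lambda>p. (s - fst p)^3 * (bump a L (snd p) * (cmod (?D2 p))\<^sup>2)) \<le> (128 * C1\<^sup>2 + 22 * C2) * L powr p"
      by (simp add: algebra_simps)
    have nn: "0 \<le> integral ?R (\<lambda>p. (s - fst p)^3 * (bump a L (snd p) * (cmod (?D2 p))\<^sup>2))"
      using pR s bump_bounds(1)[OF L(1)]
      by (intro integral_nonneg integrable_continuous continuous_intros cD2 mult_nonneg_nonneg) auto
    have "integral (cbox (- L', a - L') (s1, a + L')) (\<lambda>p. (- fst p)^3 * (cmod (?D2 p))\<^sup>2)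
        \<le> 2 ^ Suc 3 * integral ?R (\<lambda>p. (s - fst p)^3 * (bump a L (snd p) * (cmod (?D2 p))\<^sup>2))"
      unfolding L_def
      by (rule box_weight_compare) (use * s cD2 in \<open>auto simp: s_def L_def intro!: continuous_intros\<close>)
    also have "\<dots> \<le> 16 * ((128 * C1\<^sup>2 + 22 * C2) * L powr p)" using fin nn by simp
    finally show "integral (cbox (- L', a - L') (s1, a + L')) (\<lambda>p. (- fst p)^3 * (cmod (?D2 p))\<^sup>2)
       \<le> 16 * (128 * C1\<^sup>2 + 22 * C2) * (2 * L') powr p" by (simp only: L_def mult.assoc)
  qed
qed

text \<open>Of the three terms of the strip Schwarzian only the quadratic one is not linear in G'.
  The bound \<open>B\<close> reduces (-s)^3 |G'|^4 to B^2 (-s) |G'|^2, so the result stays linear in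
  \<open>C1\<^sup>2\<close> and \<open>C2\<close>.\<close>

lemma schwarzian_from_energy:
  assumes hol: "G holomorphic_on left_half_plane" and p: "0 < p" "p < 3" and gr: "strip_growth p C1 G" and C1: "C1 \<ge> 0"
    and en: "strip_carleson p C2 (energy_density G)"
    and B: "\<And>s t. - 1 \<le> s \<Longrightarrow> s < 0 \<Longrightarrow> - s * cmod (deriv G (Complex s t)) \<le> B"
  shows "strip_carleson p (48 * (128 * C1\<^sup>2 + 22 * C2) * 2 powr p + 3 * (1 + B\<^sup>2) * C2) (schwarzian_density G)"
proof -
  have hol': "deriv G holomorphic_on left_half_plane" using hol by (rule holomorphic_deriv_left_half_plane)
  have hol'': "deriv (deriv G) holomorphic_on left_half_plane" using hol' by (rule holomorphic_deriv_left_half_plane)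
  have holS: "strip_schwarzian G holomorphic_on left_half_plane" using hol by (rule holomorphic_strip_schwarzian)
  let ?E = "energy_density G"
  let ?F = "\<lambda>p. (- fst p)^3 * (cmod (deriv (deriv G) (Complex (fst p) (snd p))))\<^sup>2"
  let ?S = "schwarzian_density G"
  obtain \<delta>1 where \<delta>1: "\<delta>1 > 0" "\<forall>L a s1. 0 < L \<and> L \<le> \<delta>1 \<and> - L \<le> s1 \<and> s1 < 0 \<longrightarrow>
     integral (cbox (- L, a - L) (s1, a + L)) ?F \<le> 16 * (128 * C1\<^sup>2 + 22 * C2) * (2 * L) powr p"
    using second_derivative_from_energy[OF hol p gr C1 en] by blast
  obtain \<delta>2 where \<delta>2: "\<delta>2 > 0" "\<forall>L a s1. 0 < L \<and> L \<le> \<delta>2 \<and> - L \<le> s1 \<and> s1 < 0 \<longrightarrow>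
     integral (cbox (- L, a - L) (s1, a + L)) ?E \<le> C2 * L powr p"
    using en unfolding strip_carleson_def by blast
  show ?thesis unfolding strip_carleson_def
  proof (intro exI[of _ "min 1 (min \<delta>1 \<delta>2)"] conjI allI impI)
    show "0 < min 1 (min \<delta>1 \<delta>2)" using \<delta>1 \<delta>2 by simp
    fix L a s1 assume *: "0 < L \<and> L \<le> min 1 (min \<delta>1 \<delta>2) \<and> - L \<le> s1 \<and> s1 < 0"
    let ?R = "cbox (- L, a - L) (s1, a + L)"
    have s1: "s1 < 0" using * by simp
    have iE: "?E integrable_on ?R" and iF: "?F integrable_on ?R" and iS: "?S integrable_on ?R"
      by (intro integrable_continuous continuous_intros half_plane_continuous_box hol' hol'' holS s1)+
    have "integral ?R ?S \<le> integral ?R (\<lambda>p. 3 * ?F p + 3 * (1 + B\<^sup>2) * ?E p)"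
    proof (intro integral_le iS integrable_add integrable_on_mult_right iE iF)
      fix p assume "p \<in> ?R"
      then have p: "- 1 \<le> fst p" "fst p < 0" using * by (cases p; auto)+
      define x where "x = - fst p"
      have x: "0 < x" "x \<le> 1" using p by (auto simp: x_def)
      define d where "d = cmod (deriv G (Complex (fst p) (snd p)))"
      define e where "e = cmod (deriv (deriv G) (Complex (fst p) (snd p)))"
      have xd: "x * d \<le> B" using B[OF p] by (simp add: x_def d_def)
      have d: "d \<ge> 0" by (simp add: d_def)
      have "cmod (strip_schwarzian G (Complex (fst p) (snd p))) \<le> e + d + d\<^sup>2 / 2"
        unfolding strip_schwarzian_def e_def d_def
        by (rule norm_triangle_le_diff, intro add_mono norm_triangle_ineq4) (simp add: norm_divide norm_power)
      then have "(cmod (strip_schwarzian G (Complex (fst p) (snd p))))\<^sup>2 \<le> (e + d + d\<^sup>2 / 2)\<^sup>2"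
        by (rule power_mono) simp
      also have "\<dots> \<le> 3 * (e\<^sup>2 + d\<^sup>2 + (d\<^sup>2 / 2)\<^sup>2)"
      proof -
        have "(x + y + z)\<^sup>2 \<le> 3 * (x\<^sup>2 + y\<^sup>2 + z\<^sup>2)" for x y z :: real
          using sum_squares_bound[of x y] sum_squares_bound[of x z] sum_squares_bound[of y z]
          by (simp add: power2_eq_square algebra_simps)
        then show ?thesis .
      qed
      finally have "x^3 * (cmod (strip_schwarzian G (Complex (fst p) (snd p))))\<^sup>2 \<le> x^3 * (3 * (e\<^sup>2 + d\<^sup>2 + (d\<^sup>2 / 2)\<^sup>2))"
        using x by (intro mult_left_mono) auto
      also have "\<dots> = 3 * (x^3 * e\<^sup>2) + 3 * (x\<^sup>2 * (x * d\<^sup>2)) + 3/4 * ((x * d)\<^sup>2 * (x * d\<^sup>2))"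
        by (simp add: power2_eq_square power3_eq_cube algebra_simps)
      also have "\<dots> \<le> 3 * (x^3 * e\<^sup>2) + 3 * (1 * (x * d\<^sup>2)) + 3 * (B\<^sup>2 * (x * d\<^sup>2))"
        using x d xd by (intro add_mono mult_mono power_mono order_refl) (auto simp: power_le_one)
      also have "\<dots> = 3 * (x^3 * e\<^sup>2) + 3 * (1 + B\<^sup>2) * (x * d\<^sup>2)" by (simp add: algebra_simps)
      finally show "?S p \<le> 3 * ?F p + 3 * (1 + B\<^sup>2) * ?E p" by (simp add: x_def d_def e_def)
    qed
    also have "\<dots> = 3 * integral ?R ?F + 3 * (1 + B\<^sup>2) * integral ?R ?E"
      by (simp only: integral_add[OF integrable_on_mult_right[OF iF] integrable_on_mult_right[OF iE]] integral_mult_right)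
    also have "\<dots> \<le> 3 * (16 * (128 * C1\<^sup>2 + 22 * C2) * (2 * L) powr p) + 3 * (1 + B\<^sup>2) * (C2 * L powr p)"
      using * \<delta>1(2) \<delta>2(2) by (intro add_mono mult_left_mono) (auto simp: add_nonneg_nonneg)
    also have "\<dots> = (48 * (128 * C1\<^sup>2 + 22 * C2) * 2 powr p + 3 * (1 + B\<^sup>2) * C2) * L powr p"
      using * by (simp add: powr_mult algebra_simps)
    finally show "integral ?R ?S \<le> (48 * (128 * C1\<^sup>2 + 22 * C2) * 2 powr p + 3 * (1 + B\<^sup>2) * C2) * L powr p" .
  qed
qed

text \<open>
  The cross term of Green's identity is controlled by the growth of \<open>deriv G\<close> alone; the mean of \<open>G\<close>
  over the horizontal segments of the box links the value at the top of the box with the boundary mean.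
\<close>

lemma energy_from_oscillation:
  assumes hol: "G holomorphic_on left_half_plane" and p: "0 < p" "p < 1" and gr: "strip_growth p C1 G" and C1: "C1 \<ge> 0"
    and osc: "strip_oscillation p C G" and C: "C > 0"
  shows "strip_carleson p (288 * ((1 + 2 / (1 - p)) * C1)\<^sup>2 + 28 * C) (energy_density G)"
proof -
  have hol': "deriv G holomorphic_on left_half_plane" using hol by (rule holomorphic_deriv_left_half_plane)
  obtain \<delta>1 where \<delta>1: "\<delta>1 > 0" "\<And>s t. - \<delta>1 \<le> s \<Longrightarrow> s < 0 \<Longrightarrow> cmod (deriv G (Complex s t)) \<le> C1 * (- s) powr ((p - 3) / 2)"
    using gr unfolding strip_growth_def by metis
  obtain \<delta>2 where \<delta>2: "\<delta>2 > 0" "\<forall>L a. 0 < L \<and> L \<le> \<delta>2 \<longrightarrow> (\<exists>c s2. s2 < 0 \<and> (\<forall>s1. s2 \<le> s1 \<and> s1 < 0 \<longrightarrow>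
     integral {a - L..a + L} (\<lambda>t. (cmod (G (Complex s1 t) - c))\<^sup>2) \<le> C * L powr p))"
    using osc unfolding strip_oscillation_def by blast
  \<comment> \<open>Integrating the growth of G' gives |G - c0| of order (-r)^(-\<beta>). As 2
    \<beta> = 1 - p is less than 1, this is square integrable in r.\<close>
  define \<beta> where "\<beta> = (1 - p) / 2"
  have \<beta>: "0 < \<beta>" "\<beta> < 1/2" and p\<beta>: "p = 1 - 2 * \<beta>" using p by (auto simp: \<beta>_def field_simps)
  define B where "B = (1 + 1 / \<beta>) * C1"
  have B: "B \<ge> 0" "B \<ge> C1" using \<beta> C1 by (auto simp: B_def distrib_right)
  have B_eq: "(1 + 2 / (1 - p)) * C1 = B" by (simp add: B_def \<beta>_def)
  have e: "(p - 3) / 2 = - \<beta> - 1" by (simp add: \<beta>_def field_simps)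
  show ?thesis unfolding strip_carleson_def B_eq
  proof (intro exI[of _ "min \<delta>1 \<delta>2 / 2"] conjI allI impI)
    show "0 < min \<delta>1 \<delta>2 / 2" using \<delta>1 \<delta>2 by simp
    fix L' a s1 assume *: "0 < L' \<and> L' \<le> min \<delta>1 \<delta>2 / 2 \<and> - L' \<le> s1 \<and> s1 < 0"
    define L where "L = 2 * L'"
    have L: "L > 0" "L \<le> \<delta>1" "L \<le> \<delta>2" using * by (auto simp: L_def)
    obtain c s2 where s2: "s2 < 0" "\<forall>s1. s2 \<le> s1 \<and> s1 < 0 \<longrightarrow>
        integral {a - L..a + L} (\<lambda>t. (cmod (G (Complex s1 t) - c))\<^sup>2) \<le> C * L powr p"
      using \<delta>2(2) L by blast
    \<comment> \<open>The cut-off has to be at least s1 / 2 for \<open>box_weight_compare\<close>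
      and at least \<open>s2\<close> for the oscillation bound to apply on its slice.\<close>
    define s where "s = max (s1 / 2) s2"
    have s: "s1 / 2 \<le> s" "s2 \<le> s" "s < 0" "- L \<le> s" using * s2 by (auto simp: s_def L_def)
    have O: "integral {a - L..a + L} (\<lambda>t. (cmod (G (Complex s t) - c))\<^sup>2) \<le> C * L powr p" using s2(2) s by blast
    define I where "I = {a - L..a + L}"
    have cI: "I = cbox (a - L) (a + L)" by (simp add: I_def)
    define R where "R = cbox (- L, a - L) (s, a + L)"
    define c0 where "c0 = G (Complex (-L) a)"
    define T where "T = C1 * L powr (- \<beta> - 1)"
    have T: "cmod (deriv G (Complex (-L) t)) \<le> T" for t
      using \<delta>1(2)[of "-L" t] L unfolding e by (simp add: T_def)
    have T0: "T \<ge> 0" using C1 by (simp add: T_def)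
    have LT: "L * T = C1 * L powr (- \<beta>)" using L by (simp add: T_def powr_diff)
    have top: "cmod (G (Complex (-L) t) - c0) \<le> L * T" if "t \<in> I" for t
      unfolding c0_def using that by (intro top_bound[OF hol L(1)] T) (auto simp: I_def)
    have ub: "cmod (G (Complex r t) - c0) \<le> B * (- r) powr (- \<beta>)" if r: "- L \<le> r" "r < 0" and t: "t \<in> I" for r t
    proof -
      have "cmod (G (Complex r t) - c0) \<le> cmod (G (Complex (-L) t) - c0) + C1 / \<beta> * (- r) powr (- \<beta>)"
      proof (rule growth_step[OF r \<beta>(1)])
        fix q assume q: "q \<in> {-L..r}"
        show "((\<lambda>r. G (Complex r t) - c0) has_vector_derivative deriv G (Complex q t)) (at q within {-L..r})"
          using q r by (auto intro!: derivative_eq_intros half_plane_deriv_Re hol)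
        show "cmod (deriv G (Complex q t)) \<le> C1 * (- q) powr (- \<beta> - 1)"
          using \<delta>1(2)[of q t] q r L unfolding e by auto
      qed (use C1 in auto)
      also have "\<dots> \<le> C1 * L powr (- \<beta>) + C1 / \<beta> * (- r) powr (- \<beta>)" using top[OF t] LT by simp
      also have "\<dots> \<le> C1 * (- r) powr (- \<beta>) + C1 / \<beta> * (- r) powr (- \<beta>)"
        using r \<beta> C1 by (intro add_mono mult_left_mono powr_mono2' order_refl) auto
      finally show ?thesis by (simp add: B_def algebra_simps)
    qed
    have cG: "continuous_on A (\<lambda>t. G (Complex r t))" if "r < 0" for r and A :: "real set"
      using that by (intro half_plane_continuous[OF hol] continuous_intros) auto
    have iG: "(\<lambda>t. G (Complex r t) - x) integrable_on I" if "r < 0" for r x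
      unfolding I_def using that by (intro integrable_continuous_interval continuous_intros cG)
    \<comment> \<open>G' is only O((-r)^(-\<beta> - 1)), which is not integrable up to the boundary.
      The derivative of \<open>m\<close> is the integral of G' over a horizontal segment, hence up
      to a factor -i the difference of two values of G; it is O((-r)^(-\<beta>)) and
      integrable.\<close>
    define m where "m = (\<lambda>r. integral I (\<lambda>t. G (Complex r t) - c0))"
    have m_step: "cmod (m s - m (-L)) \<le> 4 * B * L powr (1 - \<beta>)"
    proof (cases "- L = s")
      case True
      then show ?thesis using B by simp
    next
      case False
      have dm: "(m has_vector_derivative integral I (\<lambda>t. deriv G (Complex r t))) (at r within {-L..s})"
        if r: "r \<in> {-L..s}" for r
        unfolding m_def cI
      proof (rule leibniz_rule_vector_derivative[where U="{-L..s}"])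
        fix q t assume q: "q \<in> {- L..s}"
        show "((\<lambda>r. G (Complex r t) - c0) has_vector_derivative deriv G (Complex q t)) (at q within {-L..s})"
          using q s by (auto intro!: derivative_eq_intros half_plane_deriv_Re hol)
        show "(\<lambda>t. G (Complex q t) - c0) integrable_on cbox (a - L) (a + L)"
          using iG[of q c0] q s by (simp add: I_def)
      next
        show "continuous_on ({- L..s} \<times> cbox (a - L) (a + L)) (\<lambda>(x, t). deriv G (Complex x t))"
          unfolding case_prod_unfold
          using s by (intro half_plane_continuous[OF hol'] continuous_intros) auto
      qed (use r in auto)
      have dmb: "cmod (integral I (\<lambda>t. deriv G (Complex r t))) \<le> 2 * B * (- r) powr (- \<beta>)" if r: "r \<in> {-L..s}" for r
      proof -
        have "((\<lambda>t. \<i> * deriv G (Complex r t)) has_integral ((G (Complex r (a+L)) - c0) - (G (Complex r (a-L)) - c0))) I"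
          unfolding I_def using L r s
          by (intro fundamental_theorem_of_calculus) (auto intro!: derivative_eq_intros half_plane_deriv_Im hol)
        then have "\<i> * integral I (\<lambda>t. deriv G (Complex r t)) = (G (Complex r (a+L)) - c0) - (G (Complex r (a-L)) - c0)"
          by (metis integral_mult_right integral_unique)
        then have "cmod (\<i> * integral I (\<lambda>t. deriv G (Complex r t))) \<le> B * (- r) powr (- \<beta>) + B * (- r) powr (- \<beta>)"
          using r s L by (simp only:) (intro order_trans[OF norm_triangle_ineq4] add_mono ub, auto simp: I_def)
        then show ?thesis by (simp add: norm_mult)
      qed
      have "norm (m s - m (-L)) \<le> - (2 * B / (1 - \<beta>) * (- s) powr (1 - \<beta>)) - - (2 * B / (1 - \<beta>) * (- (- L)) powr (1 - \<beta>))"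
      proof (rule differentiable_bound_general)
        show "- L < s" using False s by simp
        show "continuous_on {- L..s} m" using dm by (rule continuous_on_vector_derivative)
        show "continuous_on {- L..s} (\<lambda>s. - (2 * B / (1 - \<beta>) * (- s) powr (1 - \<beta>)))"
          using s by (intro continuous_intros) auto
        fix r assume r: "- L < r" "r < s"
        show "(m has_vector_derivative integral I (\<lambda>t. deriv G (Complex r t))) (at r)"
          using dm[of r] r by (simp add: at_within_Icc_at)
        show "((\<lambda>s. - (2 * B / (1 - \<beta>) * (- s) powr (1 - \<beta>))) has_vector_derivative 2 * B * (- r) powr (- \<beta>)) (at r)"
          unfolding has_real_derivative_iff_has_vector_derivative[symmetric]
        proof -
          define k where "k = 2 * B / (1 - \<beta>)"
          have k: "2 * B = k * (1 - \<beta>)" using \<beta> by (simp add: k_def)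
          have "((\<lambda>s. - (k * (- s) powr (1 - \<beta>))) has_real_derivative k * (1 - \<beta>) * (- r) powr (- \<beta>)) (at r)"
            using r s by (auto intro!: derivative_eq_intros)
          then show "((\<lambda>s. - (2 * B / (1 - \<beta>) * (- s) powr (1 - \<beta>))) has_real_derivative 2 * B * (- r) powr (- \<beta>)) (at r)"
            by (simp only: k_def[symmetric] k[symmetric])
        qed
        show "norm (integral I (\<lambda>t. deriv G (Complex r t))) \<le> 2 * B * (- r) powr (- \<beta>)" using dmb[of r] r by simp
      qed
      also have "\<dots> \<le> 2 * B / (1 - \<beta>) * L powr (1 - \<beta>)" using B \<beta> by simp
      also have "\<dots> \<le> (2 * B * 2) * L powr (1 - \<beta>)"
      proof (rule mult_right_mono)
        have "2 * B / (1 - \<beta>) \<le> 2 * B / (1/2)" using B \<beta> by (intro divide_left_mono) auto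
        then show "2 * B / (1 - \<beta>) \<le> 2 * B * 2" by simp
      qed simp
      finally show ?thesis by simp
    qed
    have m_top: "cmod (m (-L)) \<le> 2 * B * L powr (1 - \<beta>)"
    proof -
      have "cmod (m (-L)) \<le> integral I (\<lambda>t. L * T)"
        unfolding m_def using L top by (intro integral_norm_bound_integral iG) (auto simp: I_def)
      also have "\<dots> = 2 * L * (L * T)" using L by (simp add: I_def)
      also have "\<dots> = 2 * C1 * (L powr 1 * L powr (- \<beta>))" using L by (simp add: LT)
      also have "\<dots> = 2 * C1 * L powr (1 - \<beta>)" unfolding powr_add[symmetric] by simp
      also have "\<dots> \<le> 2 * B * L powr (1 - \<beta>)" using B by (intro mult_right_mono) auto
      finally show ?thesis .
    qed
    have osc1: "cmod (integral I (\<lambda>t. G (Complex s t) - c)) \<le> (3/2) * sqrt C * L powr (1 - \<beta>)"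
    proof -
      \<comment> \<open>\<open>x\<close> is the expected root mean square of G - c on
        \<open>I\<close>, since L^p / L = L^(-2 \<beta>); it balances the two terms of the
        arithmetic-geometric mean inequality.\<close>
      define x where "x = sqrt C * L powr (- \<beta>)"
      have x: "x > 0" using C L by (simp add: x_def)
      have i2: "(\<lambda>t. (cmod (G (Complex s t) - c))\<^sup>2) integrable_on I"
        unfolding I_def using s by (intro integrable_continuous_interval continuous_intros cG)
      have "cmod (integral I (\<lambda>t. G (Complex s t) - c)) \<le> integral I (\<lambda>t. x / 2 + (1 / (2 * x)) * (cmod (G (Complex s t) - c))\<^sup>2)"
      proof (intro integral_norm_bound_integral iG integrable_add integrable_on_mult_right i2)
        fix t
        have "2 * x * cmod (G (Complex s t) - c) \<le> x\<^sup>2 + (cmod (G (Complex s t) - c))\<^sup>2" by (rule sum_squares_bound)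
        then show "cmod (G (Complex s t) - c) \<le> x / 2 + (1 / (2 * x)) * (cmod (G (Complex s t) - c))\<^sup>2"
          using x by (simp add: field_simps power2_eq_square)
      qed (use s in \<open>auto simp: I_def\<close>)
      also have "\<dots> = L * x + (1 / (2 * x)) * integral I (\<lambda>t. (cmod (G (Complex s t) - c))\<^sup>2)"
        using i2 L by (subst integral_add[OF _ integrable_on_mult_right[OF i2]]) (auto simp: I_def)
      also have "\<dots> \<le> L * x + (1 / (2 * x)) * (C * L powr p)"
        using O x by (intro add_left_mono mult_left_mono) (auto simp: I_def)
      also have "L * x = sqrt C * (L powr 1 * L powr (- \<beta>))" using L by (simp add: x_def)
      also have "\<dots> = sqrt C * L powr (1 - \<beta>)" unfolding powr_add[symmetric] by simp
      also have "(1 / (2 * x)) * (C * L powr p) = (1/2) * sqrt C * L powr (1 - \<beta>)"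
      proof -
        have "C = sqrt C * sqrt C" using C by simp
        moreover have "L powr p = L powr (- \<beta>) * L powr (1 - \<beta>)" unfolding powr_add[symmetric] p\<beta> by simp
        ultimately have "C * L powr p = x * (sqrt C * L powr (1 - \<beta>))" by (simp add: x_def)
        then show ?thesis using x by simp
      qed
      finally show ?thesis by (simp add: algebra_simps)
    qed
    \<comment> \<open>The difference of the two integrals over the slice \<open>s\<close> is 2 L (c
      - c0). It is bounded by the change of \<open>m\<close> from top to bottom, its value at the
      top and the oscillation about \<open>c\<close>.\<close>
    have cc: "(cmod (c - c0))\<^sup>2 * L \<le> 2 * (9 * B\<^sup>2 + C) * L powr p"
    proof -
      have "m s - integral I (\<lambda>t. G (Complex s t) - c) = integral I (\<lambda>t. c - c0)"
        unfolding m_def using s by (subst integral_diff[symmetric, OF iG iG]) auto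
      also have "\<dots> = of_real (2 * L) * (c - c0)" using L by (simp add: I_def scaleR_conv_of_real)
      finally have "2 * L * cmod (c - c0) = cmod (m s - integral I (\<lambda>t. G (Complex s t) - c))"
        using L by (simp add: norm_mult)
      also have "\<dots> \<le> cmod (m s) + cmod (integral I (\<lambda>t. G (Complex s t) - c))" by (rule norm_triangle_ineq4)
      also have "\<dots> \<le> (cmod (m s - m (-L)) + cmod (m (-L))) + cmod (integral I (\<lambda>t. G (Complex s t) - c))"
        using norm_triangle_sub[of "m s" "m (-L)"] by simp
      also have "\<dots> \<le> (4 * B * L powr (1 - \<beta>) + 2 * B * L powr (1 - \<beta>)) + (3/2) * sqrt C * L powr (1 - \<beta>)"
        by (intro add_mono m_step m_top osc1)
      also have "\<dots> \<le> 2 * (3 * B + sqrt C) * L powr (1 - \<beta>)" using C by (simp add: algebra_simps)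
      also have "\<dots> = 2 * L * ((3 * B + sqrt C) * L powr (- \<beta>))" using L by (simp add: powr_diff powr_minus divide_inverse)
      finally have "cmod (c - c0) \<le> (3 * B + sqrt C) * L powr (- \<beta>)" using L by simp
      then have "(cmod (c - c0))\<^sup>2 \<le> ((3 * B + sqrt C) * L powr (- \<beta>))\<^sup>2" by (rule power_mono) simp
      also have "\<dots> = (3 * B + sqrt C)\<^sup>2 * L powr (- 2 * \<beta>)"
        by (simp add: power_mult_distrib power2_eq_square[of "_ powr _"] flip: powr_add)
      also have "\<dots> \<le> 2 * (9 * B\<^sup>2 + C) * L powr (- 2 * \<beta>)"
      proof (rule mult_right_mono)
        show "(3 * B + sqrt C)\<^sup>2 \<le> 2 * (9 * B\<^sup>2 + C)"
          using sum_squares_bound[of "3 * B" "sqrt C"] C by (simp add: power2_sum power_mult_distrib)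
      qed simp
      finally have "(cmod (c - c0))\<^sup>2 * L \<le> 2 * (9 * B\<^sup>2 + C) * L powr (- 2 * \<beta>) * L"
        using L by (intro mult_right_mono) auto
      also have "\<dots> = 2 * (9 * B\<^sup>2 + C) * (L powr (- 2 * \<beta>) * L powr 1)" using L by simp
      also have "\<dots> = 2 * (9 * B\<^sup>2 + C) * L powr p" unfolding powr_add[symmetric] p\<beta> by simp
      finally show ?thesis .
    qed
    let ?u = "\<lambda>p. G (Complex (fst p) (snd p)) - c0"
    let ?D = "\<lambda>p. deriv G (Complex (fst p) (snd p))"
    have cD: "continuous_on R ?D"
      unfolding R_def by (intro half_plane_continuous_box hol' s)
    have pR: "fst p \<le> s" "fst p \<ge> - L" "snd p \<in> I" if "p \<in> R" for p using that by (cases p; auto simp: R_def I_def)+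
    have bI: "0 \<le> bump a L t" "bump a L t \<le> 1" if "t \<in> I" for t using bump_bounds[OF L(1)] that by (auto simp: I_def)
    define X where "X = integral R (\<lambda>p. (s - fst p) * (bump a L (snd p) * (cmod (?D p))\<^sup>2))"
    have h1: "3 * X \<le>
     integral I (\<lambda>t. bump a L t *
        (- ((s - (-L)) * (2 * (?u (-L,t) \<bullet> ?D (-L,t)))) + - 1 * (cmod (?u (-L,t)))\<^sup>2 - - 1 * (cmod (?u (s,t)))\<^sup>2))
     + integral R (\<lambda>p. 0 * (bump a L (snd p) * (cmod (?u p))\<^sup>2))
     + (16 / L\<^sup>2) * integral R (\<lambda>p. (s - fst p) * (cmod (?u p))\<^sup>2)"
      unfolding X_def R_def I_def
      by (rule green_area_upper[OF hol s(4,3) L(1), where \<omega>' = "\<lambda>_. - 1" and \<omega>'' = "\<lambda>_. 0"])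
         (auto intro!: derivative_eq_intros continuous_intros)
    have h2: "integral I (\<lambda>t. bump a L t *
        (- ((s - (-L)) * (2 * (?u (-L,t) \<bullet> ?D (-L,t)))) + - 1 * (cmod (?u (-L,t)))\<^sup>2 - - 1 * (cmod (?u (s,t)))\<^sup>2))
      \<le> 4 * B\<^sup>2 * L powr p + (2 * C * L powr p + 4 * ((cmod (c - c0))\<^sup>2 * L))"
    proof -
      have i2: "(\<lambda>t. (cmod (G (Complex s t) - c))\<^sup>2) integrable_on I"
        unfolding I_def using s by (intro integrable_continuous_interval continuous_intros cG)
      have "integral I (\<lambda>t. bump a L t *
        (- ((s - (-L)) * (2 * (?u (-L,t) \<bullet> ?D (-L,t)))) + - 1 * (cmod (?u (-L,t)))\<^sup>2 - - 1 * (cmod (?u (s,t)))\<^sup>2))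
        \<le> integral I (\<lambda>t. (2 * (L * T)\<^sup>2 + 2 * (cmod (c - c0))\<^sup>2) + 2 * (cmod (G (Complex s t) - c))\<^sup>2)"
      proof (rule integral_le)
        show "(\<lambda>t. bump a L t *
        (- ((s - (-L)) * (2 * (?u (-L,t) \<bullet> ?D (-L,t)))) + - 1 * (cmod (?u (-L,t)))\<^sup>2 - - 1 * (cmod (?u (s,t)))\<^sup>2)) integrable_on I"
          unfolding fst_conv snd_conv I_def
          by (intro integrable_continuous_interval continuous_intros half_plane_continuous[OF hol] half_plane_continuous[OF hol']) (use s L in auto)
        show "(\<lambda>t. (2 * (L * T)\<^sup>2 + 2 * (cmod (c - c0))\<^sup>2) + 2 * (cmod (G (Complex s t) - c))\<^sup>2) integrable_on I"
          unfolding I_def using s by (intro integrable_continuous_interval continuous_intros cG)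
        fix t assume t: "t \<in> I"
        have "- (?u (-L,t) \<bullet> ?D (-L,t)) \<le> cmod (?u (-L,t)) * cmod (?D (-L,t))"
          using Cauchy_Schwarz_ineq2[of "?u (-L,t)" "?D (-L,t)"] by linarith
        also have "\<dots> \<le> (L * T) * T" using top[OF t] T[of t] T0 L by (intro mult_mono) auto
        finally have "(s - (-L)) * (2 * - (?u (-L,t) \<bullet> ?D (-L,t))) \<le> (s - (-L)) * (2 * ((L * T) * T))"
          using s by (intro mult_left_mono) auto
        also have "\<dots> \<le> L * (2 * ((L * T) * T))" using s L T0 by (intro mult_right_mono) auto
        also have "\<dots> = 2 * (L * T)\<^sup>2" by (simp add: power2_eq_square)
        finally have 1: "- ((s - (-L)) * (2 * (?u (-L,t) \<bullet> ?D (-L,t)))) \<le> 2 * (L * T)\<^sup>2" by (simp only: mult_minus_right)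
        have "cmod (?u (s,t)) \<le> cmod (G (Complex s t) - c) + cmod (c - c0)"
          using norm_triangle_ineq[of "G (Complex s t) - c" "c - c0"] by simp
        then have "(cmod (?u (s,t)))\<^sup>2 \<le> (cmod (G (Complex s t) - c) + cmod (c - c0))\<^sup>2" by (rule power_mono) simp
        also have "\<dots> \<le> 2 * (cmod (G (Complex s t) - c))\<^sup>2 + 2 * (cmod (c - c0))\<^sup>2"
          using sum_squares_bound[of "cmod (G (Complex s t) - c)" "cmod (c - c0)"] by (simp add: power2_sum)
        finally have 2: "(cmod (?u (s,t)))\<^sup>2 \<le> 2 * (cmod (G (Complex s t) - c))\<^sup>2 + 2 * (cmod (c - c0))\<^sup>2" .
        have 3: "0 \<le> (cmod (?u (-L,t)))\<^sup>2" by simp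
        have "(- ((s - (-L)) * (2 * (?u (-L,t) \<bullet> ?D (-L,t)))) + - 1 * (cmod (?u (-L,t)))\<^sup>2 - - 1 * (cmod (?u (s,t)))\<^sup>2)
           \<le> (2 * (L * T)\<^sup>2 + 2 * (cmod (c - c0))\<^sup>2) + 2 * (cmod (G (Complex s t) - c))\<^sup>2" (is "?l \<le> ?r")
          using 1 2 3 by linarith
        then have "bump a L t * ?l \<le> bump a L t * ?r" using bI[OF t] by (intro mult_left_mono)
        also have "\<dots> \<le> 1 * ?r" using bI[OF t] by (intro mult_right_mono) auto
        finally show "bump a L t * ?l \<le> ?r" by simp
      qed
      also have "\<dots> = 2 * L * (2 * (L * T)\<^sup>2 + 2 * (cmod (c - c0))\<^sup>2) + 2 * integral I (\<lambda>t. (cmod (G (Complex s t) - c))\<^sup>2)"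
        using L by (subst integral_add[OF _ integrable_on_mult_right[OF i2]]) (auto simp: I_def)
      also have "\<dots> \<le> 2 * L * (2 * (L * T)\<^sup>2 + 2 * (cmod (c - c0))\<^sup>2) + 2 * (C * L powr p)"
        using O by (simp add: I_def)
      also have "\<dots> = 4 * (L * (L * T)\<^sup>2) + (2 * C * L powr p + 4 * ((cmod (c - c0))\<^sup>2 * L))"
        by (simp add: algebra_simps)
      also have "L * (L * T)\<^sup>2 = C1\<^sup>2 * L powr p"
      proof -
        have "(L * T)\<^sup>2 = C1\<^sup>2 * L powr (- 2 * \<beta>)"
          by (simp add: LT power_mult_distrib power2_eq_square[of "_ powr _"] flip: powr_add)
        then have "L * (L * T)\<^sup>2 = C1\<^sup>2 * (L powr 1 * L powr (- 2 * \<beta>))" using L by simp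
        also have "\<dots> = C1\<^sup>2 * L powr p" unfolding powr_add[symmetric] p\<beta> by simp
        finally show ?thesis .
      qed
      also have "4 * (C1\<^sup>2 * L powr p) \<le> 4 * (B\<^sup>2 * L powr p)"
        using B C1 by (intro mult_left_mono mult_right_mono power_mono) auto
      finally show ?thesis by simp
    qed
    \<comment> \<open>Pointwise the integrand is at most B^2 (-r)^(1 - 2 \<beta>) = B^2 (-r)^p, so
      no further use of the energy is needed here.\<close>
    have h3: "(16 / L\<^sup>2) * integral R (\<lambda>p. (s - fst p) * (cmod (?u p))\<^sup>2) \<le> 32 * B\<^sup>2 * L powr p"
    proof -
      have "integral R (\<lambda>p. (s - fst p) * (cmod (?u p))\<^sup>2) \<le> integral R (\<lambda>_. B\<^sup>2 * L powr p)"
      proof (intro integral_le)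
        show "(\<lambda>p. (s - fst p) * (cmod (?u p))\<^sup>2) integrable_on R"
          unfolding R_def by (intro integrable_continuous continuous_intros half_plane_continuous_box hol s)
        show "(\<lambda>_. B\<^sup>2 * L powr p) integrable_on R" unfolding R_def by (rule integrable_const)
        fix q assume q: "q \<in> R"
        have q0: "0 < - fst q" "- fst q \<le> L" using pR[OF q] s by auto
        have "(cmod (?u q))\<^sup>2 \<le> (B * (- fst q) powr (- \<beta>))\<^sup>2"
          using pR[OF q] s by (intro power_mono ub) auto
        also have "\<dots> = B\<^sup>2 * (- fst q) powr (- 2 * \<beta>)"
          by (simp add: power_mult_distrib power2_eq_square[of "_ powr _"] flip: powr_add)
        finally have "(s - fst q) * (cmod (?u q))\<^sup>2 \<le> (- fst q) * (B\<^sup>2 * (- fst q) powr (- 2 * \<beta>))"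
          using pR[OF q] s by (intro mult_mono) auto
        also have "\<dots> = B\<^sup>2 * ((- fst q) powr 1 * (- fst q) powr (- 2 * \<beta>))" using q0 by simp
        also have "\<dots> = B\<^sup>2 * (- fst q) powr p" unfolding powr_add[symmetric] p\<beta> by simp
        also have "\<dots> \<le> B\<^sup>2 * L powr p" using q0 p by (intro mult_left_mono powr_mono2) auto
        finally show "(s - fst q) * (cmod (?u q))\<^sup>2 \<le> B\<^sup>2 * L powr p" .
      qed
      also have "\<dots> = (s + L) * (2 * L) * (B\<^sup>2 * L powr p)"
        using s L by (simp add: R_def content_Pair)
      also have "\<dots> \<le> L * (2 * L) * (B\<^sup>2 * L powr p)" using s L by (intro mult_right_mono) auto
      finally have "(16 / L\<^sup>2) * integral R (\<lambda>p. (s - fst p) * (cmod (?u p))\<^sup>2) \<le> (16 / L\<^sup>2) * (L * (2 * L) * (B\<^sup>2 * L powr p))"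
        by (rule mult_left_mono) simp
      also have "\<dots> = 32 * B\<^sup>2 * L powr p" using L by (simp add: power2_eq_square)
      finally show ?thesis .
    qed
    have X: "3 * X \<le> (108 * B\<^sup>2 + 10 * C) * L powr p"
      using h1 h2 h3 cc by (simp add: algebra_simps)
    have Lp: "L powr p \<le> 2 * L' powr p"
    proof -
      have "2 powr p \<le> 2 powr 1" using p by (intro powr_mono) auto
      then show ?thesis using * by (simp add: L_def powr_mult mult_right_mono)
    qed
    have "integral (cbox (- L', a - L') (s1, a + L')) (\<lambda>p. (- fst p)^1 * (cmod (?D p))\<^sup>2)
        \<le> 2 ^ Suc 1 * integral (cbox (- (2 * L'), a - 2 * L') (s, a + 2 * L')) (\<lambda>p. (s - fst p)^1 * (bump a (2 * L') (snd p) * (cmod (?D p))\<^sup>2))"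
      using * s cD by (intro box_weight_compare) (auto simp: R_def L_def intro!: continuous_intros)
    also have "\<dots> = 4 * X" by (simp add: X_def R_def L_def)
    also have "\<dots> \<le> (144 * B\<^sup>2 + 14 * C) * L powr p"
    proof -
      have "0 \<le> C * L powr p" using C by simp
      then show ?thesis using X by (simp add: algebra_simps)
    qed
    also have "\<dots> \<le> (144 * B\<^sup>2 + 14 * C) * (2 * L' powr p)" using Lp C by (intro mult_left_mono) auto
    also have "\<dots> = (288 * B\<^sup>2 + 28 * C) * L' powr p" by (simp add: algebra_simps)
    finally show "integral (cbox (- L', a - L') (s1, a + L')) (\<lambda>p. (- fst p) * (cmod (?D p))\<^sup>2)
        \<le> (288 * B\<^sup>2 + 28 * C) * L' powr p" by simp
  qed
qed

subsection \<open>Polar coordinates and area means\<close>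

text \<open>Links Lebesgue measure on the complex plane with \<open>real^2\<close>, where the change
  of variables with a Jacobian determinant takes place.\<close>

lemma lborel_complex_real2: "distr lborel borel (\<lambda>x :: real^2. Complex (x $ 1) (x $ 2)) = (lborel :: complex measure)"
proof (rule lborel_eqI[symmetric])
  have m[measurable]: "(\<lambda>x :: real^2. Complex (x $ 1) (x $ 2)) \<in> borel_measurable borel"
    unfolding Complex_eq by measurable
  fix l u :: complex assume le: "\<And>b. b \<in> Basis \<Longrightarrow> l \<bullet> b \<le> u \<bullet> b"
  then have le': "Re l \<le> Re u" "Im l \<le> Im u" using le[of 1] le[of \<i>] by (auto simp: Basis_complex_def)
  let ?v = "\<lambda>z. vector [Re z, Im z] :: real^2"
  have "(\<lambda>x :: real^2. Complex (x $ 1) (x $ 2)) -` box l u = box (?v l) (?v u)"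
    by (auto simp: mem_box_cart forall_2 in_box_complex_iff)
  then have "emeasure (distr lborel borel (\<lambda>x :: real^2. Complex (x $ 1) (x $ 2))) (box l u)
      = emeasure lborel (box (?v l) (?v u))"
    by (simp add: emeasure_distr)
  also have "\<dots> = (\<Prod>b\<in>Basis. (?v u - ?v l) \<bullet> b)"
  proof (rule emeasure_lborel_box)
    have "?v l $ i \<le> ?v u $ i" for i using le' exhaust_2[of i] by auto
    then show "?v l \<bullet> b \<le> ?v u \<bullet> b" if "b \<in> Basis" for b
      using that by (auto simp: Basis_vec_def inner_axis)
  qed
  also have "(\<Prod>b\<in>Basis. (?v u - ?v l) \<bullet> b) = (Re u - Re l) * (Im u - Im l)"
  proof -
    have B: "(Basis :: (real^2) set) = {axis 1 1, axis 2 1}" by (auto simp: Basis_vec_def UNIV_2)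
    have ne: "axis 1 1 \<noteq> (axis 2 1 :: real^2)" by (simp add: axis_eq_axis)
    have "(\<Prod>b\<in>Basis. (?v u - ?v l) \<bullet> b) = ((?v u - ?v l) \<bullet> axis 1 1) * ((?v u - ?v l) \<bullet> axis 2 1)"
      unfolding B using ne by (subst prod.insert) auto
    then show ?thesis by (simp add: inner_axis)
  qed
  also have "\<dots> = (\<Prod>b\<in>Basis. (u - l) \<bullet> b)" by (simp add: Basis_complex_def)
  finally show "emeasure (distr lborel borel (\<lambda>x :: real^2. Complex (x $ 1) (x $ 2))) (box l u) = ennreal (\<Prod>b\<in>Basis. (u - l) \<bullet> b)" .
qed simp

lemma lborel_complex_pair: "distr (lborel \<Otimes>\<^sub>M lborel) borel (\<lambda>p :: real \<times> real. Complex (fst p) (snd p)) = (lborel :: complex measure)"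
proof (rule lborel_eqI[symmetric])
  have m[measurable]: "(\<lambda>p :: real \<times> real. Complex (fst p) (snd p)) \<in> borel_measurable borel"
    by (intro borel_measurable_continuous_onI continuous_intros)
  fix l u :: complex assume le: "\<And>b. b \<in> Basis \<Longrightarrow> l \<bullet> b \<le> u \<bullet> b"
  then have le': "Re l \<le> Re u" "Im l \<le> Im u" using le[of 1] le[of \<i>] by (auto simp: Basis_complex_def)
  have "(\<lambda>p :: real \<times> real. Complex (fst p) (snd p)) -` box l u = box (Re l) (Re u) \<times> box (Im l) (Im u)"
    by (auto simp: in_box_complex_iff)
  then have "emeasure (distr (lborel \<Otimes>\<^sub>M lborel) borel (\<lambda>p :: real \<times> real. Complex (fst p) (snd p))) (box l u)
      = emeasure (lborel \<Otimes>\<^sub>M lborel) (box (Re l) (Re u) \<times> box (Im l) (Im u))"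
    by (simp add: emeasure_distr lborel_prod)
  also have "\<dots> = ennreal (Re u - Re l) * ennreal (Im u - Im l)"
    using le' by (subst lborel.emeasure_pair_measure_Times) auto
  also have "\<dots> = ennreal (\<Prod>b\<in>Basis. (u - l) \<bullet> b)" using le' by (simp add: Basis_complex_def ennreal_mult)
  finally show "emeasure (distr (lborel \<Otimes>\<^sub>M lborel) borel (\<lambda>p :: real \<times> real. Complex (fst p) (snd p))) (box l u) = ennreal (\<Prod>b\<in>Basis. (u - l) \<bullet> b)" .
qed simp

text \<open>Multiplication by a complex number E has real determinant |E|^2, here exp (2 Re w). The
  theorem on differentiable images speaks of finite measures, so an infinite integral is treated
  separately: a finite measure of the image would make the integral finite.\<close>

lemma emeasure_exp_image:
  assumes B[measurable]: "B \<in> sets borel" and inj: "inj_on exp B" and img[measurable]: "exp ` B \<in> sets (borel :: complex measure)"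
  shows "emeasure lborel (exp ` B) = (\<integral>\<^sup>+w. ennreal (exp (2 * Re w)) * indicator B w \<partial>lborel)"
proof -
  define T where "T = (\<lambda>x :: real^2. Complex (x $ 1) (x $ 2))"
  define V where "V = (\<lambda>z. vector [Re z, Im z] :: real^2)"
  have TV: "T (V z) = z" and VT: "V (T x) = x" for z x
    by (auto simp: T_def V_def vec_eq_iff forall_2 complex_eq_iff)
  have mT[measurable]: "T \<in> borel_measurable borel" unfolding T_def Complex_eq by measurable
  have linV: "linear V" by (rule linearI) (auto simp: V_def vec_eq_iff forall_2)
  have linT: "linear T" by (rule linearI) (auto simp: T_def complex_eq_iff)
  define g where "g = (\<lambda>x. V (exp (T x)))"
  define g' where "g' = (\<lambda>x h. V (exp (T x) * T h))"
  define B2 where "B2 = T -` B"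
  have B2[measurable]: "B2 \<in> sets borel" unfolding B2_def using measurable_sets[OF mT B] by simp
  have der: "(g has_derivative g' x) (at x within B2)" for x
  proof -
    have "((\<lambda>x. exp (T x)) has_derivative (\<lambda>h. exp (T x) * T h)) (at x within B2)"
      by (rule has_derivative_compose[OF linear_imp_has_derivative[OF linT] DERIV_exp[unfolded has_field_derivative_def]])
    then show ?thesis unfolding g_def g'_def
      using bounded_linear.has_derivative[OF linear_conv_bounded_linear[THEN iffD1, OF linV]] by blast
  qed
  have injg: "inj_on g B2"
  proof (rule inj_onI)
    fix x y assume "x \<in> B2" "y \<in> B2" "g x = g y"
    then have "exp (T x) = exp (T y)" by (metis g_def TV)
    then have "T x = T y" using inj \<open>x \<in> B2\<close> \<open>y \<in> B2\<close> by (auto simp: B2_def inj_on_def)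
    then show "x = y" by (metis VT)
  qed
  have det: "\<bar>det (matrix (g' x))\<bar> = exp (2 * x $ 1)" for x
  proof -
    have "det (matrix (\<lambda>h. V (E * T h))) = (cmod E)\<^sup>2" for E
      unfolding cmod_power2 by (simp add: det_2 matrix_def V_def T_def axis_def power2_eq_square)
    then have "det (matrix (g' x)) = (cmod (exp (T x)))\<^sup>2" unfolding g'_def .
    also have "\<dots> = exp (2 * x $ 1)" by (simp add: T_def power2_eq_square flip: exp_add)
    finally show ?thesis by simp
  qed
  have img2: "g ` B2 = T -` (exp ` B)"
    by (auto simp: g_def B2_def TV) (metis TV VT image_eqI vimage_eq)+
  have img2_m[measurable]: "g ` B2 \<in> sets borel" unfolding img2 using measurable_sets[OF mT img] by simp
  have L: "(lborel :: complex measure) = distr lborel borel T"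
    unfolding T_def by (rule lborel_complex_real2[symmetric])
  have l: "emeasure lborel (exp ` B) = emeasure lborel (g ` B2)"
    unfolding img2 by (subst L, subst emeasure_distr) auto
  have r: "(\<integral>\<^sup>+w. ennreal (exp (2 * Re w)) * indicator B w \<partial>lborel) = (\<integral>\<^sup>+x. ennreal (exp (2 * x $ 1) * indicator B2 x) \<partial>lborel)"
    using mT by (subst L, subst nn_integral_distr) (auto simp: T_def B2_def ennreal_mult ennreal_indicator intro!: nn_integral_cong split: split_indicator)
  have iff: "g ` B2 \<in> lmeasurable \<and> measure lebesgue (g ` B2) = m \<longleftrightarrow> ((\<lambda>x. exp (2 * x $ 1)) has_integral m) B2" for m
    using has_measure_differentiable_image[of B2 g g' m] der injg unfolding det by simp
  have hi: "((\<lambda>x. exp (2 * x $ 1)) has_integral m) B2 \<longleftrightarrow> ((\<lambda>x. exp (2 * x $ 1) * indicator B2 x) has_integral m) UNIV" for m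
  proof -
    have "(\<lambda>x. exp (2 * x $ 1) * indicator B2 x) = (\<lambda>x :: real^2. if x \<in> B2 then exp (2 * x $ 1) else 0)" by auto
    then show ?thesis using has_integral_restrict_UNIV[of B2 "\<lambda>x :: real^2. exp (2 * x $ 1)" m] by simp
  qed
  have mm: "(\<lambda>x :: real^2. exp (2 * x $ 1) * indicator B2 x) \<in> borel_measurable borel" by measurable
  show ?thesis
  proof (cases "(\<integral>\<^sup>+x. ennreal (exp (2 * x $ 1) * indicator B2 x) \<partial>lborel) = \<infinity>")
    case False
    then obtain m where m: "m \<ge> 0" "(\<integral>\<^sup>+x. ennreal (exp (2 * x $ 1) * indicator B2 x) \<partial>lborel) = ennreal m"
      by (cases "(\<integral>\<^sup>+x. ennreal (exp (2 * x $ 1) * indicator B2 x) \<partial>lborel)" rule: ennreal_cases) auto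
    have "((\<lambda>x. exp (2 * x $ 1) * indicator B2 x) has_integral m) UNIV"
      by (rule nn_integral_has_integral[OF mm _ m(2,1)]) simp
    then have "g ` B2 \<in> lmeasurable \<and> measure lebesgue (g ` B2) = m" using iff hi by blast
    then have "emeasure lebesgue (g ` B2) = ennreal m" by (metis emeasure_eq_measure2)
    then show ?thesis using l r m by simp
  next
    case True
    have "emeasure lborel (g ` B2) = \<infinity>"
    proof (rule ccontr)
      assume "emeasure lborel (g ` B2) \<noteq> \<infinity>"
      then have "emeasure lebesgue (g ` B2) < \<infinity>" by (simp add: top.not_eq_extremum)
      then have "g ` B2 \<in> lmeasurable" by (intro fmeasurableI) auto
      then have "((\<lambda>x. exp (2 * x $ 1) * indicator B2 x) has_integral measure lebesgue (g ` B2)) UNIV"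
        using iff hi by blast
      then have "(\<integral>\<^sup>+x. ennreal (exp (2 * x $ 1) * indicator B2 x) \<partial>lborel) = ennreal (measure lebesgue (g ` B2))"
        by (intro nn_integral_has_integral_lborel mm) auto
      then show False using True by simp
    qed
    then show ?thesis using l r True by simp
  qed
qed

text \<open>Both sides integrate \<open>F\<close> against a Borel measure. The two measures agree on
  each set A by \<open>emeasure_exp_image\<close>, applied to the part of B that exp maps into
  A.\<close>

lemma nn_integral_exp_image:
  fixes F :: "complex \<Rightarrow> ennreal"
  assumes F[measurable]: "F \<in> borel_measurable borel" and B[measurable]: "B \<in> sets borel" and inj: "inj_on exp B"
    and img[measurable]: "exp ` B \<in> sets (borel :: complex measure)"
  shows "(\<integral>\<^sup>+z. F z * indicator (exp ` B) z \<partial>lborel) = (\<integral>\<^sup>+w. F (exp w) * (ennreal (exp (2 * Re w)) * indicator B w) \<partial>lborel)"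
proof -
  define M1 where "M1 = density lborel (indicator (exp ` B) :: complex \<Rightarrow> ennreal)"
  define M2 where "M2 = distr (density lborel (\<lambda>w. ennreal (exp (2 * Re w)) * indicator B w)) borel (exp :: complex \<Rightarrow> complex)"
  have me[measurable]: "(exp :: complex \<Rightarrow> complex) \<in> borel_measurable borel"
    by (intro borel_measurable_continuous_onI continuous_intros)
  have "M1 = M2"
  proof (rule measure_eqI)
    show "sets M1 = sets M2" by (simp add: M1_def M2_def)
    fix A assume "A \<in> sets M1"
    then have A[measurable]: "A \<in> sets borel" by (simp add: M1_def)
    define B' where "B' = B \<inter> exp -` A"
    have B'[measurable]: "B' \<in> sets borel" unfolding B'_def using measurable_sets[OF me A] by auto
    have eB': "exp ` B' = exp ` B \<inter> A" by (auto simp: B'_def)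
    have "emeasure M1 A = (\<integral>\<^sup>+z. indicator (exp ` B) z * indicator A z \<partial>lborel)"
      unfolding M1_def by (rule emeasure_density) auto
    also have "\<dots> = (\<integral>\<^sup>+z. indicator (exp ` B \<inter> A) z \<partial>lborel)"
      by (intro nn_integral_cong) (auto split: split_indicator)
    also have "\<dots> = emeasure lborel (exp ` B')" unfolding eB' by (rule nn_integral_indicator) auto
    also have "\<dots> = (\<integral>\<^sup>+w. ennreal (exp (2 * Re w)) * indicator B' w \<partial>lborel)"
      by (rule emeasure_exp_image) (use inj eB' in \<open>auto simp: B'_def intro: inj_on_subset\<close>)
    also have "\<dots> = (\<integral>\<^sup>+w. (ennreal (exp (2 * Re w)) * indicator B w) * indicator (exp -` A) w \<partial>lborel)"
      by (intro nn_integral_cong) (auto simp: B'_def split: split_indicator)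
    also have "\<dots> = emeasure (density lborel (\<lambda>w. ennreal (exp (2 * Re w)) * indicator B w)) (exp -` A)"
      by (rule emeasure_density[symmetric]) (use measurable_sets[OF me A] in auto)
    also have "\<dots> = emeasure M2 A" unfolding M2_def by (subst emeasure_distr) auto
    finally show "emeasure M1 A = emeasure M2 A" .
  qed
  have "(\<integral>\<^sup>+z. F z * indicator (exp ` B) z \<partial>lborel) = (\<integral>\<^sup>+z. F z \<partial>M1)"
    unfolding M1_def by (subst nn_integral_density) (auto intro!: nn_integral_cong simp: mult.commute)
  also have "\<dots> = (\<integral>\<^sup>+w. F (exp w) * (ennreal (exp (2 * Re w)) * indicator B w) \<partial>lborel)"
    unfolding \<open>M1 = M2\<close> M2_def
    by (subst nn_integral_distr, simp, simp, subst nn_integral_density) (auto intro!: nn_integral_cong simp: mult.commute)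
  finally show ?thesis .
qed

lemma nn_integral_complex_iterated:
  fixes F :: "complex \<Rightarrow> ennreal"
  assumes F[measurable]: "F \<in> borel_measurable borel"
  shows "(\<integral>\<^sup>+w. F w \<partial>lborel) = (\<integral>\<^sup>+t. \<integral>\<^sup>+s. F (Complex s t) \<partial>lborel \<partial>lborel)"
    and "(\<integral>\<^sup>+w. F w \<partial>lborel) = (\<integral>\<^sup>+s. \<integral>\<^sup>+t. F (Complex s t) \<partial>lborel \<partial>lborel)"
    and "(\<integral>\<^sup>+w. F w \<partial>lborel) = (\<integral>\<^sup>+p. F (Complex (fst p) (snd p)) \<partial>lborel)"
proof -
  have m[measurable]: "(\<lambda>p :: real \<times> real. Complex (fst p) (snd p)) \<in> borel_measurable borel"
    by (intro borel_measurable_continuous_onI continuous_intros)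
  have m2[measurable]: "(\<lambda>p :: real \<times> real. F (Complex (fst p) (snd p))) \<in> borel_measurable borel" by measurable
  have m3: "(\<lambda>p :: real \<times> real. F (Complex (fst p) (snd p))) \<in> borel_measurable (lborel \<Otimes>\<^sub>M lborel)"
    unfolding lborel_prod by simp
  have e: "(\<integral>\<^sup>+w. F w \<partial>lborel) = (\<integral>\<^sup>+p. F (Complex (fst p) (snd p)) \<partial>(lborel \<Otimes>\<^sub>M lborel))"
    by (subst lborel_complex_pair[symmetric], subst nn_integral_distr) (auto simp: lborel_prod)
  show "(\<integral>\<^sup>+w. F w \<partial>lborel) = (\<integral>\<^sup>+p. F (Complex (fst p) (snd p)) \<partial>lborel)"
    using e by (simp add: lborel_prod)
  show "(\<integral>\<^sup>+w. F w \<partial>lborel) = (\<integral>\<^sup>+s. \<integral>\<^sup>+t. F (Complex s t) \<partial>lborel \<partial>lborel)"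
    unfolding e lborel.nn_integral_fst[OF m3, symmetric] by simp
  show "(\<integral>\<^sup>+w. F w \<partial>lborel) = (\<integral>\<^sup>+t. \<integral>\<^sup>+s. F (Complex s t) \<partial>lborel \<partial>lborel)"
    unfolding e lborel_pair.nn_integral_snd[OF m3, symmetric] by simp
qed

lemma circle_mean_value:
  fixes H :: "complex \<Rightarrow> complex"
  assumes "H holomorphic_on cball w r" "r > 0"
  shows "((\<lambda>t. H (w + of_real r * cis t)) has_integral 2 * pi * H w) {0..2 * pi}"
proof -
  have "((\<lambda>u. H u / (u - w)) has_contour_integral (2 * of_real pi * \<i> * H w)) (circlepath w r)"
    using assms by (intro Cauchy_integral_circlepath_simple) auto
  then have "((\<lambda>t. H (w + of_real r * cis t) / (w + of_real r * cis t - w) * r * \<i> * cis t) has_integral (2 * of_real pi * \<i> * H w)) {0..2 * pi}"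
    unfolding circlepath_def by (subst (asm) has_contour_integral_part_circlepath_iff) auto
  then have "((\<lambda>t. \<i> * H (w + of_real r * cis t)) has_integral (2 * of_real pi * \<i> * H w)) {0..2 * pi}"
    using assms by (simp add: mult_ac)
  then have "((\<lambda>t. - \<i> * (\<i> * H (w + of_real r * cis t))) has_integral - \<i> * (2 * of_real pi * \<i> * H w)) {0..2 * pi}"
    by (rule has_integral_mult_right)
  moreover have e: "- \<i> * (2 * of_real pi * \<i> * H w) = 2 * pi * H w" by (simp add: complex_eq_iff)
  ultimately show ?thesis unfolding e by simp
qed

lemma polar_nn_integral:
  fixes F :: "complex \<Rightarrow> ennreal"
  assumes F[measurable]: "F \<in> borel_measurable borel" and X[measurable]: "X \<in> sets borel"
    and ab: "a < b" "b \<le> a + 2 * pi"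
  shows "(\<integral>\<^sup>+z. F z * indicator {z. z \<noteq> 0 \<and> ln (cmod z) \<in> X \<and> z / of_real (cmod z) \<in> cis ` {a..b}} z \<partial>lborel)
    = (\<integral>\<^sup>+t. \<integral>\<^sup>+s. F (of_real (exp s) * cis t) * ennreal (exp (2 * s)) * indicator X s * indicator {a..b} t \<partial>lborel \<partial>lborel)"
proof -
  \<comment> \<open>The angle a + 2 pi is dropped so that exp remains injective when the arc is the
    full circle. The point it represents is reached through the angle a instead, and the single
    value of t is a null set in the final comparison.\<close>
  define B where "B = {w. Re w \<in> X \<and> Im w \<in> {a..b} \<inter> {..<a + 2 * pi}}"
  let ?S = "{z. z \<noteq> 0 \<and> ln (cmod z) \<in> X \<and> z / of_real (cmod z) \<in> cis ` {a..b}}"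
  have B[measurable]: "B \<in> sets borel" unfolding B_def by measurable
  have inj: "inj_on exp B"
  proof (rule inj_onI)
    fix w z assume wz: "w \<in> B" "z \<in> B" and eq: "exp w = exp z"
    have "a \<le> Im w" "Im w < a + 2 * pi" "a \<le> Im z" "Im z < a + 2 * pi" using wz by (simp_all add: B_def)
    then have "\<bar>Im w - Im z\<bar> < 2 * pi" by linarith
    then show "w = z" using eq by (rule exp_complex_eqI)
  qed
  have e: "exp w = of_real (exp (Re w)) * cis (Im w)" for w by (simp add: exp_eq_polar)
  have img: "exp ` B = ?S"
  proof (intro set_eqI iffI)
    fix z assume "z \<in> exp ` B"
    then obtain w where w: "w \<in> B" "z = exp w" by auto
    have "z / of_real (cmod z) = cis (Im w)" using w by (simp add: e[of w] norm_mult)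
    then show "z \<in> ?S" using w by (auto simp: B_def)
  next
    fix z assume z: "z \<in> ?S"
    then obtain t where t: "t \<in> {a..b}" "z / of_real (cmod z) = cis t" by auto
    define t' where "t' = (if t < a + 2 * pi then t else t - 2 * pi)"
    have t': "t' \<in> {a..b}" "t' < a + 2 * pi" "cis t' = cis t"
      using t ab by (auto simp: t'_def cis_divide[symmetric])
    have "z = exp (Complex (ln (cmod z)) t')"
      using z t t' by (simp add: e field_simps)
    moreover have "Complex (ln (cmod z)) t' \<in> B" using z t' by (simp add: B_def)
    ultimately show "z \<in> exp ` B" by blast
  qed
  have "compact (cis ` {a..b})" by (intro compact_continuous_image continuous_intros) auto
  then have [measurable]: "cis ` {a..b} \<in> sets borel" by (intro borel_closed compact_imp_closed)
  have S: "?S \<in> sets borel" by measurable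
  have me[measurable]: "(exp :: complex \<Rightarrow> complex) \<in> borel_measurable borel"
    by (intro borel_measurable_continuous_onI continuous_intros)
  have mF: "(\<lambda>w. F (exp w) * (ennreal (exp (2 * Re w)) * indicator B w)) \<in> borel_measurable borel" by measurable
  have "(\<integral>\<^sup>+z. F z * indicator ?S z \<partial>lborel) = (\<integral>\<^sup>+w. F (exp w) * (ennreal (exp (2 * Re w)) * indicator B w) \<partial>lborel)"
    unfolding img[symmetric] by (rule nn_integral_exp_image) (use inj S img in auto)
  also have "\<dots> = (\<integral>\<^sup>+t. \<integral>\<^sup>+s. F (exp (Complex s t)) * (ennreal (exp (2 * s)) * indicator B (Complex s t)) \<partial>lborel \<partial>lborel)"
    using nn_integral_complex_iterated(1)[OF mF] by simp
  also have "\<dots> = (\<integral>\<^sup>+t. \<integral>\<^sup>+s. F (of_real (exp s) * cis t) * ennreal (exp (2 * s)) * indicator X s * indicator {a..b} t \<partial>lborel \<partial>lborel)"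
  proof (rule nn_integral_cong_AE)
    have "AE t in lborel. t \<noteq> a + 2 * pi" by (rule AE_lborel_singleton)
    then show "AE t in lborel. (\<integral>\<^sup>+s. F (exp (Complex s t)) * (ennreal (exp (2 * s)) * indicator B (Complex s t)) \<partial>lborel)
       = (\<integral>\<^sup>+s. F (of_real (exp s) * cis t) * ennreal (exp (2 * s)) * indicator X s * indicator {a..b} t \<partial>lborel)"
    proof eventually_elim
      case (elim t)
      then show ?case using ab
        by (intro nn_integral_cong) (auto simp: B_def e mult_ac split: split_indicator)
    qed
  qed
  finally show ?thesis .
qed

text \<open>The mean value property for H^2 on circles about \<open>w\<close> is integrated over the
  radii from d/4 to d/2. Staying away from the centre keeps the logarithm of the radius bounded; the
  constant drops from pi to 3 pi / 16, which still exceeds 1/2.\<close>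

lemma area_mean_value:
  fixes H :: "complex \<Rightarrow> complex"
  assumes hol: "H holomorphic_on ball w d" and d: "d > 0"
  shows "ennreal (d\<^sup>2 / 2 * (cmod (H w))\<^sup>2) \<le> (\<integral>\<^sup>+z. ennreal ((cmod (H z))\<^sup>2) * indicator (ball w d) z \<partial>lborel)"
proof -
  define h where "h = (\<lambda>z. indicator (ball w d) z *\<^sub>R H z)"
  have mh[measurable]: "h \<in> borel_measurable borel" unfolding h_def
    by (intro borel_measurable_continuous_on_indicator) (use hol holomorphic_on_imp_continuous_on in auto)
  define F where "F = (\<lambda>z. ennreal ((cmod (h (w + z)))\<^sup>2))"
  have mF[measurable]: "F \<in> borel_measurable borel" unfolding F_def by measurable
  have [measurable]: "cis \<in> borel_measurable borel"
    by (intro borel_measurable_continuous_onI continuous_intros)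
  define X where "X = {ln (d/4)..ln (d/2)}"
  have X[measurable]: "X \<in> sets borel" by (simp add: X_def)
  have circ: "ennreal (2 * pi * (cmod (H w))\<^sup>2) \<le> (\<integral>\<^sup>+t. F (of_real (exp s) * cis t) * indicator {0..2 * pi} t \<partial>lborel)" if s: "s \<in> X" for s
  proof -
    define r where "r = exp s"
    have r: "0 < r" "r < d"
    proof -
      have "exp s \<le> exp (ln (d/2))" using s by (simp add: X_def)
      then show "0 < r" "r < d" using d by (auto simp: r_def)
    qed
    \<comment> \<open>The square of H is holomorphic, so its circular mean is exact, and the
      triangle inequality for integrals then gives the sub-mean value property of |H|^2.\<close>
    have hol': "(\<lambda>z. (H z)\<^sup>2) holomorphic_on cball w r"
      using hol r by (intro holomorphic_intros holomorphic_on_subset[OF hol]) auto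
    have in_ball: "w + of_real r * cis t \<in> ball w d" for t using r by (simp add: dist_norm norm_mult)
    have cont: "continuous_on {0..2*pi} (\<lambda>t. H (w + of_real r * cis t))"
      by (rule continuous_on_compose2[OF holomorphic_on_imp_continuous_on[OF hol]]) (use in_ball in \<open>auto intro!: continuous_intros\<close>)
    have i: "((\<lambda>t. (H (w + of_real r * cis t))\<^sup>2) has_integral 2 * pi * (H w)\<^sup>2) {0..2 * pi}"
      by (rule circle_mean_value[OF hol' r(1)])
    have i2: "(\<lambda>t. (cmod (H (w + of_real r * cis t)))\<^sup>2) integrable_on {0..2*pi}"
      by (intro integrable_continuous_interval continuous_intros cont)
    have "cmod (integral {0..2*pi} (\<lambda>t. (H (w + of_real r * cis t))\<^sup>2)) \<le> integral {0..2*pi} (\<lambda>t. (cmod (H (w + of_real r * cis t)))\<^sup>2)"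
      using i by (intro integral_norm_bound_integral i2) (auto simp: norm_power)
    then have "2 * pi * (cmod (H w))\<^sup>2 \<le> integral {0..2*pi} (\<lambda>t. (cmod (H (w + of_real r * cis t)))\<^sup>2)"
      unfolding integral_unique[OF i] by (simp add: norm_mult norm_power)
    then have "ennreal (2 * pi * (cmod (H w))\<^sup>2) \<le> ennreal (integral {0..2*pi} (\<lambda>t. (cmod (H (w + of_real r * cis t)))\<^sup>2))"
      by (rule ennreal_leI)
    also have "\<dots> = (\<integral>\<^sup>+t. ennreal ((cmod (H (w + of_real r * cis t)))\<^sup>2) * indicator {0..2*pi} t \<partial>lborel)"
      by (rule nn_integral_has_integral_lebesgue'[symmetric]) (use i2 in \<open>auto simp: integrable_integral\<close>)
    also have "\<dots> = (\<integral>\<^sup>+t. F (of_real (exp s) * cis t) * indicator {0..2 * pi} t \<partial>lborel)"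
      using in_ball by (intro nn_integral_cong) (simp add: F_def h_def r_def)
    finally show ?thesis .
  qed
  have I: "(\<integral>\<^sup>+s. ennreal (exp (2 * s)) * indicator X s \<partial>lborel) = ennreal (3 * d\<^sup>2 / 32)"
  proof -
    have "((\<lambda>s. exp (2 * s)) has_integral (exp (2 * ln (d/2)) / 2 - exp (2 * ln (d/4)) / 2)) {ln (d/4)..ln (d/2)}"
      using d by (intro fundamental_theorem_of_calculus)
         (auto intro!: derivative_eq_intros simp: has_real_derivative_iff_has_vector_derivative[symmetric])
    moreover have "exp (2 * ln (d/2)) / 2 - exp (2 * ln (d/4)) / 2 = 3 * d\<^sup>2 / 32"
      using d by (simp add: exp_double power2_eq_square field_simps)
    ultimately show ?thesis unfolding X_def by (intro nn_integral_has_integral_lebesgue') auto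
  qed
  have "ennreal (d\<^sup>2 / 2 * (cmod (H w))\<^sup>2) \<le> ennreal (3 * d\<^sup>2 / 32 * (2 * pi * (cmod (H w))\<^sup>2))"
  proof (rule ennreal_leI)
    have "1 / 2 * (d\<^sup>2 * (cmod (H w))\<^sup>2) \<le> 3 * pi / 16 * (d\<^sup>2 * (cmod (H w))\<^sup>2)"
      using pi_gt3 by (intro mult_right_mono) auto
    then show "d\<^sup>2 / 2 * (cmod (H w))\<^sup>2 \<le> 3 * d\<^sup>2 / 32 * (2 * pi * (cmod (H w))\<^sup>2)" by simp
  qed
  also have "\<dots> = (\<integral>\<^sup>+s. (ennreal (exp (2 * s)) * indicator X s) * ennreal (2 * pi * (cmod (H w))\<^sup>2) \<partial>lborel)"
    by (subst nn_integral_multc, simp) (simp only: I, rule ennreal_mult, auto)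
  also have "\<dots> \<le> (\<integral>\<^sup>+s. (ennreal (exp (2 * s)) * indicator X s) * (\<integral>\<^sup>+t. F (of_real (exp s) * cis t) * indicator {0..2 * pi} t \<partial>lborel) \<partial>lborel)"
    using circ by (intro nn_integral_mono) (auto intro!: mult_left_mono split: split_indicator)
  also have "\<dots> = (\<integral>\<^sup>+s. \<integral>\<^sup>+t. F (of_real (exp s) * cis t) * ennreal (exp (2 * s)) * indicator X s * indicator {0..2 * pi} t \<partial>lborel \<partial>lborel)"
    by (intro nn_integral_cong, subst nn_integral_cmult[symmetric]) (auto intro!: nn_integral_cong simp: mult_ac)
  also have "\<dots> = (\<integral>\<^sup>+t. \<integral>\<^sup>+s. F (of_real (exp s) * cis t) * ennreal (exp (2 * s)) * indicator X s * indicator {0..2 * pi} t \<partial>lborel \<partial>lborel)"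
  proof -
    have "(\<lambda>p :: real \<times> real. of_real (exp (fst p)) * cis (snd p) :: complex) \<in> borel_measurable borel"
      by (intro borel_measurable_continuous_onI continuous_intros)
    then have [measurable]: "(\<lambda>p :: real \<times> real. of_real (exp (fst p)) * cis (snd p) :: complex) \<in> borel_measurable (lborel \<Otimes>\<^sub>M lborel)"
      unfolding lborel_prod by simp
    have "(\<lambda>p :: real \<times> real. F (of_real (exp (fst p)) * cis (snd p)) * ennreal (exp (2 * fst p)) * indicator X (fst p) * indicator {0..2 * pi} (snd p)) \<in> borel_measurable (lborel \<Otimes>\<^sub>M lborel)"
      by measurable
    then show ?thesis by (intro lborel_pair.Fubini') (simp add: case_prod_unfold)
  qed
  also have "\<dots> = (\<integral>\<^sup>+z. F z * indicator {z. z \<noteq> 0 \<and> ln (cmod z) \<in> X \<and> z / of_real (cmod z) \<in> cis ` {0..2 * pi}} z \<partial>lborel)"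
    by (rule polar_nn_integral[symmetric]) auto
  also have "\<dots> \<le> (\<integral>\<^sup>+z. F z \<partial>lborel)" by (intro nn_integral_mono) (auto split: split_indicator)
  also have "\<dots> = (\<integral>\<^sup>+z. ennreal ((cmod (h z))\<^sup>2) \<partial>distr lborel borel ((+) w))"
    unfolding F_def by (subst nn_integral_distr) auto
  also have "\<dots> = (\<integral>\<^sup>+z. ennreal ((cmod (h z))\<^sup>2) \<partial>lborel)" by (simp add: lborel_distr_plus)
  also have "\<dots> = (\<integral>\<^sup>+z. ennreal ((cmod (H z))\<^sup>2) * indicator (ball w d) z \<partial>lborel)"
    by (intro nn_integral_cong) (auto simp: h_def split: split_indicator)
  finally show ?thesis .
qed

subsection \<open>Poisson and derivative kernels on horizontal lines\<close>

lemma periodic_integral: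
  fixes f :: "real \<Rightarrow> 'a::euclidean_space"
  assumes cont: "continuous_on UNIV f" and per: "\<And>x. f (x + T) = f x" and T: "T \<ge> 0"
  shows "integral {a..a + T} f = integral {b..b + T} f"
proof -
  have *: "integral {a..a + T} f = integral {b..b + T} f" if ab: "a \<le> b" for a b
  proof -
    have i: "f integrable_on {x..y}" for x y
      using cont by (intro integrable_continuous_interval continuous_on_subset[OF cont]) auto
    have "integral {a..b} f = integral {a + T..b + T} f"
      using integral_shift_Icc_real[of a b f T] by (simp add: o_def per add.commute[of T])
    moreover have "integral {a..a + T} f + integral {a + T..b + T} f = integral {a..b + T} f"
      using ab T i by (intro Henstock_Kurzweil_Integration.integral_combine) auto
    moreover have "integral {a..b} f + integral {b..b + T} f = integral {a..b + T} f"
      using ab T i by (intro Henstock_Kurzweil_Integration.integral_combine) auto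
    ultimately have "integral {a..a + T} f + integral {a + T..b + T} f = integral {b..b + T} f + integral {a + T..b + T} f"
      by (simp add: add.commute)
    then show ?thesis by (rule add_right_imp_eq)
  qed
  show ?thesis
  proof (cases "a \<le> b")
    case True
    then show ?thesis by (rule *)
  next
    case False
    then show ?thesis by (intro *[symmetric]) simp
  qed
qed

text \<open>The Poisson kernel of the disc at radius exp (- \<eta>), without the factor 1 / (2 pi),
  and complex-valued so that it can multiply values of a holomorphic function.\<close>

definition poisson_kernel :: "real \<Rightarrow> real \<Rightarrow> complex" where
  "poisson_kernel \<eta> t = of_real ((1 - (exp (- \<eta>))\<^sup>2) / (cmod (cis t - of_real (exp (- \<eta>))))\<^sup>2)"

text \<open>Cauchy's kernel for x \<phi>'(x) on the unit circle, with x = exp (- \<eta>). The extra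
  factor x makes it represent the derivative in the logarithmic coordinate.\<close>

definition derivative_kernel :: "real \<Rightarrow> real \<Rightarrow> complex" where
  "derivative_kernel \<eta> t = of_real (exp (- \<eta>)) * cis t / (cis t - of_real (exp (- \<eta>)))\<^sup>2"

lemma exp_eq_cis: "exp (Complex s t) = of_real (exp s) * cis t"
  by (simp add: exp_eq_polar)

lemma cis_minus_ne: "\<eta> > 0 \<Longrightarrow> cis t \<noteq> of_real (exp (- \<eta>))"
proof
  assume "\<eta> > 0" "cis t = of_real (exp (- \<eta>))"
  then have "cmod (cis t) = exp (- \<eta>)" by (simp only: norm_of_real abs_exp_cancel)
  then show False using \<open>\<eta> > 0\<close> by simp
qed

lemma continuous_on_kernels [continuous_intros]:
  assumes "\<eta> > 0"
  shows "continuous_on S (poisson_kernel \<eta>)" "continuous_on S (derivative_kernel \<eta>)"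
  unfolding poisson_kernel_def[abs_def] derivative_kernel_def[abs_def]
  by (intro continuous_intros; use cis_minus_ne[OF assms] in simp)+

text \<open>With q = exp (s1 + i \<theta>), the function \<phi> z = g (q z) carries the slice
  \<open>s1\<close> to the unit circle and the point s + i \<theta> to the real point x = exp (s -
  s1). Both formulas are then Cauchy's formula on the unit circle at x, the first for a modified
  function.\<close>

lemma slice_kernel_formulas:
  fixes g G :: "complex \<Rightarrow> complex"
  assumes hol: "g holomorphic_on ball 0 1" and s: "s < s1" "s1 < 0"
  defines "G \<equiv> \<lambda>w. g (exp w)"
  shows poisson_formula: "((\<lambda>t. G (Complex s1 (\<theta> + t)) * poisson_kernel (s1 - s) t) has_integral 2 * pi * G (Complex s \<theta>)) {-pi..pi}"
    and derivative_formula: "((\<lambda>t. G (Complex s1 (\<theta> + t)) * derivative_kernel (s1 - s) t) has_integral 2 * pi * deriv G (Complex s \<theta>)) {-pi..pi}"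
proof -
  define \<eta> where "\<eta> = s1 - s"
  have \<eta>: "\<eta> > 0" using s by (simp add: \<eta>_def)
  define x where "x = exp (- \<eta>)"
  have x: "0 < x" "x < 1" using \<eta> by (auto simp: x_def)
  define q where "q = exp (Complex s1 \<theta>)"
  have q: "cmod q = exp s1" by (simp add: q_def)
  have qx: "q * of_real x = exp (Complex s \<theta>)"
    by (simp add: q_def x_def \<eta>_def exp_eq_cis exp_diff exp_minus field_simps)
  define \<phi> where "\<phi> = (\<lambda>z. g (q * z))"
  have in_ball: "q * z \<in> ball 0 1" if "cmod z \<le> 1" for z
  proof -
    have "cmod (q * z) \<le> exp s1 * 1" unfolding norm_mult q using that by (intro mult_left_mono) auto
    also have "\<dots> < 1" using s by simp
    finally show ?thesis by simp
  qed
  have hol\<phi>: "\<phi> holomorphic_on cball 0 1"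
  proof -
    have "g \<circ> (\<lambda>z. q * z) holomorphic_on cball 0 1"
      by (rule holomorphic_on_compose_gen[OF _ hol]) (use in_ball in \<open>auto intro!: holomorphic_intros\<close>)
    then show ?thesis by (simp add: \<phi>_def o_def)
  qed
  have \<phi>cis: "\<phi> (cis t) = G (Complex s1 (\<theta> + t))" for t
    by (simp add: \<phi>_def G_def q_def exp_eq_cis mult.assoc cis_mult)
  have per: "cis (t + 2 * pi) = cis t" for t by (simp flip: cis_mult)
  have cont\<phi>: "continuous_on UNIV (\<lambda>t. \<phi> (cis t))"
    by (rule continuous_on_compose2[OF holomorphic_on_imp_continuous_on[OF hol\<phi>]]) (auto intro!: continuous_intros)
  have shift: "(f has_integral I) {-pi..pi}" if "(f has_integral I) {0..2 * pi}" "continuous_on UNIV f" "\<And>t. f (t + 2 * pi) = f t" for f :: "real \<Rightarrow> complex" and I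
  proof -
    have "integral {-pi..-pi + 2 * pi} f = integral {0..0 + 2 * pi} f" by (rule periodic_integral[OF that(2,3)]) simp
    moreover have "f integrable_on {-pi..pi}" by (rule integrable_continuous_interval[OF continuous_on_subset[OF that(2)]]) simp
    ultimately show ?thesis using that(1) by (simp add: has_integral_iff)
  qed
  have unit: "(1 - of_real x * cis t) * (cis t - of_real x) = cis t * of_real ((cmod (cis t - of_real x))\<^sup>2)" for t
  proof -
    have "of_real ((cmod (cis t - of_real x))\<^sup>2) = (cis t - of_real x) * cnj (cis t - of_real x)"
      by (rule complex_norm_square)
    moreover have "cis t * cnj (cis t - of_real x) = 1 - of_real x * cis t"
      by (simp add: algebra_simps cis_cnj cis_mult)
    ultimately show ?thesis by (simp add: mult_ac)
  qed
  have ne1: "1 - of_real x * u \<noteq> 0" if "cmod u \<le> 1" for u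
  proof
    assume "1 - of_real x * u = 0"
    then have "cmod (of_real x * u) = 1" by (metis eq_iff_diff_eq_0 norm_one)
    then have "x * cmod u = 1" using x by (simp add: norm_mult)
    moreover have "x * cmod u \<le> x * 1" using x that by (intro mult_left_mono) auto
    ultimately show False using x by simp
  qed
  \<comment> \<open>\<psi> agrees with \<phi> at x, and on the unit circle its extra factor combines
    with the Cauchy kernel to the positive Poisson kernel.\<close>
  define \<psi> where "\<psi> = (\<lambda>u. \<phi> u * of_real (1 - x\<^sup>2) / (1 - of_real x * u))"
  have "\<psi> holomorphic_on cball 0 1" unfolding \<psi>_def using ne1 hol\<phi> by (intro holomorphic_intros) auto
  then have "((\<lambda>u. \<psi> u / (u - of_real x)) has_contour_integral (2 * of_real pi * \<i> * \<psi> (of_real x))) (circlepath 0 1)"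
    using x by (intro Cauchy_integral_circlepath_simple) auto
  then have "((\<lambda>t. \<psi> (cis t) / (cis t - of_real x) * \<i> * cis t) has_integral (2 * of_real pi * \<i> * \<psi> (of_real x))) {0..2 * pi}"
    unfolding circlepath_def by (subst (asm) has_contour_integral_part_circlepath_iff) auto
  moreover have "\<psi> (cis t) / (cis t - of_real x) * \<i> * cis t = \<i> * (\<phi> (cis t) * poisson_kernel \<eta> t)" for t
  proof -
    have ne: "cis t - of_real x \<noteq> 0" using cis_minus_ne[OF \<eta>, of t] by (simp add: x_def)
    have "\<psi> (cis t) / (cis t - of_real x) = \<phi> (cis t) * of_real (1 - x\<^sup>2) / (cis t * of_real ((cmod (cis t - of_real x))\<^sup>2))"
      unfolding \<psi>_def unit[symmetric] by simp
    then have "\<psi> (cis t) / (cis t - of_real x) * \<i> * cis t =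
        \<phi> (cis t) * of_real (1 - x\<^sup>2) / (cis t * of_real ((cmod (cis t - of_real x))\<^sup>2)) * \<i> * cis t" by simp
    also have "\<dots> = \<i> * (\<phi> (cis t) * (of_real (1 - x\<^sup>2) / of_real ((cmod (cis t - of_real x))\<^sup>2)))"
      using ne by simp
    finally show ?thesis by (simp only: poisson_kernel_def x_def[symmetric] of_real_divide)
  qed
  moreover have "\<psi> (of_real x) = \<phi> (of_real x)"
  proof -
    have "x * x < 1 * 1" using x by (intro mult_strict_mono) auto
    then have "1 - x * x \<noteq> 0" by simp
    then have "(of_real (1 - x * x) :: complex) \<noteq> 0" by (simp only: of_real_eq_0_iff) simp
    moreover have "\<psi> (of_real x) = \<phi> (of_real x) * of_real (1 - x * x) / of_real (1 - x * x)"
      by (simp add: \<psi>_def power2_eq_square)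
    ultimately show ?thesis by simp
  qed
  ultimately have "((\<lambda>t. \<i> * (\<phi> (cis t) * poisson_kernel \<eta> t)) has_integral (2 * of_real pi * \<i> * \<phi> (of_real x))) {0..2 * pi}" by simp
  then have "((\<lambda>t. - \<i> * (\<i> * (\<phi> (cis t) * poisson_kernel \<eta> t))) has_integral - \<i> * (2 * of_real pi * \<i> * \<phi> (of_real x))) {0..2 * pi}"
    by (rule has_integral_mult_right)
  moreover have e: "- \<i> * (2 * of_real pi * \<i> * a) = 2 * pi * a" and e': "- \<i> * (\<i> * a) = a" for a :: complex
    by (simp_all add: complex_eq_iff)
  ultimately have "((\<lambda>t. \<phi> (cis t) * poisson_kernel \<eta> t) has_integral 2 * pi * \<phi> (of_real x)) {0..2 * pi}"
    by (simp only: e e')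
  then have "((\<lambda>t. \<phi> (cis t) * poisson_kernel \<eta> t) has_integral 2 * pi * \<phi> (of_real x)) {-pi..pi}"
    by (rule shift) (intro continuous_intros cont\<phi> \<eta>, simp add: per poisson_kernel_def)
  then show "((\<lambda>t. G (Complex s1 (\<theta> + t)) * poisson_kernel (s1 - s) t) has_integral 2 * pi * G (Complex s \<theta>)) {-pi..pi}"
    unfolding \<phi>cis \<eta>_def by (simp add: \<phi>_def qx G_def)
  have "((\<lambda>u. \<phi> u / (u - of_real x) ^ Suc 1) has_contour_integral (2 * pi * \<i> / fact 1 * (deriv ^^ 1) \<phi> (of_real x))) (circlepath 0 1)"
    using hol\<phi> x by (intro Cauchy_has_contour_integral_higher_derivative_circlepath holomorphic_on_imp_continuous_on)
       (auto intro: holomorphic_on_subset)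
  then have "((\<lambda>t. \<phi> (cis t) / (cis t - of_real x) ^ 2 * \<i> * cis t) has_integral (2 * of_real pi * \<i> * deriv \<phi> (of_real x))) {0..2 * pi}"
    unfolding circlepath_def by (subst (asm) has_contour_integral_part_circlepath_iff) (auto simp: power2_eq_square)
  \<comment> \<open>Multiplying by x supplies the numerator of \<open>derivative_kernel\<close> and
    changes \<phi>'(x) into x \<phi>'(x), the derivative of G.\<close>
  from has_integral_mult_right[OF this, of "- \<i> * of_real x"]
  have "((\<lambda>t. \<phi> (cis t) * derivative_kernel \<eta> t) has_integral (- \<i> * (2 * of_real pi * \<i> * (of_real x * deriv \<phi> (of_real x))))) {0..2 * pi}"
    by (simp add: derivative_kernel_def x_def[symmetric] mult_ac divide_inverse)
  then have "((\<lambda>t. \<phi> (cis t) * derivative_kernel \<eta> t) has_integral 2 * pi * (of_real x * deriv \<phi> (of_real x))) {0..2 * pi}"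
    unfolding e .
  then have "((\<lambda>t. \<phi> (cis t) * derivative_kernel \<eta> t) has_integral 2 * pi * (of_real x * deriv \<phi> (of_real x))) {-pi..pi}"
    by (rule shift) (intro continuous_intros cont\<phi> \<eta>, simp add: per derivative_kernel_def)
  moreover have "of_real x * deriv \<phi> (of_real x) = deriv G (Complex s \<theta>)"
  proof -
    have dg: "(g has_field_derivative deriv g (q * of_real x)) (at (q * of_real x))"
      using in_ball[of "of_real x"] x hol by (intro holomorphic_derivI[OF hol open_ball]) auto
    have "(\<phi> has_field_derivative deriv g (q * of_real x) * q) (at (of_real x))"
      unfolding \<phi>_def by (rule DERIV_chain2[where g="\<lambda>z. q * z", OF dg]) (auto intro!: derivative_eq_intros)
    moreover have "(G has_field_derivative deriv g (q * of_real x) * (q * of_real x)) (at (Complex s \<theta>))"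
      unfolding G_def qx by (rule DERIV_chain2[OF dg[unfolded qx] DERIV_exp])
    ultimately show ?thesis using DERIV_imp_deriv by (simp add: DERIV_imp_deriv mult_ac)
  qed
  ultimately show "((\<lambda>t. G (Complex s1 (\<theta> + t)) * derivative_kernel (s1 - s) t) has_integral 2 * pi * deriv G (Complex s \<theta>)) {-pi..pi}"
    unfolding \<phi>cis \<eta>_def by simp
qed

lemma sin_ge_half:
  assumes "0 \<le> y" "y \<le> pi / 2"
  shows "y / 2 \<le> sin y"
proof (cases "y \<le> pi / 3")
  case True
  have "sin 0 - 0 / 2 \<le> sin y - y / 2"
  proof (rule DERIV_nonneg_imp_nondecreasing[OF assms(1)])
    fix x assume x: "0 \<le> x" "x \<le> y"
    have "cos (pi / 3) \<le> cos x" using x True by (intro cos_monotone_0_pi_le) auto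
    then have "0 \<le> cos x - 1 / 2" by (simp add: cos_60)
    moreover have "((\<lambda>x. sin x - x / 2) has_real_derivative cos x - 1 / 2) (at x)"
      by (auto intro!: derivative_eq_intros)
    ultimately show "\<exists>d. ((\<lambda>x. sin x - x / 2) has_real_derivative d) (at x) \<and> 0 \<le> d" by blast
  qed
  then show ?thesis by simp
next
  case False
  have "sin (pi / 3) \<le> sin y" using False assms by (intro sin_monotone_2pi_le) auto
  moreover have "y / 2 \<le> sqrt 3 / 2"
  proof -
    have "pi / 2 \<le> 1.6" using pi_approx by simp
    moreover have "1.6 \<le> sqrt (3::real)" by (rule real_le_rsqrt) (simp add: power2_eq_square)
    ultimately show ?thesis using assms by linarith
  qed
  ultimately show ?thesis by (simp add: sin_60)
qed

text \<open>The squared distance is (1 - x)^2 + 4 x sin^2 (t / 2). As \<eta> \<le> 1, 1 - x is at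
  least \<eta> / 2 and x at least 1/3, which gives \<eta>^2 / 4 + t^2 / 12.\<close>

lemma kernel_denominator:
  assumes \<eta>: "0 < \<eta>" "\<eta> \<le> 1" and t: "\<bar>t\<bar> \<le> pi"
  shows "(\<eta>\<^sup>2 + t\<^sup>2) / 20 \<le> (cmod (cis t - of_real (exp (- \<eta>))))\<^sup>2"
proof -
  define x where "x = exp (- \<eta>)"
  have "(cmod (cis t - of_real x))\<^sup>2 = (cos t - x)\<^sup>2 + (sin t)\<^sup>2" by (simp add: cmod_power2)
  also have "\<dots> = (1 - x)\<^sup>2 + 2 * x * (1 - cos t)"
    using sin_cos_squared_add[of t] by (simp add: power2_eq_square algebra_simps)
  also have "1 - cos t = 2 * (sin (t/2))\<^sup>2"
    using cos_double_sin[of "t/2"] by simp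
  finally have e: "(cmod (cis t - of_real x))\<^sup>2 = (1 - x)\<^sup>2 + 4 * x * (sin (t/2))\<^sup>2" by simp
  have "\<eta> / 2 \<le> 1 - x"
  proof -
    have "1 + \<eta> \<le> exp \<eta>" by (rule exp_ge_add_one_self)
    then have "x \<le> 1 / (1 + \<eta>)" using \<eta> unfolding x_def exp_minus by (simp add: field_simps)
    also have "\<dots> \<le> 1 - \<eta> / 2"
      using \<eta> mult_left_mono[of \<eta> 1 \<eta>] by (simp add: field_simps)
    finally show ?thesis by simp
  qed
  then have 1: "\<eta>\<^sup>2 / 4 \<le> (1 - x)\<^sup>2"
    using power_mono[of "\<eta> / 2" "1 - x" 2] \<eta> by (simp add: power_divide)
  have x3: "1 / 3 \<le> x"
  proof -
    have "exp \<eta> \<le> exp 1" using \<eta> by simp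
    also have "\<dots> \<le> 3" by (rule exp_le)
    finally show ?thesis unfolding x_def exp_minus by (simp add: field_simps)
  qed
  have "\<bar>t\<bar> / 4 \<le> \<bar>sin (t/2)\<bar>"
  proof -
    have "\<bar>t\<bar> / 4 \<le> sin (\<bar>t\<bar> / 2)"
      using sin_ge_half[of "\<bar>t\<bar> / 2"] t by simp
    then show ?thesis by (cases "t \<ge> 0") auto
  qed
  then have "(\<bar>t\<bar> / 4)\<^sup>2 \<le> (sin (t/2))\<^sup>2" using power_mono[of "\<bar>t\<bar> / 4" "\<bar>sin (t/2)\<bar>" 2] by simp
  then have "4 * (1/3) * (t\<^sup>2 / 16) \<le> 4 * x * (sin (t/2))\<^sup>2"
    using x3 by (intro mult_mono) (auto simp: power_divide)
  then have "\<eta>\<^sup>2 / 4 + t\<^sup>2 / 12 \<le> (cmod (cis t - of_real x))\<^sup>2" unfolding e using 1 by linarith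
  moreover have "0 \<le> \<eta>\<^sup>2" "0 \<le> t\<^sup>2" by auto
  ultimately show ?thesis unfolding x_def[symmetric] add_divide_distrib by linarith
qed

lemma kernel_bounds:
  assumes \<eta>: "0 < \<eta>" "\<eta> \<le> 1" and t: "\<bar>t\<bar> \<le> pi"
  shows "cmod (poisson_kernel \<eta> t) \<le> 40 * \<eta> / (\<eta>\<^sup>2 + t\<^sup>2)"
    and "cmod (derivative_kernel \<eta> t) \<le> 20 / (\<eta>\<^sup>2 + t\<^sup>2)"
proof -
  let ?d = "(cmod (cis t - of_real (exp (- \<eta>))))\<^sup>2"
  have d: "(\<eta>\<^sup>2 + t\<^sup>2) / 20 \<le> ?d" by (rule kernel_denominator[OF assms])
  have pos: "0 < \<eta>\<^sup>2 + t\<^sup>2" using \<eta> by (simp add: add_pos_nonneg)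
  have "1 - 2 * \<eta> \<le> exp (- 2 * \<eta>)" using exp_ge_add_one_self[of "- 2 * \<eta>"] by simp
  moreover have "(exp (- \<eta>))\<^sup>2 = exp (- 2 * \<eta>)" by (simp add: power2_eq_square flip: exp_add)
  moreover have "exp (- 2 * \<eta>) \<le> 1" using \<eta> by simp
  ultimately have n: "0 \<le> 1 - (exp (- \<eta>))\<^sup>2" "1 - (exp (- \<eta>))\<^sup>2 \<le> 2 * \<eta>" by auto
  have "cmod (poisson_kernel \<eta> t) = (1 - (exp (- \<eta>))\<^sup>2) / ?d"
    unfolding poisson_kernel_def norm_of_real using n by simp
  also have "\<dots> \<le> (2 * \<eta>) / ((\<eta>\<^sup>2 + t\<^sup>2) / 20)" using n d pos \<eta> by (intro frac_le) auto
  finally show "cmod (poisson_kernel \<eta> t) \<le> 40 * \<eta> / (\<eta>\<^sup>2 + t\<^sup>2)" by simp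
  have "cmod (derivative_kernel \<eta> t) = exp (- \<eta>) / ?d"
    by (simp add: derivative_kernel_def norm_mult norm_divide norm_power)
  also have "\<dots> \<le> 1 / ((\<eta>\<^sup>2 + t\<^sup>2) / 20)" using d pos \<eta> by (intro frac_le) auto
  finally show "cmod (derivative_kernel \<eta> t) \<le> 20 / (\<eta>\<^sup>2 + t\<^sup>2)" by simp
qed

text \<open>On the shell between 2^k \<eta> and 2^(k + 1) \<eta> the kernel is at most 1 / (4^k
  \<eta>^2). Charging the shell to the integral over the whole larger interval gives the summand
  with index k + 1; the 4 is this shift of the index.\<close>

lemma dyadic_kernel_bound:
  fixes f :: "real \<Rightarrow> real"
  assumes cont: "continuous_on UNIV f" and nn: "\<And>t. 0 \<le> f t" and \<eta>: "\<eta> > 0"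
    and W: "\<And>k. k \<le> n \<Longrightarrow> integral {- (2^k * \<eta>)..2^k * \<eta>} f \<le> W k"
  shows "integral {- (2^n * \<eta>)..2^n * \<eta>} (\<lambda>t. f t / (\<eta>\<^sup>2 + t\<^sup>2)) \<le> 4 / \<eta>\<^sup>2 * (\<Sum>k\<le>n. W k / 4 ^ k)"
  using W
proof (induction n)
  case 0
  have pos: "0 < \<eta>\<^sup>2 + t\<^sup>2" for t using \<eta> by (simp add: add_pos_nonneg)
  have c: "continuous_on {-\<eta>..\<eta>} f" by (rule continuous_on_subset[OF cont]) simp
  have "integral {-\<eta>..\<eta>} (\<lambda>t. f t / (\<eta>\<^sup>2 + t\<^sup>2)) \<le> integral {-\<eta>..\<eta>} (\<lambda>t. 1 / \<eta>\<^sup>2 * f t)"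
  proof (intro integral_le integrable_continuous_interval continuous_intros c)
    show "\<forall>t\<in>{-\<eta>..\<eta>}. \<eta>\<^sup>2 + t\<^sup>2 \<noteq> 0" using pos by (metis less_irrefl)
    fix t
    show "f t / (\<eta>\<^sup>2 + t\<^sup>2) \<le> 1 / \<eta>\<^sup>2 * f t" using nn[of t] \<eta> by (simp add: frac_le)
  qed
  also have "\<dots> \<le> 1 / \<eta>\<^sup>2 * W 0" unfolding integral_mult_right using 0[of 0] by (intro mult_left_mono) auto
  also have "\<dots> \<le> 4 / \<eta>\<^sup>2 * W 0"
  proof -
    have "0 \<le> integral {-\<eta>..\<eta>} f" using c nn by (intro integral_nonneg integrable_continuous_interval) auto
    then have "0 \<le> W 0" using 0[of 0] by simp
    then show ?thesis by (intro mult_right_mono) (auto simp: divide_right_mono)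
  qed
  finally show ?case by simp
next
  case (Suc n)
  define A where "A = 2^n * \<eta>"
  have A: "A > 0" "2 ^ Suc n * \<eta> = 2 * A" using \<eta> by (auto simp: A_def)
  let ?h = "\<lambda>t. f t / (\<eta>\<^sup>2 + t\<^sup>2)"
  have pos: "0 < \<eta>\<^sup>2 + t\<^sup>2" for t using \<eta> by (simp add: add_pos_nonneg)
  have cf: "continuous_on S f" for S by (rule continuous_on_subset[OF cont]) simp
  have ch: "continuous_on S ?h" for S
    using pos by (intro continuous_intros cf) (metis less_irrefl)
  have ih: "?h integrable_on {x..y}" for x y by (intro integrable_continuous_interval ch)
  have if': "f integrable_on {x..y}" for x y by (intro integrable_continuous_interval cf)
  have split: "integral {-2*A..2*A} F = integral {-2*A..-A} F + integral {-A..A} F + integral {A..2*A} F"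
    if "\<And>x y. F integrable_on {x..y}" for F :: "real \<Rightarrow> real"
    using A that Henstock_Kurzweil_Integration.integral_combine[of "-2*A" "-A" "2*A" F]
      Henstock_Kurzweil_Integration.integral_combine[of "-A" "A" "2*A" F] by auto
  have piece: "integral {x..y} ?h \<le> 1 / A\<^sup>2 * integral {x..y} f" if "\<And>t. t \<in> {x..y} \<Longrightarrow> A \<le> \<bar>t\<bar>" for x y
  proof -
    have "integral {x..y} ?h \<le> integral {x..y} (\<lambda>t. 1 / A\<^sup>2 * f t)"
    proof (intro integral_le ih integrable_on_mult_right if')
      fix t assume "t \<in> {x..y}"
      then have "A\<^sup>2 \<le> \<bar>t\<bar>\<^sup>2" using that A by (intro power_mono) auto
      then have "A\<^sup>2 \<le> \<eta>\<^sup>2 + t\<^sup>2" by (simp add: add_increasing)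
      then show "?h t \<le> 1 / A\<^sup>2 * f t" using A nn[of t] by (simp add: frac_le)
    qed
    then show ?thesis by simp
  qed
  have nnA: "0 \<le> integral {-A..A} f" using nn by (intro integral_nonneg if') auto
  have "integral {-2*A..2*A} ?h = integral {-2*A..-A} ?h + integral {-A..A} ?h + integral {A..2*A} ?h"
    by (rule split[OF ih])
  also have "\<dots> \<le> 1 / A\<^sup>2 * integral {-2*A..-A} f + integral {-A..A} ?h + 1 / A\<^sup>2 * integral {A..2*A} f"
    using A by (intro add_mono piece order_refl) auto
  also have "\<dots> \<le> 1 / A\<^sup>2 * integral {-2*A..2*A} f + integral {-A..A} ?h"
    unfolding split[OF if'] using nnA by (simp add: distrib_left add_divide_distrib)
  also have "\<dots> \<le> 1 / A\<^sup>2 * W (Suc n) + 4 / \<eta>\<^sup>2 * (\<Sum>k\<le>n. W k / 4 ^ k)"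
  proof (intro add_mono mult_left_mono)
    show "integral {-2*A..2*A} f \<le> W (Suc n)" using Suc.prems[of "Suc n", unfolded A(2)] by simp
    show "integral {-A..A} ?h \<le> 4 / \<eta>\<^sup>2 * (\<Sum>k\<le>n. W k / 4 ^ k)" using Suc.IH Suc.prems by (simp add: A_def)
  qed simp
  also have "1 / A\<^sup>2 * W (Suc n) = 4 / \<eta>\<^sup>2 * (W (Suc n) / 4 ^ Suc n)"
  proof -
    have "A\<^sup>2 = 4 ^ n * \<eta>\<^sup>2" unfolding A_def power_mult_distrib by (simp add: power_even_eq[symmetric] power_mult[symmetric] mult.commute[of n 2] power_mult)
    then show ?thesis by simp
  qed
  finally show ?case unfolding A(2) by (simp add: distrib_left)
qed

lemma disc_lift_holomorphic:
  assumes "g holomorphic_on ball 0 1"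
  shows "(\<lambda>w. g (exp w)) holomorphic_on left_half_plane"
proof -
  have "g \<circ> exp holomorphic_on left_half_plane"
    by (rule holomorphic_on_compose_gen[OF _ assms]) (auto intro!: holomorphic_intros)
  then show ?thesis by (simp add: o_def)
qed

lemma exp_Complex_periodic: "exp (Complex s (t + 2 * pi)) = exp (Complex s t)"
proof -
  have "cis (t + 2 * pi) = cis t" by (simp flip: cis_mult)
  then show ?thesis by (simp only: exp_eq_cis)
qed

subsection \<open>Radial limits of functions in the Hardy space\<close>

text \<open>The weak type estimate by Vitali covering: some of the intervals are disjoint while
  their fivefold enlargements cover E, and an enlargement of length 10 r is shorter than 5 /
  \<alpha> times the mass of its interval. \<open>K\<close> limits how far outside
  \<open>{a..b}\<close> this mass can lie.\<close>

lemma hardy_littlewood_maximal: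
  fixes f :: "real \<Rightarrow> real"
  assumes cont: "continuous_on UNIV f" and nn: "\<And>t. 0 \<le> f t" and \<alpha>: "\<alpha> > 0" and K: "K \<ge> 0" "a \<le> b"
    and E[measurable]: "E \<in> sets lborel" and Eab: "E \<subseteq> {a..b}"
    and r: "\<And>t. t \<in> E \<Longrightarrow> \<exists>r. 0 < r \<and> r \<le> K \<and> 2 * r * \<alpha> < integral {t - r..t + r} f"
  shows "emeasure lborel E \<le> ennreal (5 / \<alpha> * integral {a - K..b + K} f)"
proof -
  obtain \<rho> where \<rho>: "\<And>t. t \<in> E \<Longrightarrow> 0 < \<rho> t \<and> \<rho> t \<le> K \<and> 2 * \<rho> t * \<alpha> < integral {t - \<rho> t..t + \<rho> t} f"
    using r by metis
  have sub: "E \<subseteq> (\<Union>t\<in>E. ball t (\<rho> t))" using \<rho> by force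
  have \<rho>': "0 < \<rho> t \<and> \<rho> t \<le> K" if "t \<in> E" for t using \<rho>[OF that] by simp
  obtain C where C: "countable C" "C \<subseteq> E" "pairwise (\<lambda>i j. disjnt (ball i (\<rho> i)) (ball j (\<rho> j))) C"
      "E \<subseteq> (\<Union>i\<in>C. ball i (5 * \<rho> i))"
    by (rule Vitali_covering_lemma_balls[where S=E and K=E and a="\<lambda>t. t" and r=\<rho> and B=K, OF sub \<rho>']) (assumption, rule that)
  \<comment> \<open>With \<open>f\<close> as a density, disjointness of the chosen intervals becomes
    countable additivity.\<close>
  define \<mu> where "\<mu> = density lborel (\<lambda>t. ennreal (f t))"
  have mf[measurable]: "f \<in> borel_measurable borel" using cont by (rule borel_measurable_continuous_onI)
  have \<mu>Icc: "emeasure \<mu> {x..y} = ennreal (integral {x..y} f)" for x y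
  proof -
    have "(f has_integral integral {x..y} f) {x..y}"
      by (intro integrable_integral integrable_continuous_interval continuous_on_subset[OF cont]) auto
    then show ?thesis unfolding \<mu>_def
      by (subst emeasure_density) (auto intro!: nn_integral_has_integral_lebesgue' nn)
  qed
  have ball_Icc: "ball t x = {t - x<..<t + x}" for t x :: real by (auto simp: dist_real_def)
  have \<mu>ball: "emeasure \<mu> (ball t x) = emeasure \<mu> {t - x..t + x}" for t x
  proof (rule emeasure_eq_AE)
    have "AE y in lborel. y \<noteq> t - x \<and> y \<noteq> t + x" by (intro AE_conjI AE_lborel_singleton)
    then have "AE y in lborel. 0 < ennreal (f y) \<longrightarrow> (y \<in> ball t x) = (y \<in> {t - x..t + x})"
      by eventually_elim (auto simp: ball_Icc)
    then show "AE y in \<mu>. (y \<in> ball t x) = (y \<in> {t - x..t + x})"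
      unfolding \<mu>_def by (subst AE_density) auto
  qed (auto simp: \<mu>_def)
  have ball_small: "emeasure lborel (ball i (5 * \<rho> i)) \<le> ennreal (5 / \<alpha>) * emeasure \<mu> (ball i (\<rho> i))" if i: "i \<in> C" for i
  proof -
    have \<rho>i: "0 < \<rho> i" "2 * \<rho> i * \<alpha> < integral {i - \<rho> i..i + \<rho> i} f" using \<rho> i C by auto
    have "emeasure lborel (ball i (5 * \<rho> i)) = ennreal (10 * \<rho> i)" using \<rho>i by (simp add: ball_Icc)
    also have "\<dots> \<le> ennreal (5 / \<alpha> * integral {i - \<rho> i..i + \<rho> i} f)"
      using \<rho>i \<alpha> by (intro ennreal_leI) (simp add: field_simps)
    also have "\<dots> = ennreal (5 / \<alpha>) * emeasure \<mu> (ball i (\<rho> i))"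
      using \<alpha> \<rho>i unfolding \<mu>ball \<mu>Icc
      by (intro ennreal_mult order_trans[OF _ less_imp_le[OF \<rho>i(2)]]) auto
    finally show ?thesis .
  qed
  \<comment> \<open>The countable family \<open>C\<close> may be finite, so it is indexed by a set
    \<open>N\<close> of naturals, and the sequences \<open>A\<close> and \<open>B\<close> are empty
    off \<open>N\<close>.\<close>
  define N where "N = to_nat_on C ` C"
  define c where "c = from_nat_into C"
  have c: "c n \<in> C" "to_nat_on C (c n) = n" if "n \<in> N" for n
    using that C(1) by (auto simp: N_def c_def)
  have surj: "\<exists>n\<in>N. c n = i" if "i \<in> C" for i
    using that C(1) by (auto simp: N_def c_def)
  define A where "A = (\<lambda>n. if n \<in> N then ball (c n) (\<rho> (c n)) else {})"
  define B where "B = (\<lambda>n. if n \<in> N then ball (c n) (5 * \<rho> (c n)) else {})"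
  have "disjoint_family A"
    unfolding disjoint_family_on_def
  proof (intro ballI impI)
    fix m n :: nat assume mn: "m \<noteq> n"
    show "A m \<inter> A n = {}"
    proof (cases "m \<in> N \<and> n \<in> N")
      case True
      then have "c m \<noteq> c n" using c mn by metis
      then show ?thesis using C(3) c True unfolding pairwise_def A_def disjnt_def by simp
    qed (auto simp: A_def)
  qed
  have UA: "(\<Union>n. A n) \<subseteq> (\<Union>i\<in>C. ball i (\<rho> i))" using c by (auto simp: A_def split: if_splits)
  have "E \<subseteq> (\<Union>n. B n)"
  proof
    fix x assume "x \<in> E"
    then obtain i where i: "i \<in> C" "x \<in> ball i (5 * \<rho> i)" using C(4) by blast
    then obtain n where "n \<in> N" "c n = i" using surj by blast
    then have "x \<in> B n" using i by (simp add: B_def)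
    then show "x \<in> (\<Union>n. B n)" by blast
  qed
  then have "emeasure lborel E \<le> emeasure lborel (\<Union>n. B n)"
    by (intro emeasure_mono) (auto simp: B_def)
  also have "\<dots> \<le> (\<Sum>n. emeasure lborel (B n))"
    by (rule emeasure_subadditive_countably) (auto simp: B_def)
  also have "\<dots> \<le> (\<Sum>n. ennreal (5 / \<alpha>) * emeasure \<mu> (A n))"
    using ball_small c(1) by (intro suminf_le summableI) (auto simp: A_def B_def)
  also have "\<dots> = ennreal (5 / \<alpha>) * (\<Sum>n. emeasure \<mu> (A n))" by (rule ennreal_suminf_cmult)
  also have "(\<Sum>n. emeasure \<mu> (A n)) = emeasure \<mu> (\<Union>n. A n)"
    using \<open>disjoint_family A\<close> by (intro suminf_emeasure) (auto simp: \<mu>_def A_def)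
  also have "\<dots> \<le> emeasure \<mu> {a - K..b + K}"
  proof (rule emeasure_mono)
    show "(\<Union>n. A n) \<subseteq> {a - K..b + K}"
    proof
      fix y assume "y \<in> (\<Union>n. A n)"
      then have "y \<in> (\<Union>i\<in>C. ball i (\<rho> i))" using UA by blast
      then obtain i where i: "i \<in> C" "y \<in> {i - \<rho> i<..<i + \<rho> i}" by (auto simp: ball_Icc)
      have "i \<in> E" using i C by auto
      then have "a \<le> i" "i \<le> b" "\<rho> i \<le> K" using Eab \<rho> by auto
      then show "y \<in> {a - K..b + K}" using i by simp
    qed
  qed (simp add: \<mu>_def)
  finally have "emeasure lborel E \<le> ennreal (5 / \<alpha>) * ennreal (integral {a - K..b + K} f)"
    unfolding \<mu>Icc by (simp add: mult_left_mono)
  also have "\<dots> = ennreal (5 / \<alpha> * integral {a - K..b + K} f)"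
    using \<alpha> by (intro ennreal_mult[symmetric] integral_nonneg nn integrable_continuous_interval continuous_on_subset[OF cont]) auto
  finally show ?thesis .
qed

lemma half_plane_continuous_line:
  assumes "H holomorphic_on left_half_plane" "s < 0"
  shows "continuous_on S (\<lambda>t. H (Complex s t))" "continuous_on S (\<lambda>t. H (Complex s (x + t)))"
  by (rule half_plane_continuous[OF assms(1)]; use assms(2) in \<open>simp add: continuous_on_add continuous_on_const continuous_on_id\<close>)+

text \<open>At distance \<eta> from the slice \<open>s1\<close> the Poisson kernel is dominated by a
  sum of averages over the intervals of radius 2^k \<eta> with weights of order 2^(-k). Hence a
  bound on all averages bounds the value itself.\<close>

lemma poisson_maximal_bound:
  assumes hol: "h holomorphic_on ball 0 1" and s: "s < s1" "s1 < 0" "s1 - s \<le> 1" and \<alpha>: "\<alpha> > 0"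
    and avg: "\<And>r. 0 < r \<Longrightarrow> r \<le> 2 * pi \<Longrightarrow> integral {\<theta> - r..\<theta> + r} (\<lambda>t. cmod (h (exp (Complex s1 t)))) \<le> 2 * r * \<alpha>"
  shows "cmod (h (exp (Complex s \<theta>))) \<le> 108 * \<alpha>"
proof -
  define \<eta> where "\<eta> = s1 - s"
  have \<eta>: "0 < \<eta>" "\<eta> \<le> 1" using s by (auto simp: \<eta>_def)
  note hol' = disc_lift_holomorphic[OF hol]
  define f where "f = (\<lambda>t. cmod (h (exp (Complex s1 (\<theta> + t)))))"
  have cf: "continuous_on S f" for S unfolding f_def by (intro continuous_intros half_plane_continuous_line hol' s)
  have f0: "0 \<le> f t" for t by (simp add: f_def)
  have avg': "integral {-r..r} f \<le> 2 * r * \<alpha>" if "0 < r" "r \<le> 2 * pi" for r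
  proof -
    have "integral {-r..r} f = integral {\<theta> - r..\<theta> + r} (\<lambda>t. cmod (h (exp (Complex s1 t))))"
      using integral_shift_Icc_real[of "-r" r "\<lambda>t. cmod (h (exp (Complex s1 t)))" \<theta>] by (simp add: f_def o_def add.commute)
    then show ?thesis using avg[OF that] by simp
  qed
  have ex: "\<exists>n. pi \<le> 2 ^ n * \<eta>"
  proof -
    obtain n where "pi / \<eta> < 2 ^ n" using real_arch_pow[of 2 "pi / \<eta>"] by auto
    then show ?thesis using \<eta> by (intro exI[of _ n]) (simp add: field_simps)
  qed
  \<comment> \<open>The first dyadic interval that covers a whole period; minimality keeps its
    radius below 2 pi, up to which the averages are controlled.\<close>
  define n where "n = (LEAST n. pi \<le> 2 ^ n * \<eta>)"
  have n1: "pi \<le> 2 ^ n * \<eta>" unfolding n_def using ex by (rule LeastI_ex)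
  have n2: "2 ^ n * \<eta> \<le> 2 * pi"
  proof (cases n)
    case 0
    then show ?thesis using n1 \<eta> pi_gt3 by simp
  next
    case (Suc m)
    then have "\<not> pi \<le> 2 ^ m * \<eta>" unfolding n_def using not_less_Least by (metis lessI)
    then show ?thesis using Suc by simp
  qed
  have W: "integral {- (2^k * \<eta>)..2^k * \<eta>} f \<le> 2 * \<eta> * \<alpha> * 2^k" if "k \<le> n" for k
  proof -
    have "2^k * \<eta> \<le> 2^n * \<eta>" using that \<eta> by (intro mult_right_mono power_increasing) auto
    then have "2^k * \<eta> \<le> 2 * pi" using n2 by (rule order_trans)
    then show ?thesis using avg'[of "2^k * \<eta>"] \<eta> by (simp add: mult_ac)
  qed
  have pos: "0 < \<eta>\<^sup>2 + t\<^sup>2" for t using \<eta> by (simp add: add_pos_nonneg)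
  have cq: "continuous_on S (\<lambda>t. f t / (\<eta>\<^sup>2 + t\<^sup>2))" for S
    by (intro continuous_intros cf) (metis pos less_irrefl)
  have P: "((\<lambda>t. h (exp (Complex s1 (\<theta> + t))) * poisson_kernel \<eta> t) has_integral 2 * pi * h (exp (Complex s \<theta>))) {-pi..pi}"
    unfolding \<eta>_def by (rule poisson_formula[OF hol s(1,2)]) 
  have "2 * pi * cmod (h (exp (Complex s \<theta>))) = cmod (integral {-pi..pi} (\<lambda>t. h (exp (Complex s1 (\<theta> + t))) * poisson_kernel \<eta> t))"
    unfolding integral_unique[OF P] by (simp add: norm_mult)
  also have "\<dots> \<le> integral {-pi..pi} (\<lambda>t. 40 * \<eta> * (f t / (\<eta>\<^sup>2 + t\<^sup>2)))"
  proof (rule integral_norm_bound_integral)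
    show "(\<lambda>t. h (exp (Complex s1 (\<theta> + t))) * poisson_kernel \<eta> t) integrable_on {-pi..pi}" using P by blast
    show "(\<lambda>t. 40 * \<eta> * (f t / (\<eta>\<^sup>2 + t\<^sup>2))) integrable_on {-pi..pi}"
      by (intro integrable_on_mult_right integrable_continuous_interval cq)
    fix t assume t: "t \<in> {-pi..pi}"
    have "cmod (h (exp (Complex s1 (\<theta> + t))) * poisson_kernel \<eta> t) \<le> f t * (40 * \<eta> / (\<eta>\<^sup>2 + t\<^sup>2))"
      unfolding norm_mult f_def using kernel_bounds(1)[OF \<eta>, of t] t by (intro mult_left_mono) auto
    then show "cmod (h (exp (Complex s1 (\<theta> + t))) * poisson_kernel \<eta> t) \<le> 40 * \<eta> * (f t / (\<eta>\<^sup>2 + t\<^sup>2))"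
      by (simp add: mult.commute)
  qed
  also have "\<dots> = 40 * \<eta> * integral {-pi..pi} (\<lambda>t. f t / (\<eta>\<^sup>2 + t\<^sup>2))" by (rule integral_mult_right)
  also have "\<dots> \<le> 40 * \<eta> * integral {- (2^n * \<eta>)..2^n * \<eta>} (\<lambda>t. f t / (\<eta>\<^sup>2 + t\<^sup>2))"
    using n1 f0 pos \<eta> by (intro mult_left_mono integral_subset_le integrable_continuous_interval cq)
       (auto intro!: divide_nonneg_pos)
  also have "\<dots> \<le> 40 * \<eta> * (4 / \<eta>\<^sup>2 * (\<Sum>k\<le>n. 2 * \<eta> * \<alpha> * 2^k / 4 ^ k))"
    using \<eta> by (intro mult_left_mono dyadic_kernel_bound cf f0 W) auto
  also have "(\<Sum>k\<le>n. 2 * \<eta> * \<alpha> * 2^k / 4 ^ k) = 2 * \<eta> * \<alpha> * (\<Sum>k\<le>n. (1/2)^k)"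
  proof -
    have "(2::real)^k / 4^k = (1/2)^k" for k by (simp flip: power_divide)
    then have "2 * \<eta> * \<alpha> * 2^k / 4 ^ k = 2 * \<eta> * \<alpha> * (1/2)^k" for k
      by (simp only: times_divide_eq_right[symmetric])
    then show ?thesis by (simp only: sum_distrib_left)
  qed
  also have "40 * \<eta> * (4 / \<eta>\<^sup>2 * (2 * \<eta> * \<alpha> * (\<Sum>k\<le>n. (1/2)^k))) = 320 * \<alpha> * (\<Sum>k\<le>n. (1/2)^k)"
    using \<eta> by (simp add: power2_eq_square)
  also have "\<dots> \<le> 320 * \<alpha> * 2"
  proof (rule mult_left_mono)
    have "(\<Sum>k\<le>n. (1/2::real)^k) = 2 - (1/2)^n" by (induction n) (auto simp: field_simps)
    then show "(\<Sum>k\<le>n. (1/2::real)^k) \<le> 2" by simp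
  qed (use \<alpha> in simp)
  finally have "2 * pi * cmod (h (exp (Complex s \<theta>))) \<le> 640 * \<alpha>" by simp
  \<comment> \<open>As 2 pi > 6, the constant is 640 / 6, which is below 108.\<close>
  moreover have "6 * cmod (h (exp (Complex s \<theta>))) \<le> 2 * pi * cmod (h (exp (Complex s \<theta>)))"
    using pi_gt3 by (intro mult_right_mono) auto
  ultimately show ?thesis using \<alpha> by linarith
qed

text \<open>Boundary values are not yet available, so a slice \<open>s1\<close> takes their place
  and only points with s < s1 are considered. The sets \<open>E s1\<close> increase to
  \<open>E 0\<close> as \<open>s1\<close> tends to 0, and the bound is uniform.
  \<open>\<kappa> \<le> 1\<close> keeps the distance of two slices in the range of the kernel
  bounds.\<close>

lemma radial_maximal_measure:
  assumes hol: "h holomorphic_on ball 0 1" and \<alpha>: "\<alpha> > 0" and \<kappa>: "0 < \<kappa>" "\<kappa> \<le> 1"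
    and M: "\<And>s. - \<kappa> < s \<Longrightarrow> s < 0 \<Longrightarrow> integral {a - 2 * pi..a + 2 * pi + 2 * pi} (\<lambda>t. cmod (h (exp (Complex s t)))) \<le> M"
  shows "{t \<in> {a..a + 2 * pi}. \<exists>s. - \<kappa> < s \<and> s < 0 \<and> 108 * \<alpha> < cmod (h (exp (Complex s t)))} \<in> sets borel"
    and "emeasure lborel {t \<in> {a..a + 2 * pi}. \<exists>s. - \<kappa> < s \<and> s < 0 \<and> 108 * \<alpha> < cmod (h (exp (Complex s t)))} \<le> ennreal (5 / \<alpha> * M)"
proof -
  note hol' = disc_lift_holomorphic[OF hol]
  define E where "E = (\<lambda>s1. {t \<in> {a..a + 2 * pi}. \<exists>s. - \<kappa> < s \<and> s < s1 \<and> 108 * \<alpha> < cmod (h (exp (Complex s t)))})"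
  have op: "open {t. 108 * \<alpha> < cmod (h (exp (Complex s t)))}" if "s < 0" for s
    using half_plane_continuous_line(1)[OF hol' that, of UNIV]
    by (intro open_Collect_less continuous_intros) auto
  have E_borel[measurable]: "E s1 \<in> sets borel" if "s1 \<le> 0" for s1
  proof -
    have "E s1 = {a..a + 2 * pi} \<inter> (\<Union>s\<in>{-\<kappa><..<s1}. {t. 108 * \<alpha> < cmod (h (exp (Complex s t)))})" by (auto simp: E_def)
    moreover have "open (\<Union>s\<in>{-\<kappa><..<s1}. {t. 108 * \<alpha> < cmod (h (exp (Complex s t)))})"
      using that by (intro open_UN ballI op) auto
    ultimately show ?thesis by auto
  qed
  have E_meas: "emeasure lborel (E s1) \<le> ennreal (5 / \<alpha> * M)" if s1: "- \<kappa> < s1" "s1 < 0" for s1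
  proof -
    have "emeasure lborel (E s1) \<le> ennreal (5 / \<alpha> * integral {a - 2 * pi..a + 2 * pi + 2 * pi} (\<lambda>t. cmod (h (exp (Complex s1 t)))))"
    proof (rule hardy_littlewood_maximal)
      show "continuous_on UNIV (\<lambda>t. cmod (h (exp (Complex s1 t))))"
        by (intro continuous_intros half_plane_continuous_line hol' s1)
      show "E s1 \<in> sets lborel" using E_borel[of s1] s1 by simp
      show "E s1 \<subseteq> {a..a + 2 * pi}" by (auto simp: E_def)
      fix t assume t: "t \<in> E s1"
      then obtain s where s: "- \<kappa> < s" "s < s1" "108 * \<alpha> < cmod (h (exp (Complex s t)))" by (auto simp: E_def)
      show "\<exists>r>0. r \<le> 2 * pi \<and> 2 * r * \<alpha> < integral {t - r..t + r} (\<lambda>t. cmod (h (exp (Complex s1 t))))"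
      proof (rule ccontr)
        assume "\<not> ?thesis"
        then have "cmod (h (exp (Complex s t))) \<le> 108 * \<alpha>"
          using s s1 \<kappa> \<alpha> by (intro poisson_maximal_bound[OF hol, of _ s1]) (auto simp: not_less)
        then show False using s by simp
      qed
    qed (use \<alpha> in auto)
    also have "\<dots> \<le> ennreal (5 / \<alpha> * M)" using M[OF s1] \<alpha> by (intro ennreal_leI mult_left_mono) auto
    finally show ?thesis .
  qed
  \<comment> \<open>The summand 2 keeps \<open>S n\<close> strictly above \<open>- \<kappa>\<close>
    also for n = 0.\<close>
  define S where "S = (\<lambda>n::nat. - \<kappa> / (real n + 2))"
  have S: "- \<kappa> < S n" "S n < 0" for n using \<kappa> by (auto simp: S_def field_simps add_pos_nonneg)
  have E0: "E 0 = (\<Union>n. E (S n))"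
  proof (intro set_eqI iffI)
    fix t assume "t \<in> E 0"
    then obtain s where s: "t \<in> {a..a + 2 * pi}" "- \<kappa> < s" "s < 0" "108 * \<alpha> < cmod (h (exp (Complex s t)))" by (auto simp: E_def)
    obtain n :: nat where "\<kappa> / (- s) < real n" using reals_Archimedean2 by blast
    then have "s < S n" using s \<kappa> by (simp add: S_def field_simps)
    then show "t \<in> (\<Union>n. E (S n))" using s by (auto simp: E_def)
  next
    fix t assume "t \<in> (\<Union>n. E (S n))"
    then obtain n s where "t \<in> {a..a + 2 * pi}" "- \<kappa> < s" "s < S n" "108 * \<alpha> < cmod (h (exp (Complex s t)))" by (auto simp: E_def)
    then show "t \<in> E 0" using S[of n] by (force simp: E_def)
  qed
  have "incseq (\<lambda>n. E (S n))"
  proof (rule incseq_SucI)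
    fix n
    have "S n \<le> S (Suc n)" using \<kappa> by (simp add: S_def field_simps)
    then show "E (S n) \<subseteq> E (S (Suc n))" by (force simp: E_def)
  qed
  then have "emeasure lborel (E 0) = (SUP n. emeasure lborel (E (S n)))"
  proof -
    have "E (S n) \<in> sets lborel" for n using E_borel[of "S n"] S(2)[of n] by simp
    then have "range (\<lambda>n. E (S n)) \<subseteq> sets lborel" by blast
    from SUP_emeasure_incseq[OF this \<open>incseq _\<close>] show ?thesis unfolding E0 by (rule sym)
  qed
  also have "\<dots> \<le> ennreal (5 / \<alpha> * M)" using E_meas S by (intro SUP_least) auto
  finally have "emeasure lborel (E 0) \<le> ennreal (5 / \<alpha> * M)" .
  then show "emeasure lborel {t \<in> {a..a + 2 * pi}. \<exists>s. - \<kappa> < s \<and> s < 0 \<and> 108 * \<alpha> < cmod (h (exp (Complex s t)))} \<le> ennreal (5 / \<alpha> * M)"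
    by (simp add: E_def)
  show "{t \<in> {a..a + 2 * pi}. \<exists>s. - \<kappa> < s \<and> s < 0 \<and> 108 * \<alpha> < cmod (h (exp (Complex s t)))} \<in> sets borel"
    using E_borel[of 0] by (simp add: E_def)
qed

section \<open>Mean-square convergence of slices and existence of radial limits\<close>

definition boundary_value :: "(complex \<Rightarrow> complex) \<Rightarrow> real \<Rightarrow> complex" where
  "boundary_value g t = Lim (at_left 0) (\<lambda>s. g (exp (Complex s t)))"

definition slice_norm :: "(complex \<Rightarrow> complex) \<Rightarrow> real \<Rightarrow> real" where
  "slice_norm g s = integral {0..2 * pi} (\<lambda>t. (cmod (g (exp (Complex s t))))\<^sup>2)"

text \<open>
  Shifting \<open>s\<close> up and \<open>t\<close> down by the same amount does not change the left side: by the
  Cauchy--Riemann equations its derivative is the integral of a derivative in \<open>\<theta>\<close>, which vanishes by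
  periodicity.
\<close>

lemma slice_inner:
  assumes hol: "g holomorphic_on ball 0 1" and s: "s < 0" "t < 0"
  shows "integral {0..2 * pi} (\<lambda>\<theta>. g (exp (Complex s \<theta>)) \<bullet> g (exp (Complex t \<theta>))) = slice_norm g ((s + t) / 2)"
proof -
  define G where "G = (\<lambda>w. g (exp w))"
  have holG: "G holomorphic_on left_half_plane" unfolding G_def by (rule disc_lift_holomorphic[OF hol])
  have holD: "deriv G holomorphic_on left_half_plane" using holG by (rule holomorphic_deriv_left_half_plane)
  have per: "G (Complex x (\<theta> + 2 * pi)) = G (Complex x \<theta>)" for x \<theta>
    unfolding G_def exp_Complex_periodic ..
  define m where "m = (s + t) / 2"
  define h where "h = \<bar>s - t\<bar> / 2"
  have mh: "m + x < 0" "m - x < 0" if "x \<in> {-h..h}" for x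
  proof -
    have x: "x \<le> h" "- h \<le> x" using that by auto
    have "m + h = max s t" by (auto simp: m_def h_def max_def abs_if field_simps)
    then have "m + h < 0" using s by simp
    then show "m + x < 0" "m - x < 0" using x by linarith+
  qed
  define \<Lambda> where "\<Lambda> = (\<lambda>x. integral (cbox 0 (2 * pi)) (\<lambda>\<theta>. G (Complex (m + x) \<theta>) \<bullet> G (Complex (m - x) \<theta>)))"
  let ?d = "\<lambda>x \<theta>. deriv G (Complex (m + x) \<theta>) \<bullet> G (Complex (m - x) \<theta>) - G (Complex (m + x) \<theta>) \<bullet> deriv G (Complex (m - x) \<theta>)"
  have D0: "integral (cbox 0 (2 * pi)) (?d x) = 0" if x: "x \<in> {-h..h}" for x
  proof -
    \<comment> \<open>Rotating one factor by i gives a primitive in \<theta> of the x-derivative of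
      the inner product; its end values agree by periodicity.\<close>
    have "((\<lambda>\<theta>. G (Complex (m + x) \<theta>) \<bullet> (\<i> * G (Complex (m - x) \<theta>))) has_real_derivative ?d x \<theta>) (at \<theta> within {0..2 * pi})" for \<theta>
    proof -
      have 1: "((\<lambda>\<theta>. \<i> * G (Complex (m - x) \<theta>)) has_vector_derivative \<i> * (\<i> * deriv G (Complex (m - x) \<theta>))) (at \<theta> within {0..2 * pi})"
        by (intro has_vector_derivative_mult_right half_plane_deriv_Im[OF holG] mh x)
      have 2: "(\<i> * a) \<bullet> (\<i> * b) = a \<bullet> b" "\<i> * (\<i> * a) = - a" for a b :: complex by (simp_all add: inner_complex_def)
      have "((\<lambda>\<theta>. G (Complex (m + x) \<theta>) \<bullet> (\<i> * G (Complex (m - x) \<theta>))) has_real_derivative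
        (G (Complex (m + x) \<theta>) \<bullet> (\<i> * (\<i> * deriv G (Complex (m - x) \<theta>))) + (\<i> * deriv G (Complex (m + x) \<theta>)) \<bullet> (\<i> * G (Complex (m - x) \<theta>)))) (at \<theta> within {0..2 * pi})"
        by (rule has_real_derivative_inner[OF half_plane_deriv_Im[OF holG mh(1)[OF x]] 1])
      then show ?thesis unfolding 2 by (simp add: inner_minus_right)
    qed
    then have "(?d x has_integral (G (Complex (m + x) (2 * pi)) \<bullet> (\<i> * G (Complex (m - x) (2 * pi)))) - (G (Complex (m + x) 0) \<bullet> (\<i> * G (Complex (m - x) 0)))) {0..2 * pi}"
      by (intro fundamental_theorem_of_calculus) (auto simp: has_real_derivative_iff_has_vector_derivative[symmetric])
    then show ?thesis using per[of _ 0] by (simp add: integral_unique)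
  qed
  have "(\<Lambda> has_field_derivative integral (cbox 0 (2 * pi)) (?d x)) (at x within {-h..h})" if x: "x \<in> {-h..h}" for x
    unfolding \<Lambda>_def
  proof (rule leibniz_rule_field_derivative)
    fix x \<theta> assume x: "x \<in> {-h..h}"
    have p: "((\<lambda>x. m + x) has_vector_derivative (0 + 1)) (at x within {-h..h})"
      and q: "((\<lambda>x. m - x) has_vector_derivative (0 - 1)) (at x within {-h..h})"
      by (intro has_vector_derivative_add has_vector_derivative_diff has_vector_derivative_const has_vector_derivative_id)+
    have a: "((\<lambda>x. G (Complex (m + x) \<theta>)) has_vector_derivative deriv G (Complex (m + x) \<theta>)) (at x within {-h..h})"
      using vector_diff_chain_within[OF p half_plane_deriv_Re[OF holG mh(1)[OF x], of \<theta>]] by (simp add: o_def)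
    have b: "((\<lambda>x. G (Complex (m - x) \<theta>)) has_vector_derivative - deriv G (Complex (m - x) \<theta>)) (at x within {-h..h})"
      using vector_diff_chain_within[OF q half_plane_deriv_Re[OF holG mh(2)[OF x], of \<theta>]] by (simp add: o_def)
    show "((\<lambda>x. G (Complex (m + x) \<theta>) \<bullet> G (Complex (m - x) \<theta>)) has_field_derivative ?d x \<theta>) (at x within {-h..h})"
      using has_real_derivative_inner[OF a b] by (simp add: inner_minus_right algebra_simps)
  next
    fix x assume x: "x \<in> {-h..h}"
    show "(\<lambda>\<theta>. G (Complex (m + x) \<theta>) \<bullet> G (Complex (m - x) \<theta>)) integrable_on cbox 0 (2 * pi)"
      by (intro integrable_continuous continuous_intros half_plane_continuous_line[OF holG] mh[OF x])
  next
    show "continuous_on ({-h..h} \<times> cbox 0 (2 * pi)) (\<lambda>(x, \<theta>). ?d x \<theta>)"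
      unfolding case_prod_unfold
      by (intro continuous_intros half_plane_continuous[OF holG] half_plane_continuous[OF holD]; use mh in auto)
  qed (use x in auto)
  then have "\<exists>c. \<forall>x\<in>{-h..h}. \<Lambda> x = c" using D0 by (intro has_field_derivative_zero_constant) auto
  then have "\<Lambda> ((s - t) / 2) = \<Lambda> 0" by (auto simp: h_def abs_if field_simps)
  moreover have "\<Lambda> ((s - t) / 2) = integral {0..2 * pi} (\<lambda>\<theta>. G (Complex s \<theta>) \<bullet> G (Complex t \<theta>))"
    by (simp add: \<Lambda>_def m_def diff_divide_distrib add_divide_distrib)
  moreover have "\<Lambda> 0 = slice_norm g m" by (simp add: \<Lambda>_def slice_norm_def G_def dot_square_norm)
  ultimately show ?thesis by (simp add: G_def m_def)
qed

text \<open>This takes the place of Parseval's identity: the distance of two slices is expressed by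
  norms of slices alone, so convergence of the norms makes the slices Cauchy.\<close>

lemma slice_distance:
  assumes hol: "g holomorphic_on ball 0 1" and s: "s < 0" "t < 0"
  shows "integral {a..a + 2 * pi} (\<lambda>\<theta>. (cmod (g (exp (Complex s \<theta>)) - g (exp (Complex t \<theta>))))\<^sup>2)
    = slice_norm g s + slice_norm g t - 2 * slice_norm g ((s + t) / 2)"
proof -
  note holG = disc_lift_holomorphic[OF hol]
  let ?G = "\<lambda>s \<theta>. g (exp (Complex s \<theta>))"
  have c: "continuous_on A (?G s)" "continuous_on A (?G t)" for A
    by (intro half_plane_continuous_line(1)[OF holG] s)+
  have "integral {a..a + 2 * pi} (\<lambda>\<theta>. (cmod (?G s \<theta> - ?G t \<theta>))\<^sup>2) = integral {0..0 + 2 * pi} (\<lambda>\<theta>. (cmod (?G s \<theta> - ?G t \<theta>))\<^sup>2)"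
    by (rule periodic_integral) (intro continuous_intros c, simp_all only: exp_Complex_periodic, simp)
  also have "\<dots> = integral {0..2 * pi} (\<lambda>\<theta>. ((cmod (?G s \<theta>))\<^sup>2 + (cmod (?G t \<theta>))\<^sup>2) - 2 * (?G s \<theta> \<bullet> ?G t \<theta>))"
  proof -
    have "(cmod (u - v))\<^sup>2 = ((cmod u)\<^sup>2 + (cmod v)\<^sup>2) - 2 * (u \<bullet> v)" for u v :: complex
      by (simp add: dot_square_norm[symmetric] inner_diff inner_commute)
    then show ?thesis by simp
  qed
  also have "\<dots> = slice_norm g s + slice_norm g t - 2 * integral {0..2 * pi} (\<lambda>\<theta>. ?G s \<theta> \<bullet> ?G t \<theta>)"
    unfolding slice_norm_def
    by (subst integral_diff integral_add, (intro integrable_continuous_interval continuous_intros c)+)+ simp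
  finally show ?thesis unfolding slice_inner[OF hol s] .
qed

text \<open>
  By \<open>slice_distance\<close> the function \<open>slice_norm g\<close> is midpoint convex; as it is bounded on \<open>s < 0\<close>, it
  cannot decrease.
\<close>

lemma slice_norm_mono:
  assumes hol: "g holomorphic_on ball 0 1" and M: "\<forall>s<0. slice_norm g s \<le> M" and st: "s < t" "t < 0"
  shows "slice_norm g s \<le> slice_norm g t"
proof (rule ccontr)
  assume "\<not> ?thesis"
  then have gt: "slice_norm g t < slice_norm g s" by simp
  \<comment> \<open>An arithmetic progression leading away from the boundary, with x 0 = t and x 1 =
    s. By midpoint convexity the increments of the norm along it do not decrease, so a positive
    first increment forces linear growth past \<open>M\<close>.\<close>
  define x where "x = (\<lambda>k::nat. t - real k * (t - s))"
  have x: "x k < 0" for k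
  proof -
    have "0 \<le> real k * (t - s)" using st by simp
    then show ?thesis using st unfolding x_def by linarith
  qed
  let ?d = "slice_norm g s - slice_norm g t"
  have step: "?d \<le> slice_norm g (x (Suc k)) - slice_norm g (x k)" for k
  proof (induction k)
    case 0
    then show ?case by (simp add: x_def)
  next
    case (Suc k)
    have "(x (Suc (Suc k)) + x k) / 2 = x (Suc k)" by (simp add: x_def field_simps)
    then have "slice_norm g (x (Suc (Suc k))) + slice_norm g (x k) - 2 * slice_norm g (x (Suc k)) \<ge> 0"
      using slice_distance[OF hol x[of "Suc (Suc k)"] x[of k], of 0] disc_lift_holomorphic[OF hol] x
      by (metis (no_types, lifting) integral_nonneg not_integrable_integral order_refl zero_le_power2)
    then show ?case using Suc by linarith
  qed
  have lin: "slice_norm g t + real k * ?d \<le> slice_norm g (x k)" for k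
  proof (induction k)
    case 0
    then show ?case by (simp add: x_def)
  next
    case (Suc k)
    then show ?case using step[of k] by (simp add: algebra_simps)
  qed
  obtain k :: nat where "(M - slice_norm g t) / ?d < real k" using reals_Archimedean2 by blast
  then have "M < slice_norm g t + real k * ?d" using gt by (simp add: field_simps)
  then show False using lin[of k] M[rule_format, OF x, of k] by linarith
qed

text \<open>The norms increase to their supremum S. Once they exceed S - \<epsilon> / 2, also at the
  midpoint, the formula for the distance gives at most 2 S - 2 (S - \<epsilon> / 2) =
  \<epsilon>.\<close>

lemma slice_cauchy:
  assumes hol: "g holomorphic_on ball 0 1" and M: "\<forall>s<0. slice_norm g s \<le> M" and \<epsilon>: "\<epsilon> > 0"
  obtains s0 where "s0 < 0" "\<And>s t a. s0 \<le> s \<Longrightarrow> s < 0 \<Longrightarrow> s0 \<le> t \<Longrightarrow> t < 0 \<Longrightarrow>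
     integral {a..a + 2 * pi} (\<lambda>\<theta>. (cmod (g (exp (Complex s \<theta>)) - g (exp (Complex t \<theta>))))\<^sup>2) \<le> \<epsilon>"
proof -
  define S where "S = Sup (slice_norm g ` {..<0})"
  have bdd: "bdd_above (slice_norm g ` {..<0})" using M by (intro bdd_aboveI[of _ M]) auto
  have le: "slice_norm g s \<le> S" if "s < 0" for s unfolding S_def using that by (intro cSup_upper bdd) auto
  have "\<exists>y\<in>slice_norm g ` {..<0}. S - \<epsilon> / 2 < y"
    unfolding S_def using \<epsilon> by (intro less_cSupD) (auto intro!: exI[of _ "-1"])
  then obtain s0 where s0: "s0 < 0" "S - \<epsilon> / 2 < slice_norm g s0" by auto
  have ge: "S - \<epsilon> / 2 < slice_norm g s" if "s0 \<le> s" "s < 0" for s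
    using slice_norm_mono[OF hol M, of s0 s] that s0 by (cases "s0 = s") auto
  show thesis
  proof (rule that[OF s0(1)])
    fix s t a assume st: "s0 \<le> s" "s < 0" "s0 \<le> t" "t < 0"
    have "S - \<epsilon> / 2 < slice_norm g ((s + t) / 2)" using st by (intro ge) auto
    then show "integral {a..a + 2 * pi} (\<lambda>\<theta>. (cmod (g (exp (Complex s \<theta>)) - g (exp (Complex t \<theta>))))\<^sup>2) \<le> \<epsilon>"
      unfolding slice_distance[OF hol st(2,4)] using le[OF st(2)] le[OF st(4)] by simp
  qed
qed

lemma tendsto_at_left_0_Cauchy:
  fixes F :: "real \<Rightarrow> complex"
  assumes "\<And>e. e > 0 \<Longrightarrow> \<exists>\<kappa>>0. \<forall>s s'. - \<kappa> < s \<and> s < 0 \<and> - \<kappa> < s' \<and> s' < 0 \<longrightarrow> cmod (F s - F s') \<le> e"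
  shows "\<exists>l. (F \<longlongrightarrow> l) (at_left 0)"
proof -
  define X where "X = (\<lambda>n::nat. F (- 1 / (real n + 1)))"
  have ev: "\<exists>N. \<forall>n\<ge>N. - \<kappa> < - 1 / (real n + 1)" if \<kappa>: "\<kappa> > 0" for \<kappa>
  proof -
    obtain N :: nat where N: "1 / \<kappa> < real N" using reals_Archimedean2 by blast
    have "- \<kappa> < - 1 / (real n + 1)" if "n \<ge> N" for n
    proof -
      have "1 / \<kappa> < real n + 1" using N that by linarith
      then show ?thesis using \<kappa> by (simp add: field_simps)
    qed
    then show ?thesis by blast
  qed
  have "Cauchy X"
  proof (rule metric_CauchyI)
    fix e :: real assume "e > 0"
    then obtain \<kappa> where \<kappa>: "\<kappa> > 0" "\<forall>s s'. - \<kappa> < s \<and> s < 0 \<and> - \<kappa> < s' \<and> s' < 0 \<longrightarrow> cmod (F s - F s') \<le> e / 2"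
      using assms[of "e/2"] by auto
    obtain N where N: "\<forall>n\<ge>N. - \<kappa> < - 1 / (real n + 1)" using ev[OF \<kappa>(1)] by blast
    have "dist (X m) (X n) < e" if "m \<ge> N" "n \<ge> N" for m n
    proof -
      have "cmod (X m - X n) \<le> e / 2" unfolding X_def using N that \<kappa>(2) by (auto simp: divide_less_0_iff)
      then show ?thesis using \<open>e > 0\<close> by (simp add: dist_norm)
    qed
    then show "\<exists>M. \<forall>m\<ge>M. \<forall>n\<ge>M. dist (X m) (X n) < e" by blast
  qed
  then obtain l where l: "X \<longlonglongrightarrow> l" using Cauchy_convergent_iff convergent_def by blast
  have "(F \<longlongrightarrow> l) (at_left 0)"
  proof (rule tendstoI)
    fix e :: real assume "e > 0"
    then obtain \<kappa> where \<kappa>: "\<kappa> > 0" "\<forall>s s'. - \<kappa> < s \<and> s < 0 \<and> - \<kappa> < s' \<and> s' < 0 \<longrightarrow> cmod (F s - F s') \<le> e / 2"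
      using assms[of "e/2"] by auto
    obtain N where N: "\<forall>n\<ge>N. - \<kappa> < - 1 / (real n + 1)" using ev[OF \<kappa>(1)] by blast
    have "dist (F s) l < e" if s: "- \<kappa> < s" "s < 0" for s
    proof -
      have "(\<lambda>n. cmod (F s - X n)) \<longlonglongrightarrow> cmod (F s - l)" by (intro tendsto_intros l)
      moreover have "\<forall>\<^sub>F n in sequentially. cmod (F s - X n) \<le> e / 2"
        unfolding X_def using N s \<kappa>(2) by (intro eventually_sequentiallyI[of N]) (auto simp: divide_less_0_iff)
      ultimately have "cmod (F s - l) \<le> e / 2" by (intro tendsto_upperbound) auto
      then show ?thesis using \<open>e > 0\<close> by (simp add: dist_norm)
    qed
    then show "\<forall>\<^sub>F s in at_left 0. dist (F s) l < e"
      using \<kappa>(1) by (intro eventually_at_leftI[of "- \<kappa>"]) auto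
  qed
  then show ?thesis ..
qed

text \<open>
  The radial oscillation of \<open>g\<close> is at most that of \<open>H w = G w - G (w - d)\<close> plus that of a function
  continuous up to the line \<open>s = 0\<close>; the slices of \<open>H\<close> are small in mean square, and the maximal
  inequality applies.
\<close>

lemma radial_limit_exists_AE:
  assumes hol: "g holomorphic_on ball 0 1" and M: "\<forall>s<0. slice_norm g s \<le> M"
  shows "AE t in lborel. t \<in> {a..a + 2 * pi} \<longrightarrow> ((\<lambda>s. g (exp (Complex s t))) \<longlongrightarrow> boundary_value g t) (at_left 0)"
proof -
  let ?G = "\<lambda>s t. g (exp (Complex s t))"
  note holG = disc_lift_holomorphic[OF hol]
  define Bd where "Bd = (\<lambda>e. {t \<in> {a..a + 2 * pi}. \<forall>\<kappa>>0. \<exists>s s'. - \<kappa> < s \<and> s < 0 \<and> - \<kappa> < s' \<and> s' < 0 \<and> e < cmod (?G s t - ?G s' t)})"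
  have neg: "negligible (Bd e)" if e: "e > 0" for e
  proof (rule negligible_outer_le[THEN iffD2], intro allI impI)
    fix e' :: real assume e': "e' > 0"
    \<comment> \<open>108 \<alpha> = e / 4 is the allowance for each of the two values of H; two
      errors of e / 8 from the inner line bring the total to 3 e / 4. The next constant is chosen so
      that the maximal inequality yields exactly \<open>e'\<close>.\<close>
    define \<alpha> where "\<alpha> = e / 432"
    have \<alpha>: "\<alpha> > 0" using e by (simp add: \<alpha>_def)
    define \<epsilon> where "\<epsilon> = e' * \<alpha> / 60"
    have \<epsilon>: "\<epsilon> > 0" using e' \<alpha> by (simp add: \<epsilon>_def)
    obtain s0 where s0: "s0 < 0" "\<And>s t a. s0 \<le> s \<Longrightarrow> s < 0 \<Longrightarrow> s0 \<le> t \<Longrightarrow> t < 0 \<Longrightarrow>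
     integral {a..a + 2 * pi} (\<lambda>\<theta>. (cmod (?G s \<theta> - ?G t \<theta>))\<^sup>2) \<le> \<epsilon>\<^sup>2"
      by (rule slice_cauchy[OF hol M zero_less_power[OF \<epsilon>, of 2]]) blast
    \<comment> \<open>Shift and range are at most half of -s0, so both s and s - \<delta> stay where
      the slices are close to each other.\<close>
    define \<kappa> where "\<kappa> = min 1 (- s0 / 2)"
    define \<delta> where "\<delta> = - s0 / 2"
    have \<kappa>: "0 < \<kappa>" "\<kappa> \<le> 1" "\<kappa> \<le> \<delta>" and \<delta>: "\<delta> > 0" using s0 by (auto simp: \<kappa>_def \<delta>_def)
    define h where "h = (\<lambda>z. g z - g (of_real (exp (- \<delta>)) * z))"
    have holh: "h holomorphic_on ball 0 1"
    proof -
      have "g \<circ> (\<lambda>z. of_real (exp (- \<delta>)) * z) holomorphic_on ball 0 1"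
      proof (rule holomorphic_on_compose_gen[OF _ hol])
        show "(\<lambda>z :: complex. of_real (exp (- \<delta>)) * z) ` ball 0 1 \<subseteq> ball 0 1"
        proof
          fix y assume "y \<in> (\<lambda>z :: complex. of_real (exp (- \<delta>)) * z) ` ball 0 1"
          then obtain z where z: "y = of_real (exp (- \<delta>)) * z" "cmod z < 1" by auto
          have "cmod y \<le> 1 * cmod z" unfolding z(1) norm_mult using \<delta> by (intro mult_right_mono) auto
          then show "y \<in> ball 0 1" using z by simp
        qed
      qed (intro holomorphic_intros)
      then show ?thesis unfolding h_def o_def by (intro holomorphic_intros hol)
    qed
    have h_eq: "h (exp (Complex s t)) = ?G s t - ?G (s - \<delta>) t" for s t
      by (simp add: h_def exp_eq_cis exp_diff exp_minus field_simps)
    \<comment> \<open>Three periods, because the maximal inequality on one period uses intervals of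
      radius up to 2 pi around its points. Each period contributes at most (pi + 1/2) \<epsilon>, by
      Cauchy-Schwarz in arithmetic-geometric mean form.\<close>
    have Mh: "integral {a - 2 * pi..a + 2 * pi + 2 * pi} (\<lambda>t. cmod (h (exp (Complex s t)))) \<le> 12 * \<epsilon>" if s: "- \<kappa> < s" "s < 0" for s
    proof -
      have ss: "s0 \<le> s" "s0 \<le> s - \<delta>" "s - \<delta> < 0" using s \<kappa> \<delta> by (auto simp: \<delta>_def)
      have ch: "continuous_on A (\<lambda>t. h (exp (Complex s t)))" for A
        by (intro half_plane_continuous_line(1)[OF disc_lift_holomorphic[OF holh]] s)
      have ih: "(\<lambda>t. cmod (h (exp (Complex s t)))) integrable_on {x..y}" for x y
        by (intro integrable_continuous_interval continuous_intros ch)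
      have one: "integral {x..x + 2 * pi} (\<lambda>t. cmod (h (exp (Complex s t)))) \<le> 4 * \<epsilon>" for x
      proof -
        have "integral {x..x + 2 * pi} (\<lambda>t. cmod (h (exp (Complex s t)))) \<le> integral {x..x + 2 * pi} (\<lambda>t. \<epsilon> / 2 + 1 / (2 * \<epsilon>) * (cmod (h (exp (Complex s t))))\<^sup>2)"
        proof (intro integral_le ih integrable_continuous_interval continuous_intros ch)
          fix t
          show "cmod (h (exp (Complex s t))) \<le> \<epsilon> / 2 + 1 / (2 * \<epsilon>) * (cmod (h (exp (Complex s t))))\<^sup>2"
            using sum_squares_bound[of \<epsilon> "cmod (h (exp (Complex s t)))"] \<epsilon> by (simp add: field_simps power2_eq_square)
        qed
        also have "\<dots> = pi * \<epsilon> + 1 / (2 * \<epsilon>) * integral {x..x + 2 * pi} (\<lambda>t. (cmod (h (exp (Complex s t))))\<^sup>2)"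
          by (subst integral_add, (intro integrable_continuous_interval continuous_intros ch)+) simp
        also have "\<dots> \<le> pi * \<epsilon> + 1 / (2 * \<epsilon>) * \<epsilon>\<^sup>2"
          unfolding h_eq using s0(2)[OF ss(1) s(2) ss(2,3)] \<epsilon> by (intro add_left_mono mult_left_mono) auto
        also have "\<dots> = (pi + 1/2) * \<epsilon>" using \<epsilon> by (simp add: power2_eq_square field_simps)
        also have "\<dots> \<le> 4 * \<epsilon>" using \<epsilon> pi_approx by (intro mult_right_mono) auto
        finally show ?thesis .
      qed
      have "integral {a - 2 * pi..a + 2 * pi + 2 * pi} (\<lambda>t. cmod (h (exp (Complex s t)))) =
         integral {a - 2 * pi..a - 2 * pi + 2 * pi} (\<lambda>t. cmod (h (exp (Complex s t)))) +
         (integral {a..a + 2 * pi} (\<lambda>t. cmod (h (exp (Complex s t)))) + integral {a + 2 * pi..a + 2 * pi + 2 * pi} (\<lambda>t. cmod (h (exp (Complex s t)))))"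
        using ih by (simp add: Henstock_Kurzweil_Integration.integral_combine)
      also have "\<dots> \<le> 4 * \<epsilon> + (4 * \<epsilon> + 4 * \<epsilon>)" by (intro add_mono one)
      finally show ?thesis by simp
    qed
    define E where "E = {t \<in> {a..a + 2 * pi}. \<exists>s. - \<kappa> < s \<and> s < 0 \<and> 108 * \<alpha> < cmod (h (exp (Complex s t)))}"
    have E: "E \<in> sets borel" "emeasure lborel E \<le> ennreal (5 / \<alpha> * (12 * \<epsilon>))"
      unfolding E_def using radial_maximal_measure[OF holh \<alpha> \<kappa>(1,2) Mh] by blast+
    have Ee: "5 / \<alpha> * (12 * \<epsilon>) = e'" using \<alpha> by (simp add: \<epsilon>_def)
    have "Bd e \<subseteq> E"
    proof
      fix t assume t: "t \<in> Bd e"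
      show "t \<in> E"
      proof (rule ccontr)
        assume "t \<notin> E"
        have tI: "t \<in> {a..a + 2 * pi}" using t by (simp add: Bd_def)
        have small: "cmod (?G s t - ?G (s - \<delta>) t) \<le> e / 4" if "- \<kappa> < s" "s < 0" for s
        proof -
          have "\<not> 108 * \<alpha> < cmod (h (exp (Complex s t)))"
            using \<open>t \<notin> E\<close> tI that unfolding E_def by blast
          then show ?thesis unfolding h_eq \<alpha>_def by simp
        qed
        have "continuous_on {- 2 * \<delta>..- \<delta> / 2} (\<lambda>s. ?G s t)"
          using \<delta> by (intro half_plane_continuous[OF holG] continuous_intros) auto
        then have "isCont (\<lambda>s. ?G s t) (- \<delta>)"
          using \<delta> by (intro continuous_on_interior) auto
        then obtain d where d: "d > 0" "\<And>x. \<bar>x - - \<delta>\<bar> < d \<Longrightarrow> cmod (?G x t - ?G (- \<delta>) t) < e / 8"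
          using e unfolding continuous_at_eps_delta dist_norm real_norm_def by (metis divide_pos_pos zero_less_numeral)
        define k where "k = min \<kappa> d"
        obtain s s' where ss: "- k < s" "s < 0" "- k < s'" "s' < 0" "e < cmod (?G s t - ?G s' t)"
          using t \<kappa> d unfolding Bd_def k_def by (auto dest!: spec[of _ "min \<kappa> d"])
        have "cmod (?G s t - ?G s' t) \<le> cmod (?G s t - ?G (s - \<delta>) t) + cmod (?G (s - \<delta>) t - ?G (- \<delta>) t)
          + cmod (?G (s' - \<delta>) t - ?G (- \<delta>) t) + cmod (?G s' t - ?G (s' - \<delta>) t)"
        proof -
          have "cmod (A - F) \<le> cmod (A - B) + cmod (B - C) + cmod (D - C) + cmod (F - D)" for A B C D F
            using norm_triangle_ineq4[of "(A - B) + (B - C) - (D - C)" "F - D"]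
              norm_triangle_ineq4[of "(A - B) + (B - C)" "D - C"] norm_triangle_ineq[of "A - B" "B - C"] by simp
          then show ?thesis .
        qed
        also have "\<dots> \<le> e / 4 + e / 8 + e / 8 + e / 4"
          using ss by (intro add_mono small less_imp_le[OF d(2)]) (auto simp: k_def)
        finally show False using ss e by simp
      qed
    qed
    moreover have "E \<in> lmeasurable"
      using E by (intro fmeasurableI) (auto simp: le_less_trans[OF _ ennreal_less_top])
    moreover have "measure lebesgue E \<le> e'"
    proof -
      have "emeasure lebesgue E \<le> ennreal e'" using E Ee by simp
      then show ?thesis using e' by (simp add: measure_def enn2real_leI)
    qed
    ultimately show "\<exists>T. Bd e \<subseteq> T \<and> T \<in> lmeasurable \<and> measure lebesgue T \<le> e'" by blast
  qed
  have "negligible (\<Union>n::nat. Bd (1 / (real n + 1)))" by (intro negligible_Union_nat neg) auto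
  then have "AE t in lebesgue. t \<notin> (\<Union>n::nat. Bd (1 / (real n + 1)))"
    by (intro AE_not_in) (simp add: negligible_iff_null_sets)
  then have "AE t in lborel. t \<notin> (\<Union>n::nat. Bd (1 / (real n + 1)))"
    by (simp only: AE_completion_iff)
  then show ?thesis
  proof eventually_elim
    case (elim t)
    show ?case
    proof
      assume t: "t \<in> {a..a + 2 * pi}"
      have "\<exists>l. ((\<lambda>s. ?G s t) \<longlongrightarrow> l) (at_left 0)"
      proof (rule tendsto_at_left_0_Cauchy)
        fix e :: real assume "e > 0"
        then obtain n :: nat where n: "1 / (real n + 1) < e"
          using reals_Archimedean[of e] by (auto simp: inverse_eq_divide add.commute)
        have "t \<notin> Bd (1 / (real n + 1))" using elim by blast
        then obtain \<kappa> where \<kappa>: "\<kappa> > 0" "\<not> (\<exists>s s'. - \<kappa> < s \<and> s < 0 \<and> - \<kappa> < s' \<and> s' < 0 \<and> 1 / (real n + 1) < cmod (?G s t - ?G s' t))"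
          using t unfolding Bd_def by blast
        show "\<exists>\<kappa>>0. \<forall>s s'. - \<kappa> < s \<and> s < 0 \<and> - \<kappa> < s' \<and> s' < 0 \<longrightarrow> cmod (?G s t - ?G s' t) \<le> e"
        proof (intro exI[of _ \<kappa>] conjI allI impI \<kappa>(1))
          fix s s' assume "- \<kappa> < s \<and> s < 0 \<and> - \<kappa> < s' \<and> s' < 0"
          then have "\<not> 1 / (real n + 1) < cmod (?G s t - ?G s' t)" using \<kappa>(2) by blast
          then show "cmod (?G s t - ?G s' t) \<le> e" using n by linarith
        qed
      qed
      then obtain l where l: "((\<lambda>s. ?G s t) \<longlongrightarrow> l) (at_left 0)" by blast
      have "boundary_value g t = l" unfolding boundary_value_def by (rule tendsto_Lim[OF _ l]) simp
      then show "((\<lambda>s. ?G s t) \<longlongrightarrow> boundary_value g t) (at_left 0)" using l by simp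
    qed
  qed
qed

text \<open>The comparison function \<open>u\<close> is a constant when oscillation is carried to
  the circle, and a slice of g when the distance of that slice from the boundary values is
  estimated.\<close>

lemma boundary_value_fatou:
  assumes hol: "g holomorphic_on ball 0 1" and M: "\<forall>s<0. slice_norm g s \<le> M"
    and xy: "{x..y} \<subseteq> {a..a + 2 * pi}" and u: "continuous_on UNIV u"
    and K: "s0 < 0" "\<And>s. s0 \<le> s \<Longrightarrow> s < 0 \<Longrightarrow> integral {x..y} (\<lambda>t. (cmod (g (exp (Complex s t)) - u t))\<^sup>2) \<le> K"
  shows "(\<integral>\<^sup>+t. ennreal ((cmod (boundary_value g t - u t))\<^sup>2) * indicator {x..y} t \<partial>lborel) \<le> ennreal K"
proof -
  let ?G = "\<lambda>s t. g (exp (Complex s t))"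
  define S where "S = (\<lambda>n::nat. s0 / (real n + 1))"
  have S: "s0 \<le> S n" "S n < 0" for n
    using K(1) by (auto simp: S_def divide_less_0_iff field_simps mult_nonpos_nonneg)
  have S0: "filterlim S (at_left 0) sequentially"
    unfolding filterlim_at
  proof
    show "S \<longlonglongrightarrow> 0" unfolding S_def by real_asymp
    show "\<forall>\<^sub>F n in sequentially. S n \<in> {..<0} \<and> S n \<noteq> 0" using S(2) by (intro always_eventually) (auto simp: less_imp_neq)
  qed
  have c: "continuous_on A (\<lambda>t. (cmod (?G s t - u t))\<^sup>2)" if "s < 0" for s A
    by (intro continuous_intros half_plane_continuous_line(1)[OF disc_lift_holomorphic[OF hol] that] continuous_on_subset[OF u]) auto
  have m[measurable]: "(\<lambda>t. ennreal ((cmod (?G (S n) t - u t))\<^sup>2) * indicator {x..y} t) \<in> borel_measurable lborel" for n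
    using borel_measurable_continuous_onI[OF c[OF S(2)]] by simp
  have "(\<integral>\<^sup>+t. ennreal ((cmod (boundary_value g t - u t))\<^sup>2) * indicator {x..y} t \<partial>lborel)
    = (\<integral>\<^sup>+t. liminf (\<lambda>n. ennreal ((cmod (?G (S n) t - u t))\<^sup>2) * indicator {x..y} t) \<partial>lborel)"
  proof (rule nn_integral_cong_AE)
    show "AE t in lborel. ennreal ((cmod (boundary_value g t - u t))\<^sup>2) * indicator {x..y} t = liminf (\<lambda>n. ennreal ((cmod (?G (S n) t - u t))\<^sup>2) * indicator {x..y} t)"
      using radial_limit_exists_AE[OF hol M, of a]
    proof eventually_elim
      case (elim t)
      show ?case
      proof (cases "t \<in> {x..y}")
        case True
        then have "((\<lambda>s. ?G s t) \<longlongrightarrow> boundary_value g t) (at_left 0)" using elim xy by blast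
        then have "(\<lambda>n. ?G (S n) t) \<longlonglongrightarrow> boundary_value g t" using S0 by (rule filterlim_compose)
        then have "(\<lambda>n. ennreal ((cmod (?G (S n) t - u t))\<^sup>2)) \<longlonglongrightarrow> ennreal ((cmod (boundary_value g t - u t))\<^sup>2)"
          by (intro tendsto_ennrealI tendsto_intros)
        then have "liminf (\<lambda>n. ennreal ((cmod (?G (S n) t - u t))\<^sup>2)) = ennreal ((cmod (boundary_value g t - u t))\<^sup>2)"
          by (intro lim_imp_Liminf) auto
        then show ?thesis using True by simp
      qed (simp add: Liminf_const)
    qed
  qed
  also have "\<dots> \<le> liminf (\<lambda>n. \<integral>\<^sup>+t. ennreal ((cmod (?G (S n) t - u t))\<^sup>2) * indicator {x..y} t \<partial>lborel)"
    by (rule nn_integral_liminf) measurable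
  also have "\<dots> \<le> liminf (\<lambda>n. ennreal K)"
  proof (intro Liminf_mono always_eventually allI)
    fix n
    have "(\<integral>\<^sup>+t. ennreal ((cmod (?G (S n) t - u t))\<^sup>2) * indicator {x..y} t \<partial>lborel) = ennreal (integral {x..y} (\<lambda>t. (cmod (?G (S n) t - u t))\<^sup>2))"
      by (intro nn_integral_has_integral_lebesgue' integrable_integral integrable_continuous_interval c S) auto
    also have "\<dots> \<le> ennreal K" by (intro ennreal_leI K S)
    finally show "(\<integral>\<^sup>+t. ennreal ((cmod (?G (S n) t - u t))\<^sup>2) * indicator {x..y} t \<partial>lborel) \<le> ennreal K" .
  qed
  also have "\<dots> = ennreal K" by (simp add: Liminf_const)
  finally show ?thesis .
qed

subsection \<open>Growth of the derivative\<close>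

text \<open>Cauchy-Schwarz in arithmetic-geometric mean form; the free parameter \<open>x\<close> is
  to be chosen as the expected root mean square of u.\<close>

lemma integral_cmod_le_square:
  fixes u :: "real \<Rightarrow> complex"
  assumes cont: "continuous_on {l..r} u" and x: "x > 0" and lr: "l \<le> r"
    and K: "integral {l..r} (\<lambda>t. (cmod (u t))\<^sup>2) \<le> K"
  shows "integral {l..r} (\<lambda>t. cmod (u t)) \<le> (r - l) * x / 2 + K / (2 * x)"
proof -
  have "integral {l..r} (\<lambda>t. cmod (u t)) \<le> integral {l..r} (\<lambda>t. x / 2 + 1 / (2 * x) * (cmod (u t))\<^sup>2)"
  proof (intro integral_le integrable_continuous_interval continuous_intros cont)
    fix t
    show "cmod (u t) \<le> x / 2 + 1 / (2 * x) * (cmod (u t))\<^sup>2"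
      using sum_squares_bound[of x "cmod (u t)"] x by (simp add: field_simps power2_eq_square)
  qed
  also have "\<dots> = (r - l) * x / 2 + 1 / (2 * x) * integral {l..r} (\<lambda>t. (cmod (u t))\<^sup>2)"
    using lr by (subst integral_add, (intro integrable_continuous_interval continuous_intros cont)+) simp
  also have "\<dots> \<le> (r - l) * x / 2 + 1 / (2 * x) * K" using K x by (intro add_left_mono mult_left_mono) auto
  finally show ?thesis by simp
qed

text \<open>The derivative formula for the constant function 1. It allows any constant to be
  subtracted from the function under the kernel.\<close>

lemma integral_derivative_kernel:
  assumes "0 < \<eta>" "\<eta> \<le> 1"
  shows "(derivative_kernel \<eta> has_integral 0) {-pi..pi}"
proof -
  have "((\<lambda>t. 1 * derivative_kernel ((-1) - (-1 - \<eta>)) t) has_integral 2 * pi * deriv (\<lambda>w. 1) (Complex (-1 - \<eta>) 0)) {-pi..pi}"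
    by (rule derivative_formula[where g="\<lambda>_. 1"]) (use assms in \<open>auto intro!: holomorphic_intros\<close>)
  then show ?thesis by simp
qed

text \<open>
  On each dyadic interval \<open>{- 2^k \<eta>..2^k \<eta>}\<close> the function is compared with its own constant \<open>c k\<close>; the
  differences of consecutive constants grow at most like \<open>2 powr (k * max ((p - 1) / 2) (1 / 2))\<close>, which
  the decay \<open>1 / (\<eta>\<^sup>2 + t\<^sup>2)\<close> of the derivative kernel compensates because \<open>p < 3\<close>.
\<close>

lemma growth_from_oscillation:
  assumes hol: "g holomorphic_on ball 0 1" and M: "\<forall>s<0. slice_norm g s \<le> M"
    and p: "0 < p" "p < 3" and E: "E > 0"
    and osc: "strip_oscillation p (E\<^sup>2) (\<lambda>w. g (exp w))"
  shows "strip_growth p ((8320 / (1 - 2 powr max ((p - 1) / 2) (1/2) / 2) + 1) * E) (\<lambda>w. g (exp w))"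
proof -
  define G where "G = (\<lambda>w. g (exp w))"
  note holG = disc_lift_holomorphic[OF hol, folded G_def]
  define \<alpha> where "\<alpha> = (p - 1) / 2"
  have \<alpha>: "- 1/2 < \<alpha>" "\<alpha> < 1" and p\<alpha>: "p = 2 * \<alpha> + 1" using p by (auto simp: \<alpha>_def field_simps)
  \<comment> \<open>\<alpha> is negative for p < 1. Raising the exponent to at least 1/2 keeps the
    ratio q at least 4/3, so that differences of constants sum geometrically, while \<beta> < 1
    keeps q / 2 below 1.\<close>
  define \<beta> where "\<beta> = max \<alpha> (1/2)"
  have \<beta>: "1/2 \<le> \<beta>" "\<beta> < 1" "\<alpha> \<le> \<beta>" using \<alpha> by (auto simp: \<beta>_def)
  define q where "q = 2 powr \<beta>"
  have q: "4/3 \<le> q" "q < 2"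
  proof -
    have "2 powr (1/2) \<le> q" unfolding q_def using \<beta> by (intro powr_mono) auto
    moreover have "4/3 \<le> sqrt (2::real)" by (rule real_le_rsqrt) (simp add: power2_eq_square)
    ultimately show "4/3 \<le> q" by (simp add: powr_half_sqrt)
    have "q < 2 powr 1" unfolding q_def using \<beta> by (intro powr_less_mono) auto
    then show "q < 2" by simp
  qed
  obtain \<delta>0 where \<delta>0: "\<delta>0 > 0" "\<forall>L a. 0 < L \<and> L \<le> \<delta>0 \<longrightarrow> (\<exists>c s2. s2 < 0 \<and> (\<forall>s1. s2 \<le> s1 \<and> s1 < 0 \<longrightarrow>
     integral {a - L..a + L} (\<lambda>t. (cmod (G (Complex s1 t) - c))\<^sup>2) \<le> E\<^sup>2 * L powr p))"
    using osc unfolding strip_oscillation_def G_def by blast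
  define \<delta> where "\<delta> = min \<delta>0 1"
  have \<delta>: "\<delta> > 0" "\<delta> \<le> 1" "\<delta> \<le> \<delta>0" using \<delta>0 by (auto simp: \<delta>_def)
  \<comment> \<open>\<open>M1\<close> bounds the integral of |G| over a period and \<open>Z\<close>
    the constant of the largest dyadic interval. \<open>A\<close> collects all contributions that do
    not come from small scales; they are of order \<eta>^(\<alpha> - \<beta>), and
    \<open>\<delta>'\<close> is chosen so that E \<eta>^(\<alpha> - 1) outweighs them.\<close>
  define M1 where "M1 = pi + \<bar>M\<bar> / 2"
  define Z where "Z = (2 * E + M1) / \<delta>"
  define A where "A = 80 * (4 / \<delta>\<^sup>2) * (M1 + 2 * pi * (Z + 12 * E))"
  have M1: "M1 > 0" by (simp add: M1_def add_pos_nonneg)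
  have Z: "Z > 0" using M1 E \<delta> by (simp add: Z_def)
  have A: "A > 0" using M1 Z E \<delta> by (simp add: A_def add_pos_pos)
  define \<nu> where "\<nu> = 1 - \<beta>"
  have \<nu>: "\<nu> > 0" using \<beta> by (simp add: \<nu>_def)
  define \<delta>' where "\<delta>' = min \<delta> ((E / A) powr (1 / \<nu>))"
  have \<delta>': "\<delta>' > 0" "\<delta>' \<le> \<delta>" "\<delta>' \<le> (E / A) powr (1 / \<nu>)" using \<delta> E A by (auto simp: \<delta>'_def)
  have bound: "cmod (deriv G (Complex s \<theta>)) \<le> (8320 / (1 - q / 2) + 1) * E * (- s) powr ((p - 3) / 2)"
    if s: "- \<delta>' \<le> s" "s < 0" for s \<theta>
  proof -
    define \<eta> where "\<eta> = - s"
    have \<eta>: "\<eta> > 0" "\<eta> \<le> \<delta>'" "\<eta> \<le> \<delta>" "\<eta> \<le> 1" using s \<delta>' \<delta> by (auto simp: \<eta>_def)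
    \<comment> \<open>The index wanted is the last n with 2^n \<eta> \<le> \<delta>, obtained as the
      predecessor of the least one that exceeds \<delta>.\<close>
    have "\<exists>n. \<delta> < 2 ^ n * \<eta>"
    proof -
      obtain n where "\<delta> / \<eta> < 2 ^ n" using real_arch_pow[of 2 "\<delta> / \<eta>"] by auto
      then show ?thesis using \<eta> by (intro exI[of _ n]) (simp add: field_simps)
    qed
    then have lst: "\<delta> < 2 ^ (LEAST n. \<delta> < 2 ^ n * \<eta>) * \<eta>" by (rule LeastI_ex)
    moreover have "(LEAST n. \<delta> < 2 ^ n * \<eta>) \<noteq> 0" using lst \<eta> by (intro notI) simp
    ultimately obtain n where n: "(LEAST n. \<delta> < 2 ^ n * \<eta>) = Suc n" by (metis not0_implies_Suc)
    define L where "L = (\<lambda>k::nat. 2 ^ k * \<eta>)"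
    have Ln: "\<delta> < 2 * L n" using lst unfolding n L_def by simp
    have "\<not> \<delta> < 2 ^ n * \<eta>" using not_less_Least[of n "\<lambda>n. \<delta> < 2 ^ n * \<eta>"] n by simp
    then have Ln': "L n \<le> \<delta>" by (simp add: L_def)
    have L0: "L k > 0" for k using \<eta> by (simp add: L_def)
    have Lmono: "L j \<le> L k" if "j \<le> k" for j k
      unfolding L_def using that \<eta> by (intro mult_right_mono power_increasing) auto
    have Lk: "L k \<le> \<delta>" if "k \<le> n" for k using Lmono[OF that] Ln' by linarith
    have LS: "L (Suc k) = 2 * L k" for k by (simp add: L_def)
    let ?P = "\<lambda>k cs. snd cs < 0 \<and> (\<forall>s1. snd cs \<le> s1 \<and> s1 < 0 \<longrightarrow>
        integral {\<theta> - L k..\<theta> + L k} (\<lambda>t. (cmod (G (Complex s1 t) - fst cs))\<^sup>2) \<le> E\<^sup>2 * L k powr p)"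
    have "\<exists>cs. k \<le> n \<longrightarrow> ?P k cs" for k
    proof (cases "k \<le> n")
      case True
      then have "0 < L k \<and> L k \<le> \<delta>0" using L0 Lk[OF True] \<delta> by simp
      then obtain c s2 where "s2 < 0" "\<forall>s1. s2 \<le> s1 \<and> s1 < 0 \<longrightarrow>
        integral {\<theta> - L k..\<theta> + L k} (\<lambda>t. (cmod (G (Complex s1 t) - c))\<^sup>2) \<le> E\<^sup>2 * L k powr p"
        using \<delta>0(2) by blast
      then show ?thesis by (intro exI[of _ "(c, s2)"]) simp
    qed simp
    then have "\<exists>cs. \<forall>k. k \<le> n \<longrightarrow> ?P k (cs k)" by (intro choice) blast
    then obtain cs where cs0: "\<forall>k. k \<le> n \<longrightarrow> ?P k (cs k)" by blast
    have cs: "?P k (cs k)" if "k \<le> n" for k using cs0 that by blast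
    define c where "c = (\<lambda>k. fst (cs k))"
    \<comment> \<open>One slice on which the oscillation bounds of all n + 1 scales hold: the
      maximum of finitely many thresholds. Including s / 2 makes the distance from s to the slice at
      least \<eta> / 2.\<close>
    define s1 where "s1 = Max (insert (s / 2) ((\<lambda>k. snd (cs k)) ` {..n}))"
    have s1: "s1 < 0" "s / 2 \<le> s1" using cs s by (auto simp: s1_def)
    have s1k: "snd (cs k) \<le> s1" if "k \<le> n" for k
      unfolding s1_def by (rule Max_ge) (use that in auto)
    define f where "f = (\<lambda>t. G (Complex s1 (\<theta> + t)))"
    have cf: "continuous_on S f" for S unfolding f_def by (rule half_plane_continuous_line(2)[OF holG s1(1)])
    have shift: "integral {- x..x} (\<lambda>t. F (\<theta> + t)) = integral {\<theta> - x..\<theta> + x} F" for x and F :: "real \<Rightarrow> real"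
      using integral_shift_Icc_real[of "-x" x F \<theta>] by (simp add: o_def add.commute)
    have osc_k: "integral {- L k..L k} (\<lambda>t. (cmod (f t - c k))\<^sup>2) \<le> E\<^sup>2 * L k powr p" if "k \<le> n" for k
    proof -
      have "integral {- L k..L k} (\<lambda>t. (cmod (f t - c k))\<^sup>2) = integral {\<theta> - L k..\<theta> + L k} (\<lambda>t. (cmod (G (Complex s1 t) - c k))\<^sup>2)"
        unfolding f_def by (rule shift)
      also have "\<dots> \<le> E\<^sup>2 * L k powr p"
        unfolding c_def using cs[OF that, THEN conjunct2, rule_format, of s1] s1k[OF that] s1(1) by simp
      finally show ?thesis .
    qed
    have osc1: "integral {- L k..L k} (\<lambda>t. cmod (f t - c k)) \<le> 3/2 * E * L k powr (\<alpha> + 1)" if k: "k \<le> n" for k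
    proof -
      define x where "x = E * L k powr \<alpha>"
      have x: "x > 0" using E L0[of k] by (simp add: x_def)
      have L1: "L k * x = E * L k powr (\<alpha> + 1)" using L0[of k] by (simp add: x_def powr_add)
      have "L k powr p = L k powr \<alpha> * L k powr (\<alpha> + 1)" unfolding p\<alpha> powr_add[symmetric] by simp
      then have L2: "E\<^sup>2 * L k powr p = x * (E * L k powr (\<alpha> + 1))" by (simp add: x_def power2_eq_square)
      have "integral {- L k..L k} (\<lambda>t. cmod (f t - c k)) \<le> (L k - - L k) * x / 2 + (E\<^sup>2 * L k powr p) / (2 * x)"
        using L0[of k] by (intro integral_cmod_le_square x osc_k k continuous_intros cf) auto
      also have "\<dots> = E * L k powr (\<alpha> + 1) + E * L k powr (\<alpha> + 1) / 2"
        unfolding L2 using x L1 by simp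
      finally show ?thesis by simp
    qed
    have i: "(\<lambda>t. cmod (f t - c k)) integrable_on {x..y}" for k x y
      by (intro integrable_continuous_interval continuous_intros cf)
    have i': "(\<lambda>t. cmod (f t)) integrable_on {x..y}" for x y
      by (intro integrable_continuous_interval continuous_intros cf)
    have Lpow: "L k powr \<alpha> \<le> \<eta> powr \<alpha> * q ^ k" for k
    proof -
      have "L k powr \<alpha> = (2 powr real k) powr \<alpha> * \<eta> powr \<alpha>" using \<eta> by (simp add: L_def powr_mult powr_realpow)
      also have "(2 powr real k) powr \<alpha> \<le> (2 powr real k) powr \<beta>" using \<beta> by (intro powr_mono) (auto simp: powr_realpow)
      also have "\<dots> = q ^ k" by (simp add: q_def powr_powr mult.commute flip: powr_realpow)
      finally show ?thesis using \<eta> by (simp add: mult.commute mult_right_mono)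
    qed
    have diff: "cmod (c (Suc k) - c k) \<le> 4 * E * (\<eta> powr \<alpha> * q ^ k)" if k: "Suc k \<le> n" for k
    proof -
      have "2 * L k * cmod (c (Suc k) - c k) = integral {- L k..L k} (\<lambda>t. cmod (c (Suc k) - c k))" using L0[of k] by simp
      also have "\<dots> \<le> integral {- L k..L k} (\<lambda>t. cmod (f t - c k) + cmod (f t - c (Suc k)))"
      proof (intro integral_le integrable_add i)
        fix t
        show "cmod (c (Suc k) - c k) \<le> cmod (f t - c k) + cmod (f t - c (Suc k))"
          using norm_triangle_ineq4[of "f t - c k" "f t - c (Suc k)"] by simp
      qed auto
      also have "\<dots> = integral {- L k..L k} (\<lambda>t. cmod (f t - c k)) + integral {- L k..L k} (\<lambda>t. cmod (f t - c (Suc k)))"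
        by (intro integral_add i)
      also have "integral {- L k..L k} (\<lambda>t. cmod (f t - c (Suc k))) \<le> integral {- L (Suc k)..L (Suc k)} (\<lambda>t. cmod (f t - c (Suc k)))"
        using Lmono[of k "Suc k"] by (intro integral_subset_le i) auto
      also have "integral {- L k..L k} (\<lambda>t. cmod (f t - c k)) + integral {- L (Suc k)..L (Suc k)} (\<lambda>t. cmod (f t - c (Suc k)))
          \<le> 3/2 * E * L k powr (\<alpha> + 1) + 3/2 * E * L (Suc k) powr (\<alpha> + 1)"
        using k by (intro add_mono osc1) auto
      also have "L (Suc k) powr (\<alpha> + 1) \<le> 4 * L k powr (\<alpha> + 1)"
      proof -
        have "2 powr (\<alpha> + 1) \<le> 2 powr 2" using \<alpha> by (intro powr_mono) auto
        then have "2 powr (\<alpha> + 1) \<le> (4::real)" by simp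
        then show ?thesis unfolding LS using L0[of k] by (simp add: powr_mult mult_right_mono)
      qed
      finally have "2 * L k * cmod (c (Suc k) - c k) \<le> 3/2 * E * L k powr (\<alpha> + 1) + 3/2 * E * (4 * L k powr (\<alpha> + 1))"
        using E by simp
      also have "\<dots> = 2 * L k * (15/4 * E * L k powr \<alpha>)" using L0[of k] by (simp add: powr_add)
      finally have "cmod (c (Suc k) - c k) \<le> 15/4 * E * L k powr \<alpha>" using L0[of k] by simp
      also have "\<dots> \<le> 4 * E * L k powr \<alpha>" using E by (intro mult_right_mono) auto
      also have "\<dots> \<le> 4 * E * (\<eta> powr \<alpha> * q ^ k)" using E by (intro mult_left_mono Lpow) auto
      finally show ?thesis .
    qed
    \<comment> \<open>The constant 12 is preserved by the induction because 4 + 12 = 16 is at most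
      12 q for q \<ge> 4/3.\<close>
    have y: "cmod (c k - c 0) \<le> 12 * E * (\<eta> powr \<alpha> * q ^ k)" if "k \<le> n" for k
      using that
    proof (induction k)
      case 0
      then show ?case using E by simp
    next
      case (Suc k)
      have "cmod (c (Suc k) - c 0) \<le> cmod (c (Suc k) - c k) + cmod (c k - c 0)"
        using norm_triangle_ineq[of "c (Suc k) - c k" "c k - c 0"] by simp
      also have "\<dots> \<le> 4 * E * (\<eta> powr \<alpha> * q ^ k) + 12 * E * (\<eta> powr \<alpha> * q ^ k)"
        using Suc by (intro add_mono diff) auto
      also have "\<dots> = 16 * (E * \<eta> powr \<alpha> * q ^ k)" by simp
      also have "\<dots> \<le> (12 * q) * (E * \<eta> powr \<alpha> * q ^ k)" using q E by (intro mult_right_mono) auto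
      finally show ?case by (simp add: mult_ac)
    qed
    have W: "integral {- (2 ^ k * \<eta>)..2 ^ k * \<eta>} (\<lambda>t. cmod (f t - c 0)) \<le> 26 * E * (\<eta> powr (\<alpha> + 1)) * (2 * q) ^ k" if k: "k \<le> n" for k
    proof -
      have "integral {- L k..L k} (\<lambda>t. cmod (f t - c 0)) \<le> integral {- L k..L k} (\<lambda>t. cmod (f t - c k) + cmod (c k - c 0))"
      proof (intro integral_le integrable_add i)
        fix t
        show "cmod (f t - c 0) \<le> cmod (f t - c k) + cmod (c k - c 0)"
          using norm_triangle_ineq[of "f t - c k" "c k - c 0"] by simp
      qed auto
      also have "\<dots> = integral {- L k..L k} (\<lambda>t. cmod (f t - c k)) + 2 * L k * cmod (c k - c 0)"
        using L0[of k] by (subst integral_add[OF i]) auto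
      also have "\<dots> \<le> 3/2 * E * L k powr (\<alpha> + 1) + 2 * L k * (12 * E * (\<eta> powr \<alpha> * q ^ k))"
        using L0[of k] by (intro add_mono osc1 k mult_left_mono y) auto
      also have "L k powr (\<alpha> + 1) = L k * L k powr \<alpha>" using L0[of k] by (simp add: powr_add)
      also have "3/2 * E * (L k * L k powr \<alpha>) \<le> 3/2 * E * (L k * (\<eta> powr \<alpha> * q ^ k))"
        using E L0[of k] by (intro mult_left_mono Lpow) auto
      finally have "integral {- L k..L k} (\<lambda>t. cmod (f t - c 0)) \<le> 51/2 * (E * (L k * (\<eta> powr \<alpha> * q ^ k)))" by (simp add: mult_ac)
      also have "\<dots> \<le> 26 * (E * (L k * (\<eta> powr \<alpha> * q ^ k)))"
        using E L0[of k] q by (intro mult_right_mono) auto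
      also have "\<dots> = 26 * E * (\<eta> powr (\<alpha> + 1)) * (2 * q) ^ k"
        using \<eta> by (simp add: L_def powr_add power_mult_distrib)
      finally show ?thesis by (simp add: L_def)
    qed
    define \<eta>1 where "\<eta>1 = s1 - s"
    have \<eta>1: "\<eta> / 2 \<le> \<eta>1" "0 < \<eta>1" "\<eta>1 \<le> 1" "s < s1" using s1 \<eta> s by (auto simp: \<eta>1_def \<eta>_def)
    have pos: "0 < \<eta>\<^sup>2 + t\<^sup>2" for t using \<eta> by (simp add: add_pos_nonneg)
    let ?h = "\<lambda>t. cmod (f t - c 0) / (\<eta>\<^sup>2 + t\<^sup>2)"
    have ch: "continuous_on S ?h" for S
      by (intro continuous_intros cf) (metis pos less_irrefl)
    have ih: "?h integrable_on {x..y}" for x y by (intro integrable_continuous_interval ch)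
    have near: "integral {- L n..L n} ?h \<le> 104 * E / (1 - q / 2) * \<eta> powr (\<alpha> - 1)"
    proof -
      have "integral {- L n..L n} ?h \<le> 4 / \<eta>\<^sup>2 * (\<Sum>k\<le>n. 26 * E * (\<eta> powr (\<alpha> + 1)) * (2 * q) ^ k / 4 ^ k)"
        unfolding L_def by (intro dyadic_kernel_bound W continuous_intros cf \<eta>) auto
      also have "(\<Sum>k\<le>n. 26 * E * (\<eta> powr (\<alpha> + 1)) * (2 * q) ^ k / 4 ^ k) = 26 * E * (\<eta> powr (\<alpha> + 1)) * (\<Sum>k\<le>n. (q / 2) ^ k)"
      proof -
        have "(2 * q) ^ k / 4 ^ k = (q / 2) ^ k" for k by (simp only: power_divide[symmetric]) simp
        then have "26 * E * (\<eta> powr (\<alpha> + 1)) * (2 * q) ^ k / 4 ^ k = 26 * E * (\<eta> powr (\<alpha> + 1)) * (q / 2) ^ k" for k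
          by (simp only: times_divide_eq_right[symmetric])
        then show ?thesis by (simp only: sum_distrib_left)
      qed
      also have "4 / \<eta>\<^sup>2 * (26 * E * (\<eta> powr (\<alpha> + 1)) * (\<Sum>k\<le>n. (q / 2) ^ k)) \<le> 4 / \<eta>\<^sup>2 * (26 * E * (\<eta> powr (\<alpha> + 1)) * (1 / (1 - q / 2)))"
      proof (intro mult_left_mono)
        have "(\<Sum>k<Suc n. (q / 2) ^ k) \<le> (\<Sum>k. (q / 2) ^ k)" using q by (intro sum_le_suminf summable_geometric) auto
        also have "\<dots> = 1 / (1 - q / 2)" using q by (intro suminf_geometric) auto
        finally show "(\<Sum>k\<le>n. (q / 2) ^ k) \<le> 1 / (1 - q / 2)" by (simp add: lessThan_Suc_atMost)
      qed (use E in auto)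
      also have "\<dots> = 104 * E / (1 - q / 2) * (\<eta> powr (\<alpha> + 1) / \<eta>\<^sup>2)" by (simp add: mult_ac)
      also have "\<eta> powr (\<alpha> + 1) / \<eta>\<^sup>2 = \<eta> powr (\<alpha> - 1)"
      proof -
        have "\<eta>\<^sup>2 = \<eta> powr 2" using \<eta> by simp
        then show ?thesis unfolding powr_diff[symmetric] by (simp add: powr_diff[symmetric])
      qed
      finally show ?thesis .
    qed
    have piLn: "L n \<le> pi" using Ln' \<delta> pi_gt3 by linarith
    have M1b: "integral {-pi..pi} (\<lambda>t. cmod (f t)) \<le> M1"
    proof -
      have "integral {-pi..pi} (\<lambda>t. (cmod (f t))\<^sup>2) = integral {\<theta> - pi..\<theta> - pi + 2 * pi} (\<lambda>t. (cmod (G (Complex s1 t)))\<^sup>2)"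
        unfolding f_def using shift[of pi "\<lambda>t. (cmod (G (Complex s1 t)))\<^sup>2"] by (simp add: add.commute)
      also have "\<dots> = integral {0..0 + 2 * pi} (\<lambda>t. (cmod (G (Complex s1 t)))\<^sup>2)"
        by (rule periodic_integral)
           (intro continuous_intros half_plane_continuous_line(1)[OF holG s1(1)], simp_all only: G_def exp_Complex_periodic, simp)
      also have "\<dots> \<le> \<bar>M\<bar>" using M[rule_format, OF s1(1)] by (simp add: slice_norm_def G_def)
      finally have "integral {-pi..pi} (\<lambda>t. cmod (f t)) \<le> (pi - - pi) * 1 / 2 + \<bar>M\<bar> / (2 * 1)"
        by (intro integral_cmod_le_square cf) auto
      then show ?thesis by (simp add: M1_def)
    qed
    \<comment> \<open>\<open>c n\<close> is controlled by the integral of |G| over a period, since L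
      n is comparable to \<delta>; descending to \<open>c 0\<close> costs q^n, which is at most
      \<eta>^(-\<beta>).\<close>
    have c0: "cmod (c 0) \<le> Z + 12 * E * \<eta> powr (\<alpha> - \<beta>)"
    proof -
      have "2 * L n * cmod (c n) = integral {- L n..L n} (\<lambda>t. cmod (c n))" using L0[of n] by simp
      also have "\<dots> \<le> integral {- L n..L n} (\<lambda>t. cmod (f t - c n) + cmod (f t))"
      proof (intro integral_le integrable_add i i')
        fix t
        show "cmod (c n) \<le> cmod (f t - c n) + cmod (f t)"
          using norm_triangle_ineq4[of "f t" "f t - c n"] by simp
      qed auto
      also have "\<dots> = integral {- L n..L n} (\<lambda>t. cmod (f t - c n)) + integral {- L n..L n} (\<lambda>t. cmod (f t))"
        by (intro integral_add i i')
      also have "\<dots> \<le> 3/2 * E * L n powr (\<alpha> + 1) + integral {-pi..pi} (\<lambda>t. cmod (f t))"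
        using piLn by (intro add_mono osc1 integral_subset_le i') auto
      also have "\<dots> \<le> 2 * E + M1"
      proof (intro add_mono M1b)
        have "L n powr (\<alpha> + 1) \<le> 1" using Ln' \<delta> L0[of n] \<alpha> by (intro powr_le1) auto
        then have "3/2 * E * L n powr (\<alpha> + 1) \<le> 3/2 * E * 1" using E by (intro mult_left_mono) auto
        then show "3/2 * E * L n powr (\<alpha> + 1) \<le> 2 * E" using E by simp
      qed
      finally have 1: "2 * L n * cmod (c n) \<le> 2 * E + M1" .
      have "\<delta> * cmod (c n) \<le> 2 * L n * cmod (c n)" using Ln by (intro mult_right_mono) auto
      then have 2: "cmod (c n) \<le> Z" using 1 \<delta> by (simp add: Z_def field_simps)
      have "q ^ n \<le> \<eta> powr (- \<beta>)"
      proof -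
        have "q ^ n = (2 ^ n) powr \<beta>" by (simp add: q_def powr_powr mult.commute flip: powr_realpow)
        also have "\<dots> \<le> (1 / \<eta>) powr \<beta>"
          using Ln' \<delta> \<eta> \<beta> by (intro powr_mono2) (auto simp: L_def field_simps)
        also have "\<dots> = \<eta> powr (- \<beta>)" using \<eta> by (simp add: powr_minus powr_divide field_simps)
        finally show ?thesis .
      qed
      then have "cmod (c n - c 0) \<le> 12 * E * (\<eta> powr \<alpha> * \<eta> powr (- \<beta>))"
        using E by (intro order_trans[OF y] mult_left_mono) auto
      then have "cmod (c n - c 0) \<le> 12 * E * \<eta> powr (\<alpha> - \<beta>)" by (simp flip: powr_add)
      then show ?thesis using 2 norm_triangle_ineq4[of "c n" "c n - c 0"] by simp
    qed
    have far: "integral {-pi..pi} (\<lambda>t. cmod (f t - c 0)) \<le> M1 + 2 * pi * (Z + 12 * E * \<eta> powr (\<alpha> - \<beta>))"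
    proof -
      have "integral {-pi..pi} (\<lambda>t. cmod (f t - c 0)) \<le> integral {-pi..pi} (\<lambda>t. cmod (f t) + cmod (c 0))"
        by (intro integral_le integrable_add i i' norm_triangle_ineq4) auto
      also have "\<dots> = integral {-pi..pi} (\<lambda>t. cmod (f t)) + 2 * pi * cmod (c 0)"
        by (subst integral_add[OF i']) auto
      also have "\<dots> \<le> M1 + 2 * pi * (Z + 12 * E * \<eta> powr (\<alpha> - \<beta>))"
        by (intro add_mono M1b mult_left_mono c0) auto
      finally show ?thesis .
    qed
    have split: "integral {-pi..pi} ?h \<le> integral {- L n..L n} ?h + 4 / \<delta>\<^sup>2 * integral {-pi..pi} (\<lambda>t. cmod (f t - c 0))"
    proof -
      have out: "integral {x..y} ?h \<le> 4 / \<delta>\<^sup>2 * integral {x..y} (\<lambda>t. cmod (f t - c 0))" if "\<And>t. t \<in> {x..y} \<Longrightarrow> L n \<le> \<bar>t\<bar>" for x y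
      proof -
        have "integral {x..y} ?h \<le> integral {x..y} (\<lambda>t. 4 / \<delta>\<^sup>2 * cmod (f t - c 0))"
        proof (intro integral_le ih integrable_on_mult_right i)
          fix t assume "t \<in> {x..y}"
          then have "\<delta> / 2 \<le> \<bar>t\<bar>" using that[of t] Ln by linarith
          then have "(\<delta> / 2)\<^sup>2 \<le> \<bar>t\<bar>\<^sup>2" using \<delta> by (intro power_mono) auto
          then have "\<delta>\<^sup>2 / 4 \<le> \<eta>\<^sup>2 + t\<^sup>2" by (simp add: power_divide add_increasing)
          then have "?h t \<le> cmod (f t - c 0) / (\<delta>\<^sup>2 / 4)" using \<delta> by (intro divide_left_mono) (auto simp: add_pos_nonneg pos)
          then show "?h t \<le> 4 / \<delta>\<^sup>2 * cmod (f t - c 0)" by (simp add: mult.commute)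
        qed
        then show ?thesis by simp
      qed
      have comb: "integral {-pi..pi} F = integral {-pi..- L n} F + integral {- L n..L n} F + integral {L n..pi} F"
        if "\<And>x y. F integrable_on {x..y}" for F :: "real \<Rightarrow> real"
        using piLn L0[of n] Henstock_Kurzweil_Integration.integral_combine[OF _ _ that, of "-pi" "- L n" pi]
          Henstock_Kurzweil_Integration.integral_combine[OF _ _ that, of "- L n" "L n" pi] by auto
      have mid: "0 \<le> integral {- L n..L n} (\<lambda>t. cmod (f t - c 0))" by (intro integral_nonneg i) auto
      have "integral {-pi..pi} ?h \<le> 4 / \<delta>\<^sup>2 * integral {-pi..- L n} (\<lambda>t. cmod (f t - c 0)) + integral {- L n..L n} ?h + 4 / \<delta>\<^sup>2 * integral {L n..pi} (\<lambda>t. cmod (f t - c 0))"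
        unfolding comb[OF ih] using L0[of n] by (intro add_mono out order_refl) auto
      also have "\<dots> = integral {- L n..L n} ?h + 4 / \<delta>\<^sup>2 * (integral {-pi..- L n} (\<lambda>t. cmod (f t - c 0)) + integral {L n..pi} (\<lambda>t. cmod (f t - c 0)))"
        by (simp only: distrib_left)
      also have "\<dots> \<le> integral {- L n..L n} ?h + 4 / \<delta>\<^sup>2 * integral {-pi..pi} (\<lambda>t. cmod (f t - c 0))"
        unfolding comb[OF i] using mid by (intro add_left_mono mult_left_mono) auto
      finally show ?thesis .
    qed
    have D1: "((\<lambda>t. f t * derivative_kernel \<eta>1 t) has_integral 2 * pi * deriv G (Complex s \<theta>)) {-pi..pi}"
      unfolding f_def \<eta>1_def G_def by (rule derivative_formula[OF hol \<eta>1(4) s1(1)])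
    have "((\<lambda>t. f t * derivative_kernel \<eta>1 t - c 0 * derivative_kernel \<eta>1 t) has_integral 2 * pi * deriv G (Complex s \<theta>) - c 0 * 0) {-pi..pi}"
      by (intro has_integral_diff D1 has_integral_mult_right integral_derivative_kernel \<eta>1)
    then have D: "((\<lambda>t. (f t - c 0) * derivative_kernel \<eta>1 t) has_integral 2 * pi * deriv G (Complex s \<theta>)) {-pi..pi}"
      by (simp add: left_diff_distrib)
    have "2 * pi * cmod (deriv G (Complex s \<theta>)) = cmod (integral {-pi..pi} (\<lambda>t. (f t - c 0) * derivative_kernel \<eta>1 t))"
      unfolding integral_unique[OF D] by (simp add: norm_mult)
    also have "\<dots> \<le> integral {-pi..pi} (\<lambda>t. 80 * ?h t)"
    proof (rule integral_norm_bound_integral)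
      show "(\<lambda>t. (f t - c 0) * derivative_kernel \<eta>1 t) integrable_on {-pi..pi}" using D by blast
      show "(\<lambda>t. 80 * ?h t) integrable_on {-pi..pi}" by (intro integrable_on_mult_right ih)
      fix t assume t: "t \<in> {-pi..pi}"
      have "\<eta>\<^sup>2 / 4 \<le> \<eta>1\<^sup>2" using power_mono[OF \<eta>1(1), of 2] \<eta> by (simp add: power_divide)
      then have "(\<eta>\<^sup>2 + t\<^sup>2) / 4 \<le> \<eta>1\<^sup>2 + t\<^sup>2" by (simp add: add_divide_distrib add_mono)
      then have "20 / (\<eta>1\<^sup>2 + t\<^sup>2) \<le> 20 / ((\<eta>\<^sup>2 + t\<^sup>2) / 4)" using pos[of t] \<eta>1 by (intro divide_left_mono) (auto simp: add_pos_nonneg)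
      then have "cmod (derivative_kernel \<eta>1 t) \<le> 80 / (\<eta>\<^sup>2 + t\<^sup>2)"
        using kernel_bounds(2)[OF \<eta>1(2,3), of t] t by (simp add: abs_le_iff)
      then have "cmod ((f t - c 0) * derivative_kernel \<eta>1 t) \<le> cmod (f t - c 0) * (80 / (\<eta>\<^sup>2 + t\<^sup>2))"
        unfolding norm_mult by (rule mult_left_mono) simp
      then show "cmod ((f t - c 0) * derivative_kernel \<eta>1 t) \<le> 80 * ?h t" by (simp add: mult.commute)
    qed
    also have "\<dots> = 80 * integral {-pi..pi} ?h" by (rule integral_mult_right)
    also have "\<dots> \<le> 80 * (104 * E / (1 - q / 2) * \<eta> powr (\<alpha> - 1) + 4 / \<delta>\<^sup>2 * (M1 + 2 * pi * (Z + 12 * E * \<eta> powr (\<alpha> - \<beta>))))"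
      using split near far by (intro mult_left_mono order_trans[OF split] add_mono) auto
    also have "\<dots> = 8320 * E / (1 - q / 2) * \<eta> powr (\<alpha> - 1) + 80 * (4 / \<delta>\<^sup>2) * (M1 + 2 * pi * (Z + 12 * E * \<eta> powr (\<alpha> - \<beta>)))"
      by (simp add: distrib_left)
    also have "80 * (4 / \<delta>\<^sup>2) * (M1 + 2 * pi * (Z + 12 * E * \<eta> powr (\<alpha> - \<beta>))) \<le> E * \<eta> powr (\<alpha> - 1)"
    proof -
      have ge1: "1 \<le> \<eta> powr (\<alpha> - \<beta>)" using \<eta> \<beta> ge_one_powr_ge_zero[of "1 / \<eta>" "\<beta> - \<alpha>"]
        by (simp add: powr_divide powr_diff field_simps)
      have "M1 + 2 * pi * (Z + 12 * E * \<eta> powr (\<alpha> - \<beta>)) \<le> M1 * \<eta> powr (\<alpha> - \<beta>) + 2 * pi * (Z * \<eta> powr (\<alpha> - \<beta>) + 12 * E * \<eta> powr (\<alpha> - \<beta>))"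
        using ge1 M1 Z E by (intro add_mono mult_left_mono) auto
      then have "80 * (4 / \<delta>\<^sup>2) * (M1 + 2 * pi * (Z + 12 * E * \<eta> powr (\<alpha> - \<beta>))) \<le> 80 * (4 / \<delta>\<^sup>2) * (M1 * \<eta> powr (\<alpha> - \<beta>) + 2 * pi * (Z * \<eta> powr (\<alpha> - \<beta>) + 12 * E * \<eta> powr (\<alpha> - \<beta>)))"
        by (rule mult_left_mono) simp
      also have "\<dots> = A * \<eta> powr (\<alpha> - \<beta>)" by (simp add: A_def algebra_simps)
      also have "\<dots> = A * (\<eta> powr (\<alpha> - 1) * \<eta> powr \<nu>)" by (simp add: \<nu>_def flip: powr_add)
      also have "A * (\<eta> powr (\<alpha> - 1) * \<eta> powr \<nu>) \<le> A * (\<eta> powr (\<alpha> - 1) * (E / A))"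
      proof (intro mult_left_mono)
        have "\<eta> powr \<nu> \<le> ((E / A) powr (1 / \<nu>)) powr \<nu>" using \<eta> \<delta>' \<nu> by (intro powr_mono2) auto
        also have "\<dots> = E / A" using \<nu> E A by (simp add: powr_powr)
        finally show "\<eta> powr \<nu> \<le> E / A" .
      qed (use A in auto)
      also have "\<dots> = E * \<eta> powr (\<alpha> - 1)" using A by simp
      finally show ?thesis .
    qed
    finally have fin: "2 * pi * cmod (deriv G (Complex s \<theta>)) \<le> (8320 / (1 - q / 2) + 1) * E * \<eta> powr (\<alpha> - 1)"
      by (simp add: algebra_simps)
    have "cmod (deriv G (Complex s \<theta>)) \<le> 2 * pi * cmod (deriv G (Complex s \<theta>))"
      using pi_gt3 by (intro mult_le_cancel_right1[THEN iffD2]) auto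
    also note fin
    also have "\<alpha> - 1 = (p - 3) / 2" by (simp add: \<alpha>_def field_simps)
    finally show ?thesis by (simp add: \<eta>_def)
  qed
  show ?thesis unfolding strip_growth_def
  proof (intro exI[of _ \<delta>'] conjI \<delta>' allI impI)
    fix s t assume "- \<delta>' \<le> s \<and> s < 0"
    then show "cmod (deriv (\<lambda>w. g (exp w)) (Complex s t)) \<le>
        (8320 / (1 - 2 powr max ((p - 1) / 2) (1/2) / 2) + 1) * E * (- s) powr ((p - 3) / 2)"
      using bound[of s t] unfolding q_def \<beta>_def \<alpha>_def G_def by simp
  qed
qed

subsection \<open>Arcs and oscillation on the circle\<close>

lemma cis_eq_cis_imp:
  assumes "cis t = cis u" "\<bar>t - u\<bar> < 2 * pi"
  shows "t = u"
proof -
  have "exp (Complex 0 t) = exp (Complex 0 u)" using assms by (simp add: exp_eq_cis)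
  then have "Complex 0 t = Complex 0 u" by (rule exp_complex_eqI[rotated]) (use assms(2) in simp)
  then show ?thesis by simp
qed

lemma cis_add_2pi: "cis (t + 2 * pi) = cis t"
  by (simp flip: cis_mult)

lemma measurable_cis_sphere [measurable]: "cis \<in> borel \<rightarrow>\<^sub>M restrict_space borel (sphere 0 1)"
  by (intro measurable_restrict_space2 borel_measurable_continuous_onI continuous_intros) auto

lemma nn_integral_translate:
  fixes f :: "real \<Rightarrow> ennreal"
  assumes "f \<in> borel_measurable borel"
  shows "(\<integral>\<^sup>+t. f t \<partial>lborel) = (\<integral>\<^sup>+t. f (c + t) \<partial>lborel)"
  using nn_integral_real_affine[OF assms, of 1 c] by simp

lemma periodic_nn_integral:
  fixes f :: "real \<Rightarrow> ennreal"
  assumes f[measurable]: "f \<in> borel_measurable borel" and per: "\<And>t. f (t + 2 * pi) = f t"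
  shows "(\<integral>\<^sup>+t. f t * indicator {a..<a + 2 * pi} t \<partial>lborel) = (\<integral>\<^sup>+t. f t * indicator {0..<2 * pi} t \<partial>lborel)"
proof -
  have per_n: "f (t + 2 * pi * real n) = f t" for t n
  proof (induction n)
    case (Suc n)
    have "f (t + 2 * pi * real (Suc n)) = f ((t + 2 * pi * real n) + 2 * pi)" by (simp add: algebra_simps)
    then show ?case using per Suc by simp
  qed simp
  have per_i: "f (t + 2 * pi * of_int k) = f t" for t k
  proof (cases "k \<ge> 0")
    case True
    then show ?thesis using per_n[of t "nat k"] by simp
  next
    case False
    then show ?thesis using per_n[of "t + 2 * pi * of_int k" "nat (- k)"] by simp
  qed
  define k where "k = \<lfloor>a / (2 * pi)\<rfloor>"
  define r where "r = a - 2 * pi * of_int k"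
  have "of_int k \<le> a / (2 * pi)" "a / (2 * pi) < of_int k + 1" unfolding k_def by linarith+
  then have r: "0 \<le> r" "r < 2 * pi" by (auto simp: r_def field_simps)
  have "(\<integral>\<^sup>+t. f t * indicator {a..<a + 2 * pi} t \<partial>lborel) = (\<integral>\<^sup>+t. f (2 * pi * of_int k + t) * indicator {a..<a + 2 * pi} (2 * pi * of_int k + t) \<partial>lborel)"
    by (rule nn_integral_translate) measurable
  also have "\<dots> = (\<integral>\<^sup>+t. f t * indicator {r..<2 * pi} t + f t * indicator {2 * pi..<r + 2 * pi} t \<partial>lborel)"
  proof (intro nn_integral_cong)
    fix t
    have "f (2 * pi * of_int k + t) = f t" using per_i[of t k] by (simp add: add.commute)
    then show "f (2 * pi * of_int k + t) * indicator {a..<a + 2 * pi} (2 * pi * of_int k + t) = f t * indicator {r..<2 * pi} t + f t * indicator {2 * pi..<r + 2 * pi} t"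
      using r by (auto simp: r_def split: split_indicator)
  qed
  also have "\<dots> = (\<integral>\<^sup>+t. f t * indicator {r..<2 * pi} t \<partial>lborel) + (\<integral>\<^sup>+t. f t * indicator {2 * pi..<r + 2 * pi} t \<partial>lborel)"
    by (rule nn_integral_add) measurable
  also have "(\<integral>\<^sup>+t. f t * indicator {2 * pi..<r + 2 * pi} t \<partial>lborel) = (\<integral>\<^sup>+t. f (2 * pi + t) * indicator {2 * pi..<r + 2 * pi} (2 * pi + t) \<partial>lborel)"
    by (rule nn_integral_translate) measurable
  also have "\<dots> = (\<integral>\<^sup>+t. f t * indicator {0..<r} t \<partial>lborel)"
    using per by (intro nn_integral_cong) (auto simp: add.commute split: split_indicator)
  also have "(\<integral>\<^sup>+t. f t * indicator {r..<2 * pi} t \<partial>lborel) + (\<integral>\<^sup>+t. f t * indicator {0..<r} t \<partial>lborel) = (\<integral>\<^sup>+t. f t * indicator {r..<2 * pi} t + f t * indicator {0..<r} t \<partial>lborel)"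
    by (rule nn_integral_add[symmetric]) measurable
  also have "\<dots> = (\<integral>\<^sup>+t. f t * indicator {0..<2 * pi} t \<partial>lborel)"
    using r by (intro nn_integral_cong) (auto split: split_indicator)
  finally show ?thesis .
qed

lemma sets_circle_measure [measurable_cong]: "sets circle_measure = sets (restrict_space borel (sphere 0 1))"
  by (simp add: circle_measure_def)

lemma nn_integral_circle:
  assumes F[measurable]: "F \<in> borel_measurable (restrict_space borel (sphere 0 1))"
  shows "(\<integral>\<^sup>+\<xi>. F \<xi> \<partial>circle_measure) = (\<integral>\<^sup>+t. F (cis t) * indicator {a..<a + 2 * pi} t \<partial>lborel)"
proof -
  have m: "cis \<in> restrict_space lborel {0..<2 * pi} \<rightarrow>\<^sub>M restrict_space borel (sphere 0 1)"
    using measurable_restrict_space1[OF measurable_cis_sphere, of "{0..<2 * pi}"]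
    unfolding measurable_cong_sets[OF sets_restrict_space_cong[OF sets_lborel] refl] .
  have "(\<integral>\<^sup>+\<xi>. F \<xi> \<partial>circle_measure) = (\<integral>\<^sup>+t. F (cis t) * indicator {0..<2 * pi} t \<partial>lborel)"
    unfolding circle_measure_def by (subst nn_integral_distr[OF m]) (use F in \<open>auto simp: nn_integral_restrict_space\<close>)
  also have "\<dots> = (\<integral>\<^sup>+t. F (cis t) * indicator {a..<a + 2 * pi} t \<partial>lborel)"
    by (rule periodic_nn_integral[symmetric]) (auto simp: cis_add_2pi intro: measurable_compose[OF measurable_cis_sphere F])
  finally show ?thesis .
qed

lemma arc_in_sets: "cis ` {a..b} \<in> sets (restrict_space borel (sphere 0 1))"
proof -
  have "compact (cis ` {a..b})" by (intro compact_continuous_image continuous_intros) auto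
  then have "cis ` {a..b} \<in> sets borel" by (intro borel_closed compact_imp_closed)
  moreover have "cis ` {a..b} \<subseteq> sphere 0 1" by auto
  ultimately show ?thesis by (subst sets_restrict_space_iff) auto
qed

lemma nn_integral_arc:
  assumes F[measurable]: "F \<in> borel_measurable (restrict_space borel (sphere 0 1))" and ab: "a < b" "b \<le> a + 2 * pi"
  shows "(\<integral>\<^sup>+\<xi>\<in>cis ` {a..b}. F \<xi> \<partial>circle_measure) = (\<integral>\<^sup>+t. F (cis t) * indicator {a..b} t \<partial>lborel)"
proof -
  have "(\<lambda>\<xi>. F \<xi> * indicator (cis ` {a..b}) \<xi>) \<in> borel_measurable (restrict_space borel (sphere 0 1))"
    using arc_in_sets by measurable
  then have "(\<integral>\<^sup>+\<xi>\<in>cis ` {a..b}. F \<xi> \<partial>circle_measure) = (\<integral>\<^sup>+t. (F (cis t) * indicator (cis ` {a..b}) (cis t)) * indicator {a..<a + 2 * pi} t \<partial>lborel)"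
    by (rule nn_integral_circle)
  also have "\<dots> = (\<integral>\<^sup>+t. F (cis t) * indicator {a..b} t \<partial>lborel)"
  proof (rule nn_integral_cong_AE)
    have "AE t in lborel. t \<noteq> a + 2 * pi" by (rule AE_lborel_singleton)
    then show "AE t in lborel. (F (cis t) * indicator (cis ` {a..b}) (cis t)) * indicator {a..<a + 2 * pi} t = F (cis t) * indicator {a..b} t"
    proof eventually_elim
      case (elim t)
      show ?case
      proof (cases "t \<in> {a..<a + 2 * pi}")
        case True
        have "cis t \<in> cis ` {a..b} \<longleftrightarrow> t \<in> {a..b}"
        proof
          assume "cis t \<in> cis ` {a..b}"
          then obtain u where u: "u \<in> {a..b}" "cis t = cis u" by auto
          show "t \<in> {a..b}"
          proof (cases "b = a + 2 * pi")
            case False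
            then have "\<bar>t - u\<bar> < 2 * pi" using u True ab by auto
            then show ?thesis using cis_eq_cis_imp[OF u(2)] u by simp
          qed (use True in auto)
        qed auto
        then show ?thesis using True by (auto split: split_indicator)
      next
        case False
        then show ?thesis using elim ab by (auto split: split_indicator)
      qed
    qed
  qed
  finally show ?thesis .
qed

lemma emeasure_arc:
  assumes "a < b" "b \<le> a + 2 * pi"
  shows "emeasure circle_measure (cis ` {a..b}) = ennreal (b - a)"
proof -
  have "emeasure circle_measure (cis ` {a..b}) = (\<integral>\<^sup>+\<xi>\<in>cis ` {a..b}. 1 \<partial>circle_measure)"
    using arc_in_sets[of a b] by (simp add: sets_circle_measure)
  also have "\<dots> = (\<integral>\<^sup>+t. 1 * indicator {a..b} t \<partial>lborel)" by (rule nn_integral_arc[OF _ assms]) simp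
  finally show ?thesis using assms by simp
qed

lemma arc_length_cis:
  assumes "a < b" "b \<le> a + 2 * pi"
  shows "arc_length (cis ` {a..b}) = (b - a) / (2 * pi)"
  unfolding arc_length_def measure_def emeasure_arc[OF assms] using assms by simp

lemma eventually_small_arcs:
  "eventually P small_arcs \<longleftrightarrow> (\<exists>\<delta>>0. \<forall>a b. a < b \<and> b \<le> a + 2 * pi \<and> b - a < \<delta> \<longrightarrow> P (cis ` {a..b}))"
proof
  assume "eventually P small_arcs"
  then have "\<forall>\<^sub>F I in filtercomap arc_length (at_right 0). I \<in> arcs \<longrightarrow> P I"
    by (simp add: small_arcs_def eventually_inf_principal)
  then obtain Q where Q: "eventually Q (at_right 0)" "\<And>I. Q (arc_length I) \<Longrightarrow> I \<in> arcs \<Longrightarrow> P I"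
    unfolding eventually_filtercomap by blast
  then obtain d where d: "d > 0" "\<And>y. 0 < y \<Longrightarrow> y < d \<Longrightarrow> Q y"
    unfolding eventually_at_right[OF zero_less_one] by auto
  show "\<exists>\<delta>>0. \<forall>a b. a < b \<and> b \<le> a + 2 * pi \<and> b - a < \<delta> \<longrightarrow> P (cis ` {a..b})"
  proof (intro exI[of _ "2 * pi * d"] conjI allI impI)
    fix a b :: real assume ab: "a < b \<and> b \<le> a + 2 * pi \<and> b - a < 2 * pi * d"
    have "Q (arc_length (cis ` {a..b}))"
      using ab by (subst arc_length_cis) (auto intro!: d(2) simp: field_simps)
    moreover have "cis ` {a..b} \<in> arcs" using ab by (auto simp: arcs_def)
    ultimately show "P (cis ` {a..b})" by (rule Q(2))
  qed (use d in simp)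
next
  assume "\<exists>\<delta>>0. \<forall>a b. a < b \<and> b \<le> a + 2 * pi \<and> b - a < \<delta> \<longrightarrow> P (cis ` {a..b})"
  then obtain \<delta> where \<delta>: "\<delta> > 0" "\<And>a b. a < b \<Longrightarrow> b \<le> a + 2 * pi \<Longrightarrow> b - a < \<delta> \<Longrightarrow> P (cis ` {a..b})" by blast
  have "\<forall>\<^sub>F y in at_right 0. y < \<delta> / (2 * pi)" using \<delta>(1) by (intro eventually_at_rightI[of 0 "\<delta> / (2 * pi)"]) auto
  then have "\<forall>\<^sub>F I in filtercomap arc_length (at_right 0). arc_length I < \<delta> / (2 * pi)"
    by (rule eventually_filtercomapI)
  then show "eventually P small_arcs"
    unfolding small_arcs_def eventually_inf_principal
  proof eventually_elim
    case (elim I)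
    show ?case
    proof
      assume "I \<in> arcs"
      then obtain a b where I: "I = cis ` {a..b}" "a < b" "b \<le> a + 2 * pi" by (auto simp: arcs_def)
      then have "(b - a) / (2 * pi) < \<delta> / (2 * pi)" using elim by (simp add: arc_length_cis)
      then have "b - a < \<delta>" by (simp add: divide_less_cancel)
      then show "P I" unfolding I(1) using I(2,3) by (intro \<delta>(2))
    qed
  qed
qed

lemma tendsto_zero_ennreal_iff:
  "((f :: 'a \<Rightarrow> ennreal) \<longlongrightarrow> 0) F \<longleftrightarrow> (\<forall>\<epsilon>>0. \<forall>\<^sub>F x in F. f x \<le> ennreal \<epsilon>)"
proof
  assume f: "(f \<longlongrightarrow> 0) F"
  show "\<forall>\<epsilon>>0. \<forall>\<^sub>F x in F. f x \<le> ennreal \<epsilon>"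
  proof (intro allI impI)
    fix \<epsilon> :: real assume "\<epsilon> > 0"
    then have "\<forall>\<^sub>F x in F. f x < ennreal \<epsilon>" using order_tendstoD(2)[OF f] by simp
    then show "\<forall>\<^sub>F x in F. f x \<le> ennreal \<epsilon>" by eventually_elim simp
  qed
next
  assume *: "\<forall>\<epsilon>>0. \<forall>\<^sub>F x in F. f x \<le> ennreal \<epsilon>"
  show "(f \<longlongrightarrow> 0) F"
  proof (rule order_tendstoI)
    fix e :: ennreal assume "0 < e"
    then obtain x where x: "0 < x" "x < e" using dense by blast
    then obtain r where "x = ennreal r" by (cases x) auto
    with x have r: "0 < ennreal r" "ennreal r < e" by auto
    then have "\<forall>\<^sub>F x in F. f x \<le> ennreal r" using * by simp
    then show "\<forall>\<^sub>F x in F. f x < e" using r by (auto elim!: eventually_mono)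
  qed simp
qed

text \<open>Stated as an equivalence for every l, so that \<open>Lim\<close> takes the same value in
  both coordinates even at points where no limit exists.\<close>

lemma tendsto_at_left_1_exp:
  fixes f :: "real \<Rightarrow> complex"
  shows "(f \<longlongrightarrow> l) (at_left 1) \<longleftrightarrow> ((\<lambda>s. f (exp s)) \<longlongrightarrow> l) (at_left 0)"
proof
  have e: "filterlim (exp :: real \<Rightarrow> real) (at_left 1) (at_left 0)"
    unfolding filterlim_at
  proof
    show "(exp \<longlongrightarrow> (1::real)) (at_left 0)" using tendsto_exp[OF tendsto_ident_at, of 0 "{..<0}"] by simp
    show "\<forall>\<^sub>F x in at_left 0. exp x \<in> {..<(1::real)} \<and> exp x \<noteq> 1"
      by (intro eventually_at_leftI[of "-1"]) auto
  qed
  show "((\<lambda>s. f (exp s)) \<longlongrightarrow> l) (at_left 0)" if "(f \<longlongrightarrow> l) (at_left 1)"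
    using that e by (rule filterlim_compose)
next
  have ln: "filterlim (ln :: real \<Rightarrow> real) (at_left 0) (at_left 1)"
    unfolding filterlim_at
  proof
    show "(ln \<longlongrightarrow> (0::real)) (at_left 1)" using tendsto_ln[OF tendsto_ident_at, of 1 "{..<1}"] by simp
    show "\<forall>\<^sub>F x in at_left 1. ln x \<in> {..<(0::real)} \<and> ln x \<noteq> 0"
      by (intro eventually_at_leftI[of "1/2"]) auto
  qed
  assume "((\<lambda>s. f (exp s)) \<longlongrightarrow> l) (at_left 0)"
  then have "((\<lambda>r. f (exp (ln r))) \<longlongrightarrow> l) (at_left 1)" using ln by (rule filterlim_compose)
  moreover have "\<forall>\<^sub>F r in at_left (1::real). f (exp (ln r)) = f r"
    by (intro eventually_at_leftI[of "1/2"]) auto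
  ultimately show "(f \<longlongrightarrow> l) (at_left 1)" by (simp add: tendsto_cong)
qed

lemma radial_limit_eq_Lim_exp: "radial_limit g \<xi> = Lim (at_left 0) (\<lambda>s. g (of_real (exp s) * \<xi>))"
  unfolding radial_limit_def Topological_Spaces.Lim_def tendsto_at_left_1_exp ..

lemma radial_limit_cis: "radial_limit g (cis t) = boundary_value g t"
  unfolding radial_limit_eq_Lim_exp boundary_value_def exp_eq_cis ..

text \<open>The limit is taken over uncountably many radii, but each inequality of the Cauchy
  criterion defines a closed set, and so does any intersection of them. Hence the set
  \<open>Cv\<close> of convergence is Borel; on it a sequence of radii computes the limit, and off
  it the value is constant.\<close>

lemma radial_limit_measurable [measurable]:
  assumes hol: "g holomorphic_on ball 0 1"
  shows "radial_limit g \<in> borel_measurable (restrict_space borel (sphere 0 1))"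
proof -
  define F where "F = (\<lambda>s \<xi>. g (of_real (exp s) * \<xi>))"
  have cF: "continuous_on (sphere 0 1) (F s)" if "s < 0" for s
    unfolding F_def
    by (rule continuous_on_compose2[OF holomorphic_on_imp_continuous_on[OF hol]]) (use that in \<open>auto intro!: continuous_intros simp: norm_mult\<close>)
  define A where "A = (\<lambda>k N::nat. {\<xi> \<in> sphere 0 1. \<forall>s s'. - 1 / (real N + 1) < s \<and> s < 0 \<and> - 1 / (real N + 1) < s' \<and> s' < 0 \<longrightarrow> cmod (F s \<xi> - F s' \<xi>) \<le> 1 / (real k + 1)})"
  have "closed (A k N)" for k N
  proof -
    let ?I = "{- 1 / (real N + 1)<..<0}"
    have "A k N = sphere 0 1 \<inter> (\<Inter>s\<in>?I. \<Inter>s'\<in>?I. {\<xi> \<in> sphere 0 1. cmod (F s \<xi> - F s' \<xi>) \<le> 1 / (real k + 1)})"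
      by (auto simp: A_def)
    moreover have "closed {\<xi> \<in> sphere 0 1. cmod (F s \<xi> - F s' \<xi>) \<le> 1 / (real k + 1)}" if "s < 0" "s' < 0" for s s'
    proof -
      have "closed (sphere 0 1 \<inter> (\<lambda>\<xi>. cmod (F s \<xi> - F s' \<xi>)) -` {..1 / (real k + 1)})"
        by (intro continuous_closed_preimage continuous_intros cF that closed_sphere closed_atMost)
      then show ?thesis by (simp add: vimage_def Int_def)
    qed
    ultimately show ?thesis by (auto intro!: closed_Int closed_INT)
  qed
  then have mA[measurable]: "A k N \<in> sets (restrict_space borel (sphere 0 1))" for k N
    by (subst sets_restrict_space_iff) (auto simp: A_def)
  define Cv where "Cv = (\<Inter>k. \<Union>N. A k N)"
  have Cv[measurable]: "Cv \<in> sets (restrict_space borel (sphere 0 1))" unfolding Cv_def by measurable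
  define X where "X = (\<lambda>n::nat. F (- 1 / (real n + 1)))"
  have Xlim: "filterlim (\<lambda>n::nat. - 1 / (real n + 1)) (at_left 0) sequentially"
    unfolding filterlim_at
  proof
    show "(\<lambda>n::nat. - 1 / (real n + 1)) \<longlonglongrightarrow> 0" by real_asymp
    show "\<forall>\<^sub>F n in sequentially. - 1 / (real n + 1) \<in> {..<0} \<and> - 1 / (real n + 1) \<noteq> 0"
      by (intro always_eventually) (auto simp: divide_less_0_iff)
  qed
  have conv: "\<xi> \<in> Cv \<longleftrightarrow> (\<exists>l. ((\<lambda>s. F s \<xi>) \<longlongrightarrow> l) (at_left 0))" if \<xi>: "\<xi> \<in> sphere 0 1" for \<xi>
  proof
    assume cv: "\<xi> \<in> Cv"
    show "\<exists>l. ((\<lambda>s. F s \<xi>) \<longlongrightarrow> l) (at_left 0)"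
    proof (rule tendsto_at_left_0_Cauchy)
      fix e :: real assume "e > 0"
      then obtain k :: nat where k: "1 / (real k + 1) < e" using reals_Archimedean[of e] by (auto simp: inverse_eq_divide add.commute)
      obtain N where N: "\<xi> \<in> A k N" using cv by (auto simp: Cv_def)
      show "\<exists>\<kappa>>0. \<forall>s s'. - \<kappa> < s \<and> s < 0 \<and> - \<kappa> < s' \<and> s' < 0 \<longrightarrow> cmod (F s \<xi> - F s' \<xi>) \<le> e"
      proof (intro exI[of _ "1 / (real N + 1)"] conjI allI impI)
        fix s s' assume "- (1 / (real N + 1)) < s \<and> s < 0 \<and> - (1 / (real N + 1)) < s' \<and> s' < 0"
        then have "cmod (F s \<xi> - F s' \<xi>) \<le> 1 / (real k + 1)" using N by (simp add: A_def)
        then show "cmod (F s \<xi> - F s' \<xi>) \<le> e" using k by linarith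
      qed simp
    qed
  next
    assume "\<exists>l. ((\<lambda>s. F s \<xi>) \<longlongrightarrow> l) (at_left 0)"
    then obtain l where l: "((\<lambda>s. F s \<xi>) \<longlongrightarrow> l) (at_left 0)" ..
    have "\<exists>N. \<xi> \<in> A k N" for k
    proof -
      have "\<forall>\<^sub>F s in at_left 0. dist (F s \<xi>) l < 1 / (real k + 1) / 2" using l by (rule tendstoD) simp
      then obtain b where b: "b < 0" "\<And>s. b < s \<Longrightarrow> s < 0 \<Longrightarrow> dist (F s \<xi>) l < 1 / (real k + 1) / 2"
        unfolding eventually_at_left[of "- 1" "0::real", simplified] by auto
      obtain N :: nat where N: "1 / (- b) < real N" using reals_Archimedean2 by blast
      have bN: "b < - 1 / (real N + 1)"
      proof -
        have "1 / (- b) < real N + 1" using N by linarith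
        then show ?thesis using b(1) by (simp add: field_simps)
      qed
      have "cmod (F s \<xi> - F s' \<xi>) \<le> 1 / (real k + 1)" if "- 1 / (real N + 1) < s" "s < 0" "- 1 / (real N + 1) < s'" "s' < 0" for s s'
      proof -
        have "dist (F s \<xi>) l < 1 / (real k + 1) / 2" "dist (F s' \<xi>) l < 1 / (real k + 1) / 2"
          using b(2)[of s] b(2)[of s'] that bN by linarith+
        then have "dist (F s \<xi>) (F s' \<xi>) < 1 / (real k + 1) / 2 + 1 / (real k + 1) / 2"
          using dist_triangle2[of "F s \<xi>" "F s' \<xi>" l] by linarith
        then show ?thesis unfolding field_sum_of_halves dist_norm by simp
      qed
      then show ?thesis using \<xi> unfolding A_def by (intro exI[of _ N]) blast
    qed
    then show "\<xi> \<in> Cv" by (auto simp: Cv_def)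
  qed
  have X[measurable]: "X n \<in> borel_measurable (restrict_space borel (sphere 0 1))" for n
    unfolding X_def by (rule borel_measurable_continuous_on_restrict[OF cF]) (simp add: divide_less_0_iff)
  \<comment> \<open>\<open>Lim\<close> is a definite description; where nothing satisfies it, it is
    the one constant \<open>THE l. False\<close>.\<close>
  have "(\<lambda>\<xi>. if \<xi> \<in> Cv then lim (\<lambda>n. X n \<xi>) else (THE l. False)) \<in> borel_measurable (restrict_space borel (sphere 0 1))"
    by (intro measurable_If_set borel_measurable_lim_metric X borel_measurable_const) (subst sets.Int_space_eq2[OF Cv], rule Cv)
  moreover have "radial_limit g \<xi> = (if \<xi> \<in> Cv then lim (\<lambda>n. X n \<xi>) else (THE l. False))"
    if "\<xi> \<in> space (restrict_space borel (sphere 0 1))" for \<xi>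
  proof -
    have \<xi>: "\<xi> \<in> sphere 0 1" using that by (simp add: space_restrict_space)
    have rl: "radial_limit g \<xi> = (THE l. ((\<lambda>s. F s \<xi>) \<longlongrightarrow> l) (at_left 0))"
      unfolding radial_limit_eq_Lim_exp F_def Topological_Spaces.Lim_def ..
    show ?thesis
    proof (cases "\<xi> \<in> Cv")
      case True
      then obtain l where l: "((\<lambda>s. F s \<xi>) \<longlongrightarrow> l) (at_left 0)" using conv[OF \<xi>] by blast
      have "radial_limit g \<xi> = l" unfolding rl
        by (rule the_equality, rule l, rule tendsto_unique[OF trivial_limit_at_left_real _ l])
      moreover have "(\<lambda>n. X n \<xi>) \<longlonglongrightarrow> l" unfolding X_def using l Xlim by (rule filterlim_compose)
      then have "lim (\<lambda>n. X n \<xi>) = l" by (rule limI)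
      ultimately show ?thesis using True by (simp only: if_True)
    next
      case False
      then have "\<not> ((\<lambda>s. F s \<xi>) \<longlongrightarrow> l) (at_left 0)" for l using conv[OF \<xi>] by blast
      then show ?thesis unfolding rl using False by (simp only: if_False)
    qed
  qed
  ultimately show ?thesis by (subst measurable_cong)
qed

lemma boundary_value_measurable [measurable]:
  assumes "g holomorphic_on ball 0 1"
  shows "boundary_value g \<in> borel_measurable borel"
  using measurable_compose[OF measurable_cis_sphere radial_limit_measurable[OF assms]] by (simp add: radial_limit_cis)

lemma nn_integral_interval:
  fixes f :: "real \<Rightarrow> real"
  assumes "continuous_on {x..y} f" "\<And>t. t \<in> {x..y} \<Longrightarrow> f t \<ge> 0"
  shows "(\<integral>\<^sup>+t. ennreal (f t) * indicator {x..y} t \<partial>lborel) = ennreal (integral {x..y} f)"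
  by (intro nn_integral_has_integral_lebesgue' integrable_integral integrable_continuous_interval assms)

section \<open>The Hardy space and the oscillation spaces in terms of slices\<close>

lemma slice_nn_integral:
  assumes hol: "g holomorphic_on ball 0 1" and s: "s < 0"
  shows "(\<integral>\<^sup>+\<xi>. ennreal ((cmod (g (of_real (exp s) * \<xi>)))\<^sup>2) \<partial>circle_measure) = ennreal (slice_norm g s)"
proof -
  have "continuous_on (sphere 0 1) (\<lambda>\<xi>. g (of_real (exp s) * \<xi>))"
    by (rule continuous_on_compose2[OF holomorphic_on_imp_continuous_on[OF hol]]) (use s in \<open>auto intro!: continuous_intros simp: norm_mult\<close>)
  then have c: "continuous_on (sphere 0 1) (\<lambda>\<xi>. (cmod (g (of_real (exp s) * \<xi>)))\<^sup>2)"
    by (intro continuous_intros)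
  have "(\<integral>\<^sup>+\<xi>. ennreal ((cmod (g (of_real (exp s) * \<xi>)))\<^sup>2) \<partial>circle_measure)
    = (\<integral>\<^sup>+t. ennreal ((cmod (g (of_real (exp s) * cis t)))\<^sup>2) * indicator {0..<0 + 2 * pi} t \<partial>lborel)"
    by (rule nn_integral_circle) (intro measurable_compose[OF _ measurable_ennreal] borel_measurable_continuous_on_restrict c)
  also have "\<dots> = (\<integral>\<^sup>+t. ennreal ((cmod (g (exp (Complex s t))))\<^sup>2) * indicator {0..2 * pi} t \<partial>lborel)"
  proof (rule nn_integral_cong_AE)
    have "AE t in lborel. t \<noteq> 2 * pi" by (rule AE_lborel_singleton)
    then show "AE t in lborel. ennreal ((cmod (g (of_real (exp s) * cis t)))\<^sup>2) * indicator {0..<0 + 2 * pi} t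
      = ennreal ((cmod (g (exp (Complex s t))))\<^sup>2) * indicator {0..2 * pi} t"
      by eventually_elim (auto simp: exp_eq_cis split: split_indicator)
  qed
  also have "\<dots> = ennreal (slice_norm g s)"
    unfolding slice_norm_def
    by (intro nn_integral_interval continuous_intros half_plane_continuous_line(1)[OF disc_lift_holomorphic[OF hol] s]) auto
  finally show ?thesis .
qed

lemma hardy2_iff_slice_norm:
  "g \<in> hardy2 \<longleftrightarrow> g holomorphic_on ball 0 1 \<and> (\<exists>M. \<forall>s<0. slice_norm g s \<le> M)"
proof (cases "g holomorphic_on ball 0 1")
  case hol: True
  let ?I = "\<lambda>r. \<integral>\<^sup>+\<xi>. ennreal ((cmod (g (of_real r * \<xi>)))\<^sup>2) \<partial>circle_measure"
  have "(SUP r\<in>{0<..<1::real}. ?I r) < \<infinity> \<longleftrightarrow> (\<exists>M. \<forall>s<0. slice_norm g s \<le> M)"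
  proof
    assume "(SUP r\<in>{0<..<1::real}. ?I r) < \<infinity>"
    then obtain M where M: "M \<ge> 0" "(SUP r\<in>{0<..<1::real}. ?I r) = ennreal M" by (cases "SUP r\<in>{0<..<1::real}. ?I r") auto
    have "slice_norm g s \<le> M" if "s < 0" for s
    proof -
      have "ennreal (slice_norm g s) = ?I (exp s)" by (rule slice_nn_integral[OF hol that, symmetric])
      also have "\<dots> \<le> ennreal M" unfolding M(2)[symmetric] by (rule SUP_upper) (use that in auto)
      finally show ?thesis using M(1) by simp
    qed
    then show "\<exists>M. \<forall>s<0. slice_norm g s \<le> M" by blast
  next
    assume "\<exists>M. \<forall>s<0. slice_norm g s \<le> M"
    then obtain M where M: "\<forall>s<0. slice_norm g s \<le> M" by blast
    have "(SUP r\<in>{0<..<1::real}. ?I r) \<le> ennreal M"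
    proof (rule SUP_least)
      fix r :: real assume r: "r \<in> {0<..<1}"
      have "?I (exp (ln r)) = ennreal (slice_norm g (ln r))" by (rule slice_nn_integral[OF hol]) (use r in simp)
      then show "?I r \<le> ennreal M" using M r by (simp add: ennreal_leI)
    qed
    also have "\<dots> < \<infinity>" by simp
    finally show "(SUP r\<in>{0<..<1::real}. ?I r) < \<infinity>" .
  qed
  then show ?thesis using hol by (simp add: hardy2_def)
qed (simp add: hardy2_def)

lemma cmod_diff_square_le: "(cmod (x - z))\<^sup>2 \<le> 2 * (cmod (x - y))\<^sup>2 + 2 * (cmod (y - z))\<^sup>2"
proof -
  have "cmod (x - z) \<le> cmod (x - y) + cmod (y - z)" using norm_triangle_ineq[of "x - y" "y - z"] by simp
  then have "(cmod (x - z))\<^sup>2 \<le> (cmod (x - y) + cmod (y - z))\<^sup>2" by (intro power_mono) auto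
  also have "\<dots> \<le> 2 * (cmod (x - y))\<^sup>2 + 2 * (cmod (y - z))\<^sup>2"
    using zero_le_power2[of "cmod (x - y) - cmod (y - z)"] by (simp add: power2_eq_square algebra_simps)
  finally show ?thesis .
qed

text \<open>The mean differs from c by at most sqrt (K / m), so replacing c by the mean costs 2 K +
  2 K. The pointwise bound of |f - c| by (l + |f - c|^2 / l) / 2 with l = sqrt (K / m) gives both
  this estimate and the integrability of f on A.\<close>

lemma nn_integral_about_mean:
  fixes f :: "'a \<Rightarrow> complex"
  assumes f[measurable]: "f \<in> borel_measurable M" and A[measurable]: "A \<in> sets M"
    and m: "emeasure M A = ennreal m" "m > 0" and K: "K > 0" "(\<integral>\<^sup>+x\<in>A. ennreal ((cmod (f x - c))\<^sup>2) \<partial>M) \<le> ennreal K"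
  shows "(\<integral>\<^sup>+x\<in>A. ennreal ((cmod (f x - (LINT x:A|M. f x) / of_real m))\<^sup>2) \<partial>M) \<le> ennreal (4 * K)"
proof -
  define q where "q = (\<lambda>x. indicator A x * (cmod (f x - c))\<^sup>2)"
  define h where "h = (\<lambda>x. indicator A x *\<^sub>R (f x - c))"
  define l where "l = sqrt (K / m)"
  have l: "l > 0" "l\<^sup>2 = K / m" using K m by (auto simp: l_def)
  have mq[measurable]: "q \<in> borel_measurable M" and mh[measurable]: "h \<in> borel_measurable M" unfolding q_def h_def by measurable
  have qnn: "q x \<ge> 0" for x by (simp add: q_def)
  have nq: "(\<integral>\<^sup>+x. ennreal (q x) \<partial>M) = (\<integral>\<^sup>+x\<in>A. ennreal ((cmod (f x - c))\<^sup>2) \<partial>M)"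
    by (intro nn_integral_cong) (auto simp: q_def split: split_indicator)
  have iq: "integrable M q"
    by (rule integrableI_nonneg) (use qnn nq K(2) in \<open>auto simp: le_less_trans[OF _ ennreal_less_top]\<close>)
  have Q: "integral\<^sup>L M q \<le> K"
  proof -
    have "ennreal (integral\<^sup>L M q) \<le> ennreal K" using nn_integral_eq_integral[OF iq] qnn nq K(2) by simp
    then show ?thesis using K(1) by simp
  qed
  have ii: "integrable M (indicator A :: 'a \<Rightarrow> real)" using m by (intro integrable_real_indicator) auto
  have iI: "integral\<^sup>L M (indicator A :: 'a \<Rightarrow> real) = m" using m A by (simp add: measure_def)
  let ?b = "\<lambda>x. (l * indicator A x + q x / l) / 2"
  have ib: "integrable M ?b" using ii iq by auto
  have bnd: "norm (h x) \<le> ?b x" for x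
  proof -
    have "0 \<le> (l - cmod (f x - c))\<^sup>2 / l" using l by simp
    then have "2 * cmod (f x - c) \<le> l + (cmod (f x - c))\<^sup>2 / l" using l by (simp add: power2_eq_square field_simps)
    then show ?thesis by (auto simp: h_def q_def split: split_indicator)
  qed
  have bnn: "?b x \<ge> 0" for x using bnd[of x] norm_ge_zero[of "h x"] by linarith
  have ih: "integrable M h"
    by (rule Bochner_Integration.integrable_bound[OF ib mh]) (use bnd bnn in auto)
  have "norm (integral\<^sup>L M h) \<le> integral\<^sup>L M ?b" by (rule order.trans[OF integral_norm_bound integral_mono[OF integrable_norm[OF ih] ib]]) (rule bnd)
  also have "\<dots> = (l * m + integral\<^sup>L M q / l) / 2" using ii iq iI by simp
  also have "\<dots> \<le> (l * m + K / l) / 2" using Q l by (simp add: divide_right_mono)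
  also have "K / l = l * m" using l m by (simp add: power2_eq_square field_simps)
  finally have nh: "norm (integral\<^sup>L M h) \<le> l * m" by simp
  have "(LINT x:A|M. f x) = integral\<^sup>L M (\<lambda>x. h x + indicator A x *\<^sub>R c)"
    unfolding set_lebesgue_integral_def by (intro Bochner_Integration.integral_cong) (auto simp: h_def algebra_simps)
  also have "\<dots> = integral\<^sup>L M h + integral\<^sup>L M (\<lambda>x. indicator A x *\<^sub>R c)"
    using ih ii by (intro Bochner_Integration.integral_add) auto
  also have "integral\<^sup>L M (\<lambda>x. indicator A x *\<^sub>R c) = of_real m * c" using ii iI by (simp add: scaleR_conv_of_real)
  finally have L: "(LINT x:A|M. f x) = integral\<^sup>L M h + of_real m * c" .
  define v where "v = (LINT x:A|M. f x) / of_real m"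
  have "c - v = - (integral\<^sup>L M h / of_real m)" unfolding v_def L using m by (simp add: field_simps)
  then have "cmod (c - v) = norm (integral\<^sup>L M h) / m" using m by (simp add: norm_divide)
  also have "\<dots> \<le> l" using nh m by (simp add: divide_le_eq)
  finally have "(cmod (c - v))\<^sup>2 \<le> l\<^sup>2" by (intro power_mono) auto
  then have cv: "(cmod (c - v))\<^sup>2 \<le> K / m" using l by simp
  have "(\<integral>\<^sup>+x\<in>A. ennreal ((cmod (f x - v))\<^sup>2) \<partial>M) \<le> (\<integral>\<^sup>+x. 2 * (ennreal ((cmod (f x - c))\<^sup>2) * indicator A x) + ennreal (2 * (K / m)) * indicator A x \<partial>M)"
  proof (rule nn_integral_mono)
    fix x
    have "ennreal ((cmod (f x - v))\<^sup>2) \<le> ennreal (2 * (cmod (f x - c))\<^sup>2 + 2 * (K / m))"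
      using cmod_diff_square_le[of "f x" v c] cv by (intro ennreal_leI) linarith
    also have "\<dots> = 2 * ennreal ((cmod (f x - c))\<^sup>2) + ennreal (2 * (K / m))"
      using K m by (simp add: ennreal_plus ennreal_mult)
    finally show "ennreal ((cmod (f x - v))\<^sup>2) * indicator A x \<le> 2 * (ennreal ((cmod (f x - c))\<^sup>2) * indicator A x) + ennreal (2 * (K / m)) * indicator A x"
      by (auto split: split_indicator)
  qed
  also have "\<dots> = (\<integral>\<^sup>+x. 2 * (ennreal ((cmod (f x - c))\<^sup>2) * indicator A x) \<partial>M) + (\<integral>\<^sup>+x. ennreal (2 * (K / m)) * indicator A x \<partial>M)"
    by (rule nn_integral_add) measurable
  also have "(\<integral>\<^sup>+x. 2 * (ennreal ((cmod (f x - c))\<^sup>2) * indicator A x) \<partial>M) = 2 * (\<integral>\<^sup>+x\<in>A. ennreal ((cmod (f x - c))\<^sup>2) \<partial>M)"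
    by (rule nn_integral_cmult) measurable
  also have "(\<integral>\<^sup>+x. ennreal (2 * (K / m)) * indicator A x \<partial>M) = ennreal (2 * (K / m)) * ennreal m"
    unfolding nn_integral_cmult_indicator[OF A] m(1) ..
  also have "2 * (\<integral>\<^sup>+x\<in>A. ennreal ((cmod (f x - c))\<^sup>2) \<partial>M) + ennreal (2 * (K / m)) * ennreal m \<le> 2 * ennreal K + ennreal (2 * (K / m)) * ennreal m"
    using K(2) by (intro add_mono mult_left_mono) auto
  also have "\<dots> = ennreal (2 * K) + ennreal (2 * (K / m) * m)"
    using K m by (subst (1 2) ennreal_mult) simp_all
  also have "\<dots> = ennreal (4 * K)" using K m by (simp flip: ennreal_plus)
  finally show ?thesis unfolding v_def .
qed

lemma integral_subinterval_le:
  fixes f :: "real \<Rightarrow> real"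
  assumes "continuous_on UNIV f" "\<And>t. f t \<ge> 0" "{x..y} \<subseteq> {a..b}"
  shows "integral {x..y} f \<le> integral {a..b} f"
  by (rule integral_subset_le[OF assms(3)]) (auto intro!: integrable_continuous_interval continuous_on_subset[OF assms(1)] assms(2))

lemma arc_oscillation_le:
  assumes hol: "g holomorphic_on ball 0 1" and M: "\<forall>s<0. slice_norm g s \<le> M"
    and ab: "a < b" "b \<le> a + 2 * pi" and K: "K > 0"
    and s0: "s0 < 0" "\<And>s. s0 \<le> s \<Longrightarrow> s < 0 \<Longrightarrow> integral {a..b} (\<lambda>t. (cmod (g (exp (Complex s t)) - c))\<^sup>2) \<le> K"
  shows "(\<integral>\<^sup>+\<xi>\<in>cis ` {a..b}. ennreal ((cmod (radial_limit g \<xi> - arc_mean g (cis ` {a..b})))\<^sup>2) \<partial>circle_measure) \<le> ennreal (4 * K)"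
proof -
  note m[measurable] = radial_limit_measurable[OF hol]
  have mc: "radial_limit g \<in> borel_measurable circle_measure" by measurable
  have A: "cis ` {a..b} \<in> sets circle_measure" using arc_in_sets by (simp add: sets_circle_measure)
  have "(\<integral>\<^sup>+\<xi>\<in>cis ` {a..b}. ennreal ((cmod (radial_limit g \<xi> - c))\<^sup>2) \<partial>circle_measure)
    = (\<integral>\<^sup>+t. ennreal ((cmod (boundary_value g t - c))\<^sup>2) * indicator {a..b} t \<partial>lborel)"
    unfolding radial_limit_cis[symmetric] by (rule nn_integral_arc[OF _ ab]) measurable
  also have "\<dots> \<le> ennreal K"
    by (rule boundary_value_fatou[OF hol M, where a = a]) (use ab s0 in auto)
  finally have cK: "(\<integral>\<^sup>+\<xi>\<in>cis ` {a..b}. ennreal ((cmod (radial_limit g \<xi> - c))\<^sup>2) \<partial>circle_measure) \<le> ennreal K" .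
  have "(\<integral>\<^sup>+x\<in>cis ` {a..b}. ennreal ((cmod (radial_limit g x - (LINT x:cis ` {a..b}|circle_measure. radial_limit g x) / of_real (b - a)))\<^sup>2) \<partial>circle_measure) \<le> ennreal (4 * K)"
    by (rule nn_integral_about_mean[where c = c]) (use mc A emeasure_arc[OF ab] ab K cK in auto)
  then show ?thesis unfolding arc_mean_def arc_length_cis[OF ab] using ab by simp
qed

lemma mean_oscillation_le:
  assumes "strip_oscillation p C (\<lambda>w. g (exp w))" and C: "C > 0"
    and hol: "g holomorphic_on ball 0 1" and M: "\<forall>s<0. slice_norm g s \<le> M"
  shows "\<exists>\<delta>>0. \<forall>a b. a < b \<and> b \<le> a + 2 * pi \<and> b - a < \<delta> \<longrightarrow> mean_oscillation p g (cis ` {a..b}) \<le> ennreal (4 * pi powr p * C)"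
proof -
  obtain \<delta> where \<delta>: "\<delta> > 0" "\<forall>L a. 0 < L \<and> L \<le> \<delta> \<longrightarrow> (\<exists>c s2. s2 < 0 \<and> (\<forall>s1. s2 \<le> s1 \<and> s1 < 0 \<longrightarrow>
     integral {a - L..a + L} (\<lambda>t. (cmod (g (exp (Complex s1 t)) - c))\<^sup>2) \<le> C * L powr p))"
    using assms(1) unfolding strip_oscillation_def by blast
  show ?thesis
  proof (intro exI[of _ \<delta>] conjI allI impI \<delta>(1))
    fix a b :: real assume ab': "a < b \<and> b \<le> a + 2 * pi \<and> b - a < \<delta>"
    then have ab: "a < b" "b \<le> a + 2 * pi" "b - a < \<delta>" by auto
    define L where "L = (b - a) / 2"
    define x where "x = (a + b) / 2"
    have L: "0 < L" "L \<le> \<delta>" "x - L = a" "x + L = b" using ab by (auto simp: L_def x_def field_simps)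
    obtain c s2 where c: "s2 < 0" "\<forall>s1. s2 \<le> s1 \<and> s1 < 0 \<longrightarrow>
     integral {x - L..x + L} (\<lambda>t. (cmod (g (exp (Complex s1 t)) - c))\<^sup>2) \<le> C * L powr p" using \<delta>(2) L(1,2) by blast
    have "(\<integral>\<^sup>+\<xi>\<in>cis ` {a..b}. ennreal ((cmod (radial_limit g \<xi> - arc_mean g (cis ` {a..b})))\<^sup>2) \<partial>circle_measure) \<le> ennreal (4 * (C * L powr p))"
      by (rule arc_oscillation_le[OF hol M ab(1,2) _ c(1)]) (use c(2) L C in auto)
    then have "mean_oscillation p g (cis ` {a..b}) \<le> ennreal (arc_length (cis ` {a..b}) powr (- p)) * ennreal (4 * (C * L powr p))"
      unfolding mean_oscillation_def by (rule mult_left_mono) simp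
    also have "arc_length (cis ` {a..b}) = L / pi" using arc_length_cis[OF ab(1,2)] by (simp add: L_def)
    also have "ennreal ((L / pi) powr (- p)) * ennreal (4 * (C * L powr p)) = ennreal (4 * pi powr p * C)"
      using L C by (simp add: powr_divide powr_minus field_simps flip: ennreal_mult)
    finally show "mean_oscillation p g (cis ` {a..b}) \<le> ennreal (4 * pi powr p * C)" .
  qed
qed

text \<open>Slices near the boundary inherit the oscillation of the boundary values because they are
  close to them in mean square. How near they have to be depends on \<open>L\<close>, which is why
  \<open>strip_oscillation\<close> admits a threshold \<open>s2\<close>.\<close>

lemma strip_oscillation_of_arcs:
  assumes hol: "g holomorphic_on ball 0 1" and M: "\<forall>s<0. slice_norm g s \<le> M" and C: "C > 0" and p: "p > 0"
    and "\<exists>\<delta>>0. \<forall>a b. a < b \<and> b \<le> a + 2 * pi \<and> b - a < \<delta> \<longrightarrow> mean_oscillation p g (cis ` {a..b}) \<le> ennreal C"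
  shows "strip_oscillation p (3 * C) (\<lambda>w. g (exp w))"
proof -
  let ?G = "\<lambda>s t. g (exp (Complex s t))"
  obtain \<delta> where \<delta>: "\<delta> > 0" "\<forall>a b. a < b \<and> b \<le> a + 2 * pi \<and> b - a < \<delta> \<longrightarrow> mean_oscillation p g (cis ` {a..b}) \<le> ennreal C"
    using assms(5) by blast
  note m[measurable] = radial_limit_measurable[OF hol] and bm[measurable] = boundary_value_measurable[OF hol]
  show ?thesis unfolding strip_oscillation_def
  proof (intro exI[of _ "min (\<delta> / 4) 1"] conjI allI impI)
    fix L a :: real assume L': "0 < L \<and> L \<le> min (\<delta> / 4) 1"
    then have L: "L > 0" "2 * L < \<delta>" "L \<le> 1" using \<delta>(1) by auto
    have ab: "a - L < a + L" "a + L \<le> a - L + 2 * pi" using L pi_gt3 by linarith+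
    define I where "I = cis ` {a - L..a + L}"
    define c where "c = arc_mean g I"
    have len: "arc_length I = L / pi" unfolding I_def arc_length_cis[OF ab] by simp
    define X where "X = (\<integral>\<^sup>+\<xi>\<in>I. ennreal ((cmod (radial_limit g \<xi> - c))\<^sup>2) \<partial>circle_measure)"
    have "mean_oscillation p g I \<le> ennreal C" unfolding I_def using \<delta>(2) ab L by auto
    then have le: "ennreal ((L / pi) powr (- p)) * X \<le> ennreal C" by (simp add: mean_oscillation_def len X_def c_def)
    have "X = ennreal ((L / pi) powr p) * (ennreal ((L / pi) powr (- p)) * X)"
      using L by (simp add: mult.assoc[symmetric] powr_minus flip: ennreal_mult)
    also have "\<dots> \<le> ennreal ((L / pi) powr p) * ennreal C" using le by (rule mult_left_mono) simp
    also have "\<dots> = ennreal ((L / pi) powr p * C)" using C by (simp add: ennreal_mult)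
    also have "\<dots> \<le> ennreal (L powr p * C)"
    proof -
      have "L / pi \<le> L / 1" using L pi_gt3 by (intro divide_left_mono) auto
      then show ?thesis using L C p by (intro ennreal_leI mult_right_mono powr_mono2) auto
    qed
    finally have X: "X \<le> ennreal (L powr p * C)" .
    have X2: "X = (\<integral>\<^sup>+t. ennreal ((cmod (boundary_value g t - c))\<^sup>2) * indicator {a - L..a + L} t \<partial>lborel)"
      unfolding X_def I_def radial_limit_cis[symmetric] by (rule nn_integral_arc[OF _ ab]) measurable
    \<comment> \<open>The distance of slice and boundary values enters with factor 2 and adds one C
      * L powr p to the two that come from the arc; this is the 3 in the conclusion.\<close>
    define \<epsilon> where "\<epsilon> = C * L powr p / 2"
    have \<epsilon>: "\<epsilon> > 0" using C L by (simp add: \<epsilon>_def)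
    obtain s0 where s0: "s0 < 0" "\<And>s t a. s0 \<le> s \<Longrightarrow> s < 0 \<Longrightarrow> s0 \<le> t \<Longrightarrow> t < 0 \<Longrightarrow>
     integral {a..a + 2 * pi} (\<lambda>\<theta>. (cmod (?G s \<theta> - ?G t \<theta>))\<^sup>2) \<le> \<epsilon>" by (rule slice_cauchy[OF hol M \<epsilon>]) blast
    have cG: "continuous_on A (?G s)" if "s < 0" for s A
      by (rule half_plane_continuous_line(1)[OF disc_lift_holomorphic[OF hol] that])
    have "integral {a - L..a + L} (\<lambda>t. (cmod (?G s1 t - c))\<^sup>2) \<le> 3 * C * L powr p" if s1: "s0 \<le> s1" "s1 < 0" for s1
    proof -
      have B: "(\<integral>\<^sup>+t. ennreal ((cmod (boundary_value g t - ?G s1 t))\<^sup>2) * indicator {a - L..a + L} t \<partial>lborel) \<le> ennreal \<epsilon>"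
      proof (rule boundary_value_fatou[OF hol M, where a = "a - L" and ?s0.0 = s0])
        show "{a - L..a + L} \<subseteq> {a - L..a - L + 2 * pi}" using ab by auto
        show "integral {a - L..a + L} (\<lambda>t. (cmod (?G s t - ?G s1 t))\<^sup>2) \<le> \<epsilon>" if "s0 \<le> s" "s < 0" for s
        proof -
          have "integral {a - L..a + L} (\<lambda>t. (cmod (?G s t - ?G s1 t))\<^sup>2) \<le> integral {a - L..a - L + 2 * pi} (\<lambda>t. (cmod (?G s t - ?G s1 t))\<^sup>2)"
            by (rule integral_subinterval_le) (use ab in \<open>auto intro!: continuous_intros cG that s1\<close>)
          also have "\<dots> \<le> \<epsilon>" by (rule s0(2)[OF that s1])
          finally show ?thesis .
        qed
      qed (use s0 s1 cG in auto)
      have mG[measurable]: "?G s1 \<in> borel_measurable borel" by (rule borel_measurable_continuous_onI[OF cG[OF s1(2)]])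
      have "ennreal (integral {a - L..a + L} (\<lambda>t. (cmod (?G s1 t - c))\<^sup>2)) = (\<integral>\<^sup>+t. ennreal ((cmod (?G s1 t - c))\<^sup>2) * indicator {a - L..a + L} t \<partial>lborel)"
        by (rule nn_integral_interval[symmetric]) (auto intro!: continuous_intros cG s1)
      also have "\<dots> \<le> (\<integral>\<^sup>+t. 2 * (ennreal ((cmod (boundary_value g t - ?G s1 t))\<^sup>2) * indicator {a - L..a + L} t)
          + 2 * (ennreal ((cmod (boundary_value g t - c))\<^sup>2) * indicator {a - L..a + L} t) \<partial>lborel)"
      proof (rule nn_integral_mono)
        fix t
        have "ennreal ((cmod (?G s1 t - c))\<^sup>2) \<le> ennreal (2 * (cmod (boundary_value g t - ?G s1 t))\<^sup>2 + 2 * (cmod (boundary_value g t - c))\<^sup>2)"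
          using cmod_diff_square_le[of "?G s1 t" c "boundary_value g t"] by (intro ennreal_leI) (simp add: norm_minus_commute)
        also have "\<dots> = 2 * ennreal ((cmod (boundary_value g t - ?G s1 t))\<^sup>2) + 2 * ennreal ((cmod (boundary_value g t - c))\<^sup>2)"
          by (simp add: ennreal_plus ennreal_mult)
        finally show "ennreal ((cmod (?G s1 t - c))\<^sup>2) * indicator {a - L..a + L} t \<le> 2 * (ennreal ((cmod (boundary_value g t - ?G s1 t))\<^sup>2) * indicator {a - L..a + L} t)
          + 2 * (ennreal ((cmod (boundary_value g t - c))\<^sup>2) * indicator {a - L..a + L} t)" by (auto split: split_indicator)
      qed
      also have "\<dots> = (\<integral>\<^sup>+t. 2 * (ennreal ((cmod (boundary_value g t - ?G s1 t))\<^sup>2) * indicator {a - L..a + L} t) \<partial>lborel)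
          + (\<integral>\<^sup>+t. 2 * (ennreal ((cmod (boundary_value g t - c))\<^sup>2) * indicator {a - L..a + L} t) \<partial>lborel)"
        by (rule nn_integral_add) measurable
      also have "\<dots> = 2 * (\<integral>\<^sup>+t. ennreal ((cmod (boundary_value g t - ?G s1 t))\<^sup>2) * indicator {a - L..a + L} t \<partial>lborel) + 2 * X"
        unfolding X2 by (subst (1 2) nn_integral_cmult) measurable
      also have "\<dots> \<le> 2 * ennreal \<epsilon> + 2 * ennreal (L powr p * C)" by (intro add_mono mult_left_mono B X) auto
      also have "\<dots> = ennreal (2 * \<epsilon>) + ennreal (2 * (L powr p * C))" using \<epsilon> C by (simp add: ennreal_mult)
      also have "\<dots> = ennreal (2 * \<epsilon> + 2 * (L powr p * C))" using \<epsilon> C by (simp add: ennreal_plus)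
      also have "2 * \<epsilon> + 2 * (L powr p * C) = 3 * C * L powr p" by (simp add: \<epsilon>_def)
      finally show ?thesis using C by (simp add: ennreal_le_iff)
    qed
    then show "\<exists>c s2. s2 < 0 \<and> (\<forall>s1. s2 \<le> s1 \<and> s1 < 0 \<longrightarrow> integral {a - L..a + L} (\<lambda>t. (cmod (?G s1 t - c))\<^sup>2) \<le> 3 * C * L powr p)"
      using s0(1) by (intro exI[of _ c] exI[of _ s0]) blast
  qed (use \<delta>(1) in auto)
qed

lemma CA_iff_strip_oscillation:
  assumes p: "p > 0"
  shows "g \<in> CA p \<longleftrightarrow> g \<in> hardy2 \<and> (\<exists>C>0. strip_oscillation p C (\<lambda>w. g (exp w)))"
proof (cases "g \<in> hardy2")
  case True
  then obtain M where hol: "g holomorphic_on ball 0 1" and M: "\<forall>s<0. slice_norm g s \<le> M"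
    unfolding hardy2_iff_slice_norm by blast
  have "(SUP I\<in>arcs. mean_oscillation p g I) < \<infinity> \<longleftrightarrow> (\<exists>C>0. strip_oscillation p C (\<lambda>w. g (exp w)))"
  proof
    assume S: "(SUP I\<in>arcs. mean_oscillation p g I) < \<infinity>"
    define C where "C = enn2real (SUP I\<in>arcs. mean_oscillation p g I) + 1"
    have C: "C > 0" unfolding C_def using enn2real_nonneg[of "SUP I\<in>arcs. mean_oscillation p g I"] by linarith
    have "mean_oscillation p g (cis ` {a..b}) \<le> ennreal C" if "a < b" "b \<le> a + 2 * pi" for a b
    proof -
      have "mean_oscillation p g (cis ` {a..b}) \<le> (SUP I\<in>arcs. mean_oscillation p g I)"
        by (rule SUP_upper) (use that in \<open>auto simp: arcs_def\<close>)
      also have "\<dots> = ennreal (enn2real (SUP I\<in>arcs. mean_oscillation p g I))" using S by simp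
      also have "\<dots> \<le> ennreal C" unfolding C_def by (intro ennreal_leI) simp
      finally show ?thesis .
    qed
    then have "\<exists>\<delta>>0. \<forall>a b. a < b \<and> b \<le> a + 2 * pi \<and> b - a < \<delta> \<longrightarrow> mean_oscillation p g (cis ` {a..b}) \<le> ennreal C"
      by (intro exI[of _ 1]) auto
    from strip_oscillation_of_arcs[OF hol M C p this] show "\<exists>C>0. strip_oscillation p C (\<lambda>w. g (exp w))"
      using C by (intro exI[of _ "3 * C"]) simp
  next
    assume "\<exists>C>0. strip_oscillation p C (\<lambda>w. g (exp w))"
    then obtain C where C: "C > 0" "strip_oscillation p C (\<lambda>w. g (exp w))" by blast
    obtain \<delta> where \<delta>: "\<delta> > 0" "\<forall>a b. a < b \<and> b \<le> a + 2 * pi \<and> b - a < \<delta> \<longrightarrow> mean_oscillation p g (cis ` {a..b}) \<le> ennreal (4 * pi powr p * C)"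
      using mean_oscillation_le[OF C(2,1) hol M] by blast
    define N where "N = max (4 * pi powr p * C) ((\<delta> / (2 * pi)) powr (- p) * (4 * max M 1))"
    have "(SUP I\<in>arcs. mean_oscillation p g I) \<le> ennreal N"
    proof (rule SUP_least)
      fix I assume "I \<in> arcs"
      then obtain a b where I: "I = cis ` {a..b}" and ab: "a < b" "b \<le> a + 2 * pi" by (auto simp: arcs_def)
      show "mean_oscillation p g I \<le> ennreal N"
      proof (cases "b - a < \<delta>")
        case True
        then have "mean_oscillation p g I \<le> ennreal (4 * pi powr p * C)" unfolding I using \<delta>(2) ab by blast
        also have "\<dots> \<le> ennreal N" unfolding N_def by (intro ennreal_leI) simp
        finally show ?thesis .
      next
        case False
        \<comment> \<open>Long arcs are compared with the constant 0: the Hardy norm bounds the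
          integral, and the arc length is bounded below.\<close>
        have "integral {a..b} (\<lambda>t. (cmod (g (exp (Complex s t)) - 0))\<^sup>2) \<le> max M 1" if s: "- 1 \<le> s" "s < 0" for s
        proof -
          have c: "continuous_on UNIV (\<lambda>t. (cmod (g (exp (Complex s t))))\<^sup>2)"
            by (intro continuous_intros half_plane_continuous_line(1)[OF disc_lift_holomorphic[OF hol] s(2)])
          have "integral {a..b} (\<lambda>t. (cmod (g (exp (Complex s t))))\<^sup>2) \<le> integral {a..a + 2 * pi} (\<lambda>t. (cmod (g (exp (Complex s t))))\<^sup>2)"
            by (rule integral_subinterval_le[OF c]) (use ab in auto)
          also have "\<dots> = integral {0..0 + 2 * pi} (\<lambda>t. (cmod (g (exp (Complex s t))))\<^sup>2)"
            by (rule periodic_integral[OF c]) (simp_all add: exp_Complex_periodic)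
          also have "\<dots> \<le> max M 1" using M s(2) by (auto simp: slice_norm_def le_max_iff_disj)
          finally show ?thesis by simp
        qed
        then have "(\<integral>\<^sup>+\<xi>\<in>I. ennreal ((cmod (radial_limit g \<xi> - arc_mean g I))\<^sup>2) \<partial>circle_measure) \<le> ennreal (4 * max M 1)"
          unfolding I by (intro arc_oscillation_le[OF hol M ab, where ?s0.0 = "- 1" and c = 0]) auto
        then have "mean_oscillation p g I \<le> ennreal (arc_length I powr (- p)) * ennreal (4 * max M 1)"
          unfolding mean_oscillation_def by (rule mult_left_mono) simp
        also have "\<dots> = ennreal (arc_length I powr (- p) * (4 * max M 1))" by (rule ennreal_mult[symmetric]) auto
        also have "\<dots> \<le> ennreal ((\<delta> / (2 * pi)) powr (- p) * (4 * max M 1))"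
        proof (intro ennreal_leI mult_right_mono)
          have "\<delta> / (2 * pi) \<le> arc_length I" unfolding I arc_length_cis[OF ab] using False by (intro divide_right_mono) auto
          then show "arc_length I powr (- p) \<le> (\<delta> / (2 * pi)) powr (- p)" using \<delta>(1) p by (intro powr_mono2') auto
        qed auto
        also have "\<dots> \<le> ennreal N" unfolding N_def by (intro ennreal_leI) simp
        finally show ?thesis .
      qed
    qed
    also have "\<dots> < \<infinity>" by simp
    finally show "(SUP I\<in>arcs. mean_oscillation p g I) < \<infinity>" .
  qed
  then show ?thesis using True by (simp add: CA_def)
qed (simp add: CA_def)

lemma CA0_iff_strip_oscillation:
  assumes p: "p > 0"
  shows "g \<in> CA0 p \<longleftrightarrow> g \<in> hardy2 \<and> (\<forall>C>0. strip_oscillation p C (\<lambda>w. g (exp w)))"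
proof (cases "g \<in> hardy2")
  case True
  then obtain M where hol: "g holomorphic_on ball 0 1" and M: "\<forall>s<0. slice_norm g s \<le> M"
    unfolding hardy2_iff_slice_norm by blast
  have "(mean_oscillation p g \<longlongrightarrow> 0) small_arcs \<longleftrightarrow> (\<forall>C>0. strip_oscillation p C (\<lambda>w. g (exp w)))"
    unfolding tendsto_zero_ennreal_iff eventually_small_arcs
  proof (intro iffI allI impI)
    fix C :: real assume *: "\<forall>\<epsilon>>0. \<exists>\<delta>>0. \<forall>a b. a < b \<and> b \<le> a + 2 * pi \<and> b - a < \<delta> \<longrightarrow> mean_oscillation p g (cis ` {a..b}) \<le> ennreal \<epsilon>" and C: "C > 0"
    have "strip_oscillation p (3 * (C / 3)) (\<lambda>w. g (exp w))"
      by (rule strip_oscillation_of_arcs[OF hol M _ p]) (use * C in auto)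
    then show "strip_oscillation p C (\<lambda>w. g (exp w))" by simp
  next
    fix \<epsilon> :: real assume *: "\<forall>C>0. strip_oscillation p C (\<lambda>w. g (exp w))" and \<epsilon>: "\<epsilon> > 0"
    have c: "\<epsilon> / (4 * pi powr p) > 0" using \<epsilon> by simp
    show "\<exists>\<delta>>0. \<forall>a b. a < b \<and> b \<le> a + 2 * pi \<and> b - a < \<delta> \<longrightarrow> mean_oscillation p g (cis ` {a..b}) \<le> ennreal \<epsilon>"
      using mean_oscillation_le[OF *[rule_format, OF c] c hol M] by simp
  qed
  moreover have "\<forall>C>0. strip_oscillation p C (\<lambda>w. g (exp w)) \<Longrightarrow> g \<in> CA p"
    unfolding CA_iff_strip_oscillation[OF p] using True zero_less_one by blast
  ultimately show ?thesis using True unfolding CA0_def by blast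
qed (simp add: CA0_def CA_def)

subsection \<open>Carleson measures\<close>

lemma ennreal_divide_le_iff:
  assumes "y > 0" "C \<ge> 0"
  shows "X / ennreal y \<le> ennreal C \<longleftrightarrow> X \<le> ennreal (C * y)"
proof
  assume le: "X / ennreal y \<le> ennreal C"
  have "X = X / ennreal y * ennreal y" using assms(1) by (simp add: ennreal_divide_times)
  also have "\<dots> \<le> ennreal C * ennreal y" using le by (rule mult_right_mono) simp
  finally show "X \<le> ennreal (C * y)" using assms by (simp add: ennreal_mult)
next
  assume "X \<le> ennreal (C * y)"
  then have "X / ennreal y \<le> ennreal (C * y) / ennreal y" by (rule divide_right_mono_ennreal)
  also have "\<dots> = ennreal C" using assms by (simp add: divide_ennreal)
  finally show "X / ennreal y \<le> ennreal C" .
qed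

lemma nn_integral_cbox:
  fixes F :: "real \<times> real \<Rightarrow> real"
  assumes "continuous_on (cbox x y) F" "\<And>p. p \<in> cbox x y \<Longrightarrow> F p \<ge> 0"
  shows "(\<integral>\<^sup>+p. ennreal (F p) * indicator (cbox x y) p \<partial>lborel) = ennreal (integral (cbox x y) F)"
  by (intro nn_integral_has_integral_lebesgue' integrable_integral integrable_continuous assms)

text \<open>Removes the cut-off at \<open>s1\<close>: the boxes increase to the one that reaches s =
  0, and the bound K is the same for all of them.\<close>

lemma half_plane_box_fatou:
  fixes F :: "real \<times> real \<Rightarrow> real"
  assumes c: "continuous_on {p. fst p < 0} F" and nn: "\<And>p. fst p < 0 \<Longrightarrow> F p \<ge> 0" and L: "L > 0"
    and K: "\<And>s1. - L \<le> s1 \<Longrightarrow> s1 < 0 \<Longrightarrow> integral (cbox (- L, x) (s1, y)) F \<le> K"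
  shows "(\<integral>\<^sup>+p. ennreal (F p) * indicator ({- L..<0} \<times> {x..y}) p \<partial>lborel) \<le> ennreal K"
proof -
  define S where "S = (\<lambda>n::nat. - L / (real n + 1))"
  have S: "- L \<le> S n" "S n < 0" for n
    using L by (auto simp: S_def divide_less_0_iff field_simps)
  have S0: "S \<longlonglongrightarrow> 0" unfolding S_def by real_asymp
  let ?Q = "\<lambda>n. cbox (- L, x) (S n, y)"
  have sub: "?Q n \<subseteq> {p. fst p < 0}" for n using S(2)[of n] by (auto simp: cbox_Pair_eq)
  have cQ: "continuous_on (?Q n) F" for n using c sub by (rule continuous_on_subset)
  have m[measurable]: "(\<lambda>p. ennreal (F p) * indicator (?Q n) p) \<in> borel_measurable borel" for n
  proof -
    have "(\<lambda>p. ennreal (indicator (?Q n) p *\<^sub>R F p)) \<in> borel_measurable borel"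
      by (intro measurable_compose[OF _ measurable_ennreal] borel_measurable_continuous_on_indicator cQ) simp
    moreover have "ennreal (indicator (?Q n) p *\<^sub>R F p) = ennreal (F p) * indicator (?Q n) p" for p
      by (auto split: split_indicator)
    ultimately show ?thesis by simp
  qed
  have "(\<integral>\<^sup>+p. ennreal (F p) * indicator ({- L..<0} \<times> {x..y}) p \<partial>lborel)
    = (\<integral>\<^sup>+p. liminf (\<lambda>n. ennreal (F p) * indicator (?Q n) p) \<partial>lborel)"
  proof (rule nn_integral_cong)
    fix p :: "real \<times> real"
    have "\<forall>\<^sub>F n in sequentially. indicator (?Q n) p = (indicator ({- L..<0} \<times> {x..y}) p :: ennreal)"
    proof (cases "fst p < 0")
      case True
      then have "\<forall>\<^sub>F n in sequentially. fst p < S n" by (rule order_tendstoD(1)[OF S0])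
      then show ?thesis by eventually_elim (use True in \<open>auto simp: cbox_Pair_eq split: split_indicator\<close>)
    next
      case False
      have "indicator (?Q n) p = (indicator ({- L..<0} \<times> {x..y}) p :: ennreal)" for n
        using False sub[of n] by (auto split: split_indicator)
      then show ?thesis by simp
    qed
    then have "(\<lambda>n. ennreal (F p) * indicator (?Q n) p) \<longlonglongrightarrow> ennreal (F p) * indicator ({- L..<0} \<times> {x..y}) p"
      by (intro tendsto_eventually) (auto elim!: eventually_mono)
    then show "ennreal (F p) * indicator ({- L..<0} \<times> {x..y}) p = liminf (\<lambda>n. ennreal (F p) * indicator (?Q n) p)"
      by (intro lim_imp_Liminf[symmetric]) auto
  qed
  also have "\<dots> \<le> liminf (\<lambda>n. \<integral>\<^sup>+p. ennreal (F p) * indicator (?Q n) p \<partial>lborel)"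
    by (rule nn_integral_liminf) measurable
  also have "\<dots> \<le> liminf (\<lambda>n. ennreal K)"
  proof (intro Liminf_mono always_eventually allI)
    fix n
    have "(\<integral>\<^sup>+p. ennreal (F p) * indicator (?Q n) p \<partial>lborel) = ennreal (integral (?Q n) F)"
      by (rule nn_integral_cbox[OF cQ]) (use nn sub[of n] in auto)
    also have "\<dots> \<le> ennreal K" by (intro ennreal_leI K S)
    finally show "(\<integral>\<^sup>+p. ennreal (F p) * indicator (?Q n) p \<partial>lborel) \<le> ennreal K" .
  qed
  also have "\<dots> = ennreal K" by (simp add: Liminf_const)
  finally show ?thesis .
qed

lemma schwarzian_density_nonneg: "fst p < 0 \<Longrightarrow> 0 \<le> schwarzian_density G p"
  by (intro mult_nonneg_nonneg zero_le_power) auto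

lemma disc_lift_deriv:
  assumes hol: "g holomorphic_on ball 0 1" and w: "Re w < 0"
  shows "deriv (\<lambda>w. g (exp w)) w = deriv g (exp w) * exp w"
proof (rule DERIV_imp_deriv)
  have "exp w \<in> ball 0 1" using w by simp
  then have "(g has_field_derivative deriv g (exp w)) (at (exp w))" by (rule holomorphic_derivI[OF hol open_ball])
  from DERIV_chain2[OF this DERIV_exp] show "((\<lambda>w. g (exp w)) has_field_derivative deriv g (exp w) * exp w) (at w)" .
qed

lemma disc_lift_deriv2:
  assumes hol: "g holomorphic_on ball 0 1" and w: "Re w < 0"
  shows "deriv (deriv (\<lambda>w. g (exp w))) w = deriv (deriv g) (exp w) * (exp w)\<^sup>2 + deriv g (exp w) * exp w"
proof -
  have hol': "deriv g holomorphic_on ball 0 1" using hol by (rule holomorphic_deriv) simp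
  have e: "exp w \<in> ball 0 1" using w by simp
  have "((\<lambda>w. deriv g (exp w) * exp w) has_field_derivative deriv (deriv g) (exp w) * (exp w)\<^sup>2 + deriv g (exp w) * exp w) (at w)"
    using DERIV_mult[OF DERIV_chain2[OF holomorphic_derivI[OF hol' open_ball e] DERIV_exp] DERIV_exp]
    by (simp add: power2_eq_square algebra_simps)
  then have "(deriv (\<lambda>w. g (exp w)) has_field_derivative deriv (deriv g) (exp w) * (exp w)\<^sup>2 + deriv g (exp w) * exp w) (at w)"
    by (rule has_field_derivative_transform_within_open[OF _ open_left_half_plane]) (use w disc_lift_deriv[OF hol] in auto)
  then show ?thesis by (rule DERIV_imp_deriv)
qed

text \<open>In logarithmic coordinates |S(f)|^2 is exp (-4 s) times the square of the strip
  Schwarzian and the area element carries exp (2 s), which leaves exp (-2 s). The constant is 24 =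
  2^3 * 3, with 3 as a bound for e.\<close>

lemma carleson_weight_upper:
  assumes "- 1/2 \<le> s" "s < (0::real)"
  shows "(1 - exp (2 * s)) ^ 3 * exp (- 2 * s) \<le> 24 * (- s) ^ 3"
proof -
  have "exp (- 2 * s) \<le> exp 1" using assms by simp
  then have e: "exp (- 2 * s) \<le> 3" using exp_le by linarith
  have "1 - exp (2 * s) \<le> 2 * (- s)" using exp_ge_add_one_self[of "2 * s"] by linarith
  then have "(1 - exp (2 * s)) ^ 3 \<le> (2 * (- s)) ^ 3" using assms by (intro power_mono) auto
  then have "(1 - exp (2 * s)) ^ 3 * exp (- 2 * s) \<le> (2 * (- s)) ^ 3 * 3" using e assms by (intro mult_mono) auto
  then show ?thesis by (simp add: power_mult_distrib)
qed

text \<open>1 - exp (2 s) is at least -2 s exp (2 s), so the product is at least 8 exp (4 s) (-s)^3;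
  the restriction on s keeps exp (4 s) above 1/2.\<close>

lemma carleson_weight_lower:
  assumes "- 1/8 \<le> s" "s < (0::real)"
  shows "(- s) ^ 3 \<le> (1 - exp (2 * s)) ^ 3 * exp (- 2 * s)"
proof -
  have "(1 - 2 * s) * exp (2 * s) \<le> exp (- 2 * s) * exp (2 * s)"
    using exp_ge_add_one_self[of "- 2 * s"] by (intro mult_right_mono) auto
  then have "(1 - 2 * s) * exp (2 * s) \<le> 1" by (simp flip: exp_add)
  then have "2 * (- s) * exp (2 * s) \<le> 1 - exp (2 * s)" by (simp add: algebra_simps)
  then have "(2 * (- s) * exp (2 * s)) ^ 3 \<le> (1 - exp (2 * s)) ^ 3"
    using mult_nonpos_nonneg[of s "exp (2 * s)"] assms by (intro power_mono) auto
  then have A: "(2 * (- s) * exp (2 * s)) ^ 3 * exp (- 2 * s) \<le> (1 - exp (2 * s)) ^ 3 * exp (- 2 * s)" by (rule mult_right_mono) simp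
  have "(2 * (- s) * exp (2 * s)) ^ 3 * exp (- 2 * s) = 8 * (- s) ^ 3 * (exp (2 * s) ^ 3 * exp (- 2 * s))"
    by (simp add: power_mult_distrib)
  moreover have "exp (2 * s) ^ 3 * exp (- 2 * s) = exp (4 * s)" by (simp flip: exp_of_nat_mult exp_add)
  ultimately have B: "(2 * (- s) * exp (2 * s)) ^ 3 * exp (- 2 * s) = (- s) ^ 3 * (8 * exp (4 * s))" by (simp only: mult_ac)
  have "1/2 \<le> exp (4 * s)" using exp_ge_add_one_self[of "4 * s"] assms by linarith
  then have "(- s) ^ 3 * 1 \<le> (- s) ^ 3 * (8 * exp (4 * s))" using assms by (intro mult_left_mono) auto
  then show ?thesis using A unfolding B by simp
qed

context
  fixes f g :: "complex \<Rightarrow> complex"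
  assumes hol: "g holomorphic_on ball 0 1" and exp_g: "\<And>z. z \<in> ball 0 1 \<Longrightarrow> exp (g z) = deriv f z"
begin

lemma deriv2_eq_exp_branch:
  assumes z: "z \<in> ball 0 1"
  shows "deriv (deriv f) z = exp (g z) * deriv g z"
proof (rule DERIV_imp_deriv)
  have "((\<lambda>w. exp (g w)) has_field_derivative exp (g z) * deriv g z) (at z)"
    by (rule DERIV_chain2[OF DERIV_exp holomorphic_derivI[OF hol open_ball z]])
  then show "(deriv f has_field_derivative exp (g z) * deriv g z) (at z)"
    by (rule has_field_derivative_transform_within_open[OF _ open_ball z]) (rule exp_g)
qed

lemma schwarzian_eq_branch:
  assumes z: "z \<in> ball 0 1"
  shows "schwarzian f z = deriv (deriv g) z - (deriv g z)\<^sup>2 / 2"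
proof -
  have q: "deriv (deriv f) w / deriv f w = deriv g w" if "w \<in> ball 0 1" for w
    unfolding deriv2_eq_exp_branch[OF that] exp_g[OF that, symmetric] by simp
  have "\<forall>\<^sub>F w in nhds z. w \<in> ball 0 1" using z by (intro eventually_nhds_in_open) auto
  then have "\<forall>\<^sub>F w in nhds z. deriv (deriv f) w / deriv f w = deriv g w" by eventually_elim (rule q)
  then have "deriv (\<lambda>w. deriv (deriv f) w / deriv f w) z = deriv (deriv g) z" by (rule deriv_cong_ev) simp
  then show ?thesis unfolding schwarzian_def q[OF z] by simp
qed

lemma strip_schwarzian_eq:
  assumes w: "Re w < 0"
  shows "strip_schwarzian (\<lambda>w. g (exp w)) w = (exp w)\<^sup>2 * schwarzian f (exp w)"
proof -
  have e: "exp w \<in> ball 0 1" using w by simp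
  show ?thesis
    unfolding strip_schwarzian_def disc_lift_deriv2[OF hol w] disc_lift_deriv[OF hol w] schwarzian_eq_branch[OF e]
    by (simp add: power2_eq_square algebra_simps)
qed

lemma continuous_schwarzian_density:
  "continuous_on {p. fst p < 0} (schwarzian_density (\<lambda>w. g (exp w)))"
  by (intro continuous_intros half_plane_continuous[OF holomorphic_strip_schwarzian[OF disc_lift_holomorphic[OF hol]]]) auto

lemma continuous_disc_density:
  "continuous_on (ball 0 1) (\<lambda>z. (cmod (schwarzian f z))\<^sup>2 * (1 - (cmod z)\<^sup>2) ^ 3)"
proof -
  have hol': "deriv g holomorphic_on ball 0 1" using hol by (rule holomorphic_deriv) simp
  then have hol'': "deriv (deriv g) holomorphic_on ball 0 1" by (rule holomorphic_deriv) simp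
  have "continuous_on (ball 0 1) (\<lambda>z. deriv (deriv g) z - (deriv g z)\<^sup>2 / 2)"
    by (intro continuous_intros holomorphic_on_imp_continuous_on hol' hol'') auto
  then have "continuous_on (ball 0 1) (schwarzian f)"
    by (rule continuous_on_eq) (simp add: schwarzian_eq_branch)
  then show ?thesis by (intro continuous_intros)
qed

lemma disc_density_measurable [measurable]:
  "(\<lambda>z. ennreal ((cmod (schwarzian f z))\<^sup>2 * (1 - (cmod z)\<^sup>2) ^ 3) * indicator (ball 0 1) z) \<in> borel_measurable borel"
proof -
  have "(\<lambda>z. ennreal (indicator (ball 0 1) z *\<^sub>R ((cmod (schwarzian f z))\<^sup>2 * (1 - (cmod z)\<^sup>2) ^ 3))) \<in> borel_measurable borel"
    by (intro measurable_compose[OF _ measurable_ennreal] borel_measurable_continuous_on_indicator continuous_disc_density) simp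
  moreover have "ennreal (indicator (ball 0 1) z *\<^sub>R x) = ennreal x * indicator (ball 0 1) z" for z :: complex and x
    by (auto split: split_indicator)
  ultimately show ?thesis by simp
qed

section \<open>Carleson boxes under the Schwarzian measure\<close>

lemma space_schwarzian_measure: "space (schwarzian_measure f) = ball 0 1"
  by (simp add: schwarzian_measure_def space_restrict_space)

lemma emeasure_schwarzian_measure:
  assumes A: "A \<in> sets borel" "A \<subseteq> ball 0 1"
  shows "A \<in> sets (schwarzian_measure f)"
    and "emeasure (schwarzian_measure f) A
      = (\<integral>\<^sup>+z. ennreal ((cmod (schwarzian f z))\<^sup>2 * (1 - (cmod z)\<^sup>2) ^ 3) * indicator (ball 0 1) z * indicator A z \<partial>lborel)"
proof -
  have A': "A \<in> sets (restrict_space lborel (ball 0 1))"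
    using A by (subst sets_restrict_space_iff) auto
  then show "A \<in> sets (schwarzian_measure f)" by (simp add: schwarzian_measure_def)
  have m: "(\<lambda>z. ennreal ((cmod (schwarzian f z))\<^sup>2 * (1 - (cmod z)\<^sup>2) ^ 3)) \<in> borel_measurable (restrict_space lborel (ball 0 1))"
    by (subst borel_measurable_restrict_space_iff_ennreal) (use disc_density_measurable in auto)
  show "emeasure (schwarzian_measure f) A
      = (\<integral>\<^sup>+z. ennreal ((cmod (schwarzian f z))\<^sup>2 * (1 - (cmod z)\<^sup>2) ^ 3) * indicator (ball 0 1) z * indicator A z \<partial>lborel)"
    unfolding schwarzian_measure_def emeasure_density[OF m A']
    by (subst nn_integral_restrict_space) (auto intro!: nn_integral_cong simp: mult_ac)
qed

text \<open>The full circle is excluded: its box contains the origin, which has no logarithm, and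
  the radial bound 1 - |I| would be 0.\<close>

lemma carleson_box_eq:
  assumes ab: "a < b" "b < a + 2 * pi"
  shows "carleson_box (cis ` {a..b}) = {z. z \<noteq> 0 \<and> ln (cmod z) \<in> {ln (1 - (b - a) / (2 * pi))..<0} \<and> z / of_real (cmod z) \<in> cis ` {a..b}}"
proof -
  define l where "l = (b - a) / (2 * pi)"
  have l: "0 < l" "l < 1" using ab by (auto simp: l_def)
  have al: "arc_length (cis ` {a..b}) = l" unfolding l_def by (rule arc_length_cis) (use ab in auto)
  show ?thesis
    unfolding carleson_box_def al l_def[symmetric]
  proof (intro set_eqI iffI; clarify)
    fix r t assume rt: "0 \<le> (r::real)" "1 - l \<le> r" "r < 1" "t \<in> {a..b}"
    then have r: "r > 0" using l by linarith
    then have c: "cmod (of_real r * cis t) = r" by (simp add: norm_mult)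
    have "ln (1 - l) \<le> ln r" using rt l r by simp
    moreover have "ln r < 0" using r rt by simp
    moreover have "of_real r * cis t / of_real r = cis t" using r by simp
    ultimately show "of_real r * cis t \<noteq> 0 \<and> ln (cmod (of_real r * cis t)) \<in> {ln (1 - l)..<0}
       \<and> of_real r * cis t / of_real (cmod (of_real r * cis t)) \<in> cis ` {a..b}" unfolding c using r rt by auto
  next
    fix z t assume z: "z \<noteq> 0" "ln (cmod z) \<in> {ln (1 - l)..<0}" "z / of_real (cmod z) = cis t" "t \<in> {a..b}"
    have "z = of_real (cmod z) * cis t" using z(1) by (simp flip: z(3))
    moreover have "1 - l \<le> cmod z" "cmod z < 1" using z(1,2) l by auto
    ultimately show "\<exists>r \<xi>. z = of_real r * \<xi> \<and> 0 \<le> r \<and> 1 - l \<le> r \<and> r < 1 \<and> \<xi> \<in> cis ` {a..b}"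
      using z(4) by (intro exI[of _ "cmod z"] exI[of _ "cis t"]) auto
  qed
qed

lemma carleson_box_borel:
  assumes ab: "a < b" "b < a + 2 * pi"
  shows "carleson_box (cis ` {a..b}) \<in> sets borel"
proof -
  have "compact (cis ` {a..b})" by (intro compact_continuous_image continuous_intros) auto
  then have [measurable]: "cis ` {a..b} \<in> sets borel" by (intro borel_closed compact_imp_closed)
  show ?thesis unfolding carleson_box_eq[OF ab] by measurable
qed

lemma carleson_box_subset: "a < b \<Longrightarrow> carleson_box (cis ` {a..b}) \<subseteq> ball 0 1"
  by (auto simp: carleson_box_def norm_mult)

lemma emeasure_carleson_box:
  assumes ab: "a < b" "b < a + 2 * pi"
  shows "emeasure (schwarzian_measure f) (carleson_box (cis ` {a..b}))
    = (\<integral>\<^sup>+p. ennreal ((cmod (strip_schwarzian (\<lambda>w. g (exp w)) (Complex (fst p) (snd p))))\<^sup>2 * (1 - exp (2 * fst p)) ^ 3 * exp (- 2 * fst p))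
        * indicator ({ln (1 - (b - a) / (2 * pi))..<0} \<times> {a..b}) p \<partial>lborel)"
proof -
  let ?h = "\<lambda>z. ennreal ((cmod (schwarzian f z))\<^sup>2 * (1 - (cmod z)\<^sup>2) ^ 3) * indicator (ball 0 1) z"
  let ?X = "{ln (1 - (b - a) / (2 * pi))..<0}"
  let ?F = "\<lambda>w. ?h (exp w) * ennreal (exp (2 * Re w)) * indicator ?X (Re w) * indicator {a..b} (Im w)"
  have F: "?F \<in> borel_measurable borel"
  proof -
    define H where "H = (\<lambda>w. ?h (exp w))"
    have [measurable]: "H \<in> borel_measurable borel"
      unfolding H_def by (rule measurable_compose[OF borel_measurable_continuous_onI disc_density_measurable]) (intro continuous_intros)
    have "(\<lambda>w. H w * ennreal (exp (2 * Re w)) * indicator ?X (Re w) * indicator {a..b} (Im w)) \<in> borel_measurable borel" by measurable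
    then show ?thesis unfolding H_def .
  qed
  have "emeasure (schwarzian_measure f) (carleson_box (cis ` {a..b})) = (\<integral>\<^sup>+z. ?h z * indicator (carleson_box (cis ` {a..b})) z \<partial>lborel)"
    by (rule emeasure_schwarzian_measure(2)[OF carleson_box_borel[OF ab] carleson_box_subset[OF ab(1)]])
  also have "\<dots> = (\<integral>\<^sup>+t. \<integral>\<^sup>+s. ?h (of_real (exp s) * cis t) * ennreal (exp (2 * s)) * indicator ?X s * indicator {a..b} t \<partial>lborel \<partial>lborel)"
    unfolding carleson_box_eq[OF ab] by (rule polar_nn_integral[OF disc_density_measurable]) (use ab in auto)
  also have "\<dots> = (\<integral>\<^sup>+t. \<integral>\<^sup>+s. ?F (Complex s t) \<partial>lborel \<partial>lborel)" by (simp add: exp_eq_cis)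
  also have "\<dots> = (\<integral>\<^sup>+p. ?F (Complex (fst p) (snd p)) \<partial>lborel)"
    unfolding nn_integral_complex_iterated(1)[OF F, symmetric] by (rule nn_integral_complex_iterated(3)[OF F])
  also have "\<dots> = (\<integral>\<^sup>+p. ennreal ((cmod (strip_schwarzian (\<lambda>w. g (exp w)) (Complex (fst p) (snd p))))\<^sup>2 * (1 - exp (2 * fst p)) ^ 3 * exp (- 2 * fst p))
        * indicator (?X \<times> {a..b}) p \<partial>lborel)"
  proof (rule nn_integral_cong)
    fix p :: "real \<times> real"
    show "?F (Complex (fst p) (snd p)) = ennreal ((cmod (strip_schwarzian (\<lambda>w. g (exp w)) (Complex (fst p) (snd p))))\<^sup>2 * (1 - exp (2 * fst p)) ^ 3 * exp (- 2 * fst p))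
        * indicator (?X \<times> {a..b}) p"
    proof (cases "p \<in> ?X \<times> {a..b}")
      case True
      then obtain s t where p: "p = (s, t)" "s < 0" "s \<in> ?X" "t \<in> {a..b}" by auto
      define S where "S = schwarzian f (exp (Complex s t))"
      have n: "cmod (strip_schwarzian (\<lambda>w. g (exp w)) (Complex s t)) = (exp s)\<^sup>2 * cmod S"
        using p(2) by (simp add: strip_schwarzian_eq S_def norm_mult norm_power)
      have 1: "(exp s)\<^sup>2 = exp (2 * s)" by (simp add: exp_double)
      have 2: "exp (2 * s) * exp (2 * s) * exp (- 2 * s) = exp (2 * s)" by (simp flip: exp_add)
      have "(cmod S)\<^sup>2 * (1 - exp (2 * s)) ^ 3 * exp (2 * s) = (exp (2 * s) * cmod S)\<^sup>2 * (1 - exp (2 * s)) ^ 3 * exp (- 2 * s)"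
      proof -
        have "(exp (2 * s) * cmod S)\<^sup>2 * (1 - exp (2 * s)) ^ 3 * exp (- 2 * s)
          = (exp (2 * s) * exp (2 * s) * exp (- 2 * s)) * ((cmod S)\<^sup>2 * (1 - exp (2 * s)) ^ 3)"
          by (simp only: power2_eq_square mult_ac)
        then show ?thesis unfolding 2 by (simp only: mult_ac)
      qed
      moreover have "(1 - exp (2 * s)) ^ 3 \<ge> 0" using p(2) by simp
      ultimately show ?thesis using p by (simp add: n 1 S_def[symmetric] flip: ennreal_mult)
    next
      case False
      then show ?thesis by (cases p) auto
    qed
  qed
  finally show ?thesis .
qed

lemma emeasure_carleson_box_le:
  assumes car: "strip_carleson p C (schwarzian_density (\<lambda>w. g (exp w)))" and C: "C > 0"
  shows "\<exists>\<delta>>0. \<forall>a b. a < b \<and> b \<le> a + 2 * pi \<and> b - a < \<delta> \<longrightarrow>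
    emeasure (schwarzian_measure f) (carleson_box (cis ` {a..b})) \<le> ennreal ((24 * pi powr p * C) * arc_length (cis ` {a..b}) powr p)"
proof -
  let ?S = "\<lambda>p. (cmod (strip_schwarzian (\<lambda>w. g (exp w)) (Complex (fst p) (snd p))))\<^sup>2"
  obtain \<delta> where \<delta>: "\<delta> > 0" "\<forall>L a s1. 0 < L \<and> L \<le> \<delta> \<and> - L \<le> s1 \<and> s1 < 0 \<longrightarrow>
     integral (cbox (- L, a - L) (s1, a + L)) (schwarzian_density (\<lambda>w. g (exp w))) \<le> C * L powr p"
    using car unfolding strip_carleson_def by blast
  show ?thesis
  proof (intro exI[of _ "min (2 * \<delta>) 1"] conjI allI impI)
    fix a b :: real assume ab': "a < b \<and> b \<le> a + 2 * pi \<and> b - a < min (2 * \<delta>) 1"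
    then have ab: "a < b" "b < a + 2 * pi" "b - a < 2 * \<delta>" "b - a < 1" using pi_gt3 by auto
    define h where "h = (b - a) / 2"
    define x where "x = (a + b) / 2"
    have h: "0 < h" "h \<le> \<delta>" "h \<le> 1/2" "x - h = a" "x + h = b" using ab by (auto simp: h_def x_def field_simps)
    have l: "(b - a) / (2 * pi) = h / pi" by (simp add: h_def)
    \<comment> \<open>The depth of the box is the normalised length h / pi of the arc. Even after
      taking the logarithm it is at most the half-length h, so the box lies inside a square of the
      kind used in \<open>strip_carleson\<close>.\<close>
    have "- h \<le> ln (1 - h / pi)"
    proof -
      have "3 * h \<le> pi * h" using pi_gt3 h by (intro mult_right_mono) auto
      moreover have "h * h \<le> h * (1/2)" using h by (intro mult_left_mono) auto
      moreover have "(1 + h) * (pi - h) = pi - h + pi * h - h * h" by (simp add: algebra_simps)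
      ultimately have "pi \<le> (1 + h) * (pi - h)" using h(1) by linarith
      then have "1 \<le> (1 + h) * (1 - h / pi)" by (simp add: field_simps)
      also have "\<dots> \<le> exp h * (1 - h / pi)" using h pi_gt3 by (intro mult_right_mono) (auto simp: exp_ge_add_one_self)
      finally have e: "exp (- h) \<le> 1 - h / pi" by (simp add: exp_minus field_simps)
      moreover have "0 < 1 - h / pi" using e exp_gt_zero[of "- h"] by linarith
      ultimately show ?thesis by (simp add: ln_ge_iff)
    qed
    then have sub: "{ln (1 - (b - a) / (2 * pi))..<0} \<subseteq> {- h..<0}" unfolding l by auto
    let ?F = "\<lambda>p. 24 * ((- fst p)^3 * ?S p)"
    have "emeasure (schwarzian_measure f) (carleson_box (cis ` {a..b})) \<le> (\<integral>\<^sup>+p. ennreal (?F p) * indicator ({- h..<0} \<times> {a..b}) p \<partial>lborel)"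
      unfolding emeasure_carleson_box[OF ab(1,2)]
    proof (rule nn_integral_mono)
      fix p :: "real \<times> real"
      have "?S p * (1 - exp (2 * fst p)) ^ 3 * exp (- 2 * fst p) \<le> ?F p" if "fst p \<in> {- h..<0}"
      proof -
        have "(1 - exp (2 * fst p)) ^ 3 * exp (- 2 * fst p) \<le> 24 * (- fst p) ^ 3"
          by (rule carleson_weight_upper) (use that h in auto)
        then have "?S p * ((1 - exp (2 * fst p)) ^ 3 * exp (- 2 * fst p)) \<le> ?S p * (24 * (- fst p) ^ 3)" by (rule mult_left_mono) simp
        then show ?thesis by (simp only: mult_ac)
      qed
      then show "ennreal (?S p * (1 - exp (2 * fst p)) ^ 3 * exp (- 2 * fst p)) * indicator ({ln (1 - (b - a) / (2 * pi))..<0} \<times> {a..b}) p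
        \<le> ennreal (?F p) * indicator ({- h..<0} \<times> {a..b}) p"
        using sub by (cases p) (auto intro!: ennreal_leI split: split_indicator)
    qed
    also have "\<dots> \<le> ennreal (24 * (C * h powr p))"
    proof (rule half_plane_box_fatou)
      show "continuous_on {p. fst p < 0} ?F" by (intro continuous_on_mult_left continuous_schwarzian_density)
      fix s1 assume s1: "- h \<le> s1" "s1 < 0"
      have "integral (cbox (- h, x - h) (s1, x + h)) (schwarzian_density (\<lambda>w. g (exp w))) \<le> C * h powr p"
        using \<delta>(2) h s1 by blast
      then show "integral (cbox (- h, a) (s1, b)) ?F \<le> 24 * (C * h powr p)" unfolding h(4,5) by simp
    next
      show "0 \<le> ?F p" if "fst p < 0" for p
        using schwarzian_density_nonneg[OF that, of "\<lambda>w. g (exp w)"] by simp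
    qed (use h in auto)
    also have "24 * (C * h powr p) = (24 * pi powr p * C) * (h / pi) powr p" using h by (simp add: powr_divide)
    also have "h / pi = arc_length (cis ` {a..b})" using arc_length_cis[of a b] ab l by simp
    finally show "emeasure (schwarzian_measure f) (carleson_box (cis ` {a..b})) \<le> ennreal ((24 * pi powr p * C) * arc_length (cis ` {a..b}) powr p)" .
  qed (use \<delta> in auto)
qed

lemma strip_carleson_of_boxes:
  assumes C: "C > 0" and box: "\<exists>\<delta>>0. \<forall>a b. a < b \<and> b \<le> a + 2 * pi \<and> b - a < \<delta> \<longrightarrow>
    emeasure (schwarzian_measure f) (carleson_box (cis ` {a..b})) \<le> ennreal (C * arc_length (cis ` {a..b}) powr p)"
  shows "strip_carleson p C (schwarzian_density (\<lambda>w. g (exp w)))"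
proof -
  let ?S = "\<lambda>p. (cmod (strip_schwarzian (\<lambda>w. g (exp w)) (Complex (fst p) (snd p))))\<^sup>2"
  obtain \<delta> where \<delta>: "\<delta> > 0" "\<forall>a b. a < b \<and> b \<le> a + 2 * pi \<and> b - a < \<delta> \<longrightarrow>
    emeasure (schwarzian_measure f) (carleson_box (cis ` {a..b})) \<le> ennreal (C * arc_length (cis ` {a..b}) powr p)"
    using box by blast
  show ?thesis unfolding strip_carleson_def
  proof (intro exI[of _ "min (1/8) (\<delta> / (4 * pi))"] conjI allI impI)
    fix L x s1 assume A: "0 < L \<and> L \<le> min (1/8) (\<delta> / (4 * pi)) \<and> - L \<le> s1 \<and> s1 < 0"
    then have L: "0 < L" "L \<le> 1/8" "- L \<le> s1" "s1 < 0" by auto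
    have "L * (4 * pi) \<le> \<delta>" using A by (simp add: le_divide_eq)
    then have pL: "2 * (pi * L) < \<delta>" using \<delta>(1) by (simp add: mult_ac)
    have pL1: "L \<le> pi * L" "pi * L \<le> pi * (1/8)" "0 < pi * L" using L pi_gt3 by (auto intro: mult_left_mono)
    \<comment> \<open>An arc of half-length pi L has normalised length exactly L, so its box is deep
      enough to contain the square, as ln (1 - L) \<le> -L; it is wider than the square by a factor
      pi.\<close>
    let ?a = "x - pi * L" and ?b = "x + pi * L"
    have ab: "?a < ?b" "?b < ?a + 2 * pi" "?b \<le> ?a + 2 * pi" "?b - ?a < \<delta>" using pL pL1 pi_gt3 by linarith+
    have l: "(?b - ?a) / (2 * pi) = L" by simp
    have al: "arc_length (cis ` {?a..?b}) = L" by (subst arc_length_cis[OF ab(1,3)]) (rule l)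
    have ln: "ln (1 - L) \<le> - L" using ln_le_minus_one[of "1 - L"] L by simp
    have c: "continuous_on (cbox (- L, x - L) (s1, x + L)) (schwarzian_density (\<lambda>w. g (exp w)))"
      by (rule continuous_on_subset[OF continuous_schwarzian_density]) (use L in \<open>auto simp: cbox_Pair_eq\<close>)
    have "ennreal (integral (cbox (- L, x - L) (s1, x + L)) (schwarzian_density (\<lambda>w. g (exp w))))
      = (\<integral>\<^sup>+p. ennreal ((- fst p)^3 * ?S p) * indicator (cbox (- L, x - L) (s1, x + L)) p \<partial>lborel)"
      by (rule nn_integral_cbox[symmetric, OF c], rule schwarzian_density_nonneg) (use L in \<open>auto simp: cbox_Pair_eq\<close>)
    also have "\<dots> \<le> emeasure (schwarzian_measure f) (carleson_box (cis ` {?a..?b}))"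
      unfolding emeasure_carleson_box[OF ab(1,2)] l
    proof (rule nn_integral_mono)
      fix p :: "real \<times> real"
      have "(- fst p)^3 * ?S p \<le> ?S p * (1 - exp (2 * fst p)) ^ 3 * exp (- 2 * fst p)" if "- L \<le> fst p" "fst p < 0"
      proof -
        have "(- fst p) ^ 3 \<le> (1 - exp (2 * fst p)) ^ 3 * exp (- 2 * fst p)"
          by (rule carleson_weight_lower) (use that L in auto)
        then have "?S p * (- fst p) ^ 3 \<le> ?S p * ((1 - exp (2 * fst p)) ^ 3 * exp (- 2 * fst p))" by (rule mult_left_mono) simp
        then show ?thesis by (simp only: mult_ac)
      qed
      moreover have "- L \<le> fst p \<and> fst p < 0 \<and> p \<in> {ln (1 - L)..<0} \<times> {?a..?b}" if "p \<in> cbox (- L, x - L) (s1, x + L)"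
      proof -
        obtain u v where p: "p = (u, v)" by (cases p)
        have "- L \<le> u" "u \<le> s1" "x - L \<le> v" "v \<le> x + L" using that by (auto simp: p cbox_Pair_eq)
        then have "ln (1 - L) \<le> u" "- L \<le> u" "u < 0" "?a \<le> v" "v \<le> ?b" using ln L pL1 by linarith+
        then show ?thesis by (simp add: p)
      qed
      ultimately show "ennreal ((- fst p)^3 * ?S p) * indicator (cbox (- L, x - L) (s1, x + L)) p
        \<le> ennreal (?S p * (1 - exp (2 * fst p)) ^ 3 * exp (- 2 * fst p)) * indicator ({ln (1 - L)..<0} \<times> {?a..?b}) p"
        by (auto intro!: ennreal_leI split: split_indicator)
    qed
    also have "\<dots> \<le> ennreal (C * L powr p)" using \<delta>(2) ab(1,3,4) al by metis
    finally show "integral (cbox (- L, x - L) (s1, x + L)) (schwarzian_density (\<lambda>w. g (exp w))) \<le> C * L powr p"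
      using C by (simp add: ennreal_le_iff)
  qed (use \<delta> in auto)
qed

text \<open>
  Large arcs are not controlled by the condition at small scales; they only need that the total mass is
  finite.
\<close>

lemma finite_schwarzian_measure:
  assumes car: "strip_carleson p C (schwarzian_density (\<lambda>w. g (exp w)))" and C: "C > 0"
  shows "emeasure (schwarzian_measure f) (ball 0 1) < \<infinity>"
proof -
  let ?\<mu> = "schwarzian_measure f"
  obtain \<delta> where \<delta>: "\<delta> > 0" "\<forall>a b. a < b \<and> b \<le> a + 2 * pi \<and> b - a < \<delta> \<longrightarrow>
    emeasure ?\<mu> (carleson_box (cis ` {a..b})) \<le> ennreal ((24 * pi powr p * C) * arc_length (cis ` {a..b}) powr p)"
    using emeasure_carleson_box_le[OF assms] by blast
  obtain n :: nat where n: "2 * pi / \<delta> < real n" using reals_Archimedean2 by blast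
  \<comment> \<open>N boxes of angle 2 pi / N and depth 1 / N cover the annulus outside the compact
    disc \<open>R\<close>, where the density is bounded. At least two are taken so that each arc is
    a proper one.\<close>
  define N where "N = max n 2"
  have N: "2 * pi / \<delta> < real N" "N \<ge> 2" using n by (auto simp: N_def)
  define d where "d = 2 * pi / real N"
  have d: "0 < d" "d < \<delta>" "d < 2 * pi" "d / (2 * pi) = 1 / real N"
    using N \<delta>(1) by (auto simp: d_def field_simps)
  define A where "A = (\<lambda>j::nat. carleson_box (cis ` {real j * d..real j * d + d}))"
  define R :: "complex set" where "R = cball 0 (1 - 1 / real N)"
  have Rs: "R \<in> sets borel" "R \<subseteq> ball 0 1" unfolding R_def cball_subset_ball_iff using N by auto
  have As: "A j \<in> sets ?\<mu>" for j unfolding A_def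
    by (rule emeasure_schwarzian_measure(1)[OF carleson_box_borel carleson_box_subset]) (use d in auto)
  have fA: "emeasure ?\<mu> (A j) < \<infinity>" for j
  proof -
    have "real j * d < real j * d + d \<and> real j * d + d \<le> real j * d + 2 * pi \<and> real j * d + d - real j * d < \<delta>" using d by auto
    then have "emeasure ?\<mu> (A j) \<le> ennreal ((24 * pi powr p * C) * arc_length (cis ` {real j * d..real j * d + d}) powr p)"
      unfolding A_def using \<delta>(2) by blast
    also have "\<dots> < \<infinity>" by simp
    finally show ?thesis .
  qed
  have fR: "emeasure ?\<mu> R < \<infinity>"
  proof -
    have "compact ((\<lambda>z. (cmod (schwarzian f z))\<^sup>2 * (1 - (cmod z)\<^sup>2) ^ 3) ` R)"
      by (rule compact_continuous_image[OF continuous_on_subset[OF continuous_disc_density Rs(2)]]) (simp add: R_def)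
    from compact_imp_bounded[OF this]
    obtain B where B: "\<And>z. z \<in> R \<Longrightarrow> norm ((cmod (schwarzian f z))\<^sup>2 * (1 - (cmod z)\<^sup>2) ^ 3) \<le> B"
      unfolding bounded_iff ball_simps by blast
    have "emeasure ?\<mu> R \<le> (\<integral>\<^sup>+z. ennreal B * indicator R z \<partial>lborel)"
      unfolding emeasure_schwarzian_measure(2)[OF Rs]
    proof (rule nn_integral_mono)
      fix z
      have "ennreal ((cmod (schwarzian f z))\<^sup>2 * (1 - (cmod z)\<^sup>2) ^ 3) \<le> ennreal B" if "z \<in> R"
        by (rule ennreal_leI, rule order.trans[OF _ B[OF that]]) simp
      then show "ennreal ((cmod (schwarzian f z))\<^sup>2 * (1 - (cmod z)\<^sup>2) ^ 3) * indicator (ball 0 1) z * indicator R z \<le> ennreal B * indicator R z"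
        by (auto split: split_indicator)
    qed
    also have "\<dots> = ennreal B * emeasure lborel R" using Rs by (intro nn_integral_cmult_indicator) simp
    also have "\<dots> < \<infinity>" unfolding R_def using emeasure_bounded_finite[OF bounded_cball] by (auto simp: ennreal_mult_less_top)
    finally show ?thesis .
  qed
  have cover: "ball 0 1 \<subseteq> R \<union> (\<Union>j<N. A j)"
  proof
    fix z :: complex assume z: "z \<in> ball 0 1"
    show "z \<in> R \<union> (\<Union>j<N. A j)"
    proof (cases "z \<in> R")
      case False
      then have zR: "1 - 1 / real N < cmod z" "cmod z < 1" using z by (auto simp: R_def)
      define t where "t = Arg2pi z"
      have t: "0 \<le> t" "t < 2 * pi" "z = of_real (cmod z) * cis t"
        using Arg2pi[of z] unfolding is_Arg_def t_def cis_conv_exp by blast+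
      define j where "j = nat \<lfloor>t / d\<rfloor>"
      have "real j \<le> t / d" "t / d < real j + 1" using t d by (auto simp: j_def)
      then have j: "real j * d \<le> t" "t \<le> real j * d + d" using d by (auto simp: field_simps)
      have "t / d < real N" using t N by (simp add: d_def field_simps)
      then have jN: "j < N" using \<open>real j \<le> t / d\<close> by linarith
      have "arc_length (cis ` {real j * d..real j * d + d}) = 1 / real N"
        using d by (subst arc_length_cis) auto
      then have "z \<in> A j" unfolding A_def carleson_box_def using zR t j
        by (auto intro!: exI[of _ "cmod z"] exI[of _ "cis t"])
      then show ?thesis using jN by blast
    qed simp
  qed
  have UA: "(\<Union>j<N. A j) \<in> sets ?\<mu>" using As by auto
  have RS: "R \<in> sets ?\<mu>" using emeasure_schwarzian_measure(1)[OF Rs] .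
  have "emeasure ?\<mu> (ball 0 1) \<le> emeasure ?\<mu> (R \<union> (\<Union>j<N. A j))"
    using cover RS UA by (intro emeasure_mono) auto
  also have "\<dots> \<le> emeasure ?\<mu> R + emeasure ?\<mu> (\<Union>j<N. A j)" by (rule emeasure_subadditive[OF RS UA])
  also have "\<dots> \<le> emeasure ?\<mu> R + (\<Sum>j<N. emeasure ?\<mu> (A j))"
    by (intro add_left_mono emeasure_subadditive_finite) (use As in auto)
  also have "\<dots> < \<infinity>" using fR fA by (simp add: ennreal_sum_less_top)
  finally show ?thesis .
qed

lemma bounded_carleson_iff:
  assumes p: "p > 0"
  shows "bounded_carleson p (schwarzian_measure f) \<longleftrightarrow> (\<exists>C>0. strip_carleson p C (schwarzian_density (\<lambda>w. g (exp w))))"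
proof
  let ?\<mu> = "schwarzian_measure f"
  let ?Q = "SUP I\<in>arcs. emeasure ?\<mu> (carleson_box I) / ennreal (arc_length I powr p)"
  assume "bounded_carleson p ?\<mu>"
  then have S: "?Q < \<infinity>" by (simp add: bounded_carleson_def)
  define C where "C = enn2real ?Q + 1"
  have C: "C > 0" unfolding C_def using enn2real_nonneg[of ?Q] by linarith
  have "emeasure ?\<mu> (carleson_box (cis ` {a..b})) \<le> ennreal (C * arc_length (cis ` {a..b}) powr p)" if "a < b" "b \<le> a + 2 * pi" for a b
  proof -
    have "emeasure ?\<mu> (carleson_box (cis ` {a..b})) / ennreal (arc_length (cis ` {a..b}) powr p) \<le> ?Q"
      by (rule SUP_upper) (use that in \<open>auto simp: arcs_def\<close>)
    also have "\<dots> = ennreal (enn2real ?Q)" using S by simp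
    also have "\<dots> \<le> ennreal C" unfolding C_def by (intro ennreal_leI) simp
    finally show ?thesis using C that by (subst (asm) ennreal_divide_le_iff) (auto simp: arc_length_cis)
  qed
  then have "strip_carleson p C (schwarzian_density (\<lambda>w. g (exp w)))"
    by (intro strip_carleson_of_boxes[OF C] exI[of _ 1]) auto
  then show "\<exists>C>0. strip_carleson p C (schwarzian_density (\<lambda>w. g (exp w)))" using C by blast
next
  let ?\<mu> = "schwarzian_measure f"
  assume "\<exists>C>0. strip_carleson p C (schwarzian_density (\<lambda>w. g (exp w)))"
  then obtain C where C: "C > 0" "strip_carleson p C (schwarzian_density (\<lambda>w. g (exp w)))" by blast
  obtain \<delta> where \<delta>: "\<delta> > 0" "\<forall>a b. a < b \<and> b \<le> a + 2 * pi \<and> b - a < \<delta> \<longrightarrow>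
    emeasure ?\<mu> (carleson_box (cis ` {a..b})) \<le> ennreal ((24 * pi powr p * C) * arc_length (cis ` {a..b}) powr p)"
    using emeasure_carleson_box_le[OF C(2,1)] by blast
  define T where "T = enn2real (emeasure ?\<mu> (ball 0 1))"
  have T: "emeasure ?\<mu> (ball 0 1) = ennreal T" "T \<ge> 0" using finite_schwarzian_measure[OF C(2,1)] by (auto simp: T_def)
  define N where "N = max (24 * pi powr p * C) (T / (\<delta> / (2 * pi)) powr p)"
  have N0: "N \<ge> 0" using C by (simp add: N_def le_max_iff_disj)
  have "(SUP I\<in>arcs. emeasure ?\<mu> (carleson_box I) / ennreal (arc_length I powr p)) \<le> ennreal N"
  proof (rule SUP_least)
    fix I assume "I \<in> arcs"
    then obtain a b where I: "I = cis ` {a..b}" and ab: "a < b" "b \<le> a + 2 * pi" by (auto simp: arcs_def)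
    have al: "arc_length I = (b - a) / (2 * pi)" unfolding I by (rule arc_length_cis[OF ab])
    have pos: "arc_length I powr p > 0" using al ab by simp
    have "emeasure ?\<mu> (carleson_box I) \<le> ennreal (N * arc_length I powr p)"
    proof (cases "b - a < \<delta>")
      case True
      then have "emeasure ?\<mu> (carleson_box I) \<le> ennreal ((24 * pi powr p * C) * arc_length I powr p)" unfolding I using \<delta>(2) ab by blast
      also have "\<dots> \<le> ennreal (N * arc_length I powr p)" unfolding N_def by (intro ennreal_leI mult_right_mono) auto
      finally show ?thesis .
    next
      case False
      have "emeasure ?\<mu> (carleson_box I) \<le> ennreal T" unfolding T(1)[symmetric] space_schwarzian_measure[symmetric] by (rule emeasure_space)
      also have "\<dots> \<le> ennreal (N * arc_length I powr p)"
      proof (rule ennreal_leI)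
        have "\<delta> / (2 * pi) \<le> arc_length I" unfolding al using False by (intro divide_right_mono) auto
        then have "(\<delta> / (2 * pi)) powr p \<le> arc_length I powr p" using \<delta>(1) p by (intro powr_mono2) auto
        then have "N * (\<delta> / (2 * pi)) powr p \<le> N * arc_length I powr p" using N0 by (rule mult_left_mono)
        moreover have "T / (\<delta> / (2 * pi)) powr p \<le> N" by (simp add: N_def)
        then have "T \<le> N * (\<delta> / (2 * pi)) powr p" using \<delta>(1) by (subst (asm) pos_divide_le_eq) auto
        ultimately show "T \<le> N * arc_length I powr p" by linarith
      qed
      finally show ?thesis .
    qed
    then show "emeasure ?\<mu> (carleson_box I) / ennreal (arc_length I powr p) \<le> ennreal N"
      using ennreal_divide_le_iff[OF pos N0] by blast
  qed
  also have "\<dots> < \<infinity>" by simp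
  finally show "bounded_carleson p ?\<mu>" by (simp add: bounded_carleson_def)
qed

lemma vanishing_carleson_iff:
  "vanishing_carleson p (schwarzian_measure f) \<longleftrightarrow> (\<forall>C>0. strip_carleson p C (schwarzian_density (\<lambda>w. g (exp w))))"
  unfolding vanishing_carleson_def tendsto_zero_ennreal_iff eventually_small_arcs
proof (intro iffI allI impI)
  let ?\<mu> = "schwarzian_measure f"
  have iff: "emeasure ?\<mu> (carleson_box (cis ` {a..b})) / ennreal (arc_length (cis ` {a..b}) powr p) \<le> ennreal C
    \<longleftrightarrow> emeasure ?\<mu> (carleson_box (cis ` {a..b})) \<le> ennreal (C * arc_length (cis ` {a..b}) powr p)"
    if "a < b" "b \<le> a + 2 * pi" "C > 0" for a b C
    by (rule ennreal_divide_le_iff) (use that in \<open>auto simp: arc_length_cis\<close>)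
  {
    fix C :: real assume C: "C > 0" and *: "\<forall>\<epsilon>>0. \<exists>\<delta>>0. \<forall>a b. a < b \<and> b \<le> a + 2 * pi \<and> b - a < \<delta> \<longrightarrow>
      emeasure ?\<mu> (carleson_box (cis ` {a..b})) / ennreal (arc_length (cis ` {a..b}) powr p) \<le> ennreal \<epsilon>"
    show "strip_carleson p C (schwarzian_density (\<lambda>w. g (exp w)))"
      by (rule strip_carleson_of_boxes[OF C]) (use *[rule_format, OF C] iff[OF _ _ C] in blast)
  }
  fix \<epsilon> :: real assume \<epsilon>: "\<epsilon> > 0" and *: "\<forall>C>0. strip_carleson p C (schwarzian_density (\<lambda>w. g (exp w)))"
  have c: "\<epsilon> / (24 * pi powr p) > 0" using \<epsilon> by simp
  have "\<exists>\<delta>>0. \<forall>a b. a < b \<and> b \<le> a + 2 * pi \<and> b - a < \<delta> \<longrightarrow>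
    emeasure ?\<mu> (carleson_box (cis ` {a..b})) \<le> ennreal (\<epsilon> * arc_length (cis ` {a..b}) powr p)"
    using emeasure_carleson_box_le[OF *[rule_format, OF c] c] by simp
  then show "\<exists>\<delta>>0. \<forall>a b. a < b \<and> b \<le> a + 2 * pi \<and> b - a < \<delta> \<longrightarrow>
      emeasure ?\<mu> (carleson_box (cis ` {a..b})) / ennreal (arc_length (cis ` {a..b}) powr p) \<le> ennreal \<epsilon>"
    using iff[OF _ _ \<epsilon>] by blast
qed

end

subsection \<open>Bloch conditions and the main theorem\<close>

text \<open>The area mean value is taken over the disc of radius d = -s / 2. There the weight
  (-Re)^3 is at least d^3, and the disc lies in the box with L = 4 d and cut-off -d. Then
  |\<sigma>|^2 is at most 2 C L^p / d^5, which explains 64 * 2^p.\<close>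

lemma schwarzian_pointwise:
  assumes hol: "G holomorphic_on left_half_plane" and C: "C > 0"
    and car: "strip_carleson p C (schwarzian_density G)"
  shows "\<exists>\<delta>>0. \<forall>s t. - \<delta> \<le> s \<and> s < 0 \<longrightarrow>
    cmod (strip_schwarzian G (Complex s t)) \<le> sqrt (64 * 2 powr p * C) * (- s) powr ((p - 5) / 2)"
proof -
  let ?H = "strip_schwarzian G"
  have holH: "?H holomorphic_on left_half_plane" using hol by (rule holomorphic_strip_schwarzian)
  obtain \<delta> where \<delta>: "\<delta> > 0" "\<forall>L a s1. 0 < L \<and> L \<le> \<delta> \<and> - L \<le> s1 \<and> s1 < 0 \<longrightarrow>
     integral (cbox (- L, a - L) (s1, a + L)) (schwarzian_density G) \<le> C * L powr p"
    using car unfolding strip_carleson_def by blast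
  show ?thesis
  proof (intro exI[of _ "\<delta> / 2"] conjI allI impI)
    fix s t assume s: "- (\<delta> / 2) \<le> s \<and> s < 0"
    define d where "d = - s / 2"
    define L where "L = - 2 * s"
    have d: "d > 0" "s / 2 = - d" "L = 4 * d" "s = - 2 * d" and L: "0 < L" "L \<le> \<delta>" using s by (auto simp: d_def L_def)
    let ?w = "Complex s t"
    let ?Q = "cbox (- L, t - L) (- d, t + L)"
    have near: "\<bar>Re z - s\<bar> < d \<and> \<bar>Im z - t\<bar> < d" if "z \<in> ball ?w d" for z
      using that abs_Re_le_cmod[of "z - ?w"] abs_Im_le_cmod[of "z - ?w"] by (auto simp: dist_norm norm_minus_commute)
    have sub: "ball ?w d \<subseteq> left_half_plane" using near d by fastforce
    have holB: "?H holomorphic_on ball ?w d" using holH sub by (rule holomorphic_on_subset)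
    have m: "(\<lambda>z. ennreal ((cmod (?H z))\<^sup>2) * indicator (ball ?w d) z) \<in> borel_measurable borel"
    proof -
      have "(\<lambda>z. ennreal (indicator (ball ?w d) z *\<^sub>R (cmod (?H z))\<^sup>2)) \<in> borel_measurable borel"
        by (intro measurable_compose[OF _ measurable_ennreal] borel_measurable_continuous_on_indicator continuous_intros
            holomorphic_on_imp_continuous_on[OF holB]) simp
      moreover have "(\<lambda>z. ennreal (indicator (ball ?w d) z *\<^sub>R (cmod (?H z))\<^sup>2)) = (\<lambda>z. ennreal ((cmod (?H z))\<^sup>2) * indicator (ball ?w d) z)"
        by (auto split: split_indicator)
      ultimately show ?thesis by (simp only:)
    qed
    have c: "continuous_on ?Q (\<lambda>p. (1 / d ^ 3) * schwarzian_density G p)"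
      using half_plane_continuous_box[OF holH, of "- d" "- L" "t - L" "t + L"] d
      by (intro continuous_intros) auto
    have "ennreal (d\<^sup>2 / 2 * (cmod (?H ?w))\<^sup>2) \<le> (\<integral>\<^sup>+z. ennreal ((cmod (?H z))\<^sup>2) * indicator (ball ?w d) z \<partial>lborel)"
      by (rule area_mean_value[OF holB d(1)])
    also have "\<dots> = (\<integral>\<^sup>+p. ennreal ((cmod (?H (Complex (fst p) (snd p))))\<^sup>2) * indicator (ball ?w d) (Complex (fst p) (snd p)) \<partial>lborel)"
      by (rule nn_integral_complex_iterated(3)[OF m])
    also have "\<dots> \<le> (\<integral>\<^sup>+p. ennreal ((1 / d ^ 3) * schwarzian_density G p) * indicator ?Q p \<partial>lborel)"
    proof (rule nn_integral_mono)
      fix p :: "real \<times> real"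
      obtain u v where p: "p = (u, v)" by (cases p)
      show "ennreal ((cmod (?H (Complex (fst p) (snd p))))\<^sup>2) * indicator (ball ?w d) (Complex (fst p) (snd p))
        \<le> ennreal ((1 / d ^ 3) * schwarzian_density G p) * indicator ?Q p"
      proof (cases "Complex u v \<in> ball ?w d")
        case True
        then have uv: "\<bar>u - s\<bar> < d" "\<bar>v - t\<bar> < d" using near[OF True] by auto
        then have "u \<ge> - L" "u \<le> - d" "t - L \<le> v" "v \<le> t + L" using d by linarith+
        then have "p \<in> ?Q" by (simp add: p cbox_Pair_eq)
        moreover have "d ^ 3 \<le> (- u) ^ 3" using \<open>u \<le> - d\<close> d by (intro power_mono) auto
        then have "(cmod (?H (Complex u v)))\<^sup>2 * d ^ 3 \<le> (cmod (?H (Complex u v)))\<^sup>2 * (- u) ^ 3" by (rule mult_left_mono) simp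
        then have "(cmod (?H (Complex u v)))\<^sup>2 \<le> (1 / d ^ 3) * ((- u) ^ 3 * (cmod (?H (Complex u v)))\<^sup>2)"
          using d(1) by (subst (asm) pos_le_divide_eq[symmetric]) (simp_all add: mult.commute)
        ultimately show ?thesis using True by (auto simp: p intro: ennreal_leI)
      qed (simp add: p)
    qed
    also have "\<dots> = ennreal (integral ?Q (\<lambda>p. (1 / d ^ 3) * schwarzian_density G p))"
    proof (rule nn_integral_cbox[OF c])
      fix p :: "real \<times> real" assume "p \<in> ?Q"
      then have "fst p < 0" using d by (cases p) (auto simp: cbox_Pair_eq)
      then show "0 \<le> (1 / d ^ 3) * schwarzian_density G p"
        using d(1) schwarzian_density_nonneg[of p G] by (intro mult_nonneg_nonneg) auto
    qed
    also have "integral ?Q (\<lambda>p. (1 / d ^ 3) * schwarzian_density G p) = (1 / d ^ 3) * integral ?Q (schwarzian_density G)"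
      by (rule integral_mult_right)
    also have "ennreal ((1 / d ^ 3) * integral ?Q (schwarzian_density G)) \<le> ennreal ((1 / d ^ 3) * (C * L powr p))"
      using \<delta>(2) L d by (intro ennreal_leI mult_left_mono) auto
    finally have le: "d\<^sup>2 / 2 * (cmod (?H ?w))\<^sup>2 \<le> (1 / d ^ 3) * (C * L powr p)"
      using C d(1) by (subst (asm) ennreal_le_iff) auto
    have "(cmod (?H ?w))\<^sup>2 = (d\<^sup>2 / 2 * (cmod (?H ?w))\<^sup>2) * (2 / d\<^sup>2)" using d(1) by simp
    also have "\<dots> \<le> ((1 / d ^ 3) * (C * L powr p)) * (2 / d\<^sup>2)" using le by (rule mult_right_mono) simp
    also have "\<dots> = 2 * C * L powr p / d ^ 5" using d(1) by (simp add: power_add[of d 3 2, simplified])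
    also have "\<dots> = 64 * 2 powr p * C * (- s) powr (p - 5)"
    proof -
      have "L powr p = 2 powr p * (- s) powr p" using s by (simp add: L_def powr_mult flip: powr_mult)
      moreover have "d ^ 5 = (- s) powr 5 / 32" using s by (simp add: d_def power_divide powr_numeral)
      moreover have "(- s) powr (p - 5) = (- s) powr p / (- s) powr 5" by (rule powr_diff)
      ultimately show ?thesis by (simp only:) simp
    qed
    finally have sq: "(cmod (?H ?w))\<^sup>2 \<le> 64 * 2 powr p * C * (- s) powr (p - 5)" .
    have eq: "(sqrt (64 * 2 powr p * C) * (- s) powr ((p - 5) / 2))\<^sup>2 = 64 * 2 powr p * C * (- s) powr (p - 5)"
    proof -
      have "((- s) powr ((p - 5) / 2))\<^sup>2 = (- s) powr (p - 5)"
        using powr_add[of "- s" "(p - 5) / 2" "(p - 5) / 2"] by (simp add: power2_eq_square)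
      then show ?thesis using C by (simp add: power_mult_distrib)
    qed
    show "cmod (?H ?w) \<le> sqrt (64 * 2 powr p * C) * (- s) powr ((p - 5) / 2)"
      by (rule power2_le_imp_le, unfold eq, rule sq) (use C in simp)
  qed (use \<delta> in auto)
qed

text \<open>This is how the converse direction reaches the Hardy space. Finitely many intervals of
  length L cover a period, each with a reference constant that does not depend on the slice; slices
  below height -L lie in a compact subset of the disc.\<close>

lemma slice_norm_bounded:
  assumes hol: "g holomorphic_on ball 0 1" and L: "L > 0"
    and osc: "\<And>a. \<exists>c. \<forall>s1. - L \<le> s1 \<and> s1 < 0 \<longrightarrow> integral {a - L / 2..a + L / 2} (\<lambda>t. (cmod (g (exp (Complex s1 t)) - c))\<^sup>2) \<le> K"
  shows "\<exists>M. \<forall>s<0. slice_norm g s \<le> M"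
proof -
  let ?G = "\<lambda>s t. g (exp (Complex s t))"
  have cG: "continuous_on A (?G s)" if "s < 0" for s A
    by (rule half_plane_continuous_line(1)[OF disc_lift_holomorphic[OF hol] that])
  have i: "(\<lambda>t. (cmod (?G s t - c))\<^sup>2) integrable_on {x..y}" "(\<lambda>t. (cmod (?G s t))\<^sup>2) integrable_on {x..y}" if "s < 0" for s c x y
    by (intro integrable_continuous_interval continuous_intros cG that)+
  have near: "\<exists>M. \<forall>s. - L \<le> s \<and> s < 0 \<longrightarrow> integral {0..real n * L} (\<lambda>t. (cmod (?G s t))\<^sup>2) \<le> M" for n
  proof (induction n)
    case (Suc n)
    then obtain M where M: "\<And>s. - L \<le> s \<Longrightarrow> s < 0 \<Longrightarrow> integral {0..real n * L} (\<lambda>t. (cmod (?G s t))\<^sup>2) \<le> M" by blast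
    obtain c where c: "\<And>s. - L \<le> s \<Longrightarrow> s < 0 \<Longrightarrow>
      integral {real n * L + L / 2 - L / 2..real n * L + L / 2 + L / 2} (\<lambda>t. (cmod (?G s t - c))\<^sup>2) \<le> K"
      using osc[of "real n * L + L / 2"] by blast
    have "integral {0..real (Suc n) * L} (\<lambda>t. (cmod (?G s t))\<^sup>2) \<le> M + (2 * K + L * (2 * (cmod c)\<^sup>2))" if s: "- L \<le> s" "s < 0" for s
    proof -
      have e: "real (Suc n) * L = real n * L + L" by (simp add: algebra_simps)
      have "integral {0..real (Suc n) * L} (\<lambda>t. (cmod (?G s t))\<^sup>2)
        = integral {0..real n * L} (\<lambda>t. (cmod (?G s t))\<^sup>2) + integral {real n * L..real n * L + L} (\<lambda>t. (cmod (?G s t))\<^sup>2)"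
        unfolding e by (rule Henstock_Kurzweil_Integration.integral_combine[symmetric]) (use L s i in auto)
      also have "integral {real n * L..real n * L + L} (\<lambda>t. (cmod (?G s t))\<^sup>2)
        \<le> integral {real n * L..real n * L + L} (\<lambda>t. 2 * (cmod (?G s t - c))\<^sup>2 + 2 * (cmod c)\<^sup>2)"
        using cmod_diff_square_le[of _ 0 c] by (intro integral_le i integrable_add integrable_on_mult_right integrable_const_ivl s(2)) simp
      also have "\<dots> = 2 * integral {real n * L..real n * L + L} (\<lambda>t. (cmod (?G s t - c))\<^sup>2) + L * (2 * (cmod c)\<^sup>2)"
        using i(1)[OF s(2)] L by (subst integral_add) auto
      also have "\<dots> \<le> 2 * K + L * (2 * (cmod c)\<^sup>2)"
      proof -
        have "real n * L + L / 2 - L / 2 = real n * L" "real n * L + L / 2 + L / 2 = real n * L + L" by simp_all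
        then show ?thesis using c[OF s] by (simp only:)
      qed
      finally show ?thesis using M[OF s] by linarith
    qed
    then show ?case by blast
  qed (intro exI[of _ 0], simp)
  obtain n :: nat where n: "2 * pi / L < real n" using reals_Archimedean2 by blast
  then have n: "2 * pi \<le> real n * L" using L by (simp add: divide_less_eq)
  obtain M1 where M1: "\<And>s. - L \<le> s \<Longrightarrow> s < 0 \<Longrightarrow> integral {0..real n * L} (\<lambda>t. (cmod (?G s t))\<^sup>2) \<le> M1" using near[of n] by blast
  have "cball 0 (exp (- L)) \<subseteq> ball (0::complex) 1" unfolding cball_subset_ball_iff using L by simp
  then have "compact (g ` cball 0 (exp (- L)))"
    by (intro compact_continuous_image continuous_on_subset[OF holomorphic_on_imp_continuous_on[OF hol]]) auto
  from compact_imp_bounded[OF this]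
  obtain B where B: "\<And>z. z \<in> cball 0 (exp (- L)) \<Longrightarrow> norm (g z) \<le> B" unfolding bounded_iff ball_simps by blast
  have "slice_norm g s \<le> max M1 (2 * pi * B\<^sup>2)" if s: "s < 0" for s
  proof (cases "- L \<le> s")
    case True
    have "slice_norm g s \<le> integral {0..real n * L} (\<lambda>t. (cmod (?G s t))\<^sup>2)"
      unfolding slice_norm_def by (rule integral_subinterval_le) (use n in \<open>auto intro!: continuous_intros cG s\<close>)
    then show ?thesis using M1[OF True s] by linarith
  next
    case False
    have "slice_norm g s \<le> (2 * pi - 0) * B\<^sup>2"
      unfolding slice_norm_def
    proof (rule integral_le_const_interval)
      show "continuous_on {0..2 * pi} (\<lambda>t. (cmod (?G s t))\<^sup>2)" by (intro continuous_intros cG s)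
      fix t
      have "exp (Complex s t) \<in> cball 0 (exp (- L))" using False by simp
      then show "(cmod (?G s t))\<^sup>2 \<le> B\<^sup>2" by (intro power_mono B) auto
    qed auto
    then show ?thesis by simp
  qed
  then show ?thesis by blast
qed

section \<open>Bloch conditions in logarithmic coordinates\<close>

lemma strip_bloch_bound:
  assumes hol: "g holomorphic_on ball 0 1" and s: "s < 0"
  shows "- s * cmod (deriv (\<lambda>w. g (exp w)) (Complex s t)) \<le> (1 - exp s) * cmod (deriv g (exp (Complex s t)))"
proof -
  have "(1 - s) * exp s \<le> exp (- s) * exp s" using exp_ge_add_one_self[of "- s"] by (intro mult_right_mono) auto
  then have "- s * exp s \<le> 1 - exp s" by (simp add: algebra_simps flip: exp_add)
  then have "- s * exp s * cmod (deriv g (exp (Complex s t))) \<le> (1 - exp s) * cmod (deriv g (exp (Complex s t)))" by (rule mult_right_mono) simp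
  then show ?thesis using s by (simp add: disc_lift_deriv[OF hol] norm_mult mult_ac)
qed

lemma bloch0_iff_strip_little_bloch:
  assumes bl: "g \<in> bloch"
  shows "g \<in> bloch0 \<longleftrightarrow> strip_little_bloch (\<lambda>w. g (exp w))"
proof -
  have hol: "g holomorphic_on ball 0 1" using bl by (simp add: bloch_def)
  let ?D = "\<lambda>s t. deriv (\<lambda>w. g (exp w)) (Complex s t)"
  have "((\<lambda>z. (1 - (cmod z)\<^sup>2) * cmod (deriv g z)) \<longlongrightarrow> 0) (filtercomap cmod (at_left 1)) \<longleftrightarrow> strip_little_bloch (\<lambda>w. g (exp w))"
  proof
    assume lim: "((\<lambda>z. (1 - (cmod z)\<^sup>2) * cmod (deriv g z)) \<longlongrightarrow> 0) (filtercomap cmod (at_left 1))"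
    show "strip_little_bloch (\<lambda>w. g (exp w))" unfolding strip_little_bloch_def
    proof (intro allI impI)
      fix \<epsilon> :: real assume \<epsilon>: "\<epsilon> > 0"
      have "\<forall>\<^sub>F z in filtercomap cmod (at_left 1). (1 - (cmod z)\<^sup>2) * cmod (deriv g z) < \<epsilon>"
        by (rule order_tendstoD(2)[OF lim \<epsilon>])
      then obtain Q where Q: "eventually Q (at_left (1::real))" "\<And>z. Q (cmod z) \<Longrightarrow> (1 - (cmod z)\<^sup>2) * cmod (deriv g z) < \<epsilon>"
        unfolding eventually_filtercomap by blast
      obtain b where b: "b < 1" "\<And>y. b < y \<Longrightarrow> y < 1 \<Longrightarrow> Q y"
        using Q(1) eventually_at_left[of 0 "1::real"] by auto
      define c where "c = (max b 0 + 1) / 2"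
      have c: "0 < c" "c < 1" "b < c" using b(1) by (auto simp: c_def)
      show "\<exists>\<delta>>0. \<forall>s t. - \<delta> \<le> s \<and> s < 0 \<longrightarrow> - s * cmod (?D s t) \<le> \<epsilon>"
      proof (intro exI[of _ "- ln c"] conjI allI impI)
        fix s t assume s: "- (- ln c) \<le> s \<and> s < 0"
        then have "exp (ln c) \<le> exp s" by simp
        then have "c \<le> exp s" using c(1) by simp
        then have "Q (cmod (exp (Complex s t)))" using c(3) s by (intro b(2)) auto
        then have q: "(1 - (exp s)\<^sup>2) * cmod (deriv g (exp (Complex s t))) < \<epsilon>" using Q(2) by fastforce
        have "(exp s)\<^sup>2 \<le> exp s" using s by (simp add: power2_eq_square mult_le_cancel_left1)
        then have "(1 - exp s) * cmod (deriv g (exp (Complex s t))) \<le> (1 - (exp s)\<^sup>2) * cmod (deriv g (exp (Complex s t)))"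
          by (intro mult_right_mono) auto
        then show "- s * cmod (?D s t) \<le> \<epsilon>" using strip_bloch_bound[OF hol, of s t] s q by linarith
      qed (use c in auto)
    qed
  next
    assume slb: "strip_little_bloch (\<lambda>w. g (exp w))"
    show "((\<lambda>z. (1 - (cmod z)\<^sup>2) * cmod (deriv g z)) \<longlongrightarrow> 0) (filtercomap cmod (at_left 1))"
    proof (rule tendstoI)
      fix \<epsilon> :: real assume \<epsilon>: "\<epsilon> > 0"
      \<comment> \<open>1 - |z|^2 \<le> -2 s costs a factor 2 and |g'| = exp (-s) |G'| at most a
        factor 3, so that \<epsilon> / 2 results.\<close>
      then have "\<epsilon> / 12 > 0" by simp
      then obtain \<delta> where \<delta>: "\<delta> > 0" "\<And>s t. - \<delta> \<le> s \<Longrightarrow> s < 0 \<Longrightarrow> - s * cmod (?D s t) \<le> \<epsilon> / 12"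
        using slb unfolding strip_little_bloch_def by blast
      define \<kappa> where "\<kappa> = min \<delta> 1"
      have \<kappa>: "0 < \<kappa>" "\<kappa> \<le> \<delta>" "\<kappa> \<le> 1" using \<delta>(1) by (auto simp: \<kappa>_def)
      have "\<forall>\<^sub>F y in at_left (1::real). exp (- \<kappa>) < y \<and> y < 1"
        using \<kappa> by (intro eventually_at_leftI[of "exp (- \<kappa>)"]) auto
      then have "\<forall>\<^sub>F z in filtercomap cmod (at_left 1). exp (- \<kappa>) < cmod z \<and> cmod z < 1"
        by (rule eventually_filtercomapI)
      then show "\<forall>\<^sub>F z in filtercomap cmod (at_left 1). dist ((1 - (cmod z)\<^sup>2) * cmod (deriv g z)) 0 < \<epsilon>"
      proof eventually_elim
        case (elim z)
        have z0: "0 < cmod z" using elim exp_gt_zero[of "- \<kappa>"] by linarith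
        define s where "s = ln (cmod z)"
        define t where "t = Im (Ln z)"
        have es: "exp s = cmod z" using z0 by (simp add: s_def)
        have "exp (- \<kappa>) < exp s" "exp s < exp 0" using elim es by auto
        then have s: "- \<kappa> < s" "s < 0" by (simp_all only: exp_less_cancel_iff)
        have "Complex s t = Ln z" using z0 by (simp add: s_def t_def complex_eq_iff)
        then have z: "z = exp (Complex s t)" using z0 by simp
        define x where "x = cmod (deriv g z)"
        have D: "cmod (?D s t) = x * exp s" using s(2) by (simp add: disc_lift_deriv[OF hol] norm_mult x_def z)
        have "exp (- s) \<le> exp 1" using s \<kappa> by simp
        then have e3: "exp (- s) \<le> 3" using exp_le by linarith
        have x: "x = exp (- s) * (x * exp s)" by (simp add: exp_minus)
        have "1 - (cmod z)\<^sup>2 \<le> 2 * (- s)"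
          using exp_ge_add_one_self[of "2 * s"] unfolding es[symmetric] exp_double[symmetric] by linarith
        then have "(1 - (cmod z)\<^sup>2) * x \<le> 2 * (- s) * x" by (rule mult_right_mono) (simp add: x_def)
        also have "\<dots> = 2 * exp (- s) * (- s * cmod (?D s t))" unfolding D by (subst x) (simp only: mult_ac)
        also have "\<dots> \<le> 2 * 3 * (\<epsilon> / 12)"
          using e3 s \<kappa> \<epsilon> by (intro mult_mono \<delta>(2) mult_nonneg_nonneg) auto
        also have "\<dots> < \<epsilon>" using \<epsilon> by simp
        finally have "(1 - (cmod z)\<^sup>2) * x < \<epsilon>" .
        moreover have "(cmod z)\<^sup>2 \<le> 1" using elim by (simp add: abs_square_le_1)
        then have "0 \<le> (1 - (cmod z)\<^sup>2) * x" by (simp add: x_def)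
        ultimately show ?case by (simp add: x_def)
      qed
    qed
  qed
  then show ?thesis using bl by (simp add: bloch0_def)
qed

lemma strip_little_bloch_from_growth:
  assumes gr: "strip_growth p C G" and C: "C > 0" and p: "p > 1"
  shows "strip_little_bloch G"
  unfolding strip_little_bloch_def
proof (intro allI impI)
  fix \<epsilon> :: real assume \<epsilon>: "\<epsilon> > 0"
  obtain \<delta> where \<delta>: "\<delta> > 0" "\<And>s t. - \<delta> \<le> s \<Longrightarrow> s < 0 \<Longrightarrow> cmod (deriv G (Complex s t)) \<le> C * (- s) powr ((p - 3) / 2)"
    using gr unfolding strip_growth_def by blast
  \<comment> \<open>Growth gives (-s) |G'| \<le> C (-s)^((p - 1) / 2), whose exponent is positive
    for p > 1; \<kappa> solves C \<kappa>^((p - 1) / 2) = \<epsilon>.\<close>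
  define \<kappa> where "\<kappa> = (\<epsilon> / C) powr (2 / (p - 1))"
  have \<kappa>: "\<kappa> > 0" using \<epsilon> C by (simp add: \<kappa>_def)
  show "\<exists>\<delta>>0. \<forall>s t. - \<delta> \<le> s \<and> s < 0 \<longrightarrow> - s * cmod (deriv G (Complex s t)) \<le> \<epsilon>"
  proof (intro exI[of _ "min \<delta> \<kappa>"] conjI allI impI)
    fix s t assume s': "- min \<delta> \<kappa> \<le> s \<and> s < 0"
    then have s: "- \<delta> \<le> s" "s < 0" "- s \<le> \<kappa>" by auto
    have "- s * cmod (deriv G (Complex s t)) \<le> - s * (C * (- s) powr ((p - 3) / 2))"
      using s by (intro mult_left_mono \<delta>(2)) auto
    also have "\<dots> = C * ((- s) powr 1 * (- s) powr ((p - 3) / 2))" using s by simp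
    also have "(- s) powr 1 * (- s) powr ((p - 3) / 2) = (- s) powr ((p - 1) / 2)"
    proof -
      have "1 + (p - 3) / 2 = (p - 1) / 2" by (simp add: field_simps)
      then show ?thesis unfolding powr_add[symmetric] by (simp only:)
    qed
    also have "C * (- s) powr ((p - 1) / 2) \<le> C * \<kappa> powr ((p - 1) / 2)"
      using s p C by (intro mult_left_mono powr_mono2) auto
    also have "\<kappa> powr ((p - 1) / 2) = \<epsilon> / C"
    proof -
      have "2 / (p - 1) * ((p - 1) / 2) = 1" using p by simp
      then show ?thesis using \<epsilon> C unfolding \<kappa>_def powr_powr by (simp only: powr_one divide_nonneg_pos less_imp_le)
    qed
    finally show "- s * cmod (deriv G (Complex s t)) \<le> \<epsilon>" using C by simp
  qed (use \<delta> \<kappa> in auto)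
qed

text \<open>\<open>K\<close> is fixed before \<open>C\<close> and depends only on p and B. The
  vanishing case lets \<open>C\<close> tend to 0, and could not be obtained from a constant chosen
  afterwards.\<close>

lemma schwarzian_from_oscillation:
  assumes hol: "g holomorphic_on ball 0 1" and M: "\<forall>s<0. slice_norm g s \<le> M"
    and p: "0 < p" "p < 3" "p \<noteq> 1"
    and B: "\<And>s t. s < 0 \<Longrightarrow> - s * cmod (deriv (\<lambda>w. g (exp w)) (Complex s t)) \<le> B"
  shows "\<exists>K>0. \<forall>C>0. strip_oscillation p C (\<lambda>w. g (exp w)) \<longrightarrow>
    strip_growth p (K * sqrt C) (\<lambda>w. g (exp w)) \<and> strip_carleson p (K * C) (schwarzian_density (\<lambda>w. g (exp w)))"
proof -
  let ?G = "\<lambda>w. g (exp w)"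
  note holG = disc_lift_holomorphic[OF hol]
  define k where "k = 8320 / (1 - 2 powr max ((p - 1) / 2) (1/2) / 2) + 1"
  have k: "k > 0"
  proof -
    have "2 powr max ((p - 1) / 2) (1/2) < 2 powr (1::real)" using p by (intro powr_less_mono) auto
    then show ?thesis by (simp add: k_def add_pos_pos)
  qed
  \<comment> \<open>The two routes to the energy, by Green's identity for p < 1 and by integrating
    the growth for p > 1. Both constants blow up as p tends to 1.\<close>
  define e where "e = (if p < 1 then 288 * ((1 + 2 / (1 - p)) * k)\<^sup>2 + 28 else 2 / (p - 1) * k\<^sup>2)"
  have e: "e > 0" using k p by (auto simp: e_def add_nonneg_pos)
  define K where "K = 48 * (128 * k\<^sup>2 + 22 * e) * 2 powr p + 3 * (1 + B\<^sup>2) * e"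
  have K: "K > 0"
  proof -
    have "0 < 48 * (128 * k\<^sup>2 + 22 * e) * 2 powr p" using e by (intro mult_pos_pos add_nonneg_pos) auto
    moreover have "0 \<le> 3 * (1 + B\<^sup>2) * e" using e by (intro mult_nonneg_nonneg) auto
    ultimately show ?thesis unfolding K_def by linarith
  qed
  have "strip_growth p (k * sqrt C) ?G \<and> strip_carleson p (K * C) (schwarzian_density ?G)"
    if C: "C > 0" and osc: "strip_oscillation p C ?G" for C
  proof -
    have gr: "strip_growth p (k * sqrt C) ?G"
      unfolding k_def by (rule growth_from_oscillation[OF hol M p(1,2)]) (use C osc in auto)
    have "strip_carleson p (e * C) (energy_density ?G)"
    proof (cases "p < 1")
      case True
      have "288 * ((1 + 2 / (1 - p)) * (k * sqrt C))\<^sup>2 + 28 * C = e * C"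
      proof -
        have "((1 + 2 / (1 - p)) * (k * sqrt C))\<^sup>2 = ((1 + 2 / (1 - p)) * k)\<^sup>2 * C"
          unfolding mult.assoc[symmetric] using C by (subst power_mult_distrib) simp
        then show ?thesis using True unfolding e_def by (simp only: if_True) (simp only: ring_distribs mult_ac)
      qed
      then show ?thesis using energy_from_oscillation[OF holG p(1) True gr _ osc C] k C by simp
    next
      case False
      then have "p > 1" using p by simp
      moreover have "2 / (p - 1) * (k * sqrt C)\<^sup>2 = e * C" using False C by (simp add: e_def power_mult_distrib)
      ultimately show ?thesis using energy_from_growth[OF holG _ gr] k C by simp
    qed
    from schwarzian_from_energy[OF holG p(1,2) gr _ this B]
    have "strip_carleson p (48 * (128 * (k * sqrt C)\<^sup>2 + 22 * (e * C)) * 2 powr p + 3 * (1 + B\<^sup>2) * (e * C)) (schwarzian_density ?G)"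
      using k C by simp
    moreover have "48 * (128 * (k * sqrt C)\<^sup>2 + 22 * (e * C)) * 2 powr p + 3 * (1 + B\<^sup>2) * (e * C) = K * C"
      using C by (simp add: K_def power_mult_distrib algebra_simps)
    ultimately show ?thesis using gr by simp
  qed
  note * = this
  define J where "J = max k K"
  have "strip_growth p (J * sqrt C) ?G \<and> strip_carleson p (J * C) (schwarzian_density ?G)"
    if C: "C > 0" and osc: "strip_oscillation p C ?G" for C
  proof
    have "strip_growth p (k * sqrt C) ?G" using *[OF that] ..
    then obtain \<delta> where \<delta>: "\<delta> > 0" "\<And>s t. - \<delta> \<le> s \<Longrightarrow> s < 0 \<Longrightarrow> cmod (deriv ?G (Complex s t)) \<le> k * sqrt C * (- s) powr ((p - 3) / 2)"
      unfolding strip_growth_def by blast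
    have "k * sqrt C * x \<le> J * sqrt C * x" if "x \<ge> 0" for x
      using C that by (intro mult_right_mono) (auto simp: J_def)
    then have "cmod (deriv ?G (Complex s t)) \<le> J * sqrt C * (- s) powr ((p - 3) / 2)" if "- \<delta> \<le> s" "s < 0" for s t
      using \<delta>(2)[OF that, of t] powr_ge_zero[of "- s" "(p - 3) / 2"] order.trans by blast
    then show "strip_growth p (J * sqrt C) ?G" unfolding strip_growth_def using \<delta>(1) by blast
    have "strip_carleson p (K * C) (schwarzian_density ?G)" using *[OF that] ..
    then show "strip_carleson p (J * C) (schwarzian_density ?G)"
      by (rule strip_carleson_mono) (use C in \<open>auto simp: J_def\<close>)
  qed
  moreover have "J > 0" using K by (simp add: J_def)
  ultimately show ?thesis by blast
qed

text \<open>The constant is again uniform in C: the pointwise bound of the Schwarzian and hence the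
  growth are of order sqrt C, and only the square of the growth constant enters the
  oscillation.\<close>

lemma oscillation_from_carleson:
  assumes hol: "g holomorphic_on ball 0 1" and p: "p < 3" and lb: "strip_little_bloch (\<lambda>w. g (exp w))"
  shows "\<exists>K>0. \<forall>C>0. strip_carleson p C (schwarzian_density (\<lambda>w. g (exp w))) \<longrightarrow>
    g \<in> hardy2 \<and> strip_oscillation p (K * C) (\<lambda>w. g (exp w))"
proof -
  let ?G = "\<lambda>w. g (exp w)"
  note holG = disc_lift_holomorphic[OF hol]
  define k where "k = 140 * ((6 / (3 - p))\<^sup>2 * (64 * 2 powr p) + 1)"
  have k: "k > 0" by (simp add: k_def add_nonneg_pos)
  have "g \<in> hardy2 \<and> strip_oscillation p (k * 2 powr p * C) ?G"
    if C: "C > 0" and car: "strip_carleson p C (schwarzian_density ?G)" for C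
  proof -
    obtain \<delta>0 where \<delta>0: "\<delta>0 > 0" "\<And>s t. - \<delta>0 \<le> s \<Longrightarrow> s < 0 \<Longrightarrow>
      cmod (strip_schwarzian ?G (Complex s t)) \<le> sqrt (64 * 2 powr p * C) * (- s) powr ((p - 5) / 2)"
      using schwarzian_pointwise[OF holG C car] by blast
    have gr: "strip_growth p (6 / (3 - p) * sqrt (64 * 2 powr p * C)) ?G"
      by (rule growth_from_schwarzian[OF holG lb p _ \<delta>0(1)]) (use C \<delta>0(2) in auto)
    have e: "140 * ((6 / (3 - p) * sqrt (64 * 2 powr p * C))\<^sup>2 + C) = k * C"
    proof -
      have "(6 / (3 - p) * sqrt (64 * 2 powr p * C))\<^sup>2 = (6 / (3 - p))\<^sup>2 * (64 * 2 powr p * C)"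
        using C by (subst power_mult_distrib) simp
      then show ?thesis unfolding k_def by (simp only:) (simp only: ring_distribs mult_ac mult_1)
    qed
    obtain \<delta> where \<delta>: "\<delta> > 0" "\<And>L a. 0 < L \<Longrightarrow> L \<le> \<delta> \<Longrightarrow> \<exists>c. \<forall>s1. - L \<le> s1 \<and> s1 < 0 \<longrightarrow>
      integral {a - L / 2..a + L / 2} (\<lambda>t. (cmod (?G (Complex s1 t) - c))\<^sup>2) \<le> k * C * L powr p"
      using oscillation_from_schwarzian[OF holG lb gr less_imp_le[OF C] car] unfolding e by blast
    have "\<exists>M. \<forall>s<0. slice_norm g s \<le> M"
      by (rule slice_norm_bounded[OF hol \<delta>(1)]) (use \<delta>(2)[OF \<delta>(1) order_refl] in blast)
    then have "g \<in> hardy2" using hol unfolding hardy2_iff_slice_norm by blast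
    \<comment> \<open>The Green estimate controls only the inner half of the interval, because of
      the cut-off; starting from 2 L instead of L costs 2^p.\<close>
    moreover have "strip_oscillation p (k * 2 powr p * C) ?G" unfolding strip_oscillation_def
    proof (intro exI[of _ "\<delta> / 2"] conjI allI impI)
      fix L a assume L: "0 < L \<and> L \<le> \<delta> / 2"
      then obtain c where c: "\<And>s1. - (2 * L) \<le> s1 \<Longrightarrow> s1 < 0 \<Longrightarrow>
        integral {a - 2 * L / 2..a + 2 * L / 2} (\<lambda>t. (cmod (?G (Complex s1 t) - c))\<^sup>2) \<le> k * C * (2 * L) powr p"
        using \<delta>(2)[of "2 * L" a] by auto
      moreover have "k * C * (2 * L) powr p = k * 2 powr p * C * L powr p" using L by (simp add: powr_mult)
      ultimately show "\<exists>c s2. s2 < 0 \<and> (\<forall>s1. s2 \<le> s1 \<and> s1 < 0 \<longrightarrow>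
        integral {a - L..a + L} (\<lambda>t. (cmod (?G (Complex s1 t) - c))\<^sup>2) \<le> k * 2 powr p * C * L powr p)"
        using L by (intro exI[of _ c] exI[of _ "- (2 * L)"]) auto
    qed (use \<delta> in auto)
    ultimately show ?thesis ..
  qed
  then show ?thesis using k by (intro exI[of _ "k * 2 powr p"]) auto
qed

theorem theorem3p3:
  fixes f log_f' :: "complex \<Rightarrow> complex" and p :: real
  assumes univalent: "univalent_on_disc f"
    and branch: "log_f' holomorphic_on ball 0 1"
      "\<And>z. z \<in> ball 0 1 \<Longrightarrow> exp (log_f' z) = deriv f z"
  shows "(p \<in> {0<..<1} \<longrightarrow>
            (log_f' \<in> CA p \<longrightarrow>
               bounded_carleson p (schwarzian_measure f) \<and> log_f' \<in> bloch) \<and>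
            (log_f' \<in> CA0 p \<longrightarrow>
               vanishing_carleson p (schwarzian_measure f) \<and> log_f' \<in> bloch) \<and>
            (bounded_carleson p (schwarzian_measure f) \<and> log_f' \<in> bloch0 \<longrightarrow>
               log_f' \<in> CA p) \<and>
            (vanishing_carleson p (schwarzian_measure f) \<and> log_f' \<in> bloch0 \<longrightarrow>
               log_f' \<in> CA0 p)) \<and>
         (p \<in> {1<..<3} \<longrightarrow>
            (log_f' \<in> CA p \<longleftrightarrow>
               bounded_carleson p (schwarzian_measure f) \<and> log_f' \<in> bloch0) \<and>
            (log_f' \<in> CA0 p \<longleftrightarrow>
               vanishing_carleson p (schwarzian_measure f) \<and> log_f' \<in> bloch0))"
proof -
  let ?G = "\<lambda>w. log_f' (exp w)"
  let ?F = "schwarzian_density ?G"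
  note hol = branch(1)
  obtain B where B: "B > 0" "\<And>z. z \<in> ball 0 1 \<Longrightarrow> (1 - cmod z) * cmod (deriv (deriv f) z) \<le> B * cmod (deriv f z)"
    by (rule univalent_pre_schwarzian_bound[OF univalent]) blast
  have d2: "deriv (deriv f) z = deriv f z * deriv log_f' z" if "z \<in> ball 0 1" for z
    using deriv2_eq_exp_branch[of log_f' f z, OF hol _ that] branch(2) that by simp
  have bounded_iff: "bounded_carleson p (schwarzian_measure f) \<longleftrightarrow> (\<exists>C>0. strip_carleson p C ?F)" if "p > 0"
    by (rule bounded_carleson_iff[OF hol _ that]) (rule branch(2))
  have vanishing_iff: "vanishing_carleson p (schwarzian_measure f) \<longleftrightarrow> (\<forall>C>0. strip_carleson p C ?F)"
    by (rule vanishing_carleson_iff[OF hol]) (rule branch(2))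
  have B': "(1 - cmod z) * cmod (deriv log_f' z) \<le> B" if z: "z \<in> ball 0 1" for z
  proof -
    have "cmod (deriv f z) * ((1 - cmod z) * cmod (deriv log_f' z)) \<le> cmod (deriv f z) * B"
      using B(2)[OF z] unfolding d2[OF z] norm_mult by (simp only: mult_ac)
    moreover have "cmod (deriv f z) > 0" unfolding branch(2)[OF z, symmetric] by simp
    ultimately show ?thesis by simp
  qed
  \<comment> \<open>Membership in the Bloch space follows from univalence alone, without any
    condition of oscillation or Carleson type.\<close>
  have bloch: "log_f' \<in> bloch" unfolding bloch_def
  proof (intro CollectI conjI hol bdd_aboveI2)
    fix z :: complex assume z: "z \<in> ball 0 1"
    have "(1 - (cmod z)\<^sup>2) * cmod (deriv log_f' z) = (1 + cmod z) * ((1 - cmod z) * cmod (deriv log_f' z))"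
      by (simp add: power2_eq_square algebra_simps)
    also have "\<dots> \<le> 2 * B" using z B(1) by (intro mult_mono B') auto
    finally show "(1 - (cmod z)\<^sup>2) * cmod (deriv log_f' z) \<le> 2 * B" .
  qed
  have strip_B: "- s * cmod (deriv ?G (Complex s t)) \<le> B" if "s < 0" for s t
    using strip_bloch_bound[OF hol that, of t] B'[of "exp (Complex s t)"] that by simp
  have fwd: "\<exists>K>0. \<forall>C>0. strip_oscillation p C ?G \<longrightarrow> strip_growth p (K * sqrt C) ?G \<and> strip_carleson p (K * C) ?F"
    if hardy: "log_f' \<in> hardy2" and p: "0 < p" "p < 3" "p \<noteq> 1"
  proof -
    obtain M where M: "\<forall>s<0. slice_norm log_f' s \<le> M" using hardy unfolding hardy2_iff_slice_norm by blast
    show ?thesis by (rule schwarzian_from_oscillation[OF hol M p strip_B])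
  qed
  have CA: "bounded_carleson p (schwarzian_measure f)" "p > 1 \<Longrightarrow> log_f' \<in> bloch0"
    if g: "log_f' \<in> CA p" and p: "0 < p" "p < 3" "p \<noteq> 1"
  proof -
    obtain C where C: "C > 0" "strip_oscillation p C ?G" and h: "log_f' \<in> hardy2"
      using g unfolding CA_iff_strip_oscillation[OF p(1)] by blast
    obtain K where K: "K > 0" "strip_growth p (K * sqrt C) ?G" "strip_carleson p (K * C) ?F"
      using fwd[OF h p] C by blast
    have KC: "K * C > 0" "K * sqrt C > 0" using K(1) C(1) by simp_all
    show "bounded_carleson p (schwarzian_measure f)"
      unfolding bounded_iff[OF p(1)] using KC(1) K(3) by blast
    show "log_f' \<in> bloch0" if "p > 1"
      unfolding bloch0_iff_strip_little_bloch[OF bloch] by (rule strip_little_bloch_from_growth[OF K(2) KC(2) that])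
  qed
  have CA0: "vanishing_carleson p (schwarzian_measure f)"
    if g: "log_f' \<in> CA0 p" and p: "0 < p" "p < 3" "p \<noteq> 1"
  proof -
    have h: "log_f' \<in> hardy2" and osc: "\<And>C. C > 0 \<Longrightarrow> strip_oscillation p C ?G"
      using g unfolding CA0_iff_strip_oscillation[OF p(1)] by blast+
    obtain K where K: "K > 0" "\<And>C. C > 0 \<Longrightarrow> strip_oscillation p C ?G \<Longrightarrow> strip_carleson p (K * C) ?F"
      using fwd[OF h p] by blast
    \<comment> \<open>As \<open>K\<close> does not depend on \<open>C\<close>, the oscillation
      condition may be used with C / K.\<close>
    have "strip_carleson p C ?F" if "C > 0" for C
      using K(2)[of "C / K"] osc[of "C / K"] that K(1) by simp
    then show ?thesis unfolding vanishing_iff by blast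
  qed
  have CA_conv: "log_f' \<in> CA p"
    if car: "bounded_carleson p (schwarzian_measure f)" and b0: "log_f' \<in> bloch0" and p: "0 < p" "p < 3"
  proof -
    obtain C where C: "C > 0" "strip_carleson p C ?F" using car unfolding bounded_iff[OF p(1)] by blast
    obtain K where K: "K > 0" "log_f' \<in> hardy2" "strip_oscillation p (K * C) ?G"
      using oscillation_from_carleson[OF hol p(2) b0[unfolded bloch0_iff_strip_little_bloch[OF bloch]]] C by blast
    then show ?thesis unfolding CA_iff_strip_oscillation[OF p(1)] using mult_pos_pos[OF K(1) C(1)] by blast
  qed
  have CA0_conv: "log_f' \<in> CA0 p"
    if car: "vanishing_carleson p (schwarzian_measure f)" and b0: "log_f' \<in> bloch0" and p: "0 < p" "p < 3"
  proof -
    have C: "\<And>C. C > 0 \<Longrightarrow> strip_carleson p C ?F" using car unfolding vanishing_iff by blast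
    obtain K where K: "K > 0" "\<And>C. C > 0 \<Longrightarrow> strip_carleson p C ?F \<Longrightarrow> log_f' \<in> hardy2 \<and> strip_oscillation p (K * C) ?G"
      using oscillation_from_carleson[OF hol p(2) b0[unfolded bloch0_iff_strip_little_bloch[OF bloch]]] by blast
    have "strip_oscillation p C ?G" if "C > 0" for C
      using K(2)[of "C / K"] C[of "C / K"] that K(1) by simp
    moreover have "log_f' \<in> hardy2" using K(2)[OF zero_less_one C[OF zero_less_one]] ..
    ultimately show ?thesis unfolding CA0_iff_strip_oscillation[OF p(1)] by blast
  qed
  have sub: "log_f' \<in> CA p" if "log_f' \<in> CA0 p" using that by (simp add: CA0_def)
  show ?thesis
    using CA CA0 CA_conv CA0_conv sub bloch by (smt (verit) greaterThanLessThan_iff)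
qed

end
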